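(* Let $(a,b,c,d)\in P_{\mathrm{gen}}$, let $0<\psi_1<\psi_2<\pi$, and let $\lambda_1=2\cos\psi_2$ and $\lambda_2=2\cos\psi_1$. Let $E$ be the spectral measure of the self-adjoint operator $(L,\mathcal D)$. Then for all finitely supported functions $f,g:\mathbb R_q\to\mathbb C$, $$\langle E((\lambda_1,\lambda_2))f,g\rangle_{\mathcal L^2}=\frac1{2\pi}\int_{\psi_1}^{\psi_2}\big((\mathcal F_c^\dagger\overline g)(e^{i\psi})\ \ (\mathcal F_c\overline g)(e^{i\psi})\big)\begin{pmatrix}v_2(e^{i\psi})&v_1^\dagger(e^{i\psi})\\ v_1(e^{i\psi})&v_2(e^{i\psi})\end{pmatrix}\begin{pmatrix}(\mathcal F_cf)(e^{i\psi})\\(\mathcal F_c^\dagger f)(e^{i\psi})\end{pmatrix}d\psi .$$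
   Context: Fix $q\in(0,1)$, $z_+>0$, $z_-<0$. $(x;q)_\infty=\prod_{k\ge0}(1-xq^k)$, $(x;q)_n=(x;q)_\infty/(xq^n;q)_\infty$, $(x_1,\dots,x_k;q)_n=\prod_i(x_i;q)_n$, $\theta(x)=(x,q/x;q)_\infty$, $\theta(x_1,\dots,x_k)=\prod_i\theta(x_i)$. An argument containing $\gamma^{\pm1}$ (or $\gamma^{\pm2}$) means the product over both signs. ${}_3\phi_2(x_1,x_2,x_3;y_1,y_2;q,z)=\sum_{k\ge0}\frac{(x_1,x_2,x_3;q)_k}{(q,y_1,y_2;q)_k}z^k$. $\mathbb R_q^{\pm}=\{z_\pm q^n:n\in\mathbb Z\}$, $\mathbb R_q=\mathbb R_q^-\cup\mathbb R_q^+$. Parameters: $P_{q,z_-,z_+}$ is the set of $(\alpha,\beta)\in(\mathbb C\setminus\{0\})^2$ with $\alpha,\beta\notin z_+^{-1}q^{\mathbb Z}\cup z_-^{-1}q^{\mathbb Z}$ and one of: (i) $\alpha=\overline\beta$; (ii) $\alpha,\beta$ real and $z_+q^{k_0}<\beta^{-1}<\alpha^{-1}<z_+q^{k_0-1}$ for some $k_0\in\mathbb Z$; (iii) $\alpha,\beta$ real and $z_-q^{k_0-1}<\alpha^{-1}<\beta^{-1}<z_-q^{k_0}$ for some $k_0\in\mathbb Z$. $P=\{(a,b,c,d): (a,b),(c,d)\in P_{q,z_-,z_+},\ a\ne b\}$; $P_{\rm gen}=\{(a,b,c,d)\in P: c\ne d,\ c/a,c/b,d/a,d/b,cd/ab\notin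 q^{\mathbb Z}\}$. $s=\sqrt{cdq/ab}>0$ (note $ab,cd>0$). For a function $h$ depending on $(a,b,c,d)$, $h^\dagger$ is the same function with $a$ and $b$ interchanged. Operator: $(Lf)(x)=A(x)f(x/q)+B(x)f(qx)+C(x)f(x)$ for $f:\mathbb R_q\to\mathbb C$, where $A(x)=s^{-1}(1-\frac q{ax})(1-\frac q{bx})$, $B(x)=s(1-\frac1{cx})(1-\frac1{dx})$, $C=s^{-1}+s-A-B$. $w(x)=\frac{(ax,bx;q)_\infty}{(cx,dx;q)_\infty}>0$. $\int_{\mathbb R_q}f\,d_qx=(1-q)\sum_{n\in\mathbb Z}\big(f(z_+q^n)z_+q^n-f(z_-q^n)z_-q^n\big)$. $\mathcal L^2$ is the Hilbert space of $f:\mathbb R_q\to\mathbb C$ with $\langle f,g\rangle_{\mathcal L^2}=\int_{\mathbb R_q}f\bar g\,w\,d_qx$. $(D_qf)(x)=\frac{f(x)-f(qx)}{(1-q)x}$, $f(0^\pm)=\lim_{k\to\infty}f(z_\pm q^k)$, $f'(0^\pm)=\lim_{k\to\infty}(D_qf)(z_\pm q^k)$. $\mathcal D=\{f\in\mathcal L^2: Lf\in\mathcal L^2,\ f(0^-)=f(0^+),\ f'(0^-)=f'(0^+)\}$ (limits required to exist); $(L,\mathcal D)$ is self-adjoint. Big $q$-Jacobi functions: with $\mu(\gamma)=\gamma+\gamma^{-1}$, for $\gamma\in\mathbb C^*$ the function $\varphi_\gamma:\mathbb R_q\to\mathbb C$ is given by $\varphi_\gamma(x)={}_3\phi_2(q/ax,s\gamma,s/\gamma;cq/a,dq/a;q,bx)$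 for $|x|<1/|b|$ and extended uniquely to all of $\mathbb R_q$ by $L\varphi_\gamma=\mu(\gamma)\varphi_\gamma$; $\varphi^\dagger_\gamma$ is obtained by interchanging $a,b$. For finitely supported $f$ and $|\gamma|=1$: $(\mathcal F_cf)(\gamma)=\int_{\mathbb R_q}f(x)\varphi_\gamma(x)w(x)d_qx$, $(\mathcal F_c^\dagger f)(\gamma)=\int_{\mathbb R_q}f(x)\varphi^\dagger_\gamma(x)w(x)d_qx$. Weights: $$v_1(\gamma)=\frac{(cq/a,dq/a;q)_\infty^2\theta(bz_+,bz_-)}{(1-q)abz_-^2z_+^2\theta(z_-/z_+,z_+/z_-,a/b,b/a)}\cdot\frac{(\gamma^{\pm2};q)_\infty}{(s\gamma^{\pm1},cq\gamma^{\pm1}/as,dq\gamma^{\pm1}/as;q)_\infty\theta(s\gamma^{\pm1},absz_-z_+\gamma^{\pm1})}\cdot\big(z_-\theta(az_+,cz_+,dz_+,bz_-,asz_-\gamma^{\pm1})-z_+\theta(az_-,cz_-,dz_-,bz_+,asz_+\gamma^{\pm1})\big),$$ $$v_2(\gamma)=\frac{(cq/a,dq/a,cq/b,dq/b;q)_\infty\theta(az_+,az_-,bz_+,bz_-,cdz_-z_+)}{abz_-^2z_+(1-q)\theta(z_+/z_-,a/b,b/a)}\cdot\frac{(\gamma^{\pm2};q)_\infty}{(s\gamma^{\pm1};q)_\infty\theta(s\gamma^{\pm1},absz_-z_+\gamma^{\pm1})}.$$ *)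

theory Defs
  imports "HOL-Analysis.Analysis"
begin

subsection \<open>\<open>q\<close>-shifted factorials, theta functions and the series \<open>3\<phi>2\<close>\<close>

definition qpoch_inf :: "real \<Rightarrow> complex \<Rightarrow> complex" where
  "qpoch_inf q x = (\<Prod>k. 1 - x * of_real q ^ k)"

text \<open>For \<open>n \<ge> 0\<close> the quotient \<open>(x;q)\<^sub>\<infinity> / (x q\<^sup>n;q)\<^sub>\<infinity>\<close> is this finite product; the product
  also makes sense at \<open>x = q\<^sup>-\<^sup>m\<close>, where the quotient can have the form \<open>0/0\<close>.\<close>

definition qpoch :: "real \<Rightarrow> complex \<Rightarrow> nat \<Rightarrow> complex" where
  "qpoch q x n = (\<Prod>k<n. 1 - x * of_real q ^ k)"

definition theta1 :: "real \<Rightarrow> complex \<Rightarrow> complex" where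
  "theta1 q x = qpoch_inf q x * qpoch_inf q (of_real q / x)"

definition qpochs_inf :: "real \<Rightarrow> complex list \<Rightarrow> complex" where
  "qpochs_inf q xs = prod_list (map (qpoch_inf q) xs)"

definition qpochs :: "real \<Rightarrow> complex list \<Rightarrow> nat \<Rightarrow> complex" where
  "qpochs q xs n = prod_list (map (\<lambda>x. qpoch q x n) xs)"

definition theta :: "real \<Rightarrow> complex list \<Rightarrow> complex" where
  "theta q xs = prod_list (map (theta1 q) xs)"

definition phi32 ::
  "complex \<Rightarrow> complex \<Rightarrow> complex \<Rightarrow> complex \<Rightarrow> complex \<Rightarrow> real \<Rightarrow> complex \<Rightarrow> complex" where
  "phi32 x1 x2 x3 y1 y2 q z =
     (\<Sum>k. qpochs q [x1, x2, x3] k / qpochs q [of_real q, y1, y2] k * z ^ k)"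

subsection \<open>The \<open>q\<close>-lattice and the parameter sets\<close>

definition Rq :: "real \<Rightarrow> real \<Rightarrow> real \<Rightarrow> real set" where
  "Rq q zm zp = (range (\<lambda>n::int. zm * q powi n)) \<union> (range (\<lambda>n::int. zp * q powi n))"

definition qZ :: "real \<Rightarrow> complex set" where
  "qZ q = range (\<lambda>n::int. of_real (q powi n))"

definition Ppair :: "real \<Rightarrow> real \<Rightarrow> real \<Rightarrow> (complex \<times> complex) set" where
  "Ppair q zm zp = {(\<alpha>, \<beta>).
     \<alpha> \<noteq> 0 \<and> \<beta> \<noteq> 0 \<and>
     (\<forall>k::int. \<forall>z\<in>{zm, zp}. \<alpha> \<noteq> of_real (inverse z * q powi k) \<and> \<beta> \<noteq> of_real (inverse z * q powi k)) \<and>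
     (\<alpha> = cnj \<beta>
      \<or> (\<exists>(x::real) (y::real) (k::int). \<alpha> = of_real x \<and> \<beta> = of_real y \<and>
            zp * q powi k < inverse y \<and> inverse y < inverse x \<and> inverse x < zp * q powi (k - 1))
      \<or> (\<exists>(x::real) (y::real) (k::int). \<alpha> = of_real x \<and> \<beta> = of_real y \<and>
            zm * q powi (k - 1) < inverse x \<and> inverse x < inverse y \<and> inverse y < zm * q powi k))}"

definition P :: "real \<Rightarrow> real \<Rightarrow> real \<Rightarrow> (complex \<times> complex \<times> complex \<times> complex) set" where
  "P q zm zp = {(a, b, c, d). (a, b) \<in> Ppair q zm zp \<and> (c, d) \<in> Ppair q zm zp \<and> a \<noteq> b}"

definition Pgen :: "real \<Rightarrow> real \<Rightarrow> real \<Rightarrow> (complex \<times> complex \<times> complex \<times> complex) set" where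
  "Pgen q zm zp = {(a, b, c, d). (a, b, c, d) \<in> P q zm zp \<and> c \<noteq> d \<and>
     c / a \<notin> qZ q \<and> c / b \<notin> qZ q \<and> d / a \<notin> qZ q \<and> d / b \<notin> qZ q \<and> (c * d) / (a * b) \<notin> qZ q}"

text \<open>On the parameter sets, \<open>ab\<close> and \<open>cd\<close> are positive reals, so that the principal
  square root below is the positive one.\<close>

definition sroot :: "real \<Rightarrow> complex \<Rightarrow> complex \<Rightarrow> complex \<Rightarrow> complex \<Rightarrow> complex" where
  "sroot q a b c d = csqrt (c * d * of_real q / (a * b))"

subsection \<open>The operator and its Hilbert space\<close>

text \<open>A function on \<open>Rq q zm zp\<close> is represented by the function on the reals that extends it by
  zero.  As the lattice is invariant under multiplication by \<open>q\<close> and \<open>1/q\<close>, the operator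
  below maps such functions to such functions.\<close>

definition fun_on :: "real set \<Rightarrow> (real \<Rightarrow> complex) set" where
  "fun_on S = {f. \<forall>x. x \<notin> S \<longrightarrow> f x = 0}"

definition finsupp :: "real set \<Rightarrow> (real \<Rightarrow> complex) set" where
  "finsupp S = {f \<in> fun_on S. finite {x. f x \<noteq> 0}}"

definition coefA :: "real \<Rightarrow> complex \<Rightarrow> complex \<Rightarrow> complex \<Rightarrow> complex \<Rightarrow> real \<Rightarrow> complex" where
  "coefA q a b c d x =
     inverse (sroot q a b c d) * (1 - of_real q / (a * of_real x)) * (1 - of_real q / (b * of_real x))"

definition coefB :: "real \<Rightarrow> complex \<Rightarrow> complex \<Rightarrow> complex \<Rightarrow> complex \<Rightarrow> real \<Rightarrow> complex" where
  "coefB q a b c d x =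
     sroot q a b c d * (1 - 1 / (c * of_real x)) * (1 - 1 / (d * of_real x))"

definition coefC :: "real \<Rightarrow> complex \<Rightarrow> complex \<Rightarrow> complex \<Rightarrow> complex \<Rightarrow> real \<Rightarrow> complex" where
  "coefC q a b c d x =
     inverse (sroot q a b c d) + sroot q a b c d - coefA q a b c d x - coefB q a b c d x"

definition L ::
  "real \<Rightarrow> complex \<Rightarrow> complex \<Rightarrow> complex \<Rightarrow> complex \<Rightarrow> (real \<Rightarrow> complex) \<Rightarrow> real \<Rightarrow> complex" where
  "L q a b c d f x =
     coefA q a b c d x * f (x / q) + coefB q a b c d x * f (q * x) + coefC q a b c d x * f x"

definition wt :: "real \<Rightarrow> complex \<Rightarrow> complex \<Rightarrow> complex \<Rightarrow> complex \<Rightarrow> real \<Rightarrow> complex" where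
  "wt q a b c d x =
     qpochs_inf q [a * of_real x, b * of_real x] / qpochs_inf q [c * of_real x, d * of_real x]"

definition qint_term :: "real \<Rightarrow> real \<Rightarrow> real \<Rightarrow> (real \<Rightarrow> complex) \<Rightarrow> int \<Rightarrow> complex" where
  "qint_term q zm zp f n =
     f (zp * q powi n) * of_real (zp * q powi n) - f (zm * q powi n) * of_real (zm * q powi n)"

definition qint :: "real \<Rightarrow> real \<Rightarrow> real \<Rightarrow> (real \<Rightarrow> complex) \<Rightarrow> complex" where
  "qint q zm zp f = of_real (1 - q) * (\<Sum>\<^sub>\<infinity>n\<in>UNIV. qint_term q zm zp f n)"

text \<open>The weight is positive on the lattice and \<open>zm < 0\<close>, so all terms in the summability
  condition are nonnegative reals.\<close>

definition L2 ::
  "real \<Rightarrow> real \<Rightarrow> real \<Rightarrow> complex \<Rightarrow> complex \<Rightarrow> complex \<Rightarrow> complex \<Rightarrow> (real \<Rightarrow> complex) set" where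
  "L2 q zm zp a b c d = {f \<in> fun_on (Rq q zm zp).
     qint_term q zm zp (\<lambda>x. f x * cnj (f x) * wt q a b c d x) summable_on UNIV}"

definition L2_inner ::
  "real \<Rightarrow> real \<Rightarrow> real \<Rightarrow> complex \<Rightarrow> complex \<Rightarrow> complex \<Rightarrow> complex
    \<Rightarrow> (real \<Rightarrow> complex) \<Rightarrow> (real \<Rightarrow> complex) \<Rightarrow> complex" where
  "L2_inner q zm zp a b c d f g = qint q zm zp (\<lambda>x. f x * cnj (g x) * wt q a b c d x)"

definition Dq :: "real \<Rightarrow> (real \<Rightarrow> complex) \<Rightarrow> real \<Rightarrow> complex" where
  "Dq q f x = (f x - f (q * x)) / of_real ((1 - q) * x)"

definition domL ::
  "real \<Rightarrow> real \<Rightarrow> real \<Rightarrow> complex \<Rightarrow> complex \<Rightarrow> complex \<Rightarrow> complex \<Rightarrow> (real \<Rightarrow> complex) set" where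
  "domL q zm zp a b c d = {f \<in> L2 q zm zp a b c d.
     L q a b c d f \<in> L2 q zm zp a b c d \<and>
     (\<exists>l. (\<lambda>k. f (zm * q ^ k)) \<longlonglongrightarrow> l \<and> (\<lambda>k. f (zp * q ^ k)) \<longlonglongrightarrow> l) \<and>
     (\<exists>l. (\<lambda>k. Dq q f (zm * q ^ k)) \<longlonglongrightarrow> l \<and> (\<lambda>k. Dq q f (zp * q ^ k)) \<longlonglongrightarrow> l)}"

subsection \<open>Spectral measure of a self-adjoint operator\<close>

text \<open>\<open>H\<close> is the underlying set of a Hilbert space of functions with inner product \<open>ip\<close> (linear in
  the first argument), and \<open>T\<close> is an operator with domain \<open>D \<subseteq> H\<close>.\<close>

definition spectral_distr ::
  "((real \<Rightarrow> complex) \<Rightarrow> (real \<Rightarrow> complex) \<Rightarrow> complex)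
    \<Rightarrow> (real set \<Rightarrow> (real \<Rightarrow> complex) \<Rightarrow> (real \<Rightarrow> complex)) \<Rightarrow> (real \<Rightarrow> complex) \<Rightarrow> real measure" where
  "spectral_distr ip E f = measure_of UNIV (sets borel) (\<lambda>B. ennreal (Re (ip (E B f) f)))"

definition projection_valued_measure ::
  "(real \<Rightarrow> complex) set \<Rightarrow> ((real \<Rightarrow> complex) \<Rightarrow> (real \<Rightarrow> complex) \<Rightarrow> complex)
    \<Rightarrow> (real set \<Rightarrow> (real \<Rightarrow> complex) \<Rightarrow> (real \<Rightarrow> complex)) \<Rightarrow> bool" where
  "projection_valued_measure H ip E \<longleftrightarrow>
     (\<forall>B\<in>sets borel. \<forall>f\<in>H. E B f \<in> H) \<and>
     (\<forall>B\<in>sets borel. \<forall>f\<in>H. \<forall>g\<in>H. \<forall>\<alpha> \<beta>.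
        E B (\<lambda>x. \<alpha> * f x + \<beta> * g x) = (\<lambda>x. \<alpha> * E B f x + \<beta> * E B g x)) \<and>
     (\<forall>B\<in>sets borel. \<forall>f\<in>H. E B (E B f) = E B f) \<and>
     (\<forall>B\<in>sets borel. \<forall>f\<in>H. \<forall>g\<in>H. ip (E B f) g = ip f (E B g)) \<and>
     (\<forall>f\<in>H. E UNIV f = f) \<and>
     (\<forall>B\<in>sets borel. \<forall>B'\<in>sets borel. \<forall>f\<in>H. E (B \<inter> B') f = E B (E B' f)) \<and>
     (\<forall>B :: nat \<Rightarrow> real set. range B \<subseteq> sets borel \<longrightarrow> disjoint_family B \<longrightarrow>
        (\<forall>f\<in>H. \<forall>g\<in>H. (\<lambda>n. ip (E (B n) f) g) sums ip (E (\<Union>n. B n) f) g))"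

text \<open>\<open>T = \<integral> t dE(t)\<close>, in the usual quadratic-form sense: the domain consists of the \<open>f\<close> with
  \<open>\<integral> t\<^sup>2 d\<langle>E f,f\<rangle> < \<infinity>\<close>, and \<open>\<langle>T f,f\<rangle> = \<integral> t d\<langle>E f,f\<rangle>\<close> there (which determines \<open>T f\<close> by
  polarization, \<open>D\<close> being dense).\<close>

definition spectral_measure_of ::
  "(real \<Rightarrow> complex) set \<Rightarrow> ((real \<Rightarrow> complex) \<Rightarrow> (real \<Rightarrow> complex) \<Rightarrow> complex)
    \<Rightarrow> (real \<Rightarrow> complex) set \<Rightarrow> ((real \<Rightarrow> complex) \<Rightarrow> (real \<Rightarrow> complex))
    \<Rightarrow> (real set \<Rightarrow> (real \<Rightarrow> complex) \<Rightarrow> (real \<Rightarrow> complex)) \<Rightarrow> bool" where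
  "spectral_measure_of H ip D T E \<longleftrightarrow>
     projection_valued_measure H ip E \<and>
     D = {f \<in> H. (\<integral>\<^sup>+ t. ennreal (t\<^sup>2) \<partial>spectral_distr ip E f) < \<infinity>} \<and>
     (\<forall>f\<in>D. ip (T f) f = of_real (\<integral> t. t \<partial>spectral_distr ip E f))"

subsection \<open>Big \<open>q\<close>-Jacobi functions and the transforms\<close>

text \<open>Interchanging \<open>a\<close> and \<open>b\<close> in the argument list gives the functions marked with a dagger.\<close>

definition bigqJacobi ::
  "real \<Rightarrow> real \<Rightarrow> real \<Rightarrow> complex \<Rightarrow> complex \<Rightarrow> complex \<Rightarrow> complex \<Rightarrow> complex \<Rightarrow> real \<Rightarrow> complex" where
  "bigqJacobi q zm zp a b c d \<gamma> = (THE f.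
     f \<in> fun_on (Rq q zm zp) \<and>
     (\<forall>x\<in>Rq q zm zp. \<bar>x\<bar> < 1 / norm b \<longrightarrow>
        f x = phi32 (of_real q / (a * of_real x)) (sroot q a b c d * \<gamma>) (sroot q a b c d / \<gamma>)
                    (c * of_real q / a) (d * of_real q / a) q (b * of_real x)) \<and>
     (\<forall>x\<in>Rq q zm zp. L q a b c d f x = (\<gamma> + inverse \<gamma>) * f x))"

definition Fc ::
  "real \<Rightarrow> real \<Rightarrow> real \<Rightarrow> complex \<Rightarrow> complex \<Rightarrow> complex \<Rightarrow> complex
    \<Rightarrow> (real \<Rightarrow> complex) \<Rightarrow> complex \<Rightarrow> complex" where
  "Fc q zm zp a b c d f \<gamma> =
     qint q zm zp (\<lambda>x. f x * bigqJacobi q zm zp a b c d \<gamma> x * wt q a b c d x)"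

definition Fc_dagger ::
  "real \<Rightarrow> real \<Rightarrow> real \<Rightarrow> complex \<Rightarrow> complex \<Rightarrow> complex \<Rightarrow> complex
    \<Rightarrow> (real \<Rightarrow> complex) \<Rightarrow> complex \<Rightarrow> complex" where
  "Fc_dagger q zm zp a b c d f \<gamma> =
     qint q zm zp (\<lambda>x. f x * bigqJacobi q zm zp b a c d \<gamma> x * wt q a b c d x)"

subsection \<open>The weight matrix\<close>

definition v1 ::
  "real \<Rightarrow> real \<Rightarrow> real \<Rightarrow> complex \<Rightarrow> complex \<Rightarrow> complex \<Rightarrow> complex \<Rightarrow> complex \<Rightarrow> complex" where
  "v1 q zm zp a b c d \<gamma> =
    (let s = sroot q a b c d; Q = complex_of_real q;
         m = complex_of_real zm; p = complex_of_real zp; \<delta> = inverse \<gamma> in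
       (qpochs_inf q [c * Q / a, d * Q / a])\<^sup>2 * theta q [b * p, b * m]
         / ((1 - Q) * a * b * m\<^sup>2 * p\<^sup>2 * theta q [m / p, p / m, a / b, b / a])
       * (qpochs_inf q [\<gamma>\<^sup>2, \<delta>\<^sup>2]
           / (qpochs_inf q [s * \<gamma>, s * \<delta>,
                c * Q * \<gamma> / (a * s), c * Q * \<delta> / (a * s),
                d * Q * \<gamma> / (a * s), d * Q * \<delta> / (a * s)]
              * theta q [s * \<gamma>, s * \<delta>, a * b * s * m * p * \<gamma>, a * b * s * m * p * \<delta>]))
       * (m * theta q [a * p, c * p, d * p, b * m, a * s * m * \<gamma>, a * s * m * \<delta>]
          - p * theta q [a * m, c * m, d * m, b * p, a * s * p * \<gamma>, a * s * p * \<delta>]))"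

definition v2 ::
  "real \<Rightarrow> real \<Rightarrow> real \<Rightarrow> complex \<Rightarrow> complex \<Rightarrow> complex \<Rightarrow> complex \<Rightarrow> complex \<Rightarrow> complex" where
  "v2 q zm zp a b c d \<gamma> =
    (let s = sroot q a b c d; Q = complex_of_real q;
         m = complex_of_real zm; p = complex_of_real zp; \<delta> = inverse \<gamma> in
       qpochs_inf q [c * Q / a, d * Q / a, c * Q / b, d * Q / b]
         * theta q [a * p, a * m, b * p, b * m, c * d * m * p]
         / (a * b * m\<^sup>2 * p * (1 - Q) * theta q [p / m, a / b, b / a])
       * (qpochs_inf q [\<gamma>\<^sup>2, \<delta>\<^sup>2]
           / (qpochs_inf q [s * \<gamma>, s * \<delta>]
              * theta q [s * \<gamma>, s * \<delta>, a * b * s * m * p * \<gamma>, a * b * s * m * p * \<delta>])))"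

definition v1_dagger ::
  "real \<Rightarrow> real \<Rightarrow> real \<Rightarrow> complex \<Rightarrow> complex \<Rightarrow> complex \<Rightarrow> complex \<Rightarrow> complex \<Rightarrow> complex" where
  "v1_dagger q zm zp a b c d \<gamma> = v1 q zm zp b a c d \<gamma>"

definition vmatrix ::
  "real \<Rightarrow> real \<Rightarrow> real \<Rightarrow> complex \<Rightarrow> complex \<Rightarrow> complex \<Rightarrow> complex \<Rightarrow> complex \<Rightarrow> complex^2^2" where
  "vmatrix q zm zp a b c d \<gamma> =
     vector [vector [v2 q zm zp a b c d \<gamma>, v1_dagger q zm zp a b c d \<gamma>],
             vector [v1 q zm zp a b c d \<gamma>, v2 q zm zp a b c d \<gamma>]]"

text \<open>The product of a row vector and a column vector; no complex conjugation is involved.\<close>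

definition row_col :: "complex^2 \<Rightarrow> complex^2 \<Rightarrow> complex" where
  "row_col u v = (\<Sum>i\<in>UNIV. u $ i * v $ i)"

end

theory Submission
  imports Defs "HOL-Complex_Analysis.Complex_Analysis"
begin

text \<open>The spectral measure is recovered from the resolvent by Stieltjes inversion.  For \<open>\<lambda> = \<gamma> + 1/\<gamma>\<close>
  with \<open>\<bar>\<gamma>\<bar> > 1\<close> the resolvent is an explicit Green kernel: at each end \<open>z\<^sub>\<plusminus> q\<^sup>n\<close>, \<open>n \<rightarrow> -\<infinity>\<close>, of the
  lattice the square summable solution is the combination of \<open>\<phi>\<^sub>\<gamma>\<close> and its dagger in which the leading
  terms cancel.  The leading coefficients are theta quotients, found from Sears' transformation of
  the \<open>3\<phi>2\<close> series and the \<open>q\<close>-Gauss sum, and the Casoratian of \<open>\<phi>\<^sub>\<gamma>\<close> and its dagger is explicit as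
  well.  On the unit circle \<open>\<phi>\<^sub>\<gamma>\<close> is invariant under \<open>\<gamma> \<mapsto> 1/\<gamma>\<close>, so the jump of the kernel across the
  continuous spectrum is a quadratic form in \<open>\<phi>\<^sub>\<gamma>\<close> and its dagger; the three-term relation for theta
  functions evaluates its coefficients to \<open>v\<^sub>1\<close>, \<open>v\<^sub>2\<close> and the dagger of \<open>v\<^sub>1\<close>.\<close>

section \<open>\<open>q\<close>-shifted factorials and theta functions\<close>

text \<open>Three obstacles shape the proof. The series for \<open>\<phi>\<^sub>\<gamma>\<close>
  converges only near the origin, whereas the kernel lives on the whole lattice. Sears'
  transformation turns \<open>(bx;q)\<^sub>\<infinity> \<phi>\<^sub>\<gamma>(x)\<close> into an
  entire function of \<open>x\<close>: identities known near 0 extend by the identity theorem, and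
  the matching conditions at 0 in the domain follow from differentiability there. The transformed
  series need not converge for a given order of \<open>c\<close> and \<open>d\<close>, but it does
  for one of the two orders. The spectral measure is given only through quadratic forms. For
  \<open>f = (L - \<lambda>) u\<close> the Poisson integral of the distribution of \<open>f\<close>
  is identified with the imaginary part of the form \<open>\<langle>u, f\<rangle>\<close> without a
  functional calculus, by comparing masses on short spectral intervals. The boundary values at the
  unit circle exist because \<open>Im \<gamma> \<noteq> 0\<close> keeps all denominators of the
  kernel away from 0. Since the forms at \<open>\<gamma>\<close> and at its conjugate are conjugate
  numbers, the imaginary part that enters the inversion is half the jump between
  \<open>\<gamma>\<close> and \<open>1/\<gamma>\<close>, divided by the imaginary unit.\<close>

lemma tendsto_infsum_dominated:
  fixes f :: "'b \<Rightarrow> 'a \<Rightarrow> complex"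
  assumes le: "\<And>n x. x \<in> X \<Longrightarrow> norm (f n x) \<le> M x" and M: "M summable_on X"
    and lim: "\<And>x. x \<in> X \<Longrightarrow> ((\<lambda>n. f n x) \<longlongrightarrow> g x) F" and F: "F \<noteq> bot"
  shows "((\<lambda>n. infsum (f n) X) \<longlongrightarrow> infsum g X) F"
proof -
  have gle: "norm (g x) \<le> M x" if "x \<in> X" for x
    by (rule tendsto_upperbound[OF tendsto_norm[OF lim[OF that]] _ F]) (use le that in auto)
  have gs: "g summable_on X"
    by (rule abs_summable_summable, rule summable_on_comparison_test[OF M]) (use gle in auto)
  \<comment> \<open>The M-test makes the finite partial sums converge uniformly in \<open>n\<close>;
    this uniformity is what permits the exchange of the two limits.\<close>
  have u: "uniform_limit UNIV (\<lambda>Y n. \<Sum>x\<in>Y. f n x) (\<lambda>n. infsum (f n) X) (finite_subsets_at_top X)"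
    by (rule Weierstrass_m_test_general[OF _ M]) (use le in auto)
  show ?thesis
  proof (rule swap_uniform_limit'[OF _ _ u])
    show "\<forall>\<^sub>F Y in finite_subsets_at_top X. ((\<lambda>n. \<Sum>x\<in>Y. f n x) \<longlongrightarrow> (\<Sum>x\<in>Y. g x)) (F :: 'b filter)"
      by (rule eventually_finite_subsets_at_top_weakI) (auto intro!: tendsto_sum lim)
    show "((\<lambda>Y. sum g Y) \<longlongrightarrow> infsum g X) (finite_subsets_at_top X)"
      using gs has_sum_def has_sum_infsum by blast
  qed auto
qed

lemma suminf_eq_infsum:
  fixes f :: "nat \<Rightarrow> complex"
  assumes "summable (\<lambda>n. norm (f n))"
  shows "suminf f = infsum f UNIV"
  using norm_summable_imp_has_sum[OF assms summable_sums[OF summable_norm_cancel[OF assms]]]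
  by (simp add: infsumI)

lemma holomorphic_on_suminf:
  fixes f :: "nat \<Rightarrow> complex \<Rightarrow> complex"
  assumes S: "open S" and hol: "\<And>n. f n holomorphic_on S"
    and bd: "\<And>x. x \<in> S \<Longrightarrow> \<exists>d M. 0 < d \<and> summable M \<and> (\<forall>n. \<forall>y\<in>ball x d \<inter> S. norm (f n y) \<le> M n)"
  shows "(\<lambda>x. \<Sum>n. f n x) holomorphic_on S"
proof -
  obtain g where g: "\<forall>x \<in> S. ((\<lambda>n. f n x) sums g x) \<and> g field_differentiable (at x)"
  proof (rule series_differentiable_comparison_complex[OF S, of f])
    show "f n field_differentiable at x" if "x \<in> S" for n x
      using hol S that by (metis holomorphic_on_imp_differentiable_at)
    fix x assume x: "x \<in> S"
    then obtain d M where dM: "0 < d" "summable M" "\<forall>n. \<forall>y\<in>ball x d \<inter> S. norm (f n y) \<le> M n"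
      using bd by blast
    have M0: "M n \<ge> 0" for n using dM x by (meson Int_iff centre_in_ball norm_ge_zero order_trans)
    show "\<exists>d h. 0 < d \<and> summable h \<and> range h \<subseteq> \<real>\<^sub>\<ge>\<^sub>0 \<and> (\<forall>\<^sub>F n in sequentially. \<forall>y\<in>ball x d \<inter> S. cmod(f n y) \<le> cmod (h n))"
      by (rule exI[of _ d], rule exI[of _ "\<lambda>n. of_real (M n)"])
        (use dM M0 in \<open>auto simp: summable_of_real_iff\<close>)
  qed blast
  have "(\<Sum>n. f n x) = g x" if "x \<in> S" for x using g that by (metis sums_unique)
  then show ?thesis
    using g S by (simp add: holomorphic_on_def cong: holomorphic_cong)
      (metis (no_types, lifting) field_differentiable_at_within field_differentiable_transform_within
        holomorphic_on_def holomorphic_transform)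
qed

section \<open>Infinite q-products: convergence, zeros, bounds, holomorphy\<close>

locale qbase =
  fixes q :: real
  assumes q0: "0 < q" and q1: "q < 1"
begin

abbreviation "pinf \<equiv> qpoch_inf q"
abbreviation "poch \<equiv> qpoch q"
abbreviation "th \<equiv> theta1 q"
abbreviation "Q \<equiv> complex_of_real q"

lemma Q_ne [simp]: "Q \<noteq> 0" "q \<noteq> 0" "q \<noteq> 1" and norm_Q [simp]: "norm Q = q" and q_nn [simp]: "0 \<le> q" "q \<le> 1"
  using q0 q1 by auto

lemma Q_pow_tendsto: "(\<lambda>n. x * Q ^ n) \<longlonglongrightarrow> 0"
  by (rule tendsto_mult_right_zero, rule LIMSEQ_power_zero) (use q1 in auto)

lemma summable_Q: "summable (\<lambda>k. norm (- (x * Q ^ k)))"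
  using q0 q1 by (simp add: norm_mult norm_power summable_mult summable_geometric)

lemma convergent_pinf: "convergent_prod (\<lambda>k. 1 - x * Q ^ k)"
  using abs_convergent_prod_imp_convergent_prod
    summable_imp_abs_convergent_prod[of "\<lambda>k. 1 - x * Q ^ k"] summable_Q[of x] by simp

lemma poch_tendsto: "(\<lambda>n. poch x n) \<longlonglongrightarrow> pinf x"
proof -
  have "(\<lambda>n. \<Prod>i\<le>n. 1 - x * Q ^ i) \<longlonglongrightarrow> pinf x"
    unfolding qpoch_inf_def by (rule convergent_prod_LIMSEQ[OF convergent_pinf])
  then have "(\<lambda>n. poch x (Suc n)) \<longlonglongrightarrow> pinf x"
    by (simp add: qpoch_def lessThan_Suc_atMost)
  then show ?thesis by (simp add: filterlim_sequentially_Suc)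
qed

lemma poch_0 [simp]: "poch x 0 = 1" and poch_Suc: "poch x (Suc n) = poch x n * (1 - x * Q ^ n)"
  by (simp_all add: qpoch_def)

lemma poch_Suc': "poch x (Suc n) = (1 - x) * poch (x * Q) n"
  unfolding qpoch_def by (subst prod.lessThan_Suc_shift) (simp add: mult.assoc)

lemma pinf_split: "pinf x = poch x n * pinf (x * Q ^ n)"
proof -
  have "(\<lambda>m. poch x (m + n)) \<longlonglongrightarrow> pinf x" using poch_tendsto by (rule LIMSEQ_ignore_initial_segment)
  moreover have "poch x (m + n) = poch x n * poch (x * Q ^ n) m" for m
    by (induction m) (auto simp: poch_Suc power_add mult_ac)
  moreover have "(\<lambda>m. poch x n * poch (x * Q ^ n) m) \<longlonglongrightarrow> poch x n * pinf (x * Q ^ n)"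
    by (intro tendsto_intros poch_tendsto)
  ultimately show ?thesis using LIMSEQ_unique by simp
qed

lemma pinf_rec: "pinf x = (1 - x) * pinf (x * Q)"
  using pinf_split[of x 1] by (simp add: qpoch_def)

lemma pinf_eq_0_iff: "pinf x = 0 \<longleftrightarrow> (\<exists>k. x * Q ^ k = 1)"
proof -
  have "(\<lambda>k. 1 - x * Q ^ k) has_prod pinf x"
    unfolding qpoch_inf_def using convergent_pinf convergent_prod_has_prod by blast
  from has_prod_eq_0_iff[OF this] show ?thesis by (auto simp: image_iff)
qed

lemma poch_eq_0_iff: "poch x n = 0 \<longleftrightarrow> (\<exists>k<n. x * Q ^ k = 1)"
  by (auto simp: qpoch_def)

lemma pinf_ne_0_poch: "pinf x \<noteq> 0 \<Longrightarrow> poch x n \<noteq> 0"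
  by (simp add: pinf_eq_0_iff poch_eq_0_iff)

lemma pinf_ne_0_lt1: "norm x < 1 \<Longrightarrow> pinf x \<noteq> 0"
proof
  assume x: "norm x < 1" and "pinf x = 0"
  then obtain k where "x * Q ^ k = 1" by (auto simp: pinf_eq_0_iff)
  then have "norm x * q ^ k = 1" by (metis norm_Q norm_mult norm_one norm_power)
  moreover have "norm x * q ^ k \<le> norm x" using q0 q1 by (simp add: mult_left_le power_le_one)
  ultimately show False using x by simp
qed

lemma pinf_Q_ne [simp]: "pinf Q \<noteq> 0" and pochQ_ne [simp]: "poch Q n \<noteq> 0"
proof -
  show "pinf Q \<noteq> 0" by (rule pinf_ne_0_lt1) (use q1 in simp)
  then show "poch Q n \<noteq> 0" by (rule pinf_ne_0_poch)
qed

lemma poch_zero [simp]: "poch 0 n = 1" by (simp add: qpoch_def)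
lemma pinf_0 [simp]: "pinf 0 = 1"
  using LIMSEQ_unique[OF poch_tendsto[of 0]] by simp
text \<open>Comparison with the exponential of a geometric sum. The bound is independent of
  \<open>n\<close>, so it supplies the constants in the later dominations of series.\<close>

lemma norm_poch_le: "norm (poch x n) \<le> exp (norm x / (1 - q))"
proof -
  have "norm (poch x n) \<le> (\<Prod>k<n. 1 + norm x * q ^ k)"
    unfolding qpoch_def prod_norm[symmetric]
    by (rule prod_mono) (auto intro!: order_trans[OF norm_triangle_ineq4] simp: norm_mult norm_power)
  also have "\<dots> \<le> exp (\<Sum>k<n. norm x * q ^ k)"
    by (rule prod_le_exp_sum) (use q0 in auto)
  also have "\<dots> \<le> exp (norm x / (1 - q))"
  proof -
    have "(\<Sum>k<n. q ^ k) \<le> (\<Sum>k. q ^ k)"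
      by (rule sum_le_suminf) (use q0 q1 in \<open>auto intro: summable_geometric\<close>)
    also have "\<dots> = 1 / (1 - q)" using q0 q1 by (simp add: suminf_geometric)
    finally have "norm x * (\<Sum>k<n. q ^ k) \<le> norm x * (1 / (1 - q))"
      by (rule mult_left_mono) simp
    then show ?thesis by (simp add: sum_distrib_left)
  qed
  finally show ?thesis .
qed

lemma norm_poch_le': "norm x \<le> r \<Longrightarrow> norm (poch x n) \<le> exp (r / (1 - q))"
  using norm_poch_le[of x n] q1 by (smt (verit) divide_right_mono exp_le_cancel_iff)

lemma norm_pinf_le: "norm x \<le> r \<Longrightarrow> norm (pinf x) \<le> exp (r / (1 - q))"
  by (rule tendsto_upperbound[OF tendsto_norm[OF poch_tendsto]]) (auto intro!: always_eventually norm_poch_le')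

lemma holomorphic_pinf0: "pinf holomorphic_on UNIV"
proof (rule holomorphic_uniform_sequence[where f = "\<lambda>n x. poch x n"])
  show "(\<lambda>x. poch x n) holomorphic_on UNIV" for n
    unfolding qpoch_def by (intro holomorphic_intros)
  fix x :: complex
  let ?r = "norm x + 1"
  have "uniformly_convergent_on (cball x 1) (\<lambda>n y. \<Prod>k<n. 1 + (- (y * Q ^ k)))"
  proof (rule uniformly_convergent_on_prod)
    have "uniformly_convergent_on (cball x 1) (\<lambda>n y. \<Sum>k<n. norm (- (y * Q ^ k)))"
    proof (rule Weierstrass_m_test'[where M = "\<lambda>k. ?r * q ^ k"])
      show "summable (\<lambda>k. (norm x + 1) * q ^ k)" using q1 by (simp add: summable_mult summable_geometric)
      fix n y assume "y \<in> cball x 1"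
      then have "norm y \<le> norm x + 1"
        by (metis add.commute diff_add_cancel dist_norm dist_commute mem_cball norm_triangle_ineq order_trans add_left_mono)
      then show "norm (norm (- (y * Q ^ n))) \<le> ?r * q ^ n"
        using q0 by (simp add: norm_mult norm_power mult_right_mono)
    qed
    then show "uniformly_convergent_on (cball x 1) (\<lambda>N y. \<Sum>n<N. norm (- (y * Q ^ n)))" .
  qed (auto intro!: continuous_intros)
  then obtain l where l: "uniform_limit (cball x 1) (\<lambda>n y. poch y n) l sequentially"
    by (auto simp: uniformly_convergent_on_def qpoch_def)
  then have "l y = pinf y" if "y \<in> cball x 1" for y
    using tendsto_uniform_limitI[OF l that] poch_tendsto LIMSEQ_unique by blast
  then have "uniform_limit (cball x 1) (\<lambda>n y. poch y n) pinf sequentially"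
    using l by (metis (mono_tags, lifting) uniform_limit_cong')
  then show "\<exists>d>0. cball x d \<subseteq> UNIV \<and> uniform_limit (cball x d) (\<lambda>n x. poch x n) pinf sequentially"
    by (intro exI[of _ 1]) auto
qed auto

lemma holomorphic_pinf [holomorphic_intros]: "f holomorphic_on S \<Longrightarrow> (\<lambda>x. pinf (f x)) holomorphic_on S"
  using holomorphic_on_compose[of f S pinf] holomorphic_pinf0
  by (metis comp_def holomorphic_on_subset subset_UNIV holomorphic_cong)

lemma continuous_pinf [continuous_intros]: "continuous_on S f \<Longrightarrow> continuous_on S (\<lambda>x. pinf (f x))"
  by (rule continuous_on_compose2[OF holomorphic_on_imp_continuous_on[OF holomorphic_pinf0]]) auto

lemma tendsto_pinf [tendsto_intros]: "(f \<longlongrightarrow> l) F \<Longrightarrow> ((\<lambda>x. pinf (f x)) \<longlongrightarrow> pinf l) F"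
  using holomorphic_on_imp_continuous_on[OF holomorphic_pinf0] 
  by (simp add: continuous_on_def) (metis UNIV_I at_within_open isCont_tendsto_compose continuous_on_eq_continuous_at[OF open_UNIV] holomorphic_on_imp_continuous_on[OF holomorphic_pinf0])

lemma bounded_inverse_poch: assumes "pinf x \<noteq> 0" obtains K where "K > 0" "\<And>n. norm (1 / poch x n) \<le> K"
proof -
  have "(\<lambda>n. 1 / poch x n) \<longlonglongrightarrow> 1 / pinf x" by (intro tendsto_intros poch_tendsto assms)
  then have "Bseq (\<lambda>n. 1 / poch x n)" using convergentI convergent_imp_Bseq by blast
  then show ?thesis using that by (auto simp: Bseq_def)
qed

text \<open>The factor \<open>pinf x\<close> vanishes at the powers of \<open>q\<close> with
  exponent at most 0, the factor \<open>pinf (Q / x)\<close> at those with positive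
  exponent.\<close>

lemma th_eq_0_iff: "x \<noteq> 0 \<Longrightarrow> th x = 0 \<longleftrightarrow> (\<exists>k::int. x = Q powi k)"
proof -
  assume x: "x \<noteq> 0"
  have 1: "pinf x = 0 \<longleftrightarrow> (\<exists>k::nat. x = Q powi (- int k))"
    unfolding pinf_eq_0_iff using x by (simp add: power_int_minus field_simps)
  have 2: "pinf (Q / x) = 0 \<longleftrightarrow> (\<exists>k::nat. x = Q powi (int (Suc k)))"
  proof -
    have "Q / x * Q ^ k = 1 \<longleftrightarrow> x = Q powi (int (Suc k))" for k
      using x by (auto simp: power_int_def nat_add_distrib field_simps)
    then show ?thesis unfolding pinf_eq_0_iff by simp
  qed
  have "th x = 0 \<longleftrightarrow> (\<exists>k::nat. x = Q powi (- int k)) \<or> (\<exists>k::nat. x = Q powi (int (Suc k)))"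
    unfolding theta1_def using 1 2 by simp
  also have "\<dots> \<longleftrightarrow> (\<exists>k::int. x = Q powi k)"
  proof
    assume "\<exists>k::int. x = Q powi k"
    then obtain k :: int where k: "x = Q powi k" by blast
    show "(\<exists>k::nat. x = Q powi (- int k)) \<or> (\<exists>k::nat. x = Q powi (int (Suc k)))"
    proof (cases "k \<le> 0")
      case True then show ?thesis using k by (intro disjI1 exI[of _ "nat (- k)"]) simp
    next
      case False
      then have "int (Suc (nat (k - 1))) = k" by simp
      then show ?thesis using k by metis
    qed
  qed blast
  finally show ?thesis .
qed

lemma th_inv: "x \<noteq> 0 \<Longrightarrow> th (Q / x) = th x"
  by (simp add: theta1_def mult.commute)

lemma th_mult_q: "x \<noteq> 0 \<Longrightarrow> th (x * Q) = - th x / x"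
proof -
  assume x: "x \<noteq> 0"
  have "x * th (x * Q) = (x * pinf (1 / x)) * pinf (x * Q)" using x by (simp add: theta1_def)
  also have "x * pinf (1 / x) = (x - 1) * pinf (Q / x)" using x pinf_rec[of "1 / x"] by (simp add: field_simps)
  also have "\<dots> * pinf (x * Q) = - th x" unfolding theta1_def pinf_rec[of x] by (simp add: algebra_simps)
  finally show ?thesis using x by (simp add: field_simps)
qed

lemma th_inverse: "x \<noteq> 0 \<Longrightarrow> th (1 / x) = - th x / x"
  using th_inv[of "1 / x"] th_mult_q[of x] by (simp add: mult.commute)

end

section \<open>Jacobi's triple product and the three-term relation for theta functions\<close>

lemma summable_on_int:
  fixes f :: "int \<Rightarrow> real"
  assumes "summable (\<lambda>n. f (int n))" "summable (\<lambda>n. f (- int (Suc n)))" "\<And>j. f j \<ge> 0"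
  shows "f summable_on UNIV"
proof -
  have U: "UNIV = range int \<union> range (\<lambda>n. - int (Suc n))"
  proof (intro equalityI subsetI)
    fix j :: int
    show "j \<in> range int \<union> range (\<lambda>n. - int (Suc n))"
      by (cases j rule: int_cases) auto
  qed simp
  have inj: "inj (\<lambda>n. - int (Suc n))" by (auto intro!: injI)
  have "f summable_on range int"
    by (subst summable_on_reindex) (use assms in \<open>auto simp: summable_on_UNIV_nonneg_real_iff o_def\<close>)
  moreover have "f summable_on range (\<lambda>n. - int (Suc n))"
    by (subst summable_on_reindex[OF inj]) (use assms in \<open>simp add: summable_on_UNIV_nonneg_real_iff o_def\<close>)
  ultimately show ?thesis unfolding U
    by (rule summable_on_Un_disjoint) auto
qed

text \<open>The binomial coefficient over 2, for negative \<open>j\<close> as well. The division is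
  exact, and \<open>two_tri\<close> is the form without division.\<close>

definition tri :: "int \<Rightarrow> int" where "tri j = j * (j - 1) div 2"

lemma two_tri: "2 * tri j = j * (j - 1)"
  unfolding tri_def by (simp add: even_two_times_div_two)

lemma tri_Suc: "tri (j + 1) = tri j + j"
  using two_tri[of j] two_tri[of "j+1"] by (simp add: algebra_simps)

context qbase
begin

text \<open>The terms of the Laurent series of \<open>pinf Q * th x\<close>, see
  \<open>jacobi_triple\<close>.\<close>

definition thterm :: "complex \<Rightarrow> int \<Rightarrow> complex" where
  "thterm x j = (-1) powi j * Q powi tri j * x powi j"

lemma thterm_Suc: "x \<noteq> 0 \<Longrightarrow> thterm x (j + 1) = - (Q powi j * x * thterm x j)"
  by (simp add: thterm_def tri_Suc power_int_add power_int_add_1)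

lemma thterm_pred: "x \<noteq> 0 \<Longrightarrow> thterm x (j - 1) = - (Q powi (1 - j) / x * thterm x j)"
  using thterm_Suc[of x "j - 1"] by (simp add: power_int_diff field_simps)

lemma thterm_summable: assumes x: "x \<noteq> 0" shows "(\<lambda>j. norm (thterm x j)) summable_on UNIV"
proof (rule summable_on_int)
  \<comment> \<open>The exponent is quadratic in the index, so the quotient of consecutive terms
    tends to 0 in both directions for every \<open>x\<close>; 1/2 serves as the ratio.\<close>
  obtain N where N: "\<And>n. n \<ge> N \<Longrightarrow> norm (x * Q ^ n) < 1/2"
    using Q_pow_tendsto[of x] unfolding LIMSEQ_iff by (metis diff_zero half_gt_zero_iff zero_less_one)
  show "summable (\<lambda>n. norm (thterm x (int n)))"
  proof (rule summable_ratio_test[where c = "1/2" and N = N])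
    fix n assume "n \<ge> N"
    have "thterm x (int (Suc n)) = - (x * Q ^ n) * thterm x (int n)"
      using thterm_Suc[OF x, of "int n"] by (simp add: add.commute mult_ac)
    then have "norm (thterm x (int (Suc n))) = norm (x * Q ^ n) * norm (thterm x (int n))"
      by (simp add: norm_mult)
    also have "\<dots> \<le> 1/2 * norm (thterm x (int n))"
      by (rule mult_right_mono) (use N[OF \<open>n \<ge> N\<close>] in auto)
    finally show "norm (norm (thterm x (int (Suc n)))) \<le> 1 / 2 * norm (norm (thterm x (int n)))" by simp
  qed simp
  obtain M where M: "\<And>n. n \<ge> M \<Longrightarrow> norm (Q^2 / x * Q ^ n) < 1/2"
    using Q_pow_tendsto[of "Q^2/x"] unfolding LIMSEQ_iff by (metis diff_zero half_gt_zero_iff zero_less_one)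
  show "summable (\<lambda>n. norm (thterm x (- int (Suc n))))"
  proof (rule summable_ratio_test[where c = "1/2" and N = M])
    fix n assume "n \<ge> M"
    have e: "- int (Suc n) - 1 = - int (Suc (Suc n))" "1 - - int (Suc n) = int (n + 2)" by simp_all
    have "thterm x (- int (Suc (Suc n))) = - (Q^2 / x * Q ^ n) * thterm x (- int (Suc n))"
      using thterm_pred[OF x, of "- int (Suc n)", unfolded e power_int_of_nat] by (simp add: power_add mult_ac power2_eq_square)
    then have "norm (thterm x (- int (Suc (Suc n)))) = norm (Q^2 / x * Q ^ n) * norm (thterm x (- int (Suc n)))"
      by (simp only: norm_mult norm_minus_cancel)
    also have "\<dots> \<le> 1/2 * norm (thterm x (- int (Suc n)))"
      by (rule mult_right_mono) (use M[OF \<open>n \<ge> M\<close>] in auto)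
    finally show "norm (norm (thterm x (- int (Suc (Suc n))))) \<le> 1 / 2 * norm (norm (thterm x (- int (Suc n))))" by simp
  qed simp
qed simp

text \<open>Reciprocal \<open>q\<close>-factorial, extended by zero to negative integers so that the recursion below
  holds without boundary cases.\<close>

definition rfact :: "int \<Rightarrow> complex" where
  "rfact k = (if k < 0 then 0 else 1 / poch Q (nat k))"

lemma rfact_pred: "rfact (k - 1) = (1 - Q powi k) * rfact k"
proof (cases "k \<le> 0")
  case True then show ?thesis by (cases "k = 0") (auto simp: rfact_def)
next
  case False
  then obtain n where n: "k = int (Suc n)" using zero_less_imp_eq_int by (metis not_le gr0_conv_Suc of_nat_0_less_iff)
  have "1 - Q * Q ^ n \<noteq> 0" using pochQ_ne[of "Suc n"] unfolding poch_Suc by simp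
  then show ?thesis unfolding n by (simp add: rfact_def poch_Suc power_int_add power_int_add_1' nat_add_distrib)
qed

text \<open>\<open>G n j\<close> is the Gaussian binomial coefficient "2n over n+j". The recursion
  combines two steps of the q-Pascal rule, which raises \<open>n\<close> by one and keeps the
  symmetry between \<open>j\<close> and \<open>-j\<close>.\<close>

lemma gauss_binomial_rec:
  fixes j :: int and n :: nat
  defines "G \<equiv> \<lambda>n j. poch Q (2 * n) * rfact (int n + j) * rfact (int n - j)"
  shows "G (Suc n) j = (1 + Q ^ (2 * n + 1)) * G n j + Q powi (int n + 1 - j) * G n (j - 1)
           + Q powi (int n + 1 + j) * G n (j + 1)"
proof -
  define \<alpha> \<beta> where "\<alpha> = Q powi (int n + j)" and "\<beta> = Q powi (int n - j)"
  \<comment> \<open>All four coefficients are polynomial multiples of \<open>R * S\<close>, so a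
    polynomial identity in \<open>\<alpha>\<close> and \<open>\<beta>\<close> remains, with
    \<open>\<alpha> * \<beta> = Q ^ (2 * n)\<close>.\<close>
  define R S where "R = rfact (int n + j + 1)" and "S = rfact (int n - j + 1)"
  have ab: "\<alpha> * \<beta> = Q ^ (2 * n)"
  proof -
    have "\<alpha> * \<beta> = Q powi ((int n + j) + (int n - j))" unfolding \<alpha>_def \<beta>_def by (simp only: power_int_add Q_ne simp_thms)
    also have "(int n + j) + (int n - j) = int (2 * n)" by simp
    finally show ?thesis by (simp only: power_int_of_nat)
  qed
  have e1: "Q powi (int n + 1 - j) = \<beta> * Q" "Q powi (int n + 1 + j) = \<alpha> * Q"
    unfolding \<alpha>_def \<beta>_def by (simp_all add: power_int_add power_int_diff)
  have r: "rfact (int n + j) = (1 - \<alpha> * Q) * R" "rfact (int n - j) = (1 - \<beta> * Q) * S"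
    "rfact (int n + (j - 1)) = (1 - \<alpha>) * ((1 - \<alpha> * Q) * R)" "rfact (int n - (j + 1)) = (1 - \<beta>) * ((1 - \<beta> * Q) * S)"
    "rfact (int n + (j + 1)) = R" "rfact (int n - (j - 1)) = S" "rfact (int (Suc n) + j) = R" "rfact (int (Suc n) - j) = S"
  proof -
    have A: "Q powi (int n + j + 1) = \<alpha> * Q" "Q powi (int n - j + 1) = \<beta> * Q"
      unfolding \<alpha>_def \<beta>_def by (simp_all only: power_int_add_1 Q_ne simp_thms)
    have B: "int n + j + 1 - 1 = int n + j" "int n - j + 1 - 1 = int n - j" "int n + (j - 1) = int n + j - 1" "int n - (j + 1) = int n - j - 1"
      "int n + (j + 1) = int n + j + 1" "int n - (j - 1) = int n - j + 1" "int (Suc n) + j = int n + j + 1" "int (Suc n) - j = int n - j + 1"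
      by simp_all
    show r1: "rfact (int n + j) = (1 - \<alpha> * Q) * R" and r2: "rfact (int n - j) = (1 - \<beta> * Q) * S"
      using rfact_pred[of "int n + j + 1"] rfact_pred[of "int n - j + 1"] unfolding A B R_def S_def .
    show "rfact (int n + (j - 1)) = (1 - \<alpha>) * ((1 - \<alpha> * Q) * R)" "rfact (int n - (j + 1)) = (1 - \<beta>) * ((1 - \<beta> * Q) * S)"
      unfolding B rfact_pred r1 r2 \<alpha>_def \<beta>_def by (rule refl)+
  qed (simp_all add: R_def S_def algebra_simps)
  have p: "poch Q (2 * Suc n) = poch Q (2 * n) * (1 - \<alpha> * \<beta> * Q) * (1 - \<alpha> * \<beta> * Q * Q)"
    unfolding ab by (simp add: poch_Suc algebra_simps)
  have qq: "Q ^ (2 * n + 1) = \<alpha> * \<beta> * Q" unfolding ab by simp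
  show ?thesis unfolding G_def p qq r e1 by (simp add: algebra_simps)
qed

text \<open>A Laurent polynomial identity: \<open>rfact\<close> cuts the sum down to the indices
  from \<open>-n\<close> to \<open>n\<close>. In the induction step the new factor
  \<open>(1 - x * Q ^ n) * (1 - Q ^ (n + 1) / x)\<close> shifts the index by one in either
  direction, and \<open>gauss_binomial_rec\<close> collects the shifted terms.\<close>

lemma jacobi_triple_finite:
  assumes x: "x \<noteq> 0"
  shows "((\<lambda>j. poch Q (2 * n) * rfact (int n + j) * rfact (int n - j) * thterm x j)
      has_sum poch x n * poch (Q / x) n) UNIV"
proof (induction n)
  case 0
  show ?case
    by (rule has_sum_finite_neutralI[of "{0}"]) (auto simp: rfact_def thterm_def tri_def)
next
  case (Suc n)
  define G where "G = (\<lambda>n j. poch Q (2 * n) * rfact (int n + j) * rfact (int n - j))"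
  define P where "P = poch x n * poch (Q / x) n"
  have IH: "((\<lambda>j. G n j * thterm x j) has_sum P) UNIV" using Suc unfolding P_def G_def .
  have b1: "bij (\<lambda>j::int. j - 1)" "bij (\<lambda>j::int. j + 1)"
    by (rule bij_betw_byWitness[where f' = "\<lambda>j. j + 1"], auto)
      (rule bij_betw_byWitness[where f' = "\<lambda>j. j - 1"], auto)
  have h1: "((\<lambda>j. G n (j - 1) * thterm x (j - 1)) has_sum P) UNIV"
    using IH has_sum_reindex_bij_betw[OF b1(1), of "\<lambda>j. G n j * thterm x j"] by simp
  have h2: "((\<lambda>j. G n (j + 1) * thterm x (j + 1)) has_sum P) UNIV"
    using IH has_sum_reindex_bij_betw[OF b1(2), of "\<lambda>j. G n j * thterm x j"] by simp
  have "((\<lambda>j. (1 + Q ^ (2 * n + 1)) * (G n j * thterm x j) + (- x * Q ^ n) * (G n (j - 1) * thterm x (j - 1))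
      + (- (Q ^ (n + 1)) / x) * (G n (j + 1) * thterm x (j + 1)))
      has_sum ((1 + Q ^ (2 * n + 1)) * P + (- x * Q ^ n) * P + (- (Q ^ (n + 1)) / x) * P)) UNIV"
    by (intro has_sum_add has_sum_cmult_right IH h1 h2)
  also have "(\<lambda>j. (1 + Q ^ (2 * n + 1)) * (G n j * thterm x j) + (- x * Q ^ n) * (G n (j - 1) * thterm x (j - 1))
      + (- (Q ^ (n + 1)) / x) * (G n (j + 1) * thterm x (j + 1))) = (\<lambda>j. G (Suc n) j * thterm x j)"
  proof
    fix j
    have 1: "- x * Q ^ n * (G n (j - 1) * thterm x (j - 1)) = Q powi (int n + 1 - j) * G n (j - 1) * thterm x j"
      unfolding thterm_pred[OF x] using x by (simp add: power_int_add power_int_diff)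
    have 2: "- (Q ^ (n + 1)) / x * (G n (j + 1) * thterm x (j + 1)) = Q powi (int n + 1 + j) * G n (j + 1) * thterm x j"
      unfolding thterm_Suc[OF x] using x by (simp add: power_int_add)
    show "(1 + Q ^ (2 * n + 1)) * (G n j * thterm x j) + (- x * Q ^ n) * (G n (j - 1) * thterm x (j - 1))
      + (- (Q ^ (n + 1)) / x) * (G n (j + 1) * thterm x (j + 1)) = G (Suc n) j * thterm x j"
      unfolding 1 2 using gauss_binomial_rec[of n j] unfolding G_def[symmetric]
      by (simp add: G_def algebra_simps)
  qed
  also have "(1 + Q ^ (2 * n + 1)) * P + (- x * Q ^ n) * P + (- (Q ^ (n + 1)) / x) * P
      = poch x (Suc n) * poch (Q / x) (Suc n)"
    unfolding poch_Suc P_def using x power_add[of Q n n] by (simp add: field_simps flip: mult_2)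
  finally show ?case unfolding G_def .
qed

text \<open>Termwise limit of the finite form. The Gaussian binomial coefficients tend to
  \<open>1 / pinf Q\<close> and are bounded uniformly in \<open>n\<close> and \<open>j\<close>, so
  dominated convergence applies.\<close>

lemma jacobi_triple:
  assumes x: "x \<noteq> 0"
  shows "(thterm x has_sum (pinf Q * th x)) UNIV"
proof -
  obtain K where K: "K > 0" "\<And>n. norm (1 / poch Q n) \<le> K" using bounded_inverse_poch[of Q] by auto
  define M where "M = exp (q / (1 - q)) * K * K"
  have rK: "norm (rfact k) \<le> K" for k using K unfolding rfact_def by auto
  define f where "f = (\<lambda>n j. poch Q (2 * n) * rfact (int n + j) * rfact (int n - j) * thterm x j)"
  have lim: "(\<lambda>n. rfact (int n + j)) \<longlonglongrightarrow> 1 / pinf Q" for j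
  proof -
    have f: "filterlim (\<lambda>n. nat (int n + j)) at_top sequentially"
      unfolding filterlim_at_top
    proof
      fix Z show "\<forall>\<^sub>F n in sequentially. Z \<le> nat (int n + j)"
        using eventually_ge_at_top[of "Z + nat (- j)"] by eventually_elim auto
    qed
    have "(\<lambda>n. 1 / poch Q (nat (int n + j))) \<longlonglongrightarrow> 1 / pinf Q"
      by (intro tendsto_divide tendsto_const filterlim_compose[OF poch_tendsto f] pinf_Q_ne)
    moreover have "\<forall>\<^sub>F n in sequentially. 1 / poch Q (nat (int n + j)) = rfact (int n + j)"
      using eventually_ge_at_top[of "nat (- j)"] by eventually_elim (auto simp: rfact_def)
    ultimately show ?thesis by (rule Lim_transform_eventually)
  qed
  have "(\<lambda>n. infsum (f n) UNIV) \<longlonglongrightarrow> infsum (\<lambda>j. pinf Q * (1 / pinf Q) * (1 / pinf Q) * thterm x j) UNIV"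
  proof (rule tendsto_infsum_dominated[where M = "\<lambda>j. M * norm (thterm x j)"])
    show "norm (f n j) \<le> M * norm (thterm x j)" for n j
      unfolding f_def M_def norm_mult
      using K by (intro mult_right_mono mult_mono rK norm_poch_le' mult_nonneg_nonneg) auto
    show "(\<lambda>j. M * norm (thterm x j)) summable_on UNIV"
      by (intro summable_on_cmult_right thterm_summable x)
    have p2: "(\<lambda>n. poch Q (2 * n)) \<longlonglongrightarrow> pinf Q"
      by (rule filterlim_compose[OF poch_tendsto]) (simp add: filterlim_subseq strict_mono_def)
    show "(\<lambda>n. f n j) \<longlonglongrightarrow> pinf Q * (1 / pinf Q) * (1 / pinf Q) * thterm x j" for j
      unfolding f_def using lim[of j] lim[of "-j"] by (intro tendsto_intros p2) auto
  qed auto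
  moreover have "infsum (f n) UNIV = poch x n * poch (Q / x) n" for n
    unfolding f_def by (rule infsumI[OF jacobi_triple_finite[OF x]])
  moreover have "(\<lambda>n. poch x n * poch (Q / x) n) \<longlonglongrightarrow> th x"
    unfolding theta1_def by (intro tendsto_intros poch_tendsto)
  ultimately have "th x = infsum (\<lambda>j. 1 / pinf Q * thterm x j) UNIV"
    using LIMSEQ_unique by simp
  then have "th x = 1 / pinf Q * infsum (thterm x) UNIV"
    using infsum_cmult_right'[of "1 / pinf Q" "thterm x" UNIV] by simp
  then have "infsum (thterm x) UNIV = pinf Q * th x"
    by simp
  moreover have "thterm x summable_on UNIV"
    by (rule abs_summable_summable) (rule thterm_summable[OF x])
  ultimately show ?thesis by (metis has_sum_infsum)
qed

text \<open>The double series of \<open>\<theta>(xy)\<theta>(x/y)\<close> splits by the parity of the summation indices, so it is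
  an alternating bilinear expression in values of two functions; the three-term relation is
  then a Pluecker relation.\<close>

lemma theta_rank_two:
  obtains \<alpha> \<beta> :: "complex \<Rightarrow> complex"
  where "\<And>x y. x \<noteq> 0 \<Longrightarrow> y \<noteq> 0 \<Longrightarrow> th (x * y) * th (x / y) = x * (\<alpha> x * \<beta> y - \<beta> x * \<alpha> y)"
proof -
  define a where "a = (\<lambda>(x::complex) (i::int). Q powi (i * i - i) * x powi (2 * i))"
  define b where "b = (\<lambda>(x::complex) (i::int). Q powi (i * i) * x powi (2 * i))"
  \<comment> \<open>\<open>e0\<close> parametrizes the pairs of indices of equal parity,
    \<open>e1\<close> those of opposite parity.\<close>
  define e0 e1 where "e0 = (\<lambda>(i::int, k::int). (i + k, i - k))" and "e1 = (\<lambda>(i::int, k::int). (i + k + 1, i - k))"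
  define A0 where "A0 = {(m::int, n::int). even (m + n)}"
  have b0: "bij_betw e0 UNIV A0"
  proof (rule bij_betw_byWitness[where f' = "\<lambda>(m, n). ((m + n) div 2, (m - n) div 2)"])
    show "\<forall>p\<in>A0. e0 (case p of (m, n) \<Rightarrow> ((m + n) div 2, (m - n) div 2)) = p"
    proof
      fix p assume p: "p \<in> A0"
      obtain m n where mn: "p = (m, n)" by force
      have "even (m + n)" using p mn by (simp add: A0_def)
      then have "(m + n) div 2 + (m - n) div 2 = m" "(m + n) div 2 - (m - n) div 2 = n" by presburger+
      then show "e0 (case p of (m, n) \<Rightarrow> ((m + n) div 2, (m - n) div 2)) = p" by (simp add: e0_def mn)
    qed
  qed (auto simp: e0_def A0_def)
  have b1: "bij_betw e1 UNIV (- A0)"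
  proof (rule bij_betw_byWitness[where f' = "\<lambda>(m, n). ((m + n - 1) div 2, (m - n - 1) div 2)"])
    show "\<forall>p\<in>- A0. e1 (case p of (m, n) \<Rightarrow> ((m + n - 1) div 2, (m - n - 1) div 2)) = p"
    proof
      fix p assume p: "p \<in> - A0"
      obtain m n where mn: "p = (m, n)" by force
      have "odd (m + n)" using p mn by (simp add: A0_def)
      then have "(m + n - 1) div 2 + (m - n - 1) div 2 + 1 = m" "(m + n - 1) div 2 - (m - n - 1) div 2 = n" by presburger+
      then show "e1 (case p of (m, n) \<Rightarrow> ((m + n - 1) div 2, (m - n - 1) div 2)) = p" by (simp add: e1_def mn)
    qed
  qed (auto simp: e1_def A0_def)
  \<comment> \<open>After the change of indices the quadratic exponents separate, see
    \<open>t0\<close> and \<open>t1\<close>: each term becomes a function of \<open>x\<close> and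
    the first index times a function of \<open>y\<close> and the second index.\<close>
  have f0: "thterm (x * y) (fst (e0 p)) * thterm (x / y) (snd (e0 p)) = a x (fst p) * b y (snd p)"
    and f1: "thterm (x * y) (fst (e1 p)) * thterm (x / y) (snd (e1 p)) = - (x / y) * (b x (fst p) * a y (snd p + 1))"
    if xy: "x \<noteq> 0" "y \<noteq> 0" for x y p
  proof -
    obtain i k where p: "p = (i, k)" by force
    have t0: "tri (i + k) + tri (i - k) = (i * i - i) + k * k"
      using two_tri[of "i + k"] two_tri[of "i - k"] by (simp add: algebra_simps)
    have t1: "tri (i + k + 1) + tri (i - k) = i * i + ((k + 1) * (k + 1) - (k + 1))"
      using two_tri[of "i + k + 1"] two_tri[of "i - k"] by (simp add: algebra_simps)
    have m: "(-1::complex) powi (i + k) * (-1) powi (i - k) = 1"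
    proof -
      have "(-1::complex) powi (i + k) * (-1) powi (i - k) = (-1) powi ((i + k) + (i - k))"
        by (rule power_int_add[symmetric]) simp
      also have "(i + k) + (i - k) = i + i" by simp
      also have "(-1::complex) powi (i + i) = 1"
        by (subst power_int_add) (simp_all add: power_int_minus_one_mult_self)
      finally show ?thesis .
    qed
    have pxy: "(x * y) powi m * (x / y) powi n = x powi (m + n) * y powi (m - n)" for m n
      using xy by (simp add: power_int_mult_distrib power_int_divide_distrib power_int_add power_int_diff)
    have "thterm (x * y) (i + k) * thterm (x / y) (i - k) =
      ((-1) powi (i + k) * (-1) powi (i - k)) * (Q powi (tri (i + k)) * Q powi (tri (i - k))) * ((x * y) powi (i + k) * (x / y) powi (i - k))"
      by (simp add: thterm_def mult_ac)
    also have "Q powi (tri (i + k)) * Q powi (tri (i - k)) = Q powi (i * i - i) * Q powi (k * k)"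
      by (simp add: t0 flip: power_int_add)
    also have "(x * y) powi (i + k) * (x / y) powi (i - k) = x powi (2 * i) * y powi (2 * k)"
      unfolding pxy by (rule arg_cong2[where f = times]; rule arg_cong2[where f = "(powi)"]) auto
    finally show "thterm (x * y) (fst (e0 p)) * thterm (x / y) (snd (e0 p)) = a x (fst p) * b y (snd p)"
      unfolding m p e0_def a_def b_def by simp
    have "thterm (x * y) (i + k + 1) * thterm (x / y) (i - k) =
      ((-1) powi (i + k + 1) * (-1) powi (i - k)) * (Q powi (tri (i + k + 1)) * Q powi (tri (i - k))) * ((x * y) powi (i + k + 1) * (x / y) powi (i - k))"
      by (simp add: thterm_def mult_ac)
    also have "(-1::complex) powi (i + k + 1) * (-1) powi (i - k) = - 1" using m by (simp add: power_int_add_1)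
    also have "Q powi (tri (i + k + 1)) * Q powi (tri (i - k)) = Q powi (i * i) * Q powi ((k + 1) * (k + 1) - (k + 1))"
      unfolding power_int_add[OF disjI1[OF Q_ne(1)], symmetric] t1 ..
    also have "(x * y) powi (i + k + 1) * (x / y) powi (i - k) = (x / y) * (x powi (2 * i) * y powi (2 * (k + 1)))"
    proof -
      have e: "i + k + 1 + (i - k) = 2 * i + 1" "i + k + 1 - (i - k) = 2 * (k + 1) - 1" by simp_all
      have "x powi (2 * i + 1) = x * x powi (2 * i)" using xy power_int_add_1'[of x "2 * i"] by simp
      moreover have "y powi (2 * (k + 1) - 1) = y powi (2 * (k + 1)) / y"
        using xy by (subst power_int_diff) auto
      ultimately show ?thesis unfolding pxy e by simp
    qed
    finally show "thterm (x * y) (fst (e1 p)) * thterm (x / y) (snd (e1 p)) = - (x / y) * (b x (fst p) * a y (snd p + 1))"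
      unfolding p e1_def a_def b_def fst_conv snd_conv prod.case
      by (simp only: mult_minus_left mult_minus_right mult_1_left mult_ac)
  qed
  have prod: "((\<lambda>p. thterm (x * y) (fst p) * thterm (x / y) (snd p)) has_sum (pinf Q * th (x * y)) * (pinf Q * th (x / y))) UNIV"
    and asum: "(\<lambda>p. norm (thterm (x * y) (fst p) * thterm (x / y) (snd p))) summable_on UNIV"
    if xy: "x \<noteq> 0" "y \<noteq> 0" for x y
  proof -
    have s: "(\<lambda>j. norm (thterm (x * y) j)) summable_on UNIV" "(\<lambda>j. norm (thterm (x / y) j)) summable_on UNIV"
      using thterm_summable xy by auto
    have "(\<lambda>p. norm (thterm (x * y) (fst p)) * norm (thterm (x / y) (snd p))) summable_on Sigma UNIV (\<lambda>_. UNIV)"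
      by (rule summable_on_SigmaI[where g = "\<lambda>i. norm (thterm (x * y) i) * infsum (\<lambda>j. norm (thterm (x / y) j)) UNIV"])
        (use s in \<open>auto intro!: has_sum_cmult_right has_sum_infsum summable_on_cmult_left\<close>)
    then show a: "(\<lambda>p. norm (thterm (x * y) (fst p) * thterm (x / y) (snd p))) summable_on UNIV"
      by (simp add: norm_mult)
    have j: "(thterm (x * y) has_sum (pinf Q * th (x * y))) UNIV" "(thterm (x / y) has_sum (pinf Q * th (x / y))) UNIV"
      using jacobi_triple xy by auto
    have "((\<lambda>p. thterm (x * y) (fst p) * thterm (x / y) (snd p)) has_sum (pinf Q * th (x * y)) * (pinf Q * th (x / y))) (Sigma UNIV (\<lambda>_. UNIV))"
      by (rule has_sum_SigmaI[where g = "\<lambda>i. thterm (x * y) i * (pinf Q * th (x / y))"])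
        (use j abs_summable_summable[OF a] in \<open>auto intro!: has_sum_cmult_right has_sum_cmult_left\<close>)
    then show "((\<lambda>p. thterm (x * y) (fst p) * thterm (x / y) (snd p)) has_sum (pinf Q * th (x * y)) * (pinf Q * th (x / y))) UNIV"
      by simp
  qed
  have s0: "(\<lambda>p. norm (a x (fst p) * b y (snd p))) summable_on UNIV" if xy: "x \<noteq> 0" "y \<noteq> 0" for x y
  proof -
    have "(\<lambda>p. norm (thterm (x * y) (fst p) * thterm (x / y) (snd p))) summable_on A0"
      using asum[OF xy] summable_on_subset_banach by blast
    then show ?thesis
      by (subst (asm) summable_on_reindex_bij_betw[OF b0, symmetric]) (simp add: f0[OF xy])
  qed
  \<comment> \<open>The double series is restricted to one row or column, where the other factor,
    taken at the point 1 and the index 0, equals 1.\<close>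
  have sa: "a x summable_on UNIV" and sb: "b x summable_on UNIV" if x: "x \<noteq> 0" for x
  proof -
    have i1: "inj (\<lambda>i::int. (i, 0::int))" and i2: "inj (\<lambda>i::int. (0::int, i))" by (auto intro!: injI)
    have "(\<lambda>p. norm (a x (fst p) * b 1 (snd p))) summable_on range (\<lambda>i. (i, 0))"
      using summable_on_subset_banach[OF s0[OF x, of 1] subset_UNIV] by simp
    then have "(\<lambda>i. norm (a x i)) summable_on UNIV"
      by (subst (asm) summable_on_reindex[OF i1]) (simp add: o_def b_def)
    then show "a x summable_on UNIV" by (rule abs_summable_summable)
    have "(\<lambda>p. norm (a 1 (fst p) * b x (snd p))) summable_on range (\<lambda>i. (0, i))"
      using summable_on_subset_banach[OF s0[OF _ x, of 1] subset_UNIV] by simp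
    then have "(\<lambda>i. norm (b x i)) summable_on UNIV"
      by (subst (asm) summable_on_reindex[OF i2]) (simp add: o_def a_def)
    then show "b x summable_on UNIV" by (rule abs_summable_summable)
  qed
  \<comment> \<open>Dividing by \<open>x\<close> in \<open>\<alpha>\<close> absorbs the factor
    \<open>x / y\<close> of the odd part, which makes the expression alternating in \<open>x\<close>
    and \<open>y\<close> up to the common factor \<open>x\<close>.\<close>
  define \<alpha> \<beta> where "\<alpha> = (\<lambda>x. infsum (a x) UNIV / x / pinf Q)" and "\<beta> = (\<lambda>x. infsum (b x) UNIV / pinf Q)"
  show thesis
  proof (rule that[of \<alpha> \<beta>])
    fix x y :: complex assume xy: "x \<noteq> 0" "y \<noteq> 0"
    let ?F = "\<lambda>p. thterm (x * y) (fst p) * thterm (x / y) (snd p)"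
    have su: "?F summable_on X" for X
      using abs_summable_summable[OF asum[OF xy]] summable_on_subset_banach by blast
    have e: "infsum ?F UNIV = infsum ?F A0 + infsum ?F (- A0)"
      using infsum_Un_disjoint[OF su su, of A0 "- A0"] by simp
    have s0': "(\<lambda>p. a x (fst p) * b y (snd p)) summable_on UNIV \<times> UNIV" 
      using abs_summable_summable[OF s0[OF xy]] by simp
    have "infsum ?F A0 = infsum (\<lambda>p. a x (fst p) * b y (snd p)) (UNIV \<times> UNIV)"
      using infsum_reindex_bij_betw[OF b0, of ?F] unfolding f0[OF xy] UNIV_Times_UNIV by (rule sym)
    also have "\<dots> = infsum (a x) UNIV * infsum (b y) UNIV"
      by (subst infsum_Sigma_banach[OF s0', symmetric]) (simp add: infsum_cmult_right' infsum_cmult_left')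
    finally have i0: "infsum ?F A0 = infsum (a x) UNIV * infsum (b y) UNIV" .
    have "(\<lambda>p. ?F (e1 p)) summable_on UNIV" by (rule summable_on_reindex_bij_betw[OF b1, THEN iffD2, OF su])
    then have s1': "(\<lambda>p. - (x / y) * (b x (fst p) * a y (snd p + 1))) summable_on UNIV \<times> UNIV"
      unfolding f1[OF xy] UNIV_Times_UNIV .
    have bs: "bij (\<lambda>k::int. k + 1)" by (rule bij_betw_byWitness[where f' = "\<lambda>j. j - 1"]) auto
    have "infsum ?F (- A0) = infsum (\<lambda>p. - (x / y) * (b x (fst p) * a y (snd p + 1))) (UNIV \<times> UNIV)"
      using infsum_reindex_bij_betw[OF b1, of ?F] unfolding f1[OF xy] UNIV_Times_UNIV by (rule sym)
    also have "\<dots> = - (x / y) * (infsum (b x) UNIV * infsum (\<lambda>k. a y (k + 1)) UNIV)"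
      by (subst infsum_Sigma_banach[OF s1', symmetric]) (simp only: infsum_cmult_right' infsum_cmult_left' fst_conv snd_conv)
    also have "infsum (\<lambda>k. a y (k + 1)) UNIV = infsum (a y) UNIV"
      using infsum_reindex_bij_betw[OF bs, of "a y"] by simp
    finally have i1: "infsum ?F (- A0) = - (x / y) * (infsum (b x) UNIV * infsum (a y) UNIV)" .
    have "(pinf Q * th (x * y)) * (pinf Q * th (x / y)) = infsum (a x) UNIV * infsum (b y) UNIV - (x / y) * (infsum (b x) UNIV * infsum (a y) UNIV)"
      using infsumI[OF prod[OF xy]] unfolding e i0 i1 by (metis add_uminus_conv_diff mult_minus_left)
    moreover have "th (x * y) * th (x / y) = ((pinf Q * th (x * y)) * (pinf Q * th (x / y))) / (pinf Q * pinf Q)"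
      by simp
    moreover have "x * (\<alpha> x * \<beta> y - \<beta> x * \<alpha> y) =
      (infsum (a x) UNIV * infsum (b y) UNIV - (x / y) * (infsum (b x) UNIV * infsum (a y) UNIV)) / (pinf Q * pinf Q)"
      unfolding \<alpha>_def \<beta>_def using xy by (simp add: divide_simps)
    ultimately show "th (x * y) * th (x / y) = x * (\<alpha> x * \<beta> y - \<beta> x * \<alpha> y)" by simp
  qed
qed

text \<open>Weierstrass's addition formula in multiplicative form. Suitable choices of the four
  variables yield the evaluations \<open>chat_delta\<close>, \<open>chat_wronskian\<close> and
  \<open>theta_cross\<close>.\<close>

lemma theta_three_term:
  assumes "x \<noteq> 0" "y \<noteq> 0" "u \<noteq> 0" "v \<noteq> 0"
  shows "th (x * y) * th (x / y) * th (u * v) * th (u / v) - th (x * v) * th (x / v) * th (u * y) * th (u / y)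
    = u / y * (th (y * v) * th (y / v) * th (x * u) * th (x / u))"
proof -
  obtain \<alpha> \<beta> where r: "\<And>x y. x \<noteq> 0 \<Longrightarrow> y \<noteq> 0 \<Longrightarrow> th (x * y) * th (x / y) = x * (\<alpha> x * \<beta> y - \<beta> x * \<alpha> y)"
    using theta_rank_two by blast
  have 1: "th (x * y) * th (x / y) = x * (\<alpha> x * \<beta> y - \<beta> x * \<alpha> y)" "th (u * v) * th (u / v) = u * (\<alpha> u * \<beta> v - \<beta> u * \<alpha> v)"
    "th (x * v) * th (x / v) = x * (\<alpha> x * \<beta> v - \<beta> x * \<alpha> v)" "th (u * y) * th (u / y) = u * (\<alpha> u * \<beta> y - \<beta> u * \<alpha> y)"
    "th (x * u) * th (x / u) = x * (\<alpha> x * \<beta> u - \<beta> x * \<alpha> u)"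
    "u / y * (th (y * v) * th (y / v)) = u * (\<alpha> y * \<beta> v - \<beta> y * \<alpha> v)"
    using assms by (simp_all add: r)
  have "th (x * y) * th (x / y) * (th (u * v) * th (u / v)) - th (x * v) * th (x / v) * (th (u * y) * th (u / y))
    = (u / y * (th (y * v) * th (y / v))) * (th (x * u) * th (x / u))"
    unfolding 1 by (simp add: algebra_simps)
  then show ?thesis by (simp add: mult_ac)
qed

end

section \<open>The q-binomial theorem, the transformations of Euler and Sears, the q-Gauss
  sum\<close>

lemma suminf_swap_geometric:
  fixes f :: "nat \<Rightarrow> nat \<Rightarrow> complex"
  assumes bd: "\<And>k m. norm (f k m) \<le> K * (x ^ k * y ^ m)" and xy: "0 \<le> x" "x < 1" "0 \<le> y" "y < 1"
  shows "(\<Sum>k. \<Sum>m. f k m) = (\<Sum>m. \<Sum>k. f k m)"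
proof -
  have K: "0 \<le> K" using order_trans[OF norm_ge_zero bd[of 0 0]] by simp
  have gs: "(\<lambda>p. x ^ fst p * y ^ snd p) summable_on UNIV \<times> UNIV"
  proof (rule summable_on_SigmaI[where g = "\<lambda>k. x ^ k * (1 / (1 - y))"])
    show "((\<lambda>m. x ^ fst (k, m) * y ^ snd (k, m)) has_sum x ^ k * (1 / (1 - y))) UNIV" for k
      unfolding fst_conv snd_conv
      by (rule has_sum_cmult_right, rule sums_nonneg_imp_has_sum, rule geometric_sums) (use xy in auto)
    show "(\<lambda>k. x ^ k * (1 / (1 - y))) summable_on UNIV"
      using xy by (intro summable_on_cmult_left norm_summable_imp_summable_on) (auto intro: summable_geometric)
  qed (use xy in auto)
  have s: "(\<lambda>p. f (fst p) (snd p)) summable_on UNIV \<times> UNIV"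
    by (rule abs_summable_summable, rule summable_on_comparison_test[OF summable_on_cmult_right[OF gs, of K]])
      (use bd in auto)
  have 1: "summable (\<lambda>m. norm (f k m))" for k
    by (rule summable_comparison_test'[of "\<lambda>m. K * x ^ k * y ^ m" 0])
      (use bd[of k] xy in \<open>auto simp: mult_ac intro!: summable_mult summable_geometric\<close>)
  have 2: "summable (\<lambda>k. norm (f k m))" for m
    by (rule summable_comparison_test'[of "\<lambda>k. K * y ^ m * x ^ k" 0])
      (use bd[of _ m] xy in \<open>auto simp: mult_ac intro!: summable_mult summable_mult2 summable_geometric\<close>)
  have n1: "norm (\<Sum>m. f k m) \<le> K / (1 - y) * x ^ k" for k
  proof -
    have "norm (\<Sum>m. f k m) \<le> (\<Sum>m. norm (f k m))" by (rule summable_norm[OF 1])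
    also have "\<dots> \<le> (\<Sum>m. K * x ^ k * y ^ m)"
      by (rule suminf_le[OF _ 1]) (use bd[of k] xy in \<open>auto simp: mult_ac intro!: summable_mult summable_geometric\<close>)
    finally show ?thesis using xy by (simp add: suminf_mult suminf_geometric summable_geometric)
  qed
  have n2: "norm (\<Sum>k. f k m) \<le> K / (1 - x) * y ^ m" for m
  proof -
    have "norm (\<Sum>k. f k m) \<le> (\<Sum>k. norm (f k m))" by (rule summable_norm[OF 2])
    also have "\<dots> \<le> (\<Sum>k. K * y ^ m * x ^ k)"
      by (rule suminf_le[OF _ 2]) (use bd[of _ m] xy in \<open>auto simp: mult_ac intro!: summable_mult summable_mult2 summable_geometric\<close>)
    finally show ?thesis using xy by (simp add: suminf_mult suminf_geometric summable_geometric)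
  qed
  have "summable (\<lambda>k. norm (\<Sum>m. f k m))" "summable (\<lambda>m. norm (\<Sum>k. f k m))"
    by (rule summable_comparison_test'[of "\<lambda>k. K / (1 - y) * x ^ k" 0], use n1 xy in \<open>auto intro!: summable_mult summable_geometric\<close>)
      (rule summable_comparison_test'[of "\<lambda>k. K / (1 - x) * y ^ k" 0], use n2 xy in \<open>auto intro!: summable_mult summable_geometric\<close>)
  then have "(\<Sum>k. \<Sum>m. f k m) = infsum (\<lambda>k. infsum (f k) UNIV) UNIV"
    "(\<Sum>m. \<Sum>k. f k m) = infsum (\<lambda>m. infsum (\<lambda>k. f k m) UNIV) UNIV"
    using suminf_eq_infsum[OF 1] suminf_eq_infsum[OF 2] by (simp_all add: suminf_eq_infsum)
  moreover have "infsum (\<lambda>k. infsum (f k) UNIV) UNIV = infsum (\<lambda>m. infsum (\<lambda>k. f k m) UNIV) UNIV"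
    by (rule infsum_swap_banach) (use s in \<open>simp add: case_prod_unfold\<close>)
  ultimately show ?thesis by simp
qed

context qbase
begin

lemma bounded_poch_quotient:
  assumes "pinf D \<noteq> 0"
  obtains K where "K > 0" "\<And>k. norm (poch A k * poch B k / (poch Q k * poch D k)) \<le> K"
proof -
  obtain K1 where K1: "K1 > 0" "\<And>n. norm (1 / poch Q n) \<le> K1" using bounded_inverse_poch[OF pinf_Q_ne] by blast
  obtain K2 where K2: "K2 > 0" "\<And>n. norm (1 / poch D n) \<le> K2" using bounded_inverse_poch[OF assms] by blast
  define a b where "a = exp (norm A / (1 - q))" and "b = exp (norm B / (1 - q))"
  show thesis
  proof (rule that[of "a * b * (K1 * K2)"])
    show "a * b * (K1 * K2) > 0" using K1 K2 by (simp add: a_def b_def)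
    fix k
    have "norm (poch A k * poch B k / (poch Q k * poch D k)) =
      norm (poch A k) * norm (poch B k) * (norm (1 / poch Q k) * norm (1 / poch D k))"
      by (simp add: norm_mult norm_divide)
    also have "\<dots> \<le> a * b * (K1 * K2)"
      using K1 K2 norm_poch_le[of A k] norm_poch_le[of B k] unfolding a_def b_def
      by (intro mult_mono mult_nonneg_nonneg) auto
    finally show "norm (poch A k * poch B k / (poch Q k * poch D k)) \<le> a * b * (K1 * K2)" .
  qed
qed

lemma summable_bounded_powser:
  fixes u :: "nat \<Rightarrow> complex"
  assumes "\<And>k. norm (u k) \<le> K" "norm z < 1"
  shows "summable (\<lambda>k. norm (u k * z ^ k))" "summable (\<lambda>k. u k * z ^ k)"
proof -
  show "summable (\<lambda>k. norm (u k * z ^ k))"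
    by (rule summable_comparison_test'[of "\<lambda>k. K * norm z ^ k" 0])
      (use assms in \<open>auto simp: norm_mult norm_power intro!: summable_mult summable_geometric mult_right_mono\<close>)
  then show "summable (\<lambda>k. u k * z ^ k)" by (rule summable_norm_cancel)
qed

lemma holomorphic_bounded_powser:
  fixes u :: "nat \<Rightarrow> complex"
  assumes "\<And>k. norm (u k) \<le> K"
  shows "(\<lambda>z. \<Sum>k. u k * z ^ k) holomorphic_on ball 0 1"
  by (rule power_series_holomorphic) (use summable_bounded_powser(2)[OF assms] in \<open>auto intro!: summable_sums\<close>)

text \<open>If \<open>h\<close> were not identically zero, it would vanish at 0 to some order
  \<open>n > 0\<close>. Dividing the equation by the n-th power of the variable and passing to 0
  gives \<open>1 = \<alpha>' * Q ^ n + \<beta>' * (Q\<^sup>2) ^ n\<close>, which \<open>ne\<close>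
  excludes.\<close>

lemma holomorphic_qdiff_unique:
  assumes hol: "h holomorphic_on ball 0 r" and "h 0 = 0"
    and eq: "\<And>z. norm z < r \<Longrightarrow> h z = \<alpha> z * h (Q * z) + \<beta> z * h (Q\<^sup>2 * z)"
    and lim: "(\<alpha> \<longlongrightarrow> \<alpha>') (at 0)" "(\<beta> \<longlongrightarrow> \<beta>') (at 0)"
    and ne: "\<And>m. m > 0 \<Longrightarrow> 1 - \<alpha>' * Q ^ m - \<beta>' * (Q\<^sup>2) ^ m \<noteq> 0"
    and z: "norm z < r"
  shows "h z = 0"
proof (rule ccontr)
  assume nz: "h z \<noteq> 0"
  have r: "r > 0" using z by (meson norm_ge_zero order.strict_trans1)
  have nc: "\<not> h constant_on ball 0 r"
    using nz z r \<open>h 0 = 0\<close> unfolding constant_on_def by (metis centre_in_ball dist_0_norm mem_ball)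
  have c0: "0 \<in> ball 0 r" using r by simp
  obtain g \<rho> n where g: "0 < n" "0 < \<rho>" "ball (0::complex) \<rho> \<subseteq> ball 0 r" "g holomorphic_on ball 0 \<rho>"
      "\<And>w. w \<in> ball 0 \<rho> \<Longrightarrow> h w = (w - 0)^n * g w" "\<And>w. w \<in> ball 0 \<rho> \<Longrightarrow> g w \<noteq> 0"
    by (rule holomorphic_factor_zero_nonconstant[OF hol open_ball connected_ball c0 \<open>h 0 = 0\<close> nc]) (rule that)
  have gc: "(g \<longlongrightarrow> g 0) (at 0)"
  proof -
    have "0 \<in> ball (0::complex) \<rho>" using g(2) by simp
    then show ?thesis
      using holomorphic_on_imp_continuous_on[OF g(4)] unfolding continuous_on_eq_continuous_at[OF open_ball] isCont_def by (rule bspec[rotated])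
  qed
  have l1: "((\<lambda>w. g (c * w)) \<longlongrightarrow> g 0) (at 0)" for c
  proof -
    have "isCont g 0" unfolding isCont_def by (rule gc)
    from isCont_tendsto_compose[OF this tendsto_mult_right_zero[OF tendsto_ident_at]] show ?thesis .
  qed
  have T: "((\<lambda>w. g w - \<alpha> w * Q ^ n * g (Q * w) - \<beta> w * (Q\<^sup>2) ^ n * g (Q\<^sup>2 * w)) \<longlongrightarrow>
      g 0 - \<alpha>' * Q ^ n * g 0 - \<beta>' * (Q\<^sup>2) ^ n * g 0) (at 0)"
    by (rule tendsto_diff[OF tendsto_diff[OF gc tendsto_mult[OF tendsto_mult[OF lim(1) tendsto_const] l1]]
          tendsto_mult[OF tendsto_mult[OF lim(2) tendsto_const] l1]])
  have E: "\<forall>\<^sub>F w in at 0. g w - \<alpha> w * Q ^ n * g (Q * w) - \<beta> w * (Q\<^sup>2) ^ n * g (Q\<^sup>2 * w) = 0"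
    unfolding eventually_at
  proof (intro exI[of _ \<rho>] conjI ballI impI)
    fix w :: complex assume w: "w \<noteq> 0 \<and> dist w 0 < \<rho>"
    have q2: "q\<^sup>2 \<le> 1" using q0 q1 by (simp add: power_le_one)
    have "norm (Q * w) \<le> norm w" "norm (Q\<^sup>2 * w) \<le> norm w"
      using q2 q1 by (simp_all add: norm_mult norm_power mult_left_le_one_le)
    then have in1: "w \<in> ball 0 \<rho>" "Q * w \<in> ball 0 \<rho>" "Q\<^sup>2 * w \<in> ball 0 \<rho>" using w by auto
    have "norm w < r" using subsetD[OF g(3) in1(1)] by simp
    from eq[OF this] have "w ^ n * g w = \<alpha> w * ((Q * w) ^ n * g (Q * w)) + \<beta> w * ((Q\<^sup>2 * w) ^ n * g (Q\<^sup>2 * w))"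
      unfolding g(5)[OF in1(1)] g(5)[OF in1(2)] g(5)[OF in1(3)] diff_zero .
    then have "w ^ n * (g w - \<alpha> w * Q ^ n * g (Q * w) - \<beta> w * (Q\<^sup>2) ^ n * g (Q\<^sup>2 * w)) = 0"
      unfolding power_mult_distrib right_diff_distrib by (simp only: mult_ac diff_diff_eq diff_self)
    then show "g w - \<alpha> w * Q ^ n * g (Q * w) - \<beta> w * (Q\<^sup>2) ^ n * g (Q\<^sup>2 * w) = 0"
      using w by simp
  qed (rule g(2))
  have "g 0 - \<alpha>' * Q ^ n * g 0 - \<beta>' * (Q\<^sup>2) ^ n * g 0 = 0"
    by (rule tendsto_unique[OF trivial_limit_at T tendsto_eventually[OF E]])
  then have "g 0 * (1 - \<alpha>' * Q ^ n - \<beta>' * (Q\<^sup>2) ^ n) = 0" by (simp only: right_diff_distrib mult_ac mult_1_right mult_1_left)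
  moreover have "g 0 \<noteq> 0" by (rule g(6)) (use g(2) in simp)
  ultimately show False using ne[OF g(1)] by simp
qed

text \<open>The sum \<open>f\<close> satisfies
  \<open>(1 - z) * f z = (1 - A * z) * f (z * Q)\<close>. Iteration moves the argument to 0, where
  \<open>f\<close> is 1, and the collected factors form the two products.\<close>

lemma q_binomial:
  assumes z: "norm z < 1"
  shows "(\<Sum>k. poch A k / poch Q k * z ^ k) = pinf (A * z) / pinf z"
    and "summable (\<lambda>k. norm (poch A k / poch Q k * z ^ k))"
proof -
  define u where "u = (\<lambda>k. poch A k / poch Q k)"
  obtain K where K: "K > 0" "\<And>k. norm (u k) \<le> K"
    using bounded_poch_quotient[of 0 A 0] unfolding u_def by auto
  note sm = summable_bounded_powser[OF K(2)]
  show "summable (\<lambda>k. norm (poch A k / poch Q k * z ^ k))" using sm(1)[OF z] unfolding u_def .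
  define f where "f = (\<lambda>z. \<Sum>k. u k * z ^ k)"
  have urec: "(1 - Q ^ Suc k) * u (Suc k) = (1 - A * Q ^ k) * u k" for k
    using pochQ_ne[of "Suc k"] unfolding u_def poch_Suc by (simp add: field_simps)
  have rec: "(1 - z) * f z = (1 - A * z) * f (z * Q)" if z: "norm z < 1" for z
  proof -
    have "norm (z * Q) \<le> norm z * 1" unfolding norm_mult norm_Q by (rule mult_left_mono) auto
    then have zq: "norm (z * Q) < 1" using z by simp
    have s1: "(\<lambda>k. u k * z ^ k) sums f z" "(\<lambda>k. u k * (z * Q) ^ k) sums f (z * Q)"
      unfolding f_def using sm(2)[OF z] sm(2)[OF zq] by (auto intro: summable_sums)
    have "(\<lambda>k. (1 - Q ^ k) * u k * z ^ k) sums (f z - f (z * Q))"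
      using sums_diff[OF s1] by (simp add: algebra_simps power_mult_distrib)
    then have "(\<lambda>k. (1 - Q ^ Suc k) * u (Suc k) * z ^ Suc k) sums (f z - f (z * Q))"
      by (subst sums_Suc_iff) simp
    moreover have "(\<lambda>k. z * (u k * z ^ k) - z * A * (u k * (z * Q) ^ k)) sums (z * f z - z * A * f (z * Q))"
      by (intro sums_diff sums_mult s1)
    moreover have "z * (u k * z ^ k) - z * A * (u k * (z * Q) ^ k) = (1 - Q ^ Suc k) * u (Suc k) * z ^ Suc k" for k
      unfolding urec by (simp add: algebra_simps power_mult_distrib)
    ultimately have "f z - f (z * Q) = z * f z - z * A * f (z * Q)" using sums_unique2 by simp
    then show ?thesis by (simp add: algebra_simps)
  qed
  have it: "poch z n * f z = poch (A * z) n * f (z * Q ^ n)" for n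
  proof (induction n)
    case (Suc n)
    have "norm (z * Q ^ n) \<le> norm z * 1" unfolding norm_mult norm_power norm_Q
      by (rule mult_left_mono) (auto intro: power_le_one)
    then have "(1 - z * Q ^ n) * f (z * Q ^ n) = (1 - A * (z * Q ^ n)) * f (z * Q ^ Suc n)"
      using rec[of "z * Q ^ n"] z by (simp add: mult_ac)
    then show ?case unfolding poch_Suc using Suc
      by (metis (no_types, opaque_lifting) mult.assoc mult.commute)
  qed simp
  have "continuous_on (ball 0 1) f" unfolding f_def
    by (rule holomorphic_on_imp_continuous_on[OF holomorphic_bounded_powser[OF K(2)]])
  then have "isCont f 0" by (simp add: continuous_on_eq_continuous_at)
  then have "(\<lambda>n. f (z * Q ^ n)) \<longlonglongrightarrow> f 0" by (rule isCont_tendsto_compose[OF _ Q_pow_tendsto])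
  then have "(\<lambda>n. poch (A * z) n * f (z * Q ^ n)) \<longlonglongrightarrow> pinf (A * z) * f 0" by (intro tendsto_intros poch_tendsto)
  moreover have "(\<lambda>n. poch z n * f z) \<longlonglongrightarrow> pinf z * f z" by (intro tendsto_intros poch_tendsto)
  ultimately have "pinf z * f z = pinf (A * z) * f 0" using it LIMSEQ_unique by simp
  moreover have "f 0 = 1" unfolding f_def powser_zero by (simp add: u_def)
  ultimately show "(\<Sum>k. poch A k / poch Q k * z ^ k) = pinf (A * z) / pinf z"
    using pinf_ne_0_lt1[OF z] unfolding f_def u_def by (simp add: field_simps)
qed

definition phi21 :: "complex \<Rightarrow> complex \<Rightarrow> complex \<Rightarrow> complex \<Rightarrow> complex" where
  "phi21 A B D z = (\<Sum>k. poch A k * poch B k / (poch Q k * poch D k) * z ^ k)"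

text \<open>The two-term recursion of the coefficients, rewritten: multiplying the k-th coefficient
  by \<open>Q ^ k\<close> is the same as replacing \<open>z\<close> by \<open>Q * z\<close>.\<close>

lemma phi21_qdiff:
  assumes D: "pinf D \<noteq> 0" and z: "norm z < 1"
  shows "(1 - z) * phi21 A B D z - (1 + D / Q - (A + B) * z) * phi21 A B D (Q * z)
    + (D / Q - A * B * z) * phi21 A B D (Q\<^sup>2 * z) = 0"
proof -
  define u where "u = (\<lambda>k. poch A k * poch B k / (poch Q k * poch D k))"
  obtain K where K: "K > 0" "\<And>k. norm (u k) \<le> K" using bounded_poch_quotient[OF D, of A B] unfolding u_def by blast
  note sm = summable_bounded_powser(2)[OF K(2)]
  have q2: "q\<^sup>2 \<le> 1" by (simp add: power_le_one)
  have "norm (Q * z) \<le> norm z" "norm (Q\<^sup>2 * z) \<le> norm z"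
    using q2 q1 by (simp_all add: norm_mult norm_power mult_left_le_one_le)
  then have zz: "norm (Q * z) < 1" "norm (Q\<^sup>2 * z) < 1" using z by auto
  have s0: "(\<lambda>k. u k * z ^ k) sums phi21 A B D z" "(\<lambda>k. u k * (Q * z) ^ k) sums phi21 A B D (Q * z)"
     "(\<lambda>k. u k * (Q\<^sup>2 * z) ^ k) sums phi21 A B D (Q\<^sup>2 * z)"
    using sm[OF z, THEN summable_sums] sm[OF zz(1), THEN summable_sums] sm[OF zz(2), THEN summable_sums]
    unfolding phi21_def u_def .
  have urec: "(1 - Q ^ Suc k) * (1 - D * Q ^ k) * u (Suc k) = (1 - A * Q ^ k) * (1 - B * Q ^ k) * u k" for k
    using pochQ_ne[of "Suc k"] pinf_ne_0_poch[OF D, of "Suc k"] unfolding u_def poch_Suc by (simp add: divide_simps)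
  have "(\<lambda>k. u k * z ^ k - (1 + D / Q) * (u k * (Q * z) ^ k) + D / Q * (u k * (Q\<^sup>2 * z) ^ k)) sums
      (phi21 A B D z - (1 + D / Q) * phi21 A B D (Q * z) + D / Q * phi21 A B D (Q\<^sup>2 * z))" (is "?f sums ?l")
    by (intro sums_add sums_diff sums_mult s0)
  \<comment> \<open>The term with index 0 has the factor \<open>1 - (1 + D / Q) + D / Q\<close>,
    which is 0, so the shift of the index loses nothing.\<close>
  then have "(\<lambda>k. ?f (Suc k)) sums ?l" by (subst sums_Suc_iff) (simp add: u_def)
  moreover have "(\<lambda>k. z * (u k * z ^ k) - (A + B) * z * (u k * (Q * z) ^ k) + A * B * z * (u k * (Q\<^sup>2 * z) ^ k)) sums
      (z * phi21 A B D z - (A + B) * z * phi21 A B D (Q * z) + A * B * z * phi21 A B D (Q\<^sup>2 * z))"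
    by (intro sums_add sums_diff sums_mult s0)
  moreover have "?f (Suc k) = z * (u k * z ^ k) - (A + B) * z * (u k * (Q * z) ^ k) + A * B * z * (u k * (Q\<^sup>2 * z) ^ k)" for k
  proof -
    define y where "y = Q ^ k"
    have p: "(Q * z) ^ k = y * z ^ k" "(Q\<^sup>2 * z) ^ k = y * y * z ^ k"
      by (simp_all add: y_def power_mult_distrib power_mult[symmetric] mult_2 power_add[symmetric] mult.commute[of 2])
    have "?f (Suc k) = (1 - Q ^ Suc k) * (1 - D * Q ^ k) * u (Suc k) * z ^ Suc k"
      unfolding power_Suc p y_def[symmetric] by (simp add: field_simps power2_eq_square)
    also have "\<dots> = (1 - A * y) * (1 - B * y) * u k * z ^ Suc k" unfolding urec y_def ..
    finally show ?thesis unfolding p by (simp add: algebra_simps)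
  qed
  ultimately have "?l = z * phi21 A B D z - (A + B) * z * phi21 A B D (Q * z) + A * B * z * phi21 A B D (Q\<^sup>2 * z)"
    using sums_unique2 by simp
  then show ?thesis by (simp add: algebra_simps)
qed

lemma phi21_holomorphic: "pinf D \<noteq> 0 \<Longrightarrow> phi21 A B D holomorphic_on ball 0 1"
proof -
  assume D: "pinf D \<noteq> 0"
  obtain K where "\<And>k. norm (poch A k * poch B k / (poch Q k * poch D k)) \<le> K" using bounded_poch_quotient[OF D] by blast
  from holomorphic_bounded_powser[OF this] show ?thesis unfolding phi21_def .
qed

lemma phi21_0: "phi21 A B D 0 = 1"
  using powser_zero[of "\<lambda>k. poch A k * poch B k / (poch Q k * poch D k)"] by (simp add: phi21_def)

text \<open>The q-analogue of Euler's transformation, also known as Heine's third transformation.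
  Both sides are holomorphic near 0, have the value 1 there and solve the same second order
  q-difference equation, so \<open>holomorphic_qdiff_unique\<close> applies to their
  difference.\<close>

lemma q_Euler:
  assumes D: "pinf D \<noteq> 0" and nz: "A \<noteq> 0" "B \<noteq> 0" "D \<noteq> 0" and z: "norm z < 1" and t: "norm (A * B / D * z) < 1"
  shows "pinf z * phi21 A B D z = pinf (A * B / D * z) * phi21 (D / A) (D / B) D (A * B / D * z)"
proof -
  define r where "r = A * B / D"
  have r0: "r \<noteq> 0" using nz by (simp add: r_def)
  \<comment> \<open>The radius within which both series converge; the given \<open>z\<close> lies
    inside.\<close>
  define \<rho> where "\<rho> = min 1 (1 / norm r)"
  have \<rho>: "norm w < 1" "norm (r * w) < 1" if "norm w < \<rho>" for w
    using that r0 by (auto simp: \<rho>_def norm_mult field_simps)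
  define h1 where "h1 = (\<lambda>z. pinf z * phi21 A B D z)"
  define h2 where "h2 = (\<lambda>z. pinf (r * z) * phi21 (D / A) (D / B) D (r * z))"
  define \<alpha> where "\<alpha> = (\<lambda>z. 1 + D / Q - (A + B) * z)"
  define \<beta> where "\<beta> = (\<lambda>z. - ((D / Q - A * B * z) * (1 - Q * z)))"
  have e1: "h1 w = \<alpha> w * h1 (Q * w) + \<beta> w * h1 (Q\<^sup>2 * w)" if w: "norm w < \<rho>" for w
  proof -
    have p: "pinf w = (1 - w) * ((1 - Q * w) * pinf (Q\<^sup>2 * w))" "pinf (Q * w) = (1 - Q * w) * pinf (Q\<^sup>2 * w)"
      using pinf_rec[of w] pinf_rec[of "Q * w"] by (simp_all add: mult_ac power2_eq_square)
    define X where "X = (1 - Q * w) * pinf (Q\<^sup>2 * w)"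
    have "h1 w - \<alpha> w * h1 (Q * w) - \<beta> w * h1 (Q\<^sup>2 * w) = X *
       ((1 - w) * phi21 A B D w - (1 + D / Q - (A + B) * w) * phi21 A B D (Q * w)
    + (D / Q - A * B * w) * phi21 A B D (Q\<^sup>2 * w))"
      unfolding h1_def p \<alpha>_def \<beta>_def X_def by (simp add: algebra_simps)
    then have "h1 w - \<alpha> w * h1 (Q * w) - \<beta> w * h1 (Q\<^sup>2 * w) = 0" using phi21_qdiff[OF D \<rho>(1)[OF w], of A B] by simp
    then show ?thesis by (simp add: algebra_simps)
  qed
  have e2: "h2 w = \<alpha> w * h2 (Q * w) + \<beta> w * h2 (Q\<^sup>2 * w)" if w: "norm w < \<rho>" for w
  proof -
    define y where "y = r * w"
    have p: "pinf y = (1 - y) * ((1 - Q * y) * pinf (Q\<^sup>2 * y))" "pinf (Q * y) = (1 - Q * y) * pinf (Q\<^sup>2 * y)"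
      using pinf_rec[of y] pinf_rec[of "Q * y"] by (simp_all add: mult_ac power2_eq_square)
    define X where "X = (1 - Q * y) * pinf (Q\<^sup>2 * y)"
    have c: "(D / A + D / B) * y = (A + B) * w" "D / A * (D / B) * y = D * w" "y = A * B * w / D"
      using nz by (simp_all add: y_def r_def field_simps)
    have m: "r * (Q * w) = Q * y" "r * (Q\<^sup>2 * w) = Q\<^sup>2 * y" "r * w = y" by (simp_all add: y_def)
    have \<beta>w: "\<beta> w = - ((D / Q - D * w) * (1 - Q * y))"
      unfolding \<beta>_def c(3) using nz by (simp add: field_simps)
    have "h2 w - \<alpha> w * h2 (Q * w) - \<beta> w * h2 (Q\<^sup>2 * w) = X *
       ((1 - y) * phi21 (D / A) (D / B) D y - (1 + D / Q - (D / A + D / B) * y) * phi21 (D / A) (D / B) D (Q * y)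
    + (D / Q - D / A * (D / B) * y) * phi21 (D / A) (D / B) D (Q\<^sup>2 * y))"
      unfolding h2_def m p \<alpha>_def \<beta>w X_def c(1,2) by (simp add: algebra_simps)
    then have "h2 w - \<alpha> w * h2 (Q * w) - \<beta> w * h2 (Q\<^sup>2 * w) = 0"
      using phi21_qdiff[OF D, of y "D / A" "D / B"] \<rho>(2)[OF w] by (simp add: y_def)
    then show ?thesis by (simp add: algebra_simps)
  qed
  have "(\<lambda>w. h1 w - h2 w) z = 0"
  proof (rule holomorphic_qdiff_unique[where h = "\<lambda>w. h1 w - h2 w" and z = z and r = \<rho> and \<alpha> = \<alpha> and \<beta> = \<beta> and \<alpha>' = "1 + D / Q" and \<beta>' = "- D / Q"])
    have "(\<lambda>w. phi21 (D / A) (D / B) D (r * w)) holomorphic_on ball 0 \<rho>"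
    proof -
      have "(\<lambda>z. r * z) ` ball 0 \<rho> \<subseteq> ball 0 1" using \<rho>(2) by auto
      then have "phi21 (D / A) (D / B) D holomorphic_on ((\<lambda>z. r * z) ` ball 0 \<rho>)"
        by (rule holomorphic_on_subset[OF phi21_holomorphic[OF D]])
      from holomorphic_on_compose[OF _ this] show ?thesis
        by (simp add: o_def holomorphic_intros)
    qed
    moreover have "phi21 A B D holomorphic_on ball 0 \<rho>"
      by (rule holomorphic_on_subset[OF phi21_holomorphic[OF D]]) (auto simp: \<rho>_def)
    ultimately show "(\<lambda>w. h1 w - h2 w) holomorphic_on ball 0 \<rho>"
      unfolding h1_def h2_def by (intro holomorphic_intros)
    show "h1 0 - h2 0 = 0" by (simp add: h1_def h2_def phi21_0)
    show "h1 w - h2 w = \<alpha> w * (h1 (Q * w) - h2 (Q * w)) + \<beta> w * (h1 (Q\<^sup>2 * w) - h2 (Q\<^sup>2 * w))" if "norm w < \<rho>" for w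
      by (subst e1[OF that], subst e2[OF that]) (simp add: algebra_simps)
    show "(\<alpha> \<longlongrightarrow> 1 + D / Q) (at 0)" "(\<beta> \<longlongrightarrow> - D / Q) (at 0)"
      unfolding \<alpha>_def \<beta>_def by (auto intro!: tendsto_eq_intros)
    show "norm z < \<rho>" using z t r0 by (auto simp: \<rho>_def r_def[symmetric] norm_mult field_simps)
    fix m :: nat assume "m > 0"
    then obtain n where m: "m = Suc n" using gr0_conv_Suc by blast
    \<comment> \<open>The indicial expression at order \<open>m\<close> factors. Its second factor
      is nonzero because \<open>pinf D\<close> is.\<close>
    have "1 - (1 + D / Q) * Q ^ m - - D / Q * (Q\<^sup>2) ^ m = (1 - Q ^ Suc n) * (1 - D * Q ^ n)"
      unfolding m by (simp add: field_simps power_mult[symmetric] mult_2 power_add power2_eq_square power_mult_distrib)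
    moreover have "1 - Q ^ Suc n \<noteq> 0" "1 - D * Q ^ n \<noteq> 0"
      using pochQ_ne[of "Suc n"] pinf_ne_0_poch[OF D, of "Suc n"] unfolding poch_Suc by auto
    ultimately show "1 - (1 + D / Q) * Q ^ m - - D / Q * (Q\<^sup>2) ^ m \<noteq> 0" by simp
  qed
  then show ?thesis unfolding h1_def h2_def r_def by simp
qed

lemma holomorphic_geometric_suminf:
  fixes f :: "nat \<Rightarrow> complex \<Rightarrow> complex"
  assumes S: "open S" and hol: "\<And>n. f n holomorphic_on S"
    and bd: "\<And>x. x \<in> S \<Longrightarrow> \<exists>d K \<rho>. 0 < d \<and> 0 \<le> \<rho> \<and> \<rho> < 1 \<and> (\<forall>n. \<forall>y\<in>ball x d \<inter> S. norm (f n y) \<le> K * \<rho> ^ n)"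
  shows "(\<lambda>x. \<Sum>n. f n x) holomorphic_on S"
proof (rule holomorphic_on_suminf[OF S hol])
  fix x assume "x \<in> S"
  then obtain d K \<rho> where "0 < d" "0 \<le> \<rho>" "\<rho> < (1::real)" "\<forall>n. \<forall>y\<in>ball x d \<inter> S. norm (f n y) \<le> K * \<rho> ^ n"
    using bd by blast
  then show "\<exists>d M. 0 < d \<and> summable M \<and> (\<forall>n. \<forall>y\<in>ball x d \<inter> S. norm (f n y) \<le> M n)"
    by (intro exI[of _ d] exI[of _ "\<lambda>n. K * \<rho> ^ n"]) (auto intro!: summable_mult summable_geometric)
qed

lemma norm_poch_pinf_le:
  assumes "norm x \<le> r" "norm y \<le> r"
  shows "norm (poch x k * pinf (y * Q ^ k)) \<le> exp (r / (1 - q)) * exp (r / (1 - q))"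
  unfolding norm_mult
proof (intro mult_mono norm_poch_le' norm_pinf_le assms)
  have "norm (y * Q ^ k) \<le> norm y * 1" unfolding norm_mult norm_power norm_Q
    by (rule mult_left_mono) (auto intro: power_le_one)
  then show "norm (y * Q ^ k) \<le> r" using assms by simp
qed auto

text \<open>The series 3phi2 with third upper parameter \<open>C\<close> and second lower parameter
  \<open>C * t\<close>, multiplied by \<open>pinf (C * t)\<close>: the factor
  \<open>pinf (C * t * Q ^ k)\<close> stands for the quotient of \<open>pinf (C * t)\<close> by
  \<open>poch (C * t) k\<close>. This removes the poles in \<open>C\<close>.\<close>

definition sears_sum :: "complex \<Rightarrow> complex \<Rightarrow> complex \<Rightarrow> complex \<Rightarrow> complex \<Rightarrow> complex \<Rightarrow> complex" where
  "sears_sum A B D t z C =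
    (\<Sum>k. poch A k * poch B k / (poch Q k * poch D k) * (poch C k * pinf (C * t * Q ^ k)) * z ^ k)"

lemma sears_sum_holomorphic:
  assumes D: "pinf D \<noteq> 0" and z: "norm z < 1"
  shows "sears_sum A B D t z holomorphic_on UNIV"
  unfolding sears_sum_def[abs_def]
proof (rule holomorphic_geometric_suminf)
  fix x :: complex
  obtain K where K: "K > 0" "\<And>k. norm (poch A k * poch B k / (poch Q k * poch D k)) \<le> K" using bounded_poch_quotient[OF D] by blast
  define r where "r = (norm x + 1) * (1 + norm t)"
  have "norm (poch A k * poch B k / (poch Q k * poch D k) * (poch y k * pinf (y * t * Q ^ k)) * z ^ k)
      \<le> (K * (exp (r / (1 - q)) * exp (r / (1 - q)))) * norm z ^ k" if y: "y \<in> ball x 1" for y k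
  proof -
    have y1: "norm y \<le> norm x + 1" using y norm_triangle_ineq[of x "y - x"] by (simp add: dist_norm norm_minus_commute)
    have "norm y \<le> r" using mult_mono[OF y1, of 1 "1 + norm t"] by (simp add: r_def)
    moreover have "norm (y * t) \<le> r" using mult_mono[OF y1, of "norm t" "1 + norm t"] by (simp add: r_def norm_mult)
    ultimately show ?thesis unfolding norm_mult[of _ "z ^ k"] norm_power norm_mult[of "_ / _"]
      by (intro mult_right_mono mult_mono K norm_poch_pinf_le) (use K in auto)
  qed
  then show "\<exists>d K' \<rho>. 0 < d \<and> 0 \<le> \<rho> \<and> \<rho> < 1 \<and> (\<forall>n. \<forall>y\<in>ball x d \<inter> UNIV.
      norm (poch A n * poch B n / (poch Q n * poch D n) * (poch y n * pinf (y * t * Q ^ n)) * z ^ n) \<le> K' * \<rho> ^ n)"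
    using z by (intro exI[of _ 1] exI[of _ "K * (exp (r / (1 - q)) * exp (r / (1 - q)))"] exI[of _ "norm z"]) auto
qed (unfold qpoch_def, auto intro!: holomorphic_intros)

text \<open>The factor \<open>poch C k * pinf (C * t * Q ^ k)\<close> is \<open>pinf C\<close> times
  a quotient of infinite products, which the q-binomial theorem expands in powers of
  \<open>C * Q ^ k\<close>. Interchanging the two sums leaves 2phi1 series at
  \<open>z * Q ^ m\<close>.\<close>

lemma sears_sum_small:
  assumes D: "pinf D \<noteq> 0" and z: "norm z < 1" and C: "norm C < 1"
  shows "sears_sum A B D t z C = pinf C * (\<Sum>m. poch t m / poch Q m * C ^ m * phi21 A B D (z * Q ^ m))"
proof -
  define u where "u k = poch A k * poch B k / (poch Q k * poch D k)" for k
  define v where "v k = poch t k / poch Q k" for k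
  obtain K where K: "K > 0" "\<And>k. norm (u k) \<le> K" using bounded_poch_quotient[OF D] unfolding u_def by blast
  obtain K' where K': "K' > 0" "\<And>k. norm (v k) \<le> K'"
    using bounded_poch_quotient[of 0 t 0] unfolding v_def by auto
  have Qle: "norm (x * Q ^ n) \<le> norm x" for x n
    unfolding norm_mult norm_power norm_Q by (simp add: mult_left_le power_le_one)
  define f where "f = (\<lambda>k m. u k * z ^ k * (v m * C ^ m) * Q ^ (k * m))"
  have fb: "norm (f k m) \<le> (K * K') * (norm z ^ k * norm C ^ m)" for k m
  proof -
    have "norm (f k m) \<le> norm (u k * z ^ k * (v m * C ^ m))" unfolding f_def by (rule Qle)
    also have "\<dots> = norm (u k) * norm (v m) * (norm z ^ k * norm C ^ m)" by (simp add: norm_mult norm_power)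
    also have "\<dots> \<le> (K * K') * (norm z ^ k * norm C ^ m)" using K K' by (intro mult_right_mono mult_mono) auto
    finally show ?thesis .
  qed
  have 1: "poch C k * pinf (C * t * Q ^ k) = pinf C * (\<Sum>m. v m * (C * Q ^ k) ^ m)" for k
  proof -
    have n: "norm (C * Q ^ k) < 1" using Qle[of C k] C by simp
    have "(\<Sum>m. v m * (C * Q ^ k) ^ m) = pinf (t * (C * Q ^ k)) / pinf (C * Q ^ k)" unfolding v_def by (rule q_binomial(1)[OF n])
    moreover have "t * (C * Q ^ k) = C * t * Q ^ k" by simp
    ultimately show ?thesis using pinf_split[of C k] pinf_ne_0_lt1[OF n] by simp
  qed
  have "sears_sum A B D t z C = (\<Sum>k. pinf C * (\<Sum>m. f k m))"
    unfolding sears_sum_def u_def[symmetric] 1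
  proof (rule suminf_cong)
    fix k
    have n: "norm (C * Q ^ k) < 1" using Qle[of C k] C by simp
    have "(\<Sum>m. f k m) = (\<Sum>m. u k * z ^ k * (v m * (C * Q ^ k) ^ m))"
      unfolding f_def power_mult_distrib power_mult by (simp only: mult_ac)
    also have "\<dots> = u k * z ^ k * (\<Sum>m. v m * (C * Q ^ k) ^ m)"
      by (rule suminf_mult[OF summable_bounded_powser(2)[OF K'(2) n]])
    finally show "u k * (pinf C * (\<Sum>m. v m * (C * Q ^ k) ^ m)) * z ^ k = pinf C * (\<Sum>m. f k m)" by simp
  qed
  also have "\<dots> = pinf C * (\<Sum>k. \<Sum>m. f k m)"
  proof (rule suminf_mult, rule summable_comparison_test'[of "\<lambda>k. K * K' / (1 - norm C) * norm z ^ k" 0])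
    fix k
    have s: "summable (\<lambda>m. norm (f k m))"
      by (rule summable_comparison_test'[of "\<lambda>m. K * K' * norm z ^ k * norm C ^ m" 0])
        (use fb[of k] C in \<open>auto simp: mult.assoc intro!: summable_mult summable_geometric\<close>)
    have "norm (\<Sum>m. f k m) \<le> (\<Sum>m. norm (f k m))" by (rule summable_norm[OF s])
    also have "\<dots> \<le> (\<Sum>m. K * K' * norm z ^ k * norm C ^ m)"
      by (rule suminf_le[OF _ s]) (use fb[of k] C in \<open>auto simp: mult.assoc intro!: summable_mult summable_geometric\<close>)
    finally show "norm (\<Sum>m. f k m) \<le> K * K' / (1 - norm C) * norm z ^ k"
      using C by (simp add: suminf_mult suminf_geometric summable_geometric)
  qed (use z in \<open>auto intro!: summable_mult summable_geometric\<close>)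
  also have "(\<Sum>k. \<Sum>m. f k m) = (\<Sum>m. \<Sum>k. f k m)"
    by (rule suminf_swap_geometric[OF fb]) (use z C in auto)
  also have "\<dots> = (\<Sum>m. v m * C ^ m * phi21 A B D (z * Q ^ m))"
  proof (rule suminf_cong)
    fix m
    have n: "norm (z * Q ^ m) < 1" using Qle[of z m] z by simp
    have "(\<Sum>k. f k m) = (\<Sum>k. v m * C ^ m * (u k * (z * Q ^ m) ^ k))"
      unfolding f_def power_mult_distrib power_mult[symmetric] by (simp only: mult_ac)
    also have "\<dots> = v m * C ^ m * phi21 A B D (z * Q ^ m)"
      unfolding phi21_def u_def[symmetric] by (rule suminf_mult[OF summable_bounded_powser(2)[OF K(2) n]])
    finally show "(\<Sum>k. f k m) = v m * C ^ m * phi21 A B D (z * Q ^ m)" .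
  qed
  finally show ?thesis unfolding v_def .
qed

lemma holomorphic_eq_UNIV:
  assumes "f holomorphic_on UNIV" "g holomorphic_on UNIV" "open S" "S \<noteq> {}" "\<And>z. z \<in> S \<Longrightarrow> f z = g z"
  shows "f z = g z"
  by (rule analytic_continuation_open[of S UNIV f g]) (use assms in auto)

text \<open>The transformation (III.9) of Gasper and Rahman, multiplied by its denominators: both sides
  are entire in \<open>C\<close>, which removes the restriction \<open>norm C < 1\<close> of the double series argument.\<close>

lemma sears_transform:
  assumes D: "pinf D \<noteq> 0" and nz: "A \<noteq> 0" "B \<noteq> 0" "D \<noteq> 0"
    and t: "norm t < 1" and z: "norm z < 1" and zt: "z = D * t / (A * B)"
  shows "pinf z * sears_sum A B D t z C = pinf t * sears_sum (D / A) (D / B) D z t C"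
proof (rule holomorphic_eq_UNIV[where S = "ball 0 1" and z = C and f = "\<lambda>C. pinf z * sears_sum A B D t z C"
    and g = "\<lambda>C. pinf t * sears_sum (D / A) (D / B) D z t C"])
  show "(\<lambda>C. pinf z * sears_sum A B D t z C) holomorphic_on UNIV"
    "(\<lambda>C. pinf t * sears_sum (D / A) (D / B) D z t C) holomorphic_on UNIV"
    by (intro holomorphic_intros sears_sum_holomorphic D t z)+
  fix C :: complex assume "C \<in> ball 0 1"
  then have C: "norm C < 1" by simp
  have Qle: "norm (x * Q ^ n) \<le> norm x" for x n
    unfolding norm_mult norm_power norm_Q by (simp add: mult_left_le power_le_one)
  have sm: "summable (\<lambda>m. poch t m / poch Q m * C ^ m * phi21 A B D (z * Q ^ m))"
    if z: "norm z < 1" for A B t z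
  proof -
    obtain K where K: "K > 0" "\<And>m. norm (poch t m / poch Q m) \<le> K"
      using bounded_poch_quotient[of 0 t 0] by auto
    have "isCont (phi21 A B D) 0"
      using holomorphic_on_imp_continuous_on[OF phi21_holomorphic[OF D]] by (simp add: continuous_on_eq_continuous_at)
    then have "(\<lambda>m. phi21 A B D (z * Q ^ m)) \<longlonglongrightarrow> phi21 A B D 0" by (rule isCont_tendsto_compose[OF _ Q_pow_tendsto])
    then have "Bseq (\<lambda>m. phi21 A B D (z * Q ^ m))" using convergentI convergent_imp_Bseq by blast
    then obtain K' where K': "K' > 0" "\<And>m. norm (phi21 A B D (z * Q ^ m)) \<le> K'" by (auto simp: Bseq_def)
    show ?thesis
    proof (rule summable_comparison_test'[of "\<lambda>m. K * K' * norm C ^ m" 0])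
      fix m
      have "norm (poch t m / poch Q m * C ^ m * phi21 A B D (z * Q ^ m)) =
        norm (poch t m / poch Q m) * norm (phi21 A B D (z * Q ^ m)) * norm C ^ m" by (simp add: norm_mult norm_power norm_divide)
      also have "\<dots> \<le> K * K' * norm C ^ m" using K K' by (intro mult_right_mono mult_mono) auto
      finally show "norm (poch t m / poch Q m * C ^ m * phi21 A B D (z * Q ^ m)) \<le> K * K' * norm C ^ m" .
    qed (use C in \<open>auto intro!: summable_mult summable_geometric\<close>)
  qed
  have tz: "t = A * B / D * z" using nz zt by simp
  \<comment> \<open>Euler's transformation is applied at the argument \<open>z * Q ^ m\<close>; the
    factors \<open>poch z m\<close> and \<open>poch t m\<close> complete the infinite products to
    \<open>pinf z\<close> and \<open>pinf t\<close>.\<close>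
  have tm: "pinf z * (poch t m / poch Q m * C ^ m * phi21 A B D (z * Q ^ m)) =
     pinf t * (poch z m / poch Q m * C ^ m * phi21 (D / A) (D / B) D (t * Q ^ m))" for m
  proof -
    have n: "norm (z * Q ^ m) < 1" "norm (A * B / D * (z * Q ^ m)) < 1"
      using Qle[of z m] Qle[of t m] z t by (auto simp: tz mult_ac)
    have "pinf (z * Q ^ m) * phi21 A B D (z * Q ^ m) = pinf (t * Q ^ m) * phi21 (D / A) (D / B) D (t * Q ^ m)"
      using q_Euler[OF D nz n] by (simp add: tz mult_ac)
    then have "poch z m * poch t m / poch Q m * C ^ m * (pinf (z * Q ^ m) * phi21 A B D (z * Q ^ m)) =
      poch z m * poch t m / poch Q m * C ^ m * (pinf (t * Q ^ m) * phi21 (D / A) (D / B) D (t * Q ^ m))" by simp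
    then show ?thesis unfolding pinf_split[of z m] pinf_split[of t m] by (simp only: mult_ac times_divide_eq_left times_divide_eq_right)
  qed
  show "pinf z * sears_sum A B D t z C = pinf t * sears_sum (D / A) (D / B) D z t C"
    unfolding sears_sum_small[OF D z C] sears_sum_small[OF D t C]
    using suminf_mult[OF sm[OF z], of "pinf z" t A B] suminf_mult[OF sm[OF t], of "pinf t" z "D / A" "D / B"]
    unfolding tm by (simp add: mult.left_commute)
qed auto

text \<open>Sears' transformation with \<open>B = D = Q\<close>: one upper parameter on the right
  becomes 1, so that series reduces to its first term. The conditions \<open>A \<noteq> 0\<close>
  and \<open>norm (A * w) < 1\<close> needed for this are removed because both sides are entire in
  \<open>A\<close>.\<close>

lemma q_Gauss:
  assumes w: "norm w < 1"
  shows "pinf w * (\<Sum>k. poch A k * poch C k / poch Q k * pinf (A * C * w * Q ^ k) * w ^ k) = pinf (A * w) * pinf (C * w)"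
proof (rule holomorphic_eq_UNIV[where S = "ball 0 (1 / (norm w + 1)) - {0}" and z = A
    and f = "\<lambda>A. pinf w * (\<Sum>k. poch A k * poch C k / poch Q k * pinf (A * C * w * Q ^ k) * w ^ k)"
    and g = "\<lambda>A. pinf (A * w) * pinf (C * w)"])
  obtain K where K: "K > 0" "\<And>k. norm (poch C k / poch Q k) \<le> K"
    using bounded_poch_quotient[of 0 C 0] by auto
  have "(\<lambda>A. \<Sum>k. poch A k * poch C k / poch Q k * pinf (A * C * w * Q ^ k) * w ^ k) holomorphic_on UNIV"
  proof (rule holomorphic_geometric_suminf)
    fix x :: complex
    define r where "r = (norm x + 1) * (1 + norm (C * w))"
    have "norm (poch y k * poch C k / poch Q k * pinf (y * C * w * Q ^ k) * w ^ k)
      \<le> (exp (r / (1 - q)) * exp (r / (1 - q)) * K) * norm w ^ k" if y: "y \<in> ball x 1" for y k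
    proof -
      have y1: "norm y \<le> norm x + 1" using y norm_triangle_ineq[of x "y - x"] by (simp add: dist_norm norm_minus_commute)
      have "norm y \<le> r" using mult_mono[OF y1, of 1 "1 + norm (C * w)"] by (simp add: r_def)
      moreover have "norm (y * C * w) \<le> r"
        using mult_mono[OF y1, of "norm (C * w)" "1 + norm (C * w)"] by (simp add: r_def norm_mult mult_ac)
      moreover have "norm (poch y k * poch C k / poch Q k * pinf (y * C * w * Q ^ k) * w ^ k) =
        norm (poch y k * pinf (y * C * w * Q ^ k)) * norm (poch C k / poch Q k) * norm w ^ k"
        by (simp add: norm_mult norm_divide norm_power mult_ac)
      ultimately show ?thesis
        using K by (auto intro!: mult_right_mono mult_mono norm_poch_pinf_le)
    qed
    then show "\<exists>d K' \<rho>. 0 < d \<and> 0 \<le> \<rho> \<and> \<rho> < 1 \<and> (\<forall>k. \<forall>y\<in>ball x d \<inter> UNIV.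
       norm (poch y k * poch C k / poch Q k * pinf (y * C * w * Q ^ k) * w ^ k) \<le> K' * \<rho> ^ k)"
      using w by (intro exI[of _ 1] exI[of _ "exp (r / (1 - q)) * exp (r / (1 - q)) * K"] exI[of _ "norm w"]) auto
  qed (unfold qpoch_def, auto intro!: holomorphic_intros)
  then show "(\<lambda>A. pinf w * (\<Sum>k. poch A k * poch C k / poch Q k * pinf (A * C * w * Q ^ k) * w ^ k)) holomorphic_on UNIV"
    by (intro holomorphic_intros)
  show "(\<lambda>A. pinf (A * w) * pinf (C * w)) holomorphic_on UNIV" by (intro holomorphic_intros)
  show "open (ball 0 (1 / (norm w + 1)) - {0::complex})" by auto
  have "0 < 1 / (norm w + 1) / 2" "1 / (norm w + 1) / 2 < 1 / (norm w + 1)"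
    using norm_ge_zero[of w] by (simp_all add: field_simps add_pos_nonneg)
  then have "of_real (1 / (norm w + 1) / 2) \<in> ball 0 (1 / (norm w + 1)) - {0::complex}"
    by (simp only: Diff_iff mem_ball dist_norm norm_of_real diff_0 norm_minus_cancel singleton_iff of_real_eq_0_iff)
      linarith
  then show "ball 0 (1 / (norm w + 1)) - {0::complex} \<noteq> {}" by blast
  fix A :: complex assume "A \<in> ball 0 (1 / (norm w + 1)) - {0}"
  then have A0: "A \<noteq> 0" and A1: "norm A < 1 / (norm w + 1)" by auto
  have "norm A * (norm w + 1) < 1" using A1 by (simp add: field_simps add_pos_nonneg)
  then have t: "norm (A * w) < 1" using A0 by (simp add: norm_mult distrib_left) (use norm_ge_zero[of A] in linarith)
  have p1: "poch 1 k = 0" if "k \<noteq> 0" for k using that by (cases k) (simp_all add: poch_Suc')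
  have "pinf w * sears_sum A Q Q (A * w) w C = pinf (A * w) * sears_sum (Q / A) (Q / Q) Q w (A * w) C"
    by (rule sears_transform) (use A0 t w in auto)
  moreover have "sears_sum (Q / A) (Q / Q) Q w (A * w) C = pinf (C * w)"
    unfolding sears_sum_def by (subst suminf_finite[of "{0}"]) (auto simp: p1)
  moreover have "sears_sum A Q Q (A * w) w C = (\<Sum>k. poch A k * poch C k / poch Q k * pinf (A * C * w * Q ^ k) * w ^ k)"
    unfolding sears_sum_def by (rule suminf_cong) (simp add: mult_ac)
  ultimately show "pinf w * (\<Sum>k. poch A k * poch C k / poch Q k * pinf (A * C * w * Q ^ k) * w ^ k) = pinf (A * w) * pinf (C * w)"
    by simp
qed

end

section \<open>Big \<open>q\<close>-Jacobi functions\<close>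

locale bqj = qbase +
  fixes zm zp :: real and a b c d s :: complex
  assumes zm: "zm < 0" and zp: "0 < zp"
    and nz: "a \<noteq> 0" "b \<noteq> 0" "c \<noteq> 0" "d \<noteq> 0"
    and s_pos: "s \<in> \<real>" "0 < Re s" and s_sq: "s\<^sup>2 * (a * b) = c * d * Q"
    and ab: "(a = cnj b \<or> a \<in> \<real> \<and> b \<in> \<real>)" "0 < Re (a * b)" "q < norm (a / b)" "norm (a / b) < 1 / q" "a \<noteq> b"
    and cd: "(c = cnj d \<or> c \<in> \<real> \<and> d \<in> \<real>)" "q < norm (c / d)" "norm (c / d) < 1 / q"
    and pos: "\<And>x. x \<in> Rq q zm zp \<Longrightarrow> (1 - a * of_real x) * (1 - b * of_real x) \<in> \<real> \<and> 0 < Re ((1 - a * of_real x) * (1 - b * of_real x))"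
      "\<And>x. x \<in> Rq q zm zp \<Longrightarrow> (1 - c * of_real x) * (1 - d * of_real x) \<in> \<real> \<and> 0 < Re ((1 - c * of_real x) * (1 - d * of_real x))"
    and gen: "c / a \<notin> qZ q" "c / b \<notin> qZ q" "d / a \<notin> qZ q" "d / b \<notin> qZ q"
begin

lemma holomorphic_poch: "f holomorphic_on S \<Longrightarrow> (\<lambda>x. poch (f x) n) holomorphic_on S"
  unfolding qpoch_def by (intro holomorphic_intros)

lemma s_ne [simp]: "s \<noteq> 0" using s_pos by auto

text \<open>The setting is symmetric in \<open>a\<close>, \<open>b\<close> and in \<open>c\<close>,
  \<open>d\<close>. An object marked with a dagger is the same definition in the locale with
  \<open>a\<close> and \<open>b\<close> interchanged, so every result about
  \<open>\<phi>\<^sub>\<gamma>\<close> is available for its dagger without a second proof.\<close>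

lemma swap_ab: "bqj q zm zp b a c d s"
proof unfold_locales
  have "norm (b / a) = 1 / norm (a / b)" by (simp add: norm_divide)
  then show "q < norm (b / a)" "norm (b / a) < 1 / q"
    using ab(3,4) q0 nz by (auto simp: field_simps norm_divide)
  show "(1 - b * of_real x) * (1 - a * of_real x) \<in> \<real> \<and> 0 < Re ((1 - b * of_real x) * (1 - a * of_real x))" if "x \<in> Rq q zm zp" for x
    using pos(1)[OF that] by (simp add: mult.commute)
qed (use zm zp nz s_pos s_sq ab cd gen pos(2) in \<open>auto simp: mult.commute\<close>)

lemma swap_cd: "bqj q zm zp a b d c s"
proof unfold_locales
  have "norm (d / c) = 1 / norm (c / d)" by (simp add: norm_divide)
  then show "q < norm (d / c)" "norm (d / c) < 1 / q"
    using cd(2,3) q0 nz by (auto simp: field_simps norm_divide)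
  show "(1 - d * of_real x) * (1 - c * of_real x) \<in> \<real> \<and> 0 < Re ((1 - d * of_real x) * (1 - c * of_real x))" if "x \<in> Rq q zm zp" for x
    using pos(2)[OF that] by (simp add: mult.commute)
qed (use zm zp nz s_pos s_sq ab cd gen pos(1) in \<open>auto simp: mult.commute\<close>)

lemma pinf_ne_0_qZ: "x \<notin> qZ q \<Longrightarrow> pinf (x * Q) \<noteq> 0"
proof
  assume x: "x \<notin> qZ q" and "pinf (x * Q) = 0"
  then obtain k where k: "x * Q ^ Suc k = 1" by (auto simp: pinf_eq_0_iff mult_ac)
  then have "x = inverse (Q ^ Suc k)" by (metis inverse_unique mult.commute)
  then have "x = of_real (q powi (- int (Suc k)))" by (simp only: power_int_minus power_int_of_nat of_real_inverse of_real_power)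
  then show False using x unfolding qZ_def by blast
qed

lemma pinf_ca_ne [simp]: "pinf (c * Q / a) \<noteq> 0" "pinf (d * Q / a) \<noteq> 0" "pinf (c * Q / b) \<noteq> 0" "pinf (d * Q / b) \<noteq> 0"
  using pinf_ne_0_qZ[OF gen(1)] pinf_ne_0_qZ[OF gen(2)] pinf_ne_0_qZ[OF gen(3)] pinf_ne_0_qZ[OF gen(4)] by simp_all

text \<open>Sears' transformation replaces the argument \<open>b * x\<close> of the series by
  \<open>tau / \<gamma>\<close>. Hence \<open>norm tau < 1\<close> secures convergence for all
  \<open>\<gamma>\<close> on or outside the unit circle, whatever \<open>x\<close> is.\<close>

definition tau :: complex where "tau = d * Q / (a * s)"

text \<open>The transformed series for \<open>pinf (b * x) * ser \<gamma> x\<close>, see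
  \<open>N0_ser\<close>. Here \<open>x\<close> occurs only in the parameters and not in the argument
  of the series, so the function is entire in \<open>x\<close>.\<close>

definition N0 :: "complex \<Rightarrow> complex \<Rightarrow> complex" where
  "N0 \<gamma> x = pinf (tau / \<gamma>) / pinf (d * Q / a) *
     sears_sum (c * x) (c * Q * \<gamma> / (a * s)) (c * Q / a) (b * x) (tau / \<gamma>) (s * \<gamma>)"

definition ser :: "complex \<Rightarrow> complex \<Rightarrow> complex" where
  "ser \<gamma> x = phi32 (Q / (a * x)) (s * \<gamma>) (s / \<gamma>) (c * Q / a) (d * Q / a) q (b * x)"

text \<open>\<open>(q/ax;q)\<^sub>k x\<^sup>k\<close>, a polynomial in \<open>x\<close>\<close>

definition shifted_power :: "nat \<Rightarrow> complex \<Rightarrow> complex" where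
  "shifted_power k x = (\<Prod>j<k. x - Q ^ Suc j / a)"

definition sig :: "complex \<Rightarrow> nat \<Rightarrow> complex" where
  "sig \<gamma> k = poch (s * \<gamma>) k * poch (s / \<gamma>) k / (poch Q k * poch (c * Q / a) k * poch (d * Q / a) k)"

lemma shifted_power_eq: "x \<noteq> 0 \<Longrightarrow> poch (Q / (a * x)) k * (b * x) ^ k = b ^ k * shifted_power k x"
  using nz by (induction k) (simp_all add: shifted_power_def poch_Suc field_simps)

lemma ser_eq: "x \<noteq> 0 \<Longrightarrow> ser \<gamma> x = (\<Sum>k. sig \<gamma> k * (b ^ k * shifted_power k x))"
  unfolding ser_def phi32_def by (rule suminf_cong) (simp add: qpochs_def sig_def mult_ac flip: shifted_power_eq)

lemma sig_bounded: obtains K where "K > 0" "\<And>k. norm (sig \<gamma> k) \<le> K"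
proof -
  obtain K1 where K1: "K1 > 0" "\<And>k. norm (poch (s * \<gamma>) k * poch (s / \<gamma>) k / (poch Q k * poch (c * Q / a) k)) \<le> K1"
    using bounded_poch_quotient[OF pinf_ca_ne(1)] by blast
  obtain K2 where K2: "K2 > 0" "\<And>n. norm (1 / poch (d * Q / a) n) \<le> K2" using bounded_inverse_poch[OF pinf_ca_ne(2)] by blast
  show thesis
  proof (rule that[of "K1 * K2"])
    fix k
    have "sig \<gamma> k = poch (s * \<gamma>) k * poch (s / \<gamma>) k / (poch Q k * poch (c * Q / a) k) * (1 / poch (d * Q / a) k)"
      by (simp add: sig_def)
    then have "norm (sig \<gamma> k) = norm (poch (s * \<gamma>) k * poch (s / \<gamma>) k / (poch Q k * poch (c * Q / a) k)) * norm (1 / poch (d * Q / a) k)"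
      by (simp only: norm_mult)
    also have "\<dots> \<le> K1 * K2" using K1 K2 by (intro mult_mono) auto
    finally show "norm (sig \<gamma> k) \<le> K1 * K2" .
  qed (use K1 K2 in simp)
qed

lemma poch_bx_bounded:
  assumes "x \<noteq> 0"
  shows "norm (b ^ k * shifted_power k x) \<le> exp (norm (Q / (a * x)) / (1 - q)) * norm (b * x) ^ k"
  unfolding shifted_power_eq[OF assms, symmetric] norm_mult norm_power
  by (intro mult_right_mono norm_poch_le zero_le_power) (auto simp: norm_mult)

lemma ser_sums:
  assumes x: "x \<noteq> 0" "norm (b * x) < 1"
  shows "(\<lambda>k. sig \<gamma> k * (b ^ k * shifted_power k x)) sums ser \<gamma> x"
proof -
  obtain K where K: "K > 0" "\<And>k. norm (sig \<gamma> k) \<le> K" using sig_bounded by blast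
  have "summable (\<lambda>k. norm (sig \<gamma> k * (b ^ k * shifted_power k x)))"
  proof (rule summable_comparison_test'[of "\<lambda>k. K * (exp (norm (Q / (a * x)) / (1 - q)) * norm (b * x) ^ k)" 0])
    fix k
    have "norm (sig \<gamma> k * (b ^ k * shifted_power k x)) \<le> K * (exp (norm (Q / (a * x)) / (1 - q)) * norm (b * x) ^ k)"
      unfolding norm_mult[of "sig \<gamma> k"] by (intro mult_mono K poch_bx_bounded x) (use K in auto)
    then show "norm (norm (sig \<gamma> k * (b ^ k * shifted_power k x))) \<le> K * (exp (norm (Q / (a * x)) / (1 - q)) * norm (b * x) ^ k)"
      by simp
  qed (use x in \<open>auto intro!: summable_mult summable_geometric\<close>)
  then show ?thesis unfolding ser_eq[OF x(1)] by (rule summable_sums[OF summable_norm_cancel])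
qed

lemma s_sq': "s * s = c * d * Q / (a * b)" using s_sq nz by (simp add: field_simps power2_eq_square)

lemma shifted_power_Suc: "shifted_power (Suc k) x = shifted_power k x * (x - Q ^ Suc k / a)" by (simp add: shifted_power_def)

text \<open>Replacing \<open>x\<close> by \<open>Q * x\<close> divides the zeros of the polynomial
  by \<open>q\<close>, so all but one of them remain zeros. Read at \<open>x / Q\<close>, the same
  formula also handles the other shift in the operator.\<close>

lemma shifted_power_shift: "shifted_power (Suc k) (Q * x) = Q ^ Suc k * (x - 1 / a) * shifted_power k x"
proof (induction k)
  case (Suc k)
  show ?case unfolding shifted_power_Suc[of "Suc k" "Q * x"] Suc shifted_power_Suc[of k x] by (simp add: algebra_simps)
qed (simp add: shifted_power_def algebra_simps)

text \<open>With \<open>S\<^sub>k\<close> the contribution of the \<open>k\<close>-th term of the series to \<open>L\<phi> - \<mu>\<phi>\<close>, the partial sums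
  telescope to a multiple of \<open>(q/ax;q)\<^sub>k (bx/q)\<^sup>k\<close>.\<close>

lemma telescope:
  fixes x \<gamma> :: complex
  assumes x: "x \<noteq> 0" and g: "\<gamma> \<noteq> 0"
  defines "A \<equiv> inverse s * (1 - Q / (a * x)) * (1 - Q / (b * x))"
    and "B \<equiv> s * (1 - 1 / (c * x)) * (1 - 1 / (d * x))"
  shows "(\<Sum>k\<le>n. sig \<gamma> k * b ^ k * (A * (shifted_power k (x / Q) - shifted_power k x) + B * (shifted_power k (Q * x) - shifted_power k x) + (inverse s + s - (\<gamma> + inverse \<gamma>)) * shifted_power k x))
     = sig \<gamma> n * b ^ n * ((1 - s * \<gamma> * Q ^ n) * (1 - s / \<gamma> * Q ^ n) * inverse s * shifted_power n x / Q ^ n)"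
proof (induction n)
  case 0
  show ?case using g by (simp add: shifted_power_def sig_def field_simps)
next
  case (Suc m)
  define y where "y = Q ^ Suc m"
  define g where "g = \<gamma> + inverse \<gamma>"
  define u where "u = shifted_power m x"
  define S where "S = A * (shifted_power (Suc m) (x / Q) - shifted_power (Suc m) x) + B * (shifted_power (Suc m) (Q * x) - shifted_power (Suc m) x) + (inverse s + s - (\<gamma> + inverse \<gamma>)) * shifted_power (Suc m) x"
  define N where "N = Q / (a * b) * ((1 - y) * (1 - c * y / a) * (1 - d * y / a))"
  define Pm where "Pm = (1 - s * \<gamma> * Q ^ m) * (1 - s / \<gamma> * Q ^ m)"
  have y0: "y \<noteq> 0" by (simp add: y_def)
  have Pk: "(1 - s * \<gamma> * Q ^ Suc m) * (1 - s / \<gamma> * Q ^ Suc m) = 1 - s * g * y + s * s * y * y"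
    using assms(2) by (simp add: g_def y_def field_simps)
  have uk: "shifted_power (Suc m) x = (x - y / a) * u" by (simp add: shifted_power_Suc u_def y_def)
  have uB: "shifted_power (Suc m) (Q * x) - shifted_power (Suc m) x = - ((1 - y) * x * u)"
    unfolding shifted_power_shift uk using nz by (simp add: u_def y_def field_simps)
  define X V C1 D1 where "X = x - y / a" and "V = x - Q / b" and "C1 = x - 1 / c" and "D1 = x - 1 / d"
  define E where "E = 1 - s * g * y + s * s * y * y"
  define W where "W = Q / b * x * (1 - c * y / a) * (1 - d * y / a)"
  have uA: "(x - Q / a) * (shifted_power (Suc m) (x / Q) - shifted_power (Suc m) x) = (1 / y - 1) * x * (X * u)"
  proof -
    have "shifted_power (Suc (Suc m)) (Q * (x / Q)) = Q ^ Suc (Suc m) * (x / Q - 1 / a) * shifted_power (Suc m) (x / Q)" by (rule shifted_power_shift)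
    moreover have "Q ^ Suc (Suc m) * (x / Q - 1 / a) = y * (x - Q / a)" by (simp add: y_def algebra_simps)
    moreover have "shifted_power (Suc (Suc m)) (Q * (x / Q)) = X * u * (x - y * Q / a)"
      using shifted_power_Suc[of "Suc m" x] by (simp add: uk X_def y_def mult.commute)
    ultimately have "X * u * (x - y * Q / a) = y * ((x - Q / a) * shifted_power (Suc m) (x / Q))" by (simp only: mult_ac)
    then have "(x - Q / a) * shifted_power (Suc m) (x / Q) = X * u * ((x - y * Q / a) / y)"
      using y0 by (metis nonzero_mult_div_cancel_left times_divide_eq_right)
    moreover have "(x - y * Q / a) / y = x / y - Q / a" using y0 by (simp add: diff_divide_distrib)
    ultimately show ?thesis unfolding uk X_def[symmetric] by (simp add: algebra_simps)
  qed
  have A: "A * (shifted_power (Suc m) (x / Q) - shifted_power (Suc m) x) = inverse s * (V / x) * ((1 / y - 1) * (X * u))"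
  proof -
    have "1 - Q / (a * x) = (x - Q / a) / x" "1 - Q / (b * x) = V / x" using x nz by (simp_all add: V_def field_simps)
    then have "A * (shifted_power (Suc m) (x / Q) - shifted_power (Suc m) x) = inverse s * (V / x) * (((x - Q / a) * (shifted_power (Suc m) (x / Q) - shifted_power (Suc m) x)) / x)"
      by (simp add: A_def)
    then show ?thesis unfolding uA using x by simp
  qed
  \<comment> \<open>Here the relation \<open>s * s = c * d * Q / (a * b)\<close> enters. The
    identity says that what is left after separating the telescoping part is the product of the
    three linear factors in the denominator of the coefficient recursion.\<close>
  have key: "X * (V - (1 - s * s * y) * x) - s * s * y * C1 * D1 + W = 0"
  proof -
    define ia ib ic id' where "ia = 1 / a" and "ib = 1 / b" and "ic = 1 / c" and "id' = 1 / d"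
    have r: "c * ic = 1" "d * id' = 1" "s * s = c * d * Q * ia * ib"
      unfolding ia_def ib_def ic_def id'_def s_sq' using nz by simp_all
    have "X = x - y * ia" "V = x - Q * ib" "C1 = x - ic" "D1 = x - id'" "W = Q * ib * x * (1 - c * y * ia) * (1 - d * y * ia)"
      by (simp_all add: X_def V_def C1_def D1_def W_def ia_def ib_def ic_def id'_def)
    then show ?thesis using r by algebra
  qed
  have "s * y * x * S = (X * ((1 - y) * V + y * (1 - s * g + s * s) * x) - s * s * y * (1 - y) * C1 * D1) * u"
  proof -
    have "s * y * x * S = s * y * x * (A * (shifted_power (Suc m) (x / Q) - shifted_power (Suc m) x)) + s * y * x * (B * (shifted_power (Suc m) (Q * x) - shifted_power (Suc m) x))
        + s * y * x * ((inverse s + s - g) * (X * u))"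
      unfolding S_def uk g_def X_def[symmetric] by (simp add: algebra_simps)
    also have "s * y * x * (A * (shifted_power (Suc m) (x / Q) - shifted_power (Suc m) x)) = X * (1 - y) * V * u"
    proof -
      have "s * y * x * (A * (shifted_power (Suc m) (x / Q) - shifted_power (Suc m) x)) = (s * inverse s) * (x * (V / x)) * (y * (1 / y - 1)) * (X * u)"
        unfolding A by (simp only: mult_ac)
      also have "y * (1 / y - 1) = 1 - y" using y0 by (simp add: right_diff_distrib)
      finally show ?thesis using x by simp
    qed
    also have "s * y * x * (B * (shifted_power (Suc m) (Q * x) - shifted_power (Suc m) x)) = - (s * s * y * (1 - y) * C1 * D1 * u)"
    proof -
      have "1 - 1 / (c * x) = C1 / x" "1 - 1 / (d * x) = D1 / x" using x nz by (simp_all add: C1_def D1_def field_simps)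
      then show ?thesis unfolding uB B_def using x by simp
    qed
    also have "s * y * x * ((inverse s + s - g) * (X * u)) = X * (y * (1 - s * g + s * s) * x) * u"
    proof -
      have "s * (inverse s + s - g) = 1 - s * g + s * s" by (simp add: algebra_simps)
      moreover have "s * y * x * ((inverse s + s - g) * (X * u)) = X * (y * (s * (inverse s + s - g)) * x) * u" by (simp only: mult_ac)
      ultimately show ?thesis by simp
    qed
    finally show ?thesis by (simp add: algebra_simps)
  qed
  also have "X * ((1 - y) * V + y * (1 - s * g + s * s) * x) - s * s * y * (1 - y) * C1 * D1 = E * X * x - N * a * x"
  proof -
    have "X * ((1 - y) * V + y * (1 - s * g + s * s) * x) - s * s * y * (1 - y) * C1 * D1 - (E * X * x - (1 - y) * W)
      = (1 - y) * (X * (V - (1 - s * s * y) * x) - s * s * y * C1 * D1 + W)"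
      by (simp add: E_def algebra_simps)
    moreover have "N * a * x = (1 - y) * W" using nz by (simp add: N_def W_def)
    ultimately show ?thesis unfolding key by simp
  qed
  finally have "x * (s * y * S) = x * (E * X * u - N * a * u)" by (simp add: algebra_simps)
  then have "s * y * S = E * X * u - N * a * u" using x by simp
  then have S: "S = (E * X * u - N * a * u) / (s * y)"
    using y0 by (metis nonzero_mult_div_cancel_left mult_eq_0_iff s_ne)
  have ne: "1 - Q * Q ^ m \<noteq> 0" "1 - c * Q / a * Q ^ m \<noteq> 0" "1 - d * Q / a * Q ^ m \<noteq> 0"
    using pochQ_ne[of "Suc m"] pinf_ne_0_poch[OF pinf_ca_ne(1), of "Suc m"] pinf_ne_0_poch[OF pinf_ca_ne(2), of "Suc m"]
    unfolding poch_Suc by auto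
  have sg: "sig \<gamma> (Suc m) * ((1 - y) * (1 - c * y / a) * (1 - d * y / a)) = sig \<gamma> m * Pm"
  proof -
    have aux: "(p1 * f1) * (p2 * f2) / ((P1 * e1) * (R1 * e2) * (T1 * e3)) * (e1 * e2 * e3) = p1 * p2 / (P1 * R1 * T1) * (f1 * f2)"
      if "e1 \<noteq> 0" "e2 \<noteq> 0" "e3 \<noteq> 0" for p1 p2 P1 R1 T1 f1 f2 e1 e2 e3 :: complex
      using that by (simp add: field_simps)
    have e: "1 - y = 1 - Q * Q ^ m" "1 - c * y / a = 1 - c * Q / a * Q ^ m" "1 - d * y / a = 1 - d * Q / a * Q ^ m"
      by (simp_all add: y_def)
    show ?thesis unfolding sig_def poch_Suc e Pm_def by (rule aux[OF ne])
  qed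
  \<comment> \<open>By the coefficient recursion, the part of \<open>S\<close> containing
    \<open>N\<close> cancels the remainder of the preceding partial sum; the part containing
    \<open>E\<close> is the new remainder.\<close>
  have sN: "sig \<gamma> (Suc m) * N = Q / (a * b) * (sig \<gamma> m * Pm)"
    unfolding N_def sg[symmetric] by (simp only: mult_ac)
  have "(\<Sum>k\<le>Suc m. sig \<gamma> k * b ^ k * (A * (shifted_power k (x / Q) - shifted_power k x) + B * (shifted_power k (Q * x) - shifted_power k x) + (inverse s + s - (\<gamma> + inverse \<gamma>)) * shifted_power k x))
     = sig \<gamma> m * b ^ m * (Pm * inverse s * u / Q ^ m) + sig \<gamma> (Suc m) * b ^ Suc m * S"
    unfolding sum.atMost_Suc Suc S_def u_def Pm_def ..
  also have "sig \<gamma> (Suc m) * b ^ Suc m * S = sig \<gamma> (Suc m) * b ^ Suc m * (E * X * u / (s * y))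
      - (sig \<gamma> (Suc m) * N) * b ^ Suc m * (a * u / (s * y))"
    unfolding S by (simp add: diff_divide_distrib right_diff_distrib mult_ac)
  also have "(sig \<gamma> (Suc m) * N) * b ^ Suc m * (a * u / (s * y)) = sig \<gamma> m * b ^ m * (Pm * inverse s * u / Q ^ m)"
    unfolding sN y_def using nz by (simp add: field_simps)
  finally have fin: "(\<Sum>k\<le>Suc m. sig \<gamma> k * b ^ k * (A * (shifted_power k (x / Q) - shifted_power k x) + B * (shifted_power k (Q * x) - shifted_power k x) + (inverse s + s - (\<gamma> + inverse \<gamma>)) * shifted_power k x))
     = sig \<gamma> (Suc m) * b ^ Suc m * (E * X * u / (s * y))" by simp
  have Pk': "(1 - s * \<gamma> * y) * (1 - s / \<gamma> * y) = E" using Pk by (simp add: y_def E_def)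
  show ?case unfolding fin uk X_def[symmetric] y_def[symmetric] Pk'
    by (simp add: divide_inverse mult_ac)
qed

text \<open>The remainder of \<open>telescope\<close> is of the order of the n-th power of
  \<open>norm (b * x) / q\<close>. The condition \<open>norm (b * x) < q\<close> makes it tend to 0
  and at the same time puts \<open>x / Q\<close> inside the disc of convergence.\<close>

lemma ser_qdiff:
  assumes x: "x \<noteq> 0" and bx: "norm (b * x) < q" and g: "\<gamma> \<noteq> 0"
  defines "A \<equiv> inverse s * (1 - Q / (a * x)) * (1 - Q / (b * x))"
    and "B \<equiv> s * (1 - 1 / (c * x)) * (1 - 1 / (d * x))"
  shows "A * (ser \<gamma> (x / Q) - ser \<gamma> x) + B * (ser \<gamma> (Q * x) - ser \<gamma> x) + (inverse s + s - (\<gamma> + inverse \<gamma>)) * ser \<gamma> x = 0"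
proof -
  have n: "norm (b * (x / Q)) < 1" "norm (b * x) < 1" "norm (b * (Q * x)) < 1"
  proof -
    have "norm (b * (x / Q)) = norm (b * x) / q" by (simp add: norm_mult norm_divide)
    then show "norm (b * (x / Q)) < 1" using bx q0 by simp
    show "norm (b * x) < 1" using bx q1 by simp
    have "norm (b * (Q * x)) = norm (b * x) * q" by (simp add: norm_mult)
    also have "\<dots> \<le> norm (b * x) * 1" by (rule mult_left_mono) auto
    finally show "norm (b * (Q * x)) < 1" using bx q1 by simp
  qed
  have s1: "(\<lambda>k. sig \<gamma> k * (b ^ k * shifted_power k (x / Q))) sums ser \<gamma> (x / Q)" "(\<lambda>k. sig \<gamma> k * (b ^ k * shifted_power k x)) sums ser \<gamma> x"
    "(\<lambda>k. sig \<gamma> k * (b ^ k * shifted_power k (Q * x))) sums ser \<gamma> (Q * x)"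
    using ser_sums[OF _ n(1)] ser_sums[OF x n(2)] ser_sums[OF _ n(3)] x by auto
  define T where "T = (\<lambda>k. sig \<gamma> k * b ^ k * (A * (shifted_power k (x / Q) - shifted_power k x) + B * (shifted_power k (Q * x) - shifted_power k x) + (inverse s + s - (\<gamma> + inverse \<gamma>)) * shifted_power k x))"
  have "(\<lambda>k. A * (sig \<gamma> k * (b ^ k * shifted_power k (x / Q)) - sig \<gamma> k * (b ^ k * shifted_power k x)) + B * (sig \<gamma> k * (b ^ k * shifted_power k (Q * x)) - sig \<gamma> k * (b ^ k * shifted_power k x))
      + (inverse s + s - (\<gamma> + inverse \<gamma>)) * (sig \<gamma> k * (b ^ k * shifted_power k x))) sums
     (A * (ser \<gamma> (x / Q) - ser \<gamma> x) + B * (ser \<gamma> (Q * x) - ser \<gamma> x) + (inverse s + s - (\<gamma> + inverse \<gamma>)) * ser \<gamma> x)"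
    by (intro sums_add sums_mult sums_diff s1)
  then have T1: "T sums (A * (ser \<gamma> (x / Q) - ser \<gamma> x) + B * (ser \<gamma> (Q * x) - ser \<gamma> x) + (inverse s + s - (\<gamma> + inverse \<gamma>)) * ser \<gamma> x)"
    unfolding T_def by (simp add: algebra_simps)
  obtain K where K: "K > 0" "\<And>k. norm (sig \<gamma> k) \<le> K" using sig_bounded by blast
  define R where "R = (\<lambda>n. sig \<gamma> n * b ^ n * ((1 - s * \<gamma> * Q ^ n) * (1 - s / \<gamma> * Q ^ n) * inverse s * shifted_power n x / Q ^ n))"
  have "R \<longlonglongrightarrow> 0"
  proof (rule Lim_null_comparison)
    define M where "M = K * ((1 + norm (s * \<gamma>)) * (1 + norm (s / \<gamma>)) * norm (inverse s) * exp (norm (Q / (a * x)) / (1 - q)))"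
    show "(\<lambda>n. M * (norm (b * x) / q) ^ n) \<longlonglongrightarrow> 0"
      by (rule tendsto_mult_right_zero, rule LIMSEQ_power_zero) (use bx q0 in auto)
    show "\<forall>\<^sub>F n in sequentially. norm (R n) \<le> M * (norm (b * x) / q) ^ n"
    proof (rule always_eventually, rule allI)
      fix n
      have le: "norm (1 - w * Q ^ n) \<le> 1 + norm w" for w
      proof -
        have "norm (1 - w * Q ^ n) \<le> norm (1::complex) + norm (w * Q ^ n)" by (rule norm_triangle_ineq4)
        also have "norm (w * Q ^ n) \<le> norm w * 1" unfolding norm_mult norm_power norm_Q
          by (rule mult_left_mono) (auto intro: power_le_one)
        finally show ?thesis by simp
      qed
      have "norm (R n) = norm (sig \<gamma> n) * (norm (1 - s * \<gamma> * Q ^ n) * norm (1 - s / \<gamma> * Q ^ n) * norm (inverse s) * norm (b ^ n * shifted_power n x)) / q ^ n"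
        unfolding R_def by (simp add: norm_mult norm_divide norm_power)
      also have "\<dots> \<le> K * ((1 + norm (s * \<gamma>)) * (1 + norm (s / \<gamma>)) * norm (inverse s) * (exp (norm (Q / (a * x)) / (1 - q)) * norm (b * x) ^ n)) / q ^ n"
        by (intro divide_right_mono mult_mono K le poch_bx_bounded x mult_nonneg_nonneg) (use K in auto)
      finally show "norm (R n) \<le> M * (norm (b * x) / q) ^ n" by (simp add: M_def power_divide mult_ac)
    qed
  qed
  moreover have "(\<Sum>k\<le>n. T k) = R n" for n
    unfolding T_def R_def A_def B_def by (rule telescope[OF x g])
  ultimately have "T sums 0" by (simp add: sums_def_le)
  then show ?thesis using T1 sums_unique2 by blast
qed

end

section \<open>Entire continuation of the series by Sears' transformation\<close>

locale bqjd = bqj +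
  assumes tau_lt: "norm tau < 1"
begin

text \<open>Sears' transformation with \<open>A = Q / (a * x)\<close>,
  \<open>B = s / \<gamma>\<close>, \<open>D = c * Q / a\<close>, \<open>C = s * \<gamma>\<close> and
  \<open>t = tau / \<gamma>\<close>. Its condition on the arguments is the relation between
  \<open>s\<close> and the parameters.\<close>

lemma N0_ser:
  assumes g: "1 \<le> norm \<gamma>" and x: "x \<noteq> 0" "norm (b * x) < 1"
  shows "N0 \<gamma> x = pinf (b * x) * ser \<gamma> x"
proof -
  have g0: "\<gamma> \<noteq> 0" using g by auto
  have t: "norm (tau / \<gamma>) < 1" using tau_lt g by (simp add: norm_divide divide_less_eq)
  have zt: "b * x = c * Q / a * (tau / \<gamma>) / (Q / (a * x) * (s / \<gamma>))"
  proof -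
    have "c * Q / a * (tau / \<gamma>) / (Q / (a * x) * (s / \<gamma>)) = x * (c * d * Q) / (a * (s * s))"
      unfolding tau_def using nz g0 x by (simp add: field_simps)
    also have "\<dots> = b * x" unfolding s_sq' using nz by (simp add: field_simps)
    finally show ?thesis ..
  qed
  have "pinf (b * x) * sears_sum (Q / (a * x)) (s / \<gamma>) (c * Q / a) (tau / \<gamma>) (b * x) (s * \<gamma>)
    = pinf (tau / \<gamma>) * sears_sum (c * Q / a / (Q / (a * x))) (c * Q / a / (s / \<gamma>)) (c * Q / a) (b * x) (tau / \<gamma>) (s * \<gamma>)"
    by (rule sears_transform[OF _ _ _ _ t x(2) zt]) (use nz g0 x in auto)
  also have "c * Q / a / (Q / (a * x)) = c * x" using nz by simp
  also have "c * Q / a / (s / \<gamma>) = c * Q * \<gamma> / (a * s)" by simp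
  finally have 1: "N0 \<gamma> x = pinf (b * x) * sears_sum (Q / (a * x)) (s / \<gamma>) (c * Q / a) (tau / \<gamma>) (b * x) (s * \<gamma>) / pinf (d * Q / a)"
    unfolding N0_def by simp
  have "sears_sum (Q / (a * x)) (s / \<gamma>) (c * Q / a) (tau / \<gamma>) (b * x) (s * \<gamma>) = (\<Sum>k. pinf (d * Q / a) * (sig \<gamma> k * (b ^ k * shifted_power k x)))"
    unfolding sears_sum_def
  proof (rule suminf_cong)
    fix k
    have e: "s * \<gamma> * (tau / \<gamma>) = d * Q / a" using g0 by (simp add: tau_def)
    have p: "pinf (d * Q / a * Q ^ k) = pinf (d * Q / a) / poch (d * Q / a) k"
      using pinf_split[of "d * Q / a" k] pinf_ne_0_poch[OF pinf_ca_ne(2), of k] by simp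
    show "poch (Q / (a * x)) k * poch (s / \<gamma>) k / (poch Q k * poch (c * Q / a) k) * (poch (s * \<gamma>) k * pinf (s * \<gamma> * (tau / \<gamma>) * Q ^ k)) * (b * x) ^ k
       = pinf (d * Q / a) * (sig \<gamma> k * (b ^ k * shifted_power k x))"
      unfolding e p shifted_power_eq[OF x(1), symmetric] sig_def by (simp add: mult_ac)
  qed
  also have "\<dots> = pinf (d * Q / a) * ser \<gamma> x"
    by (rule sums_unique[symmetric, OF sums_mult[OF ser_sums[OF x]]])
  finally show ?thesis unfolding 1 by simp
qed

text \<open>At this point the upper parameter \<open>c * x\<close> coincides with the lower
  parameter \<open>c * Q / a\<close>, and the remaining series is a q-Gauss sum. The value is needed
  for the constant in \<open>Dh_eq\<close>.\<close>

lemma N0_Qa: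
  assumes g: "1 \<le> norm \<gamma>"
  shows "N0 \<gamma> (Q / a) = pinf (b * Q / a)"
proof -
  have g0: "\<gamma> \<noteq> 0" using g by auto
  have t: "norm (tau / \<gamma>) < 1" using tau_lt g by (simp add: norm_divide divide_less_eq)
  have e1: "s * \<gamma> * (c * Q * \<gamma> / (a * s)) * (tau / \<gamma>) = s * \<gamma> * (b * (Q / a))"
  proof -
    have "s * \<gamma> * (c * Q * \<gamma> / (a * s)) * (tau / \<gamma>) = \<gamma> * (c * d * Q) * Q / (a * a * s)" unfolding tau_def using nz g0 by (simp add: field_simps)
    also have "\<dots> = \<gamma> * (s * s * (a * b)) * Q / (a * a * s)" unfolding s_sq' using nz by simp
    finally show ?thesis using nz by simp
  qed
  have e2: "c * Q * \<gamma> / (a * s) * (tau / \<gamma>) = b * Q / a"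
  proof -
    have "c * Q * \<gamma> / (a * s) * (tau / \<gamma>) = (c * d * Q) * Q / (a * a * (s * s))" unfolding tau_def using nz g0 by (simp add: field_simps)
    also have "\<dots> = b * Q / a" unfolding s_sq' using nz by (simp add: field_simps)
    finally show ?thesis .
  qed
  have e3: "s * \<gamma> * (tau / \<gamma>) = d * Q / a" using g0 by (simp add: tau_def)
  have "sears_sum (c * (Q / a)) (c * Q * \<gamma> / (a * s)) (c * Q / a) (b * (Q / a)) (tau / \<gamma>) (s * \<gamma>) =
    (\<Sum>k. poch (s * \<gamma>) k * poch (c * Q * \<gamma> / (a * s)) k / poch Q k * pinf (s * \<gamma> * (c * Q * \<gamma> / (a * s)) * (tau / \<gamma>) * Q ^ k) * (tau / \<gamma>) ^ k)"
    unfolding sears_sum_def e1 by (rule suminf_cong) (use pinf_ne_0_poch[OF pinf_ca_ne(1)] in \<open>simp add: mult_ac\<close>)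
  then have "pinf (tau / \<gamma>) * sears_sum (c * (Q / a)) (c * Q * \<gamma> / (a * s)) (c * Q / a) (b * (Q / a)) (tau / \<gamma>) (s * \<gamma>)
     = pinf (d * Q / a) * pinf (b * Q / a)"
    using q_Gauss[OF t, of "s * \<gamma>" "c * Q * \<gamma> / (a * s)"] unfolding e2 e3 by simp
  then show ?thesis unfolding N0_def using pinf_ca_ne(2) by simp
qed

text \<open>Since \<open>b * x = 1\<close>, the factor
  \<open>poch (s * \<gamma>) k * pinf (s * \<gamma> * Q ^ k)\<close> is the constant
  \<open>pinf (s * \<gamma>)\<close>, and a q-Gauss sum is left. Together with \<open>N0_Qa\<close>
  it gives the constant in \<open>Dh_eq\<close>.\<close>

lemma N0_1b:
  assumes g: "1 \<le> norm \<gamma>"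
  shows "N0 \<gamma> (1 / b) = pinf (s * \<gamma>) * pinf (s / \<gamma>) * pinf (b * Q / a) / (pinf (c * Q / a) * pinf (d * Q / a))"
proof -
  have g0: "\<gamma> \<noteq> 0" using g by auto
  have t: "norm (tau / \<gamma>) < 1" using tau_lt g by (simp add: norm_divide divide_less_eq)
  have e2: "c * Q * \<gamma> / (a * s) * (tau / \<gamma>) = b * Q / a"
  proof -
    have "c * Q * \<gamma> / (a * s) * (tau / \<gamma>) = (c * d * Q) * Q / (a * a * (s * s))" unfolding tau_def using nz g0 by (simp add: field_simps)
    also have "\<dots> = b * Q / a" unfolding s_sq' using nz by (simp add: field_simps)
    finally show ?thesis .
  qed
  have e1: "c / b * (c * Q * \<gamma> / (a * s)) * (tau / \<gamma>) = c * Q / a"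
  proof -
    have "c / b * (c * Q * \<gamma> / (a * s)) * (tau / \<gamma>) = c / b * (c * Q * \<gamma> / (a * s) * (tau / \<gamma>))" by (simp only: mult.assoc)
    then show ?thesis unfolding e2 using nz by simp
  qed
  have e3: "c / b * (tau / \<gamma>) = s / \<gamma>"
  proof -
    have "c / b * (tau / \<gamma>) = (c * d * Q) / (a * b) / (s * \<gamma>)" unfolding tau_def using nz g0 by (simp add: field_simps)
    also have "\<dots> = s / \<gamma>" unfolding s_sq'[symmetric] by simp
    finally show ?thesis .
  qed
  have "pinf (tau / \<gamma>) * sears_sum (c * (1 / b)) (c * Q * \<gamma> / (a * s)) (c * Q / a) (b * (1 / b)) (tau / \<gamma>) (s * \<gamma>) =
    pinf (tau / \<gamma>) * (\<Sum>k. pinf (s * \<gamma>) / pinf (c * Q / a) * (poch (c / b) k * poch (c * Q * \<gamma> / (a * s)) k / poch Q k *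
        pinf (c / b * (c * Q * \<gamma> / (a * s)) * (tau / \<gamma>) * Q ^ k) * (tau / \<gamma>) ^ k))"
    unfolding sears_sum_def e1
  proof (rule arg_cong[where f = "\<lambda>z. pinf (tau / \<gamma>) * z"], rule suminf_cong)
    fix k
    have 1: "poch (s * \<gamma>) k * pinf (s * \<gamma> * (b * (1 / b)) * Q ^ k) = pinf (s * \<gamma>)" using pinf_split[of "s * \<gamma>" k] nz by simp
    have 2: "pinf (c * Q / a * Q ^ k) = pinf (c * Q / a) / poch (c * Q / a) k"
      using pinf_split[of "c * Q / a" k] pinf_ne_0_poch[OF pinf_ca_ne(1), of k] by simp
    show "poch (c * (1 / b)) k * poch (c * Q * \<gamma> / (a * s)) k / (poch Q k * poch (c * Q / a) k) * (poch (s * \<gamma>) k * pinf (s * \<gamma> * (b * (1 / b)) * Q ^ k)) * (tau / \<gamma>) ^ k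
      = pinf (s * \<gamma>) / pinf (c * Q / a) * (poch (c / b) k * poch (c * Q * \<gamma> / (a * s)) k / poch Q k * pinf (c * Q / a * Q ^ k) * (tau / \<gamma>) ^ k)"
      unfolding 1 2 by simp
  qed
  also have "\<dots> = pinf (s * \<gamma>) / pinf (c * Q / a) * (pinf (tau / \<gamma>) * (\<Sum>k. poch (c / b) k * poch (c * Q * \<gamma> / (a * s)) k / poch Q k *
        pinf (c / b * (c * Q * \<gamma> / (a * s)) * (tau / \<gamma>) * Q ^ k) * (tau / \<gamma>) ^ k))"
  proof -
    obtain K where K: "K > 0" "\<And>k. norm (poch (c / b) k * poch (c * Q * \<gamma> / (a * s)) k / (poch Q k * poch (c * Q / a) k)) \<le> K"
      using bounded_poch_quotient[OF pinf_ca_ne(1)] by blast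
    have "poch (c / b) k * poch (c * Q * \<gamma> / (a * s)) k / poch Q k * pinf (c / b * (c * Q * \<gamma> / (a * s)) * (tau / \<gamma>) * Q ^ k) * (tau / \<gamma>) ^ k
      = pinf (c * Q / a) * (poch (c / b) k * poch (c * Q * \<gamma> / (a * s)) k / (poch Q k * poch (c * Q / a) k) * (tau / \<gamma>) ^ k)" for k
      unfolding e1 using pinf_split[of "c * Q / a" k] pinf_ne_0_poch[OF pinf_ca_ne(1), of k] by (simp add: field_simps)
    then have sm: "summable (\<lambda>k. poch (c / b) k * poch (c * Q * \<gamma> / (a * s)) k / poch Q k * pinf (c / b * (c * Q * \<gamma> / (a * s)) * (tau / \<gamma>) * Q ^ k) * (tau / \<gamma>) ^ k)"
      using summable_mult[OF summable_bounded_powser(2)[OF K(2) t], of "pinf (c * Q / a)"] by simp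
    show ?thesis unfolding suminf_mult[OF sm] by (rule mult.left_commute)
  qed
  also have "pinf (tau / \<gamma>) * (\<Sum>k. poch (c / b) k * poch (c * Q * \<gamma> / (a * s)) k / poch Q k *
        pinf (c / b * (c * Q * \<gamma> / (a * s)) * (tau / \<gamma>) * Q ^ k) * (tau / \<gamma>) ^ k) = pinf (s / \<gamma>) * pinf (b * Q / a)"
    using q_Gauss[OF t, of "c / b" "c * Q * \<gamma> / (a * s)"] unfolding e2 e3 .
  finally have "pinf (tau / \<gamma>) * sears_sum (c * (1 / b)) (c * Q * \<gamma> / (a * s)) (c * Q / a) (b * (1 / b)) (tau / \<gamma>) (s * \<gamma>)
    = pinf (s * \<gamma>) / pinf (c * Q / a) * (pinf (s / \<gamma>) * pinf (b * Q / a))" .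
  then show ?thesis unfolding N0_def by (simp add: field_simps)
qed

text \<open>One estimate serves for holomorphy in \<open>x\<close> and in \<open>\<gamma>\<close>.\<close>

lemma N0_term_bound:
  assumes r: "norm (c * x) \<le> r" "norm (s * \<gamma> * (b * x)) \<le> r" "norm (s * \<gamma>) \<le> r" "norm (c * Q * \<gamma> / (a * s)) \<le> r"
    and t: "norm (tau / \<gamma>) \<le> \<rho>" and K: "\<And>k. norm (1 / poch Q k) \<le> K1" "\<And>k. norm (1 / poch (c * Q / a) k) \<le> K2"
  shows "norm (poch (c * x) k * poch (c * Q * \<gamma> / (a * s)) k / (poch Q k * poch (c * Q / a) k) * (poch (s * \<gamma>) k * pinf (s * \<gamma> * (b * x) * Q ^ k)) * (tau / \<gamma>) ^ k)
    \<le> exp (r / (1 - q)) * exp (r / (1 - q)) * (K1 * K2) * (exp (r / (1 - q)) * exp (r / (1 - q))) * \<rho> ^ k"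
proof -
  have K0: "0 \<le> K1" "0 \<le> K2" using K(1)[of 0] K(2)[of 0] by (auto intro: order_trans[OF norm_ge_zero])
  have "norm (poch (c * x) k * poch (c * Q * \<gamma> / (a * s)) k / (poch Q k * poch (c * Q / a) k) * (poch (s * \<gamma>) k * pinf (s * \<gamma> * (b * x) * Q ^ k)) * (tau / \<gamma>) ^ k)
    = norm (poch (c * x) k) * norm (poch (c * Q * \<gamma> / (a * s)) k) * (norm (1 / poch Q k) * norm (1 / poch (c * Q / a) k))
      * norm (poch (s * \<gamma>) k * pinf (s * \<gamma> * (b * x) * Q ^ k)) * norm (tau / \<gamma>) ^ k"
    by (simp add: norm_mult norm_divide norm_power)
  also have "\<dots> \<le> exp (r / (1 - q)) * exp (r / (1 - q)) * (K1 * K2) * (exp (r / (1 - q)) * exp (r / (1 - q))) * \<rho> ^ k"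
    by (intro mult_mono norm_poch_pinf_le norm_poch_le' r K power_mono t mult_nonneg_nonneg) (use K0 in auto)
  finally show ?thesis .
qed

lemma N0_holomorphic_x:
  assumes g: "1 \<le> norm \<gamma>"
  shows "N0 \<gamma> holomorphic_on UNIV"
proof -
  have t: "norm (tau / \<gamma>) < 1" using tau_lt g by (simp add: norm_divide divide_less_eq)
  obtain K1 where K1: "K1 > 0" "\<And>n. norm (1 / poch Q n) \<le> K1" using bounded_inverse_poch[OF pinf_Q_ne] by blast
  obtain K2 where K2: "K2 > 0" "\<And>n. norm (1 / poch (c * Q / a) n) \<le> K2" using bounded_inverse_poch[OF pinf_ca_ne(1)] by blast
  have "(\<lambda>x. \<Sum>k. poch (c * x) k * poch (c * Q * \<gamma> / (a * s)) k / (poch Q k * poch (c * Q / a) k) * (poch (s * \<gamma>) k * pinf (s * \<gamma> * (b * x) * Q ^ k)) * (tau / \<gamma>) ^ k) holomorphic_on UNIV"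
  proof (rule holomorphic_geometric_suminf)
    fix x :: complex
    define r where "r = (norm x + 1) * (norm c + norm (s * \<gamma> * b)) + norm (s * \<gamma>) + norm (c * Q * \<gamma> / (a * s))"
    have r: "norm (c * y) \<le> r" "norm (s * \<gamma> * (b * y)) \<le> r" "norm (s * \<gamma>) \<le> r" "norm (c * Q * \<gamma> / (a * s)) \<le> r" if y: "y \<in> ball x 1" for y
    proof -
      have y1: "norm y \<le> norm x + 1" using y norm_triangle_ineq[of x "y - x"] by (simp add: dist_norm norm_minus_commute)
      have 1: "norm (c * y) \<le> (norm x + 1) * norm c" "norm (s * \<gamma> * (b * y)) \<le> (norm x + 1) * norm (s * \<gamma> * b)"
        using mult_right_mono[OF y1, of "norm c"] mult_right_mono[OF y1, of "norm (s * \<gamma> * b)"] by (simp_all add: norm_mult mult_ac)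
      have 2: "0 \<le> (norm x + 1) * norm c" "0 \<le> (norm x + 1) * norm (s * \<gamma> * b)" by simp_all
      have 3: "r = (norm x + 1) * norm c + (norm x + 1) * norm (s * \<gamma> * b) + norm (s * \<gamma>) + norm (c * Q * \<gamma> / (a * s))"
        unfolding r_def by (simp only: distrib_left)
      show "norm (c * y) \<le> r" "norm (s * \<gamma> * (b * y)) \<le> r" "norm (s * \<gamma>) \<le> r" "norm (c * Q * \<gamma> / (a * s)) \<le> r"
        using 1 2 norm_ge_zero[of "s * \<gamma>"] norm_ge_zero[of "c * Q * \<gamma> / (a * s)"] unfolding 3 by linarith+
    qed
    show "\<exists>e K \<rho>. 0 < e \<and> 0 \<le> \<rho> \<and> \<rho> < 1 \<and> (\<forall>k. \<forall>y\<in>ball x e \<inter> UNIV.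
       norm (poch (c * y) k * poch (c * Q * \<gamma> / (a * s)) k / (poch Q k * poch (c * Q / a) k) * (poch (s * \<gamma>) k * pinf (s * \<gamma> * (b * y) * Q ^ k)) * (tau / \<gamma>) ^ k) \<le> K * \<rho> ^ k)"
    proof (rule exI, rule exI, rule exI, intro conjI allI ballI)
      show "(0::real) < 1" by simp
      show "0 \<le> norm (tau / \<gamma>)" by (rule norm_ge_zero)
      show "norm (tau / \<gamma>) < 1" by (rule t)
      fix k y assume "y \<in> ball x 1 \<inter> UNIV"
      then have y: "y \<in> ball x 1" by simp
      show "norm (poch (c * y) k * poch (c * Q * \<gamma> / (a * s)) k / (poch Q k * poch (c * Q / a) k) * (poch (s * \<gamma>) k * pinf (s * \<gamma> * (b * y) * Q ^ k)) * (tau / \<gamma>) ^ k)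
        \<le> exp (r / (1 - q)) * exp (r / (1 - q)) * (K1 * K2) * (exp (r / (1 - q)) * exp (r / (1 - q))) * norm (tau / \<gamma>) ^ k"
        by (rule N0_term_bound[OF r[OF y] order_refl K1(2) K2(2)])
    qed
  qed (unfold qpoch_def, auto intro!: holomorphic_intros)
  then show ?thesis unfolding N0_def[abs_def] sears_sum_def by (intro holomorphic_intros)
qed

lemma N0_holomorphic_gamma: "(\<lambda>\<gamma>. N0 \<gamma> x) holomorphic_on {\<gamma>. norm tau < norm \<gamma>}"
proof -
  obtain K1 where K1: "K1 > 0" "\<And>n. norm (1 / poch Q n) \<le> K1" using bounded_inverse_poch[OF pinf_Q_ne] by blast
  obtain K2 where K2: "K2 > 0" "\<And>n. norm (1 / poch (c * Q / a) n) \<le> K2" using bounded_inverse_poch[OF pinf_ca_ne(1)] by blast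
  have nz0: "\<gamma> \<noteq> 0" if "\<gamma> \<in> {\<gamma>. norm tau < norm \<gamma>}" for \<gamma> using that by auto
  have op: "open {\<gamma>. norm tau < norm \<gamma>}" by (intro open_Collect_less continuous_intros)
  have "(\<lambda>\<gamma>. \<Sum>k. poch (c * x) k * poch (c * Q * \<gamma> / (a * s)) k / (poch Q k * poch (c * Q / a) k) * (poch (s * \<gamma>) k * pinf (s * \<gamma> * (b * x) * Q ^ k)) * (tau / \<gamma>) ^ k)
      holomorphic_on {\<gamma>. norm tau < norm \<gamma>}"
  proof (rule holomorphic_geometric_suminf[OF op])
    show "(\<lambda>\<gamma>. poch (c * x) n * poch (c * Q * \<gamma> / (a * s)) n / (poch Q n * poch (c * Q / a) n) * (poch (s * \<gamma>) n * pinf (s * \<gamma> * (b * x) * Q ^ n)) * (tau / \<gamma>) ^ n)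
      holomorphic_on {\<gamma>. norm tau < norm \<gamma>}" for n
      by (intro holomorphic_intros holomorphic_poch) (use nz0 pinf_ne_0_poch[OF pinf_ca_ne(1)] in auto)
    fix g :: complex assume g: "g \<in> {\<gamma>. norm tau < norm \<gamma>}"
    \<comment> \<open>Half the distance from \<open>g\<close> to the boundary circle: on the ball of
      this radius \<open>norm (tau / y)\<close> stays below a fixed
      \<open>\<rho> < 1\<close>.\<close>
    define e where "e = (norm g - norm tau) / 2"
    define R where "R = norm g + e"
    define r where "r = norm (c * x) + R * norm (s * (b * x)) + R * norm s + R * norm (c * Q / (a * s))"
    define \<rho> where "\<rho> = norm tau / (norm tau + e)"
    have e: "0 < e" using g by (simp add: e_def)
    have R0: "0 \<le> R" using e by (simp add: R_def)
    have r: "norm (c * x) \<le> r" "norm (s * y * (b * x)) \<le> r" "norm (s * y) \<le> r" "norm (c * Q * y / (a * s)) \<le> r" "norm (tau / y) \<le> \<rho>" if y: "y \<in> ball g e" for y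
    proof -
      have y1: "norm y \<le> R" using y norm_triangle_ineq[of g "y - g"] by (simp add: R_def dist_norm norm_minus_commute)
      have "norm (g - y) < e" using y by (simp add: dist_norm)
      moreover have "norm g \<le> norm y + norm (g - y)" using norm_triangle_ineq[of y "g - y"] by simp
      moreover have "norm tau + e = norm g - e" by (simp add: e_def field_simps)
      ultimately have y2: "norm tau + e \<le> norm y" by linarith
      have 1: "norm (s * y * (b * x)) \<le> R * norm (s * (b * x))" "norm (s * y) \<le> R * norm s" "norm (c * Q * y / (a * s)) \<le> R * norm (c * Q / (a * s))"
        using mult_right_mono[OF y1, of "norm (s * (b * x))"] mult_right_mono[OF y1, of "norm s"] mult_right_mono[OF y1, of "norm (c * Q / (a * s))"]
        by (simp_all add: norm_mult norm_divide mult_ac)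
      have 2: "0 \<le> R * norm (s * (b * x))" "0 \<le> R * norm s" "0 \<le> R * norm (c * Q / (a * s))" using R0 by simp_all
      show "norm (c * x) \<le> r" "norm (s * y * (b * x)) \<le> r" "norm (s * y) \<le> r" "norm (c * Q * y / (a * s)) \<le> r"
        using 1 2 norm_ge_zero[of "c * x"] unfolding r_def by linarith+
      show "norm (tau / y) \<le> \<rho>" unfolding \<rho>_def norm_divide
        by (rule frac_le[OF norm_ge_zero order_refl add_nonneg_pos[OF norm_ge_zero e] y2])
    qed
    have "0 < norm tau + e" by (rule add_nonneg_pos[OF norm_ge_zero e])
    then have \<rho>: "0 \<le> \<rho>" "\<rho> < 1" using e by (simp_all add: \<rho>_def divide_less_eq)
    show "\<exists>e K \<rho>. 0 < e \<and> 0 \<le> \<rho> \<and> \<rho> < 1 \<and> (\<forall>k. \<forall>y\<in>ball g e \<inter> {\<gamma>. norm tau < norm \<gamma>}.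
       norm (poch (c * x) k * poch (c * Q * y / (a * s)) k / (poch Q k * poch (c * Q / a) k) * (poch (s * y) k * pinf (s * y * (b * x) * Q ^ k)) * (tau / y) ^ k) \<le> K * \<rho> ^ k)"
    proof (rule exI, rule exI, rule exI, intro conjI allI ballI)
      show "0 < e" by (rule e)
      show "0 \<le> \<rho>" "\<rho> < 1" by (rule \<rho>)+
      fix k y assume "y \<in> ball g e \<inter> {\<gamma>. norm tau < norm \<gamma>}"
      then have y: "y \<in> ball g e" by simp
      show "norm (poch (c * x) k * poch (c * Q * y / (a * s)) k / (poch Q k * poch (c * Q / a) k) * (poch (s * y) k * pinf (s * y * (b * x) * Q ^ k)) * (tau / y) ^ k)
        \<le> exp (r / (1 - q)) * exp (r / (1 - q)) * (K1 * K2) * (exp (r / (1 - q)) * exp (r / (1 - q))) * \<rho> ^ k"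
        by (rule N0_term_bound[OF r[OF y] K1(2) K2(2)])
    qed
  qed
  then show ?thesis unfolding N0_def[abs_def] sears_sum_def
    by (intro holomorphic_intros) (use nz0 in auto)
qed

end

context qbase
begin

text \<open>The first \<open>n\<close> factors of the product on the left are inverted,
  \<open>1 - w / Q ^ j\<close> being \<open>- w / Q ^ j\<close> times \<open>1 - Q ^ j / w\<close>.
  The product of the powers of \<open>Q\<close> stays on the left because it does not depend on
  \<open>w\<close> and cancels in \<open>pinf_ratio_limit\<close>.\<close>

lemma pinf_div_Q_pow:
  assumes "w \<noteq> 0"
  shows "pinf (w / Q ^ n) * (\<Prod>j<n. Q ^ Suc j) = (- w) ^ n * (pinf w * poch (Q / w) n)"
proof (induction n)
  case (Suc n)
  have 1: "pinf (w / Q ^ Suc n) = (1 - w / Q ^ Suc n) * pinf (w / Q ^ n)"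
    using pinf_rec[of "w / Q ^ Suc n"] by simp
  have 2: "(1 - w / Q ^ Suc n) * Q ^ Suc n = (- w) * (1 - Q / w * Q ^ n)"
    using assms by (simp add: field_simps)
  have "pinf (w / Q ^ Suc n) * (\<Prod>j<Suc n. Q ^ Suc j) =
    ((1 - w / Q ^ Suc n) * Q ^ Suc n) * (pinf (w / Q ^ n) * (\<Prod>j<n. Q ^ Suc j))"
    unfolding 1 prod.lessThan_Suc by (simp only: mult_ac)
  also have "\<dots> = (- w) ^ Suc n * (pinf w * poch (Q / w) (Suc n))"
    unfolding 2 Suc by (simp only: poch_Suc power_Suc mult_ac)
  finally show ?case .
qed simp

lemma pinf_ratio_limit:
  assumes "w \<noteq> 0" "v \<noteq> 0" "th v \<noteq> 0"
  shows "(\<lambda>n. pinf (w / Q ^ n) / pinf (v / Q ^ n) * (v / w) ^ n) \<longlonglongrightarrow> th w / th v"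
proof -
  have P: "(\<Prod>j<n. Q ^ Suc j) \<noteq> 0" for n by simp
  have e: "pinf (w / Q ^ n) / pinf (v / Q ^ n) * (v / w) ^ n = (pinf w * poch (Q / w) n) / (pinf v * poch (Q / v) n)" for n
  proof -
    have f: "pinf (u / Q ^ n) = (- u) ^ n * (pinf u * poch (Q / u) n) / (\<Prod>j<n. Q ^ Suc j)" if "u \<noteq> 0" for u
      using pinf_div_Q_pow[OF that, of n] P[of n] by (metis nonzero_mult_div_cancel_right)
    have g: "(- w) ^ n / (- v) ^ n * (v / w) ^ n = 1"
      using assms by (simp add: power_divide[symmetric] power_mult_distrib[symmetric])
    have "pinf (w / Q ^ n) / pinf (v / Q ^ n) * (v / w) ^ n =
      ((- w) ^ n / (- v) ^ n * (v / w) ^ n) * ((pinf w * poch (Q / w) n) / (pinf v * poch (Q / v) n))"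
      unfolding f[OF assms(1)] f[OF assms(2)] using P[of n] by simp
    then show ?thesis unfolding g by simp
  qed
  have "(\<lambda>n. (pinf w * poch (Q / w) n) / (pinf v * poch (Q / v) n)) \<longlonglongrightarrow> (pinf w * pinf (Q / w)) / (pinf v * pinf (Q / v))"
    by (intro tendsto_intros poch_tendsto) (use assms(3) in \<open>simp add: theta1_def\<close>)
  then show ?thesis unfolding e theta1_def .
qed

lemma half_in_ball: "0 < r \<Longrightarrow> of_real (r / 2) \<in> ball 0 r - {0::complex}"
  by (simp add: dist_norm)

lemma th_ne_0_qZ: "x \<noteq> 0 \<Longrightarrow> x \<notin> qZ q \<Longrightarrow> th x \<noteq> 0"
  unfolding th_eq_0_iff qZ_def by (auto simp: image_iff)

lemma Rq_cases:
  assumes "x \<in> Rq q zm zp"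
  obtains z k where "z \<in> {zm, zp}" "x = z * q powi k"
  using assms unfolding Rq_def by auto

lemma RqI: "z \<in> {zm, zp} \<Longrightarrow> z * q powi k \<in> Rq q zm zp"
  unfolding Rq_def by auto

lemma Rq_mult: "x \<in> Rq q zm zp \<Longrightarrow> x * q powi j \<in> Rq q zm zp"
  by (elim Rq_cases) (auto simp: mult.assoc power_int_add[symmetric] intro!: RqI)

lemma Rq_mult': "x \<in> Rq q zm zp \<Longrightarrow> x * q ^ n \<in> Rq q zm zp" "x \<in> Rq q zm zp \<Longrightarrow> q * x \<in> Rq q zm zp" "x \<in> Rq q zm zp \<Longrightarrow> x / q \<in> Rq q zm zp"
  "x \<in> Rq q zm zp \<Longrightarrow> x / q ^ n \<in> Rq q zm zp"
  using Rq_mult[of x zm zp "int n"] Rq_mult[of x zm zp 1] Rq_mult[of x zm zp "- 1"] Rq_mult[of x zm zp "- int n"]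
  by (simp_all add: power_int_minus divide_inverse mult.commute)

end

section \<open>The solutions on the whole lattice: symmetry, difference equation, Casoratian\<close>

context bqj
begin

lemma Rq_ne_0: "x \<in> Rq q zm zp \<Longrightarrow> x \<noteq> 0"
  using zm zp by (auto simp: Rq_def)

lemma Rq_factor_ne: assumes "x \<in> Rq q zm zp"
  shows "a * of_real x \<noteq> 1" "b * of_real x \<noteq> 1" "c * of_real x \<noteq> 1" "d * of_real x \<noteq> 1"
proof -
  have "(1 - a * of_real x) * (1 - b * of_real x) \<noteq> 0" "(1 - c * of_real x) * (1 - d * of_real x) \<noteq> 0"
    using pos(1)[OF assms] pos(2)[OF assms] by (metis less_irrefl zero_complex.simps(1))+
  then show "a * of_real x \<noteq> 1" "b * of_real x \<noteq> 1" "c * of_real x \<noteq> 1" "d * of_real x \<noteq> 1" by auto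
qed

lemma pinf_Rq_ne: assumes "x \<in> Rq q zm zp"
  shows "pinf (a * of_real x) \<noteq> 0" "pinf (b * of_real x) \<noteq> 0" "pinf (c * of_real x) \<noteq> 0" "pinf (d * of_real x) \<noteq> 0"
  using Rq_factor_ne[OF Rq_mult'(1)[OF assms]] unfolding pinf_eq_0_iff by (auto simp: mult.assoc)

lemma th_Rq_ne: assumes "x \<in> Rq q zm zp"
  shows "th (a * of_real x) \<noteq> 0" "th (b * of_real x) \<noteq> 0" "th (c * of_real x) \<noteq> 0" "th (d * of_real x) \<noteq> 0"
proof -
  have "th (w * of_real x) \<noteq> 0" if w: "w \<noteq> 0" "\<And>y. y \<in> Rq q zm zp \<Longrightarrow> w * of_real y \<noteq> 1" for w
  proof -
    have x: "x \<noteq> 0" by (rule Rq_ne_0[OF assms])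
    have "w * of_real x \<noteq> Q powi k" for k
    proof
      assume "w * of_real x = Q powi k"
      then have "w * of_real (x * q powi (- k)) = 1" by (simp add: power_int_minus mult.assoc[symmetric])
      then show False using w(2)[OF Rq_mult[OF assms, of "- k"]] by simp
    qed
    then show ?thesis using th_eq_0_iff[of "w * of_real x"] w x by auto
  qed
  from this[OF nz(1)] this[OF nz(2)] this[OF nz(3)] this[OF nz(4)]
  show "th (a * of_real x) \<noteq> 0" "th (b * of_real x) \<noteq> 0" "th (c * of_real x) \<noteq> 0" "th (d * of_real x) \<noteq> 0"
    using Rq_factor_ne by blast+
qed

text \<open>The product of \<open>tau\<close> and its version with \<open>c\<close> and
  \<open>d\<close> interchanged is \<open>b * Q / a\<close>, of modulus less than 1, so at least one
  of the two lies in the unit disc.\<close>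

lemma tau_cases: "norm tau < 1 \<or> norm (bqj.tau q a c s) < 1"
proof -
  interpret sw: bqj q zm zp a b d c s by (rule swap_cd)
  have "tau * sw.tau = (c * d * Q) * Q / (a * a * (s * s))" unfolding tau_def sw.tau_def by (simp add: mult_ac)
  also have "\<dots> = b * Q / a" unfolding s_sq' using nz by (simp add: field_simps)
  finally have "norm tau * norm sw.tau = norm (b / a) * q" by (simp flip: norm_mult) (simp add: norm_mult norm_divide)
  also have "\<dots> < 1" using bqj.ab(4)[OF swap_ab] q0 by (simp add: field_simps)
  finally have lt: "norm tau * norm sw.tau < 1" .
  show ?thesis
  proof (rule ccontr)
    assume "\<not> ?thesis"
    then have "1 * 1 \<le> norm tau * norm sw.tau" by (intro mult_mono) auto
    then show False using lt by simp
  qed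
qed

text \<open>Uses the order of \<open>c\<close> and \<open>d\<close> for which the transformed series
  converges. Since \<open>ser\<close> is symmetric in \<open>c\<close> and \<open>d\<close>
  (\<open>ser_swap\<close>), either branch continues
  \<open>pinf (b * x) * ser \<gamma> x\<close>.\<close>

definition NN :: "complex \<Rightarrow> complex \<Rightarrow> complex" where
  "NN \<gamma> x = (if norm tau < 1 then N0 \<gamma> x else bqj.N0 q a b d c s \<gamma> x)"

lemma ser_swap: "bqj.ser q a b d c s \<gamma> x = ser \<gamma> x"
proof -
  interpret sw: bqj q zm zp a b d c s by (rule swap_cd)
  show ?thesis unfolding sw.ser_def ser_def phi32_def by (rule suminf_cong) (simp add: qpochs_def mult_ac)
qed

lemma bqjdI: "norm tau < 1 \<Longrightarrow> bqjd q zm zp a b c d s"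
  by unfold_locales

lemma NN_ser:
  assumes "1 \<le> norm \<gamma>" "x \<noteq> 0" "norm (b * x) < 1"
  shows "NN \<gamma> x = pinf (b * x) * ser \<gamma> x"
proof (cases "norm tau < 1")
  case True
  then have "NN = N0" by (intro ext) (simp add: NN_def)
  then show ?thesis using bqjd.N0_ser[OF bqjdI[OF True] assms] by simp
next
  case False
  then have t: "norm (bqj.tau q a c s) < 1" using tau_cases by blast
  have "NN = bqj.N0 q a b d c s" using False by (intro ext) (simp add: NN_def)
  then show ?thesis using bqjd.N0_ser[OF bqj.bqjdI[OF swap_cd t] assms] by (simp add: ser_swap)
qed

lemma NN_Qa:
  assumes "1 \<le> norm \<gamma>"
  shows "NN \<gamma> (Q / a) = pinf (b * Q / a)"
proof (cases "norm tau < 1")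
  case True
  then have "NN = N0" by (intro ext) (simp add: NN_def)
  then show ?thesis using bqjd.N0_Qa[OF bqjdI[OF True] assms] by simp
next
  case False
  then have t: "norm (bqj.tau q a c s) < 1" using tau_cases by blast
  have "NN = bqj.N0 q a b d c s" using False by (intro ext) (simp add: NN_def)
  then show ?thesis using bqjd.N0_Qa[OF bqj.bqjdI[OF swap_cd t] assms] by simp
qed

lemma NN_1b:
  assumes "1 \<le> norm \<gamma>"
  shows "NN \<gamma> (1 / b) = pinf (s * \<gamma>) * pinf (s / \<gamma>) * pinf (b * Q / a) / (pinf (c * Q / a) * pinf (d * Q / a))"
proof (cases "norm tau < 1")
  case True
  then have "NN = N0" by (intro ext) (simp add: NN_def)
  then show ?thesis using bqjd.N0_1b[OF bqjdI[OF True] assms] by simp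
next
  case False
  then have t: "norm (bqj.tau q a c s) < 1" using tau_cases by blast
  have "NN = bqj.N0 q a b d c s" using False by (intro ext) (simp add: NN_def)
  then show ?thesis using bqjd.N0_1b[OF bqj.bqjdI[OF swap_cd t] assms] by (simp add: mult.commute)
qed

lemma NN_holomorphic_x: "1 \<le> norm \<gamma> \<Longrightarrow> NN \<gamma> holomorphic_on UNIV"
proof (cases "norm tau < 1")
  case True
  then have "NN = N0" by (intro ext) (simp add: NN_def)
  then show "1 \<le> norm \<gamma> \<Longrightarrow> ?thesis" using bqjd.N0_holomorphic_x[OF bqjdI[OF True]] by simp
next
  case False
  then have t: "norm (bqj.tau q a c s) < 1" using tau_cases by blast
  have "NN = bqj.N0 q a b d c s" using False by (intro ext) (simp add: NN_def)
  then show "1 \<le> norm \<gamma> \<Longrightarrow> ?thesis" using bqjd.N0_holomorphic_x[OF bqj.bqjdI[OF swap_cd t]] by simp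
qed

lemma NN_holomorphic:
  assumes "1 \<le> norm \<gamma>" "f holomorphic_on S"
  shows "(\<lambda>x. NN \<gamma> (f x)) holomorphic_on S"
  using holomorphic_on_compose[OF assms(2) holomorphic_on_subset[OF NN_holomorphic_x[OF assms(1)] subset_UNIV]]
  by (simp add: o_def)

lemma NN_continuous_gamma: "continuous_on {\<gamma>. 1 \<le> norm \<gamma>} (\<lambda>\<gamma>. NN \<gamma> x)"
proof (cases "norm tau < 1")
  case True
  have "continuous_on {\<gamma>. norm tau < norm \<gamma>} (\<lambda>\<gamma>. N0 \<gamma> x)"
    by (rule holomorphic_on_imp_continuous_on[OF bqjd.N0_holomorphic_gamma[OF bqjdI[OF True]]])
  then show ?thesis unfolding NN_def using True by simp (rule continuous_on_subset, assumption, auto)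
next
  case False
  then have t: "norm (bqj.tau q a c s) < 1" using tau_cases by blast
  have "continuous_on {\<gamma>. norm (bqj.tau q a c s) < norm \<gamma>} (\<lambda>\<gamma>. bqj.N0 q a b d c s \<gamma> x)"
    by (rule holomorphic_on_imp_continuous_on[OF bqjd.N0_holomorphic_gamma[OF bqj.bqjdI[OF swap_cd t]]])
  then show ?thesis unfolding NN_def using False t by simp (rule continuous_on_subset, assumption, auto)
qed

text \<open>The original series is symmetric in \<open>s * \<gamma>\<close> and
  \<open>s / \<gamma>\<close>, the transformed one is not. The symmetry is therefore read off for
  small \<open>x\<close> and extended by the identity theorem; on the unit circle both
  \<open>\<gamma>\<close> and its inverse are admissible.\<close>

lemma NN_inverse_gamma:
  assumes "norm \<gamma> = 1"
  shows "NN (inverse \<gamma>) x = NN \<gamma> x"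
proof (rule holomorphic_eq_UNIV[where S = "ball 0 (1 / norm b) - {0}" and z = x and f = "NN (inverse \<gamma>)" and g = "NN \<gamma>"])
  show "NN (inverse \<gamma>) holomorphic_on UNIV" "NN \<gamma> holomorphic_on UNIV" using assms by (auto intro!: NN_holomorphic_x simp: norm_inverse)
  show "open (ball 0 (1 / norm b) - {0::complex})" by auto
  have "of_real (1 / norm b / 2) \<in> ball 0 (1 / norm b) - {0::complex}" by (rule half_in_ball) (use nz in simp)
  then show "ball 0 (1 / norm b) - {0::complex} \<noteq> {}" by blast
  fix y :: complex assume y: "y \<in> ball 0 (1 / norm b) - {0}"
  then have y': "y \<noteq> 0" "norm (b * y) < 1" using nz by (auto simp: norm_mult field_simps)
  have "ser (inverse \<gamma>) y = ser \<gamma> y"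
    unfolding ser_def phi32_def by (rule suminf_cong) (simp add: qpochs_def divide_inverse mult_ac)
  then show "NN (inverse \<gamma>) y = NN \<gamma> y" using NN_ser[OF _ y'] assms by (simp add: norm_inverse)
qed

text \<open>The eigenvalue equation of \<open>\<phi>\<^sub>\<gamma>\<close>, multiplied by
  \<open>x * x\<close> and by \<open>pinf (b * x)\<close>. All its coefficients are then polynomials
  in \<open>x\<close>, so the equation passes from small \<open>x\<close> to the whole
  plane.\<close>

lemma NN_qdiff:
  assumes g: "1 \<le> norm \<gamma>"
  shows "- (Q / (s * b)) * (x - Q / a) * NN \<gamma> (x / Q) + s * (x - 1 / c) * (x - 1 / d) * (1 - b * x) * NN \<gamma> (Q * x)
    + (x * x * (s + inverse s - (\<gamma> + inverse \<gamma>)) - inverse s * (x - Q / a) * (x - Q / b) - s * (x - 1 / c) * (x - 1 / d)) * NN \<gamma> x = 0"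
    (is "?F x = 0")
proof (rule holomorphic_eq_UNIV[where S = "ball 0 (q / norm b) - {0}" and z = x and f = ?F and g = "\<lambda>_. 0"])
  show "?F holomorphic_on UNIV" by (intro holomorphic_intros NN_holomorphic[OF g]) auto
  show "open (ball 0 (q / norm b) - {0::complex})" by auto
  have "of_real (q / norm b / 2) \<in> ball 0 (q / norm b) - {0::complex}" by (rule half_in_ball) (use nz q0 in simp)
  then show "ball 0 (q / norm b) - {0::complex} \<noteq> {}" by blast
  fix x :: complex assume "x \<in> ball 0 (q / norm b) - {0}"
  then have x: "x \<noteq> 0" "norm (b * x) < q" using nz by (auto simp: norm_mult field_simps)
  have g0: "\<gamma> \<noteq> 0" using g by auto
  have n: "norm (b * (x / Q)) < 1" "norm (b * x) < 1" "norm (b * (Q * x)) < 1"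
  proof -
    have "norm (b * (x / Q)) = norm (b * x) / q" by (simp add: norm_mult norm_divide)
    then show "norm (b * (x / Q)) < 1" using x q0 by simp
    show "norm (b * x) < 1" using x q1 by simp
    have "norm (b * (Q * x)) = norm (b * x) * q" by (simp add: norm_mult)
    also have "\<dots> \<le> norm (b * x) * 1" by (rule mult_left_mono) auto
    finally show "norm (b * (Q * x)) < 1" using x q1 by simp
  qed
  define p where "p = pinf (b * (Q * x))"
  define f0 f1 f2 where "f0 = ser \<gamma> (x / Q)" and "f1 = ser \<gamma> x" and "f2 = ser \<gamma> (Q * x)"
  have e: "NN \<gamma> (x / Q) = (1 - b * (x / Q)) * ((1 - b * x) * p) * f0" "NN \<gamma> x = (1 - b * x) * p * f1" "NN \<gamma> (Q * x) = p * f2"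
    using NN_ser[OF g _ n(1)] NN_ser[OF g x(1) n(2)] NN_ser[OF g _ n(3)] x pinf_rec[of "b * (x / Q)"] pinf_rec[of "b * x"]
    by (simp_all add: p_def f0_def f1_def f2_def mult_ac)
  define X Y Z where "X = x - Q / a" and "Y = x - Q / b" and "Z = s * (x - 1 / c) * (x - 1 / d)"
  have Y: "- (Q / (s * b)) * (1 - b * (x / Q)) = inverse s * Y" using nz by (simp add: Y_def field_simps)
  have c: "inverse s * (1 - Q / (a * x)) * (1 - Q / (b * x)) = inverse s * X * Y / (x * x)"
    "s * (1 - 1 / (c * x)) * (1 - 1 / (d * x)) = Z / (x * x)"
  proof -
    have "1 - Q / (a * x) = X / x" "1 - Q / (b * x) = Y / x" "1 - 1 / (c * x) = (x - 1 / c) / x" "1 - 1 / (d * x) = (x - 1 / d) / x"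
      using x nz by (simp_all add: X_def Y_def field_simps)
    then show "inverse s * (1 - Q / (a * x)) * (1 - Q / (b * x)) = inverse s * X * Y / (x * x)"
      "s * (1 - 1 / (c * x)) * (1 - 1 / (d * x)) = Z / (x * x)" by (simp_all add: Z_def)
  qed
  have "inverse s * X * Y / (x * x) * (f0 - f1) + Z / (x * x) * (f2 - f1) + (inverse s + s - (\<gamma> + inverse \<gamma>)) * f1 = 0"
    using ser_qdiff[OF x(1) x(2) g0] unfolding c f0_def f1_def f2_def .
  then have "(x * x) * (inverse s * X * Y / (x * x) * (f0 - f1) + Z / (x * x) * (f2 - f1) + (inverse s + s - (\<gamma> + inverse \<gamma>)) * f1) = 0" by simp
  then have "inverse s * X * Y * (f0 - f1) + Z * (f2 - f1) + x * x * (inverse s + s - (\<gamma> + inverse \<gamma>)) * f1 = 0"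
    using x(1) by (simp add: distrib_left mult.assoc)
  moreover define w where "w = (1 - b * x) * p"
  ultimately have 0: "w * (inverse s * X * Y * (f0 - f1) + Z * (f2 - f1) + x * x * (inverse s + s - (\<gamma> + inverse \<gamma>)) * f1) = 0" by simp
  have 1: "- (Q / (s * b)) * X * ((1 - b * (x / Q)) * w * f0) = (inverse s * Y) * X * (w * f0)"
    unfolding Y[symmetric] by (simp only: mult_ac)
  have 2: "Z * (1 - b * x) * (p * f2) = Z * (w * f2)" by (simp add: w_def)
  have F: "?F x = - (Q / (s * b)) * X * ((1 - b * (x / Q)) * w * f0) + Z * (1 - b * x) * (p * f2)
    + (x * x * (s + inverse s - (\<gamma> + inverse \<gamma>)) - inverse s * X * Y - Z) * (w * f1)"
    unfolding e X_def Y_def Z_def w_def by (simp only: mult.assoc)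
  show "?F x = 0" unfolding F 1 2 using 0 by (simp add: algebra_simps)
qed auto

definition Dh :: "complex \<Rightarrow> complex \<Rightarrow> complex" where
  "Dh \<gamma> y = (1 - b * y) * NN \<gamma> (Q * y) * bqj.NN q b a c d s \<gamma> y - (1 - a * y) * NN \<gamma> y * bqj.NN q b a c d s \<gamma> (Q * y)"

definition kap :: "complex \<Rightarrow> complex" where
  "kap \<gamma> = a * th (b / a) * pinf (s * \<gamma>) * pinf (s / \<gamma>) / (pinf (c * Q / a) * pinf (d * Q / a) * pinf (c * Q / b) * pinf (d * Q / b))"

text \<open>The q-analogue of Abel's identity: the equations for \<open>NN\<close> and its dagger
  share the coefficient \<open>G\<close>, and cross multiplication eliminates it.\<close>

lemma Dh_rec:
  assumes g: "1 \<le> norm \<gamma>"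
  shows "Dh \<gamma> y * Q = Dh \<gamma> (Q * y) * ((1 - c * Q * y) * (1 - d * Q * y))"
proof -
  interpret sw: bqj q zm zp b a c d s by (rule swap_ab)
  define x where "x = Q * y"
  define n0 n1 n2 m0 m1 m2 where "n0 = NN \<gamma> y" and "n1 = NN \<gamma> x" and "n2 = NN \<gamma> (Q * x)" and "m0 = sw.NN \<gamma> y" and "m1 = sw.NN \<gamma> x" and "m2 = sw.NN \<gamma> (Q * x)"
  have y: "x / Q = y" by (simp add: x_def)
  define Z where "Z = s * (x - 1 / c) * (x - 1 / d)"
  define G where "G = x * x * (s + inverse s - (\<gamma> + inverse \<gamma>)) - inverse s * (x - Q / a) * (x - Q / b) - Z"
  have 1: "- (Q / (s * b)) * (x - Q / a) * n0 + Z * (1 - b * x) * n2 + G * n1 = 0"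
    using NN_qdiff[OF g, of x] unfolding y n0_def n1_def n2_def Z_def G_def .
  have 2: "- (Q / (s * a)) * (x - Q / b) * m0 + Z * (1 - a * x) * m2 + G * m1 = 0"
    using sw.NN_qdiff[OF g, of x] unfolding y m0_def m1_def m2_def Z_def G_def by (simp add: mult_ac)
  have c1: "- (Q / (s * b)) * (x - Q / a) = Q * Q / (s * a * b) * (1 - a * y)" "- (Q / (s * a)) * (x - Q / b) = Q * Q / (s * a * b) * (1 - b * y)"
    unfolding x_def using nz by (simp_all add: field_simps)
  have "(Q * Q / (s * a * b) * (1 - a * y) * n0 + Z * (1 - b * x) * n2 + G * n1) * m1 - (Q * Q / (s * a * b) * (1 - b * y) * m0 + Z * (1 - a * x) * m2 + G * m1) * n1 = 0"
    using 1 2 unfolding c1 by simp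
  moreover have "K * ((1 - b * y) * n1 * m0 - (1 - a * y) * n0 * m1) = Z * ((1 - b * x) * n2 * m1 - (1 - a * x) * n1 * m2)"
    if "(K * (1 - a * y) * n0 + Z * (1 - b * x) * n2 + G * n1) * m1 - (K * (1 - b * y) * m0 + Z * (1 - a * x) * m2 + G * m1) * n1 = 0" for K
    using that by (simp add: algebra_simps)
  ultimately have "Q * Q / (s * a * b) * ((1 - b * y) * n1 * m0 - (1 - a * y) * n0 * m1) = Z * ((1 - b * x) * n2 * m1 - (1 - a * x) * n1 * m2)"
    by blast
  then have e: "Q * Q / (s * a * b) * Dh \<gamma> y = Z * Dh \<gamma> x"
    unfolding Dh_def n0_def n1_def n2_def m0_def m1_def m2_def x_def by (simp add: mult_ac)
  have Z: "Z = s / (c * d) * ((1 - c * x) * (1 - d * x))" unfolding Z_def using nz by (simp add: field_simps)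
  have k: "Q * Q / (s * a * b) = s / (c * d) * Q"
  proof -
    have "s * (s / (c * d) * Q) = s * s * Q / (c * d)" by simp
    also have "\<dots> = s * (Q * Q / (s * a * b))" unfolding s_sq' using nz by (simp add: field_simps)
    finally show ?thesis by (metis mult_left_cancel s_ne)
  qed
  have "s / (c * d) * (Dh \<gamma> y * Q) = s / (c * d) * (Dh \<gamma> x * ((1 - c * x) * (1 - d * x)))"
    using e unfolding Z k by (simp only: mult_ac)
  then have "Dh \<gamma> y * Q = Dh \<gamma> x * ((1 - c * x) * (1 - d * x))" using nz by simp
  then show ?thesis unfolding x_def by (simp add: mult_ac)
qed

text \<open>The Casorati determinant of \<open>\<phi>\<^sub>\<gamma>\<close> and its dagger, up to explicit factors.  It is determined up
  to the constant \<open>kap\<close> by its \<open>q\<close>-difference equation, and \<open>kap\<close> is found at \<open>y = 1/a\<close>, where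
  one of the two products vanishes and the remaining values are known in closed form.\<close>

lemma Dh_eq:
  assumes g: "1 \<le> norm \<gamma>"
  shows "Dh \<gamma> y = kap \<gamma> * y * (pinf (c * Q * y) * pinf (d * Q * y))"
proof -
  interpret sw: bqj q zm zp b a c d s by (rule swap_ab)
  have "Dh \<gamma> holomorphic_on UNIV" unfolding Dh_def[abs_def]
    by (intro holomorphic_intros NN_holomorphic[OF g] sw.NN_holomorphic[OF g])
  then have "Dh \<gamma> field_differentiable at 0" by (auto simp: holomorphic_on_def)
  then obtain D' where D': "(Dh \<gamma> has_field_derivative D') (at 0)" by (auto simp: field_differentiable_def)
  have D0: "Dh \<gamma> 0 = 0" by (simp add: Dh_def)
  \<comment> \<open>The equation is iterated towards 0, where \<open>Dh \<gamma>\<close> vanishes.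
    In the limit the quotient \<open>Dh \<gamma> w / w\<close> gives the derivative
    \<open>D'\<close>, the only free constant.\<close>
  have it: "Dh \<gamma> y * Q ^ n = Dh \<gamma> (Q ^ n * y) * (poch (c * Q * y) n * poch (d * Q * y) n)" for y n
  proof (induction n)
    case (Suc n)
    have "Dh \<gamma> y * Q ^ Suc n = (Dh \<gamma> (Q ^ n * y) * Q) * (poch (c * Q * y) n * poch (d * Q * y) n)"
      using Suc by (simp add: mult_ac)
    also have "Dh \<gamma> (Q ^ n * y) * Q = Dh \<gamma> (Q ^ Suc n * y) * ((1 - c * Q * y * Q ^ n) * (1 - d * Q * y * Q ^ n))"
      using Dh_rec[OF g, of "Q ^ n * y"] by (simp add: mult_ac)
    finally show ?case unfolding poch_Suc by (simp only: mult_ac)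
  qed simp
  have Dy: "Dh \<gamma> y = D' * y * (pinf (c * Q * y) * pinf (d * Q * y))" for y
  proof (cases "y = 0")
    case False
    have l: "(\<lambda>w. Dh \<gamma> w / w) \<midarrow>0\<rightarrow> D'" using D' unfolding has_field_derivative_iff D0 by simp
    have "filterlim (\<lambda>n. Q ^ n * y) (at 0) sequentially"
      unfolding filterlim_at using Q_pow_tendsto[of y] False by (auto simp: mult.commute intro!: always_eventually)
    from filterlim_compose[OF l this]
    have "(\<lambda>n. Dh \<gamma> (Q ^ n * y) / (Q ^ n * y) * y * (poch (c * Q * y) n * poch (d * Q * y) n)) \<longlonglongrightarrow> D' * y * (pinf (c * Q * y) * pinf (d * Q * y))"
      by (intro tendsto_mult tendsto_const poch_tendsto)
    moreover have "Dh \<gamma> (Q ^ n * y) / (Q ^ n * y) * y * (poch (c * Q * y) n * poch (d * Q * y) n) = Dh \<gamma> y" for n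
    proof -
      have "Dh \<gamma> (Q ^ n * y) / (Q ^ n * y) * y * (poch (c * Q * y) n * poch (d * Q * y) n)
        = Dh \<gamma> (Q ^ n * y) * (poch (c * Q * y) n * poch (d * Q * y) n) / Q ^ n" using False by simp
      also have "\<dots> = Dh \<gamma> y" unfolding it[symmetric] by simp
      finally show ?thesis .
    qed
    ultimately show ?thesis using LIMSEQ_unique[OF tendsto_const] by simp
  qed (use D0 in simp)
  have "(1 - b / a) * pinf (b * Q / a) * (pinf (s * \<gamma>) * pinf (s / \<gamma>) * pinf (a * Q / b) / (pinf (c * Q / b) * pinf (d * Q / b)))
    = D' * (1 / a) * (pinf (c * Q / a) * pinf (d * Q / a))"
    using Dy[of "1 / a"] NN_Qa[OF g] sw.NN_1b[OF g] nz unfolding Dh_def by simp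
  moreover have "(1 - b / a) * pinf (b * Q / a) * pinf (a * Q / b) = th (b / a)"
    unfolding theta1_def pinf_rec[of "b / a"] using nz by (simp add: mult_ac)
  ultimately have "th (b / a) * (pinf (s * \<gamma>) * pinf (s / \<gamma>)) / (pinf (c * Q / b) * pinf (d * Q / b)) = D' * (1 / a) * (pinf (c * Q / a) * pinf (d * Q / a))"
    by (simp add: mult_ac)
  then have "D' * (pinf (c * Q / a) * pinf (d * Q / a)) = a * (th (b / a) * (pinf (s * \<gamma>) * pinf (s / \<gamma>)) / (pinf (c * Q / b) * pinf (d * Q / b)))"
    using nz by simp
  then have "D' = a * (th (b / a) * (pinf (s * \<gamma>) * pinf (s / \<gamma>)) / (pinf (c * Q / b) * pinf (d * Q / b))) / (pinf (c * Q / a) * pinf (d * Q / a))"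
    by (metis nonzero_mult_div_cancel_right mult_eq_0_iff pinf_ca_ne(1,2))
  then have "D' = kap \<gamma>" unfolding kap_def by (simp add: mult_ac)
  then show ?thesis using Dy by simp
qed

definition Phi :: "complex \<Rightarrow> real \<Rightarrow> complex" where
  "Phi \<gamma> x = (if x \<in> Rq q zm zp then NN \<gamma> (of_real x) / pinf (b * of_real x) else 0)"

lemma sroot_eq: "sroot q a b c d = s"
proof -
  have "c * d * Q / (a * b) = s\<^sup>2" using s_sq' by (simp add: power2_eq_square)
  then show ?thesis unfolding sroot_def using s_pos by (simp add: csqrt_square)
qed

lemma coefA_ne: assumes "x \<in> Rq q zm zp" shows "coefA q a b c d x \<noteq> 0" "coefB q a b c d x \<noteq> 0"
proof -
  have "x \<noteq> 0" by (rule Rq_ne_0[OF assms])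
  moreover have "a * of_real (x / q) \<noteq> 1" "b * of_real (x / q) \<noteq> 1" using Rq_factor_ne[OF Rq_mult'(3)[OF assms]] by auto
  ultimately have "1 - Q / (a * of_real x) \<noteq> 0" "1 - Q / (b * of_real x) \<noteq> 0" "1 - 1 / (c * of_real x) \<noteq> 0" "1 - 1 / (d * of_real x) \<noteq> 0"
    using nz Rq_factor_ne[OF assms] by (simp_all add: divide_eq_eq eq_commute[of 1])
  then show "coefA q a b c d x \<noteq> 0" "coefB q a b c d x \<noteq> 0"
    unfolding coefA_def coefB_def sroot_eq by simp_all
qed

lemma Phi_L:
  assumes g: "1 \<le> norm \<gamma>" and x: "x \<in> Rq q zm zp"
  shows "L q a b c d (Phi \<gamma>) x = (\<gamma> + inverse \<gamma>) * Phi \<gamma> x"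
proof -
  define y where "y = complex_of_real x"
  have y0: "y \<noteq> 0" using Rq_ne_0[OF x] by (simp add: y_def)
  define p where "p = pinf (b * (Q * y))"
  define n0 n1 n2 where "n0 = NN \<gamma> (y / Q)" and "n1 = NN \<gamma> y" and "n2 = NN \<gamma> (Q * y)"
  define u v where "u = 1 - b * y" and "v = 1 - b * (y / Q)"
  have uv: "u \<noteq> 0" "v \<noteq> 0" using Rq_factor_ne(2)[OF x] Rq_factor_ne(2)[OF Rq_mult'(3)[OF x]] by (auto simp: u_def v_def y_def)
  have p0: "p \<noteq> 0" using pinf_Rq_ne(2)[OF Rq_mult'(2)[OF x]] by (simp add: p_def y_def)
  have P: "Phi \<gamma> (x / q) = n0 / (v * (u * p))" "Phi \<gamma> x = n1 / (u * p)" "Phi \<gamma> (q * x) = n2 / p"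
    using x Rq_mult'(2,3)[OF x] pinf_rec[of "b * (y / Q)"] pinf_rec[of "b * y"]
    by (simp_all add: Phi_def n0_def n1_def n2_def p_def u_def v_def y_def mult_ac)
  define X Y Z where "X = y - Q / a" and "Y = y - Q / b" and "Z = s * (y - 1 / c) * (y - 1 / d)"
  have cA: "coefA q a b c d x = inverse s * X * Y / (y * y)" "coefB q a b c d x = Z / (y * y)"
  proof -
    have "1 - Q / (a * y) = X / y" "1 - Q / (b * y) = Y / y" "1 - 1 / (c * y) = (y - 1 / c) / y" "1 - 1 / (d * y) = (y - 1 / d) / y"
      using y0 nz by (simp_all add: X_def Y_def field_simps)
    then show "coefA q a b c d x = inverse s * X * Y / (y * y)" "coefB q a b c d x = Z / (y * y)"
      unfolding coefA_def coefB_def sroot_eq y_def[symmetric] by (simp_all add: Z_def)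
  qed
  have Y: "Y = - (Q / b) * v" unfolding Y_def v_def using nz by (simp add: field_simps)
  have e: "- (Q / (s * b)) * X * n0 + Z * u * n2 + (y * y * (s + inverse s - (\<gamma> + inverse \<gamma>)) - inverse s * X * Y - Z) * n1 = 0"
    using NN_qdiff[OF g, of y] unfolding n0_def n1_def n2_def X_def Y_def Z_def u_def .
  have f: "inverse s * X * Y * (n0 / (v * (u * p))) = - (Q / (s * b)) * X * n0 / (u * p)"
    unfolding Y using uv nz by (simp add: field_simps)
  have "y * y * (L q a b c d (Phi \<gamma>) x - (\<gamma> + inverse \<gamma>) * Phi \<gamma> x) =
     inverse s * X * Y * (n0 / (v * (u * p))) + Z * (n2 / p) + (y * y * (s + inverse s - (\<gamma> + inverse \<gamma>)) - inverse s * X * Y - Z) * (n1 / (u * p))"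
  proof -
    have "y * y * coefA q a b c d x = inverse s * X * Y" "y * y * coefB q a b c d x = Z" unfolding cA using y0 by simp_all
    moreover have "y * y * (A' * f0 + B' * f2 + (inverse s + s - A' - B') * f1 - (\<gamma> + inverse \<gamma>) * f1) =
      (y * y * A') * f0 + (y * y * B') * f2 + (y * y * (s + inverse s - (\<gamma> + inverse \<gamma>)) - (y * y * A') - (y * y * B')) * f1" for A' B' f0 f1 f2
      by (simp add: algebra_simps)
    ultimately show ?thesis unfolding L_def coefC_def P sroot_eq by (simp only:)
  qed
  also have "\<dots> = (- (Q / (s * b)) * X * n0 + Z * u * n2 + (y * y * (s + inverse s - (\<gamma> + inverse \<gamma>)) - inverse s * X * Y - Z) * n1) / (u * p)"
    unfolding f add_divide_distrib using uv by simp
  also have "\<dots> = 0" unfolding e by simp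
  finally show ?thesis using y0 by simp
qed

text \<open>For uniqueness: \<open>coefA\<close> has no zero on the lattice, so the eigenvalue
  equation determines the value at \<open>x / q\<close> from those at \<open>x\<close> and
  \<open>q * x\<close>. A solution is thus fixed by its values near 0.\<close>

lemma bigqJacobi_eq:
  assumes g: "norm \<gamma> = 1"
  shows "bigqJacobi q zm zp a b c d \<gamma> = Phi \<gamma>"
  unfolding bigqJacobi_def
proof (rule the_equality)
  have "Phi \<gamma> x = ser \<gamma> (of_real x)" if "x \<in> Rq q zm zp" "\<bar>x\<bar> < 1 / norm b" for x
  proof -
    have "norm (b * of_real x) < 1" using that nz by (simp add: norm_mult field_simps)
    then show ?thesis using NN_ser[of \<gamma> "of_real x"] g Rq_ne_0[OF that(1)] pinf_Rq_ne(2)[OF that(1)] that by (simp add: Phi_def)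
  qed
  moreover have "Phi \<gamma> \<in> fun_on (Rq q zm zp)" by (simp add: fun_on_def Phi_def)
  ultimately show "Phi \<gamma> \<in> fun_on (Rq q zm zp) \<and>
     (\<forall>x\<in>Rq q zm zp. \<bar>x\<bar> < 1 / norm b \<longrightarrow>
        Phi \<gamma> x = phi32 (of_real q / (a * of_real x)) (sroot q a b c d * \<gamma>) (sroot q a b c d / \<gamma>)
                    (c * of_real q / a) (d * of_real q / a) q (b * of_real x)) \<and>
     (\<forall>x\<in>Rq q zm zp. L q a b c d (Phi \<gamma>) x = (\<gamma> + inverse \<gamma>) * Phi \<gamma> x)"
    using Phi_L g by (auto simp: ser_def sroot_eq)
  fix f assume f: "f \<in> fun_on (Rq q zm zp) \<and>
     (\<forall>x\<in>Rq q zm zp. \<bar>x\<bar> < 1 / norm b \<longrightarrow>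
        f x = phi32 (of_real q / (a * of_real x)) (sroot q a b c d * \<gamma>) (sroot q a b c d / \<gamma>)
                    (c * of_real q / a) (d * of_real q / a) q (b * of_real x)) \<and>
     (\<forall>x\<in>Rq q zm zp. L q a b c d f x = (\<gamma> + inverse \<gamma>) * f x)"
  have small: "f x = Phi \<gamma> x" if "x \<in> Rq q zm zp" "\<bar>x\<bar> < 1 / norm b" for x
    using f \<open>\<And>x. x \<in> Rq q zm zp \<Longrightarrow> \<bar>x\<bar> < 1 / norm b \<Longrightarrow> Phi \<gamma> x = ser \<gamma> (of_real x)\<close> that by (simp add: ser_def sroot_eq)
  have step: "f (x / q) = Phi \<gamma> (x / q)" if x: "x \<in> Rq q zm zp" and e: "f x = Phi \<gamma> x" "f (q * x) = Phi \<gamma> (q * x)" for x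
  proof -
    have "L q a b c d f x = L q a b c d (Phi \<gamma>) x" using f x Phi_L[of \<gamma> x] g e by simp
    then show ?thesis using coefA_ne(1)[OF x] e unfolding L_def by simp
  qed
  \<comment> \<open>Agreement at two consecutive lattice points moves outwards one step at a time
    until it reaches \<open>x\<close>.\<close>
  have main: "f (x * q ^ n) = Phi \<gamma> (x * q ^ n) \<and> f (x * q ^ Suc n) = Phi \<gamma> (x * q ^ Suc n) \<Longrightarrow> f x = Phi \<gamma> x" if x: "x \<in> Rq q zm zp" for x n
  proof (induction n)
    case (Suc n)
    have "f (x * q ^ Suc n / q) = Phi \<gamma> (x * q ^ Suc n / q)"
      using Suc.prems by (intro step Rq_mult'(1)[OF x]) (auto simp: mult_ac)
    then show ?case using Suc by simp
  qed simp
  show "f = Phi \<gamma>"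
  proof
    fix x
    show "f x = Phi \<gamma> x"
    proof (cases "x \<in> Rq q zm zp")
      case True
      have "(\<lambda>n. x * q ^ n) \<longlonglongrightarrow> 0" by (rule tendsto_mult_right_zero, rule LIMSEQ_power_zero) (use q0 q1 in auto)
      then have "\<forall>\<^sub>F n in sequentially. \<bar>x * q ^ n\<bar> < 1 / norm b"
        by (rule order_tendstoD(2)[OF tendsto_rabs_zero]) (use nz in simp)
      then obtain n where n: "\<And>m. m \<ge> n \<Longrightarrow> \<bar>x * q ^ m\<bar> < 1 / norm b" by (auto simp: eventually_sequentially)
      have "f (x * q ^ n) = Phi \<gamma> (x * q ^ n)" by (rule small[OF Rq_mult'(1)[OF True] n]) simp
      moreover have "f (x * q ^ Suc n) = Phi \<gamma> (x * q ^ Suc n)" by (rule small[OF Rq_mult'(1)[OF True] n]) simp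
      ultimately show ?thesis by (intro main[OF True, of n] conjI)
    next
      case False
      then show ?thesis using f by (simp add: fun_on_def Phi_def)
    qed
  qed
qed

text \<open>The coefficient of the leading growth \<open>(s * \<gamma>) ^ n\<close> of
  \<open>\<phi>\<^sub>\<gamma>\<close> at \<open>z / q ^ n\<close>, without the factor
  \<open>1 / pinf (1 / \<gamma>\<^sup>2)\<close>, see \<open>Phi_asymp\<close>. The omitted factor
  is the same for the dagger.\<close>

definition chat :: "complex \<Rightarrow> complex \<Rightarrow> complex" where
  "chat \<gamma> z = pinf (s / \<gamma>) * pinf (c * Q / (a * s * \<gamma>)) * pinf (d * Q / (a * s * \<gamma>)) * th (b * s * \<gamma> * z)
     / (pinf (c * Q / a) * pinf (d * Q / a) * th (b * z))"

lemma chat_swap: "bqj.chat q a b d c s \<gamma> z = chat \<gamma> z"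
  unfolding chat_def bqj.chat_def[OF swap_cd] by (simp add: mult_ac)

end

section \<open>Behaviour of the solutions at the infinite ends of the lattice\<close>

context bqjd
begin

text \<open>As \<open>x \<rightarrow> \<plusminus>\<infinity>\<close> along the lattice the series for \<open>N0\<close> tends termwise to a series that is summed by
  the \<open>q\<close>-Gauss formula.\<close>

lemma N0_asymp:
  assumes g: "1 < norm \<gamma>" and z: "z \<in> {zm, zp}"
  shows "(\<lambda>n. N0 \<gamma> (of_real z / Q ^ n) / pinf (b * (of_real z / Q ^ n)) / (s * \<gamma>) ^ n) \<longlonglongrightarrow> chat \<gamma> (of_real z) / pinf (1 / \<gamma>\<^sup>2)"
proof -
  define zc where "zc = complex_of_real z"
  define r w t C where "r = b * s * \<gamma>" and "w = 1 / \<gamma>\<^sup>2" and "t = tau / \<gamma>" and "C = c * Q * \<gamma> / (a * s)"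
  have g0: "\<gamma> \<noteq> 0" using g by auto
  have zR: "z \<in> Rq q zm zp" using RqI[OF z, of 0] by simp
  have z0: "zc \<noteq> 0" using Rq_ne_0[OF zR] by (simp add: zc_def)
  have r0: "r \<noteq> 0" using nz g0 by (simp add: r_def)
  have thn: "th (c * zc) \<noteq> 0" "th (b * zc) \<noteq> 0" using th_Rq_ne[OF zR] by (simp_all add: zc_def)
  have w1: "norm w < 1" using g by (simp add: w_def norm_divide norm_power divide_less_eq one_less_power)
  have t1: "norm t < 1" using tau_lt g by (simp add: t_def norm_divide divide_less_eq)
  \<comment> \<open>By the relation for \<open>s\<close>, the limiting series has the argument
    \<open>1 / \<gamma>\<^sup>2\<close>, which lies in the unit disc.\<close>
  have ctr: "c * t / r = w"
  proof -
    have "c * t / r = c * d * Q / (a * b) / (s * s) / \<gamma>\<^sup>2" unfolding t_def r_def tau_def by (simp add: power2_eq_square mult_ac)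
    then show ?thesis unfolding s_sq'[symmetric] w_def by simp
  qed
  define sg where "sg k = poch C k * poch (s * \<gamma>) k / (poch Q k * poch (c * Q / a) k)" for k
  \<comment> \<open>The k-th term of the series at the n-th lattice point depends on the position
    \<open>n - k\<close>, because \<open>poch u k\<close> is the quotient of \<open>pinf u\<close>
    by \<open>pinf (u * Q ^ k)\<close>. For \<open>k > n\<close> the position is negative, hence the
    integer index. The power of \<open>c / r\<close> makes the limit at infinity finite.\<close>
  define \<rho> where "\<rho> m = pinf (r * (zc / Q powi m)) / pinf (c * (zc / Q powi m)) * (c / r) powi m" for m :: int
  define \<eta> where "\<eta> n = pinf (c * zc / Q ^ n) / pinf (b * zc / Q ^ n) * (b / c) ^ n" for n
  define K0 where "K0 = pinf t / pinf (d * Q / a)"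
  have lat: "pinf (c * (zc / Q powi m)) \<noteq> 0" "pinf (b * (zc / Q powi m)) \<noteq> 0" for m :: int
    using pinf_Rq_ne(3)[OF Rq_mult[OF zR, of "- m"]] pinf_Rq_ne(2)[OF Rq_mult[OF zR, of "- m"]]
    by (simp_all add: zc_def power_int_minus divide_inverse)
  have trm: "poch (c * (zc / Q ^ n)) k * poch C k / (poch Q k * poch (c * Q / a) k) * (poch (s * \<gamma>) k * pinf (s * \<gamma> * (b * (zc / Q ^ n)) * Q ^ k)) * t ^ k
      = pinf (b * (zc / Q ^ n)) * (s * \<gamma>) ^ n * (\<eta> n * (sg k * \<rho> (int n - int k) * w ^ k))" for n k
  proof -
    define X where "X = zc / Q powi (int n - int k)"
    have X: "zc / Q ^ n * Q ^ k = X" unfolding X_def by (simp add: power_int_diff)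
    have p1: "poch (c * (zc / Q ^ n)) k = pinf (c * (zc / Q ^ n)) / pinf (c * X)"
      using pinf_split[of "c * (zc / Q ^ n)" k] lat(1)[of "int n - int k"] unfolding X_def[symmetric] X[symmetric] by (simp add: mult.assoc)
    have p2: "s * \<gamma> * (b * (zc / Q ^ n)) * Q ^ k = r * X" unfolding X[symmetric] r_def by (simp only: mult_ac)
    have p3: "(b / c) ^ n * (c / r) powi (int n - int k) * w ^ k * (s * \<gamma>) ^ n = t ^ k"
    proof -
      have "(b / c) ^ n * (c / r) powi (int n - int k) * w ^ k * (s * \<gamma>) ^ n = (b / c * (c / r) * (s * \<gamma>)) ^ n * (w / (c / r)) ^ k"
        using nz r0 by (simp add: power_int_diff power_mult_distrib power_divide)
      also have "b / c * (c / r) * (s * \<gamma>) = 1" unfolding r_def using nz g0 by simp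
      also have "w / (c / r) = t" unfolding ctr[symmetric] using nz r0 by simp
      finally show ?thesis by simp
    qed
    have "pinf (b * (zc / Q ^ n)) * (s * \<gamma>) ^ n * (\<eta> n * (sg k * \<rho> (int n - int k) * w ^ k)) =
      pinf (c * (zc / Q ^ n)) / pinf (c * X) * poch C k / (poch Q k * poch (c * Q / a) k) * (poch (s * \<gamma>) k * pinf (r * X)) *
       ((b / c) ^ n * (c / r) powi (int n - int k) * w ^ k * (s * \<gamma>) ^ n)"
      unfolding \<eta>_def \<rho>_def sg_def X_def[symmetric] using lat(2)[of "int n"] by (simp add: mult_ac)
    then show ?thesis unfolding p1 p2 p3 by simp
  qed
  have N: "N0 \<gamma> (zc / Q ^ n) / pinf (b * (zc / Q ^ n)) / (s * \<gamma>) ^ n = K0 * (\<eta> n * (\<Sum>k. sg k * \<rho> (int n - int k) * w ^ k))"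
    if sm: "summable (\<lambda>k. sg k * \<rho> (int n - int k) * w ^ k)" for n
  proof -
    have "(\<Sum>k. pinf (b * (zc / Q ^ n)) * (s * \<gamma>) ^ n * (\<eta> n * (sg k * \<rho> (int n - int k) * w ^ k))) =
      pinf (b * (zc / Q ^ n)) * (s * \<gamma>) ^ n * (\<eta> n * (\<Sum>k. sg k * \<rho> (int n - int k) * w ^ k))"
      using suminf_mult[OF summable_mult[OF sm]] suminf_mult[OF sm] by simp
    then have "N0 \<gamma> (zc / Q ^ n) = K0 * (pinf (b * (zc / Q ^ n)) * (s * \<gamma>) ^ n * (\<eta> n * (\<Sum>k. sg k * \<rho> (int n - int k) * w ^ k)))"
      unfolding N0_def sears_sum_def K0_def t_def[symmetric] C_def[symmetric] trm by simp
    then show ?thesis using lat(2)[of "int n"] g0 by simp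
  qed
  define Lr where "Lr = th (r * zc) / th (c * zc)"
  have r_lim: "(\<lambda>m. \<rho> (int m)) \<longlonglongrightarrow> Lr"
  proof -
    have "(\<lambda>n. pinf (r * zc / Q ^ n) / pinf (c * zc / Q ^ n) * (c * zc / (r * zc)) ^ n) \<longlonglongrightarrow> Lr"
      unfolding Lr_def by (rule pinf_ratio_limit) (use r0 z0 nz thn in auto)
    then show ?thesis unfolding \<rho>_def using z0 by simp
  qed
  have e_lim: "\<eta> \<longlonglongrightarrow> th (c * zc) / th (b * zc)"
  proof -
    have "(\<lambda>n. pinf (c * zc / Q ^ n) / pinf (b * zc / Q ^ n) * (b * zc / (c * zc)) ^ n) \<longlonglongrightarrow> th (c * zc) / th (b * zc)"
      by (rule pinf_ratio_limit) (use z0 nz thn in auto)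
    then show ?thesis unfolding \<eta>_def[abs_def] using z0 by simp
  qed
  obtain K1 where K1: "K1 > 0" "\<And>m. norm (\<rho> (int m)) \<le> K1"
    using convergent_imp_Bseq[OF convergentI[OF r_lim]] by (auto simp: Bseq_def)
  have lim2: "(\<lambda>j. 1 / pinf (c * (zc * Q ^ j))) \<longlonglongrightarrow> 1 / pinf (c * 0)"
    by (intro tendsto_intros Q_pow_tendsto) simp
  obtain K2 where K2: "K2 > 0" "\<And>j. norm (1 / pinf (c * (zc * Q ^ j))) \<le> K2"
    using convergent_imp_Bseq[OF convergentI[OF lim2]] by (auto simp: Bseq_def)
  define E where "E = exp (norm (r * zc) / (1 - q))"
  define K3 where "K3 = max K1 (E * K2)"
  define M where "M = max (norm w) (norm t)"
  have M: "0 \<le> M" "M < 1" "norm w \<le> M" "norm t \<le> M" using w1 t1 by (auto simp: M_def le_max_iff_disj)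
  have K3: "0 \<le> K3" "K1 \<le> K3" "E * K2 \<le> K3" using K1 by (auto simp: K3_def)
  \<comment> \<open>Two regimes. For \<open>k \<le> n\<close> the values of \<open>\<rho>\<close>
    are bounded and \<open>w\<close> gives the decay. For \<open>k > n\<close> the growing power of
    \<open>r / c\<close> in \<open>\<rho>\<close> combines with powers of \<open>w\<close> to powers
    of \<open>t\<close>, which is also in the unit disc.\<close>
  have rb: "norm (\<rho> (int n - int k) * w ^ k) \<le> K3 * M ^ k" for n k
  proof (cases "k \<le> n")
    case True
    then have e: "int n - int k = int (n - k)" by (rule of_nat_diff[symmetric])
    have "norm (\<rho> (int n - int k)) \<le> K3" unfolding e by (rule order_trans[OF K1(2) K3(2)])
    then show ?thesis unfolding norm_mult norm_power
      by (rule mult_mono[OF _ power_mono[OF M(3)]]) (use K3 in auto)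
  next
    case False
    define j where "j = k - n"
    have k: "k = n + j" using False by (simp add: j_def)
    have m: "int n - int k = - int j" by (simp add: k)
    have "norm (pinf (r * (zc * Q ^ j))) \<le> E"
      unfolding E_def
    proof (rule norm_pinf_le)
      have "norm (r * (zc * Q ^ j)) = norm (r * zc) * q ^ j" by (simp add: norm_mult norm_power)
      also have "\<dots> \<le> norm (r * zc) * 1" by (intro mult_left_mono power_le_one) auto
      finally show "norm (r * (zc * Q ^ j)) \<le> norm (r * zc)" by simp
    qed
    then have "norm (pinf (r * (zc * Q ^ j))) * norm (1 / pinf (c * (zc * Q ^ j))) \<le> E * K2"
      by (rule mult_mono[OF _ K2(2)]) (simp_all add: E_def)
    then have 1: "norm (pinf (r * (zc * Q ^ j))) * norm (1 / pinf (c * (zc * Q ^ j))) \<le> K3" using K3(3) by simp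
    have 2: "\<rho> (- int j) * w ^ k = pinf (r * (zc * Q ^ j)) * (1 / pinf (c * (zc * Q ^ j))) * (w ^ n * t ^ j)"
    proof -
      have "w * (r / c) = t" unfolding ctr[symmetric] using nz r0 by simp
      then have "w ^ n * t ^ j = w ^ k * (r / c) ^ j" unfolding k power_add by (simp add: power_mult_distrib[symmetric] mult.assoc)
      moreover have "(c / r) powi (- int j) = (r / c) ^ j" by (simp add: power_int_minus power_divide)
      moreover have "zc / Q powi (- int j) = zc * Q ^ j" by (simp add: power_int_minus divide_inverse)
      ultimately show ?thesis unfolding \<rho>_def by simp
    qed
    have "norm (\<rho> (int n - int k) * w ^ k) = norm (pinf (r * (zc * Q ^ j))) * norm (1 / pinf (c * (zc * Q ^ j))) * (norm w ^ n * norm t ^ j)"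
      unfolding m 2 by (simp only: norm_mult norm_power)
    also have "\<dots> \<le> K3 * (M ^ n * M ^ j)"
      by (rule mult_mono[OF 1 mult_mono[OF power_mono[OF M(3)] power_mono[OF M(4)]]]) (use M K3 in auto)
    finally show ?thesis by (simp add: k power_add)
  qed
  obtain K4 where K4': "K4 > 0" "\<And>k. norm (poch C k * poch (s * \<gamma>) k / (poch Q k * poch (c * Q / a) k)) \<le> K4"
    using bounded_poch_quotient[OF pinf_ca_ne(1), of C "s * \<gamma>"] by blast
  then have K4: "K4 > 0" "\<And>k. norm (sg k) \<le> K4" by (simp_all add: sg_def)
  have tb: "norm (sg k * \<rho> (int n - int k) * w ^ k) \<le> K4 * K3 * M ^ k" for n k
  proof -
    have "norm (sg k * \<rho> (int n - int k) * w ^ k) = norm (sg k) * norm (\<rho> (int n - int k) * w ^ k)"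
      by (simp only: norm_mult mult.assoc)
    also have "\<dots> \<le> K4 * (K3 * M ^ k)" by (rule mult_mono[OF K4(2) rb]) (use K4 in auto)
    finally show ?thesis by (simp only: mult.assoc)
  qed
  have sm: "summable (\<lambda>k. norm (sg k * \<rho> (int n - int k) * w ^ k))" for n
    by (rule summable_comparison_test'[of "\<lambda>k. K4 * K3 * M ^ k" 0])
      (use M in \<open>auto intro!: summable_mult summable_geometric tb\<close>)
  have sm2: "summable (\<lambda>k. norm (sg k * (Lr) * w ^ k))"
  proof -
    have "summable (\<lambda>k. norm (sg k * w ^ k))" by (rule summable_bounded_powser(1)[where u = sg, OF K4(2) w1])
    from summable_mult[OF this, of "norm Lr"] show ?thesis by (simp only: norm_mult mult_ac)
  qed
  have "(\<lambda>n. \<Sum>k. sg k * \<rho> (int n - int k) * w ^ k) \<longlonglongrightarrow> (\<Sum>k. sg k * (Lr) * w ^ k)"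
    unfolding suminf_eq_infsum[OF sm] suminf_eq_infsum[OF sm2]
  proof (rule tendsto_infsum_dominated[OF tb])
    show "(\<lambda>k. K4 * K3 * M ^ k) summable_on UNIV"
    proof (rule norm_summable_imp_summable_on)
      have "summable (\<lambda>k. (K4 * K3) * M ^ k)" by (intro summable_mult summable_geometric) (use M in simp)
      moreover have "norm (K4 * K3 * M ^ k) = (K4 * K3) * M ^ k" for k using M K4 K3 by simp
      ultimately show "summable (\<lambda>k. norm (K4 * K3 * M ^ k))" by simp
    qed
    fix k
    have "(\<lambda>n. \<rho> (int n - int k)) \<longlonglongrightarrow> Lr"
    proof (rule LIMSEQ_offset[where k = k])
      show "(\<lambda>n. \<rho> (int (n + k) - int k)) \<longlonglongrightarrow> Lr" using r_lim by simp
    qed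
    then show "(\<lambda>n. sg k * \<rho> (int n - int k) * w ^ k) \<longlonglongrightarrow> sg k * (Lr) * w ^ k"
      by (intro tendsto_mult tendsto_const)
  qed simp
  then have "(\<lambda>n. K0 * (\<eta> n * (\<Sum>k. sg k * \<rho> (int n - int k) * w ^ k))) \<longlonglongrightarrow> K0 * (th (c * zc) / th (b * zc) * (\<Sum>k. sg k * (Lr) * w ^ k))"
    by (intro tendsto_mult tendsto_const e_lim)
  also have "(\<Sum>k. sg k * (Lr) * w ^ k) = Lr * (\<Sum>k. sg k * w ^ k)"
    using suminf_mult[OF summable_bounded_powser(2)[where u = sg, OF K4(2) w1], of "Lr"] by (simp add: mult_ac)
  \<comment> \<open>The q-Gauss sum with parameters \<open>s * \<gamma>\<close> and
    \<open>C\<close>, whose product with \<open>w\<close> is the lower parameter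
    \<open>c * Q / a\<close>.\<close>
  also have "(\<Sum>k. sg k * w ^ k) = pinf (s / \<gamma>) * pinf (c * Q / (a * s * \<gamma>)) / (pinf (c * Q / a) * pinf w)"
  proof -
    have e1: "s * \<gamma> * C * w = c * Q / a" unfolding C_def w_def using g0 by (simp add: power2_eq_square)
    have e2: "s * \<gamma> * w = s / \<gamma>" "C * w = c * Q / (a * s * \<gamma>)" unfolding C_def w_def using g0 by (simp_all add: power2_eq_square)
    have "poch (s * \<gamma>) k * poch C k / poch Q k * pinf (c * Q / a * Q ^ k) * w ^ k = pinf (c * Q / a) * (sg k * w ^ k)" for k
      unfolding sg_def using pinf_split[of "c * Q / a" k] pinf_ne_0_poch[OF pinf_ca_ne(1), of k] by (simp add: field_simps)
    then have "pinf w * (pinf (c * Q / a) * (\<Sum>k. sg k * w ^ k)) = pinf (s / \<gamma>) * pinf (c * Q / (a * s * \<gamma>))"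
      using q_Gauss[OF w1, of "s * \<gamma>" C] suminf_mult[OF summable_bounded_powser(2)[where u = sg, OF K4(2) w1], of "pinf (c * Q / a)"]
      unfolding e1 e2 by simp
    then show ?thesis using pinf_ne_0_lt1[OF w1] pinf_ca_ne(1) by (simp add: field_simps)
  qed
  also have "K0 * (th (c * zc) / th (b * zc) * (Lr * (pinf (s / \<gamma>) * pinf (c * Q / (a * s * \<gamma>)) / (pinf (c * Q / a) * pinf w)))) = chat \<gamma> zc / pinf w"
    unfolding Lr_def chat_def K0_def t_def tau_def r_def using thn by (simp add: mult_ac)
  finally show ?thesis unfolding zc_def[symmetric] w_def[symmetric] N[OF summable_norm_cancel[OF sm]] .
qed

end

section \<open>Theta function identities for the leading coefficients\<close>

context bqj
begin

lemma Phi_asymp: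
  assumes g: "1 < norm \<gamma>" and z: "z \<in> {zm, zp}"
  shows "(\<lambda>n. Phi \<gamma> (z / q ^ n) / (s * \<gamma>) ^ n) \<longlonglongrightarrow> chat \<gamma> (of_real z) / pinf (1 / \<gamma>\<^sup>2)"
proof -
  have zR: "z \<in> Rq q zm zp" using RqI[OF z, of 0] by simp
  have P: "Phi \<gamma> (z / q ^ n) = NN \<gamma> (of_real z / Q ^ n) / pinf (b * (of_real z / Q ^ n))" for n
    using Rq_mult'(4)[OF zR, of n] by (simp add: Phi_def)
  show ?thesis unfolding P
  proof (cases "norm tau < 1")
    case True
    then have "NN = N0" by (intro ext) (simp add: NN_def)
    then show "(\<lambda>n. NN \<gamma> (of_real z / Q ^ n) / pinf (b * (of_real z / Q ^ n)) / (s * \<gamma>) ^ n) \<longlonglongrightarrow> chat \<gamma> (of_real z) / pinf (1 / \<gamma>\<^sup>2)"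
      using bqjd.N0_asymp[OF bqjdI[OF True] g z] by simp
  next
    case False
    then have t: "norm (bqj.tau q a c s) < 1" using tau_cases by blast
    have "NN = bqj.N0 q a b d c s" using False by (intro ext) (simp add: NN_def)
    then show "(\<lambda>n. NN \<gamma> (of_real z / Q ^ n) / pinf (b * (of_real z / Q ^ n)) / (s * \<gamma>) ^ n) \<longlonglongrightarrow> chat \<gamma> (of_real z) / pinf (1 / \<gamma>\<^sup>2)"
      using bqjd.N0_asymp[OF bqj.bqjdI[OF swap_cd t] g z] by (simp add: chat_swap)
  qed
qed

abbreviation "chatd \<equiv> bqj.chat q b a c d s"

definition prodc :: complex where
  "prodc = pinf (c * Q / a) * pinf (d * Q / a) * pinf (c * Q / b) * pinf (d * Q / b)"

lemma prodc_ne [simp]: "prodc \<noteq> 0" unfolding prodc_def by simp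

lemma chatd_def: "chatd \<gamma> z = pinf (s / \<gamma>) * pinf (c * Q / (b * s * \<gamma>)) * pinf (d * Q / (b * s * \<gamma>)) * th (a * s * \<gamma> * z)
     / (pinf (c * Q / b) * pinf (d * Q / b) * th (a * z))"
  using bqj.chat_def[OF swap_ab] .

lemma s_sq3: "s * s * a * b = c * d * Q" using s_sq by (simp add: power2_eq_square mult_ac)

text \<open>The determinant of the leading coefficients at the two ends; where it is nonzero, the
  solutions decaying at one and at the other end are independent. In the three-term relation
  \<open>u\<close> is a square root of \<open>a * b * m * p\<close>, and only products and quotients
  of pairs of variables occur, so the choice of the root does not matter.\<close>

lemma chat_delta:
  assumes g: "\<gamma> \<noteq> 0" and mp: "m \<noteq> 0" "p \<noteq> 0"
    and n: "th (a * m) \<noteq> 0" "th (b * m) \<noteq> 0" "th (a * p) \<noteq> 0" "th (b * p) \<noteq> 0"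
  shows "chat \<gamma> m * chatd \<gamma> p - chatd \<gamma> m * chat \<gamma> p =
    pinf (s / \<gamma>) * pinf (s / \<gamma>) * (pinf (c * Q / (a * s * \<gamma>)) * pinf (d * Q / (a * s * \<gamma>)) * (pinf (c * Q / (b * s * \<gamma>)) * pinf (d * Q / (b * s * \<gamma>))))
     * (a * p * (th (m / p) * th (b / a) * th (a * b * s * m * p * \<gamma>) * th (s * \<gamma>)))
     / (prodc * (th (a * m) * th (b * m) * th (a * p) * th (b * p)))"
proof -
  define u where "u = csqrt (a * b * m * p)"
  have u2: "u * u = a * b * m * p" using power2_csqrt[of "a * b * m * p"] by (simp add: u_def power2_eq_square)
  have u0: "u \<noteq> 0" using u2 nz mp by auto
  define v y x where "v = a * m / u" and "y = b * m / u" and "x = s * \<gamma> * u"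
  have n0: "x \<noteq> 0" "y \<noteq> 0" "u \<noteq> 0" "v \<noteq> 0" using u0 nz mp g by (auto simp: x_def y_def v_def)
  have div: "w = w1 / w2" if "w * w2 = w1" "w2 \<noteq> 0" for w w1 w2 :: complex using that by (simp add: field_simps)
  have e: "x * y = b * s * \<gamma> * m" "x / y = a * s * \<gamma> * p" "u * v = a * m" "u / v = b * p" "x * v = a * s * \<gamma> * m" "x / v = b * s * \<gamma> * p"
    "u * y = b * m" "u / y = a * p" "y * v = m / p" "y / v = b / a" "x * u = a * b * s * m * p * \<gamma>" "x / u = s * \<gamma>"
  proof -
    show "x * y = b * s * \<gamma> * m" "u * v = a * m" "x * v = a * s * \<gamma> * m" "u * y = b * m" "x / u = s * \<gamma>"
      using u0 by (simp_all add: x_def y_def v_def)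
    have "x / y = s * \<gamma> * (u * u) / (b * m)" by (simp add: x_def y_def)
    then show "x / y = a * s * \<gamma> * p" unfolding u2 using nz mp by simp
    have "u / v = (u * u) / (a * m)" by (simp add: v_def)
    then show "u / v = b * p" unfolding u2 using nz mp by simp
    have "x / v = s * \<gamma> * (u * u) / (a * m)" by (simp add: x_def v_def)
    then show "x / v = b * s * \<gamma> * p" unfolding u2 using nz mp by simp
    have "u / y = (u * u) / (b * m)" by (simp add: y_def)
    then show "u / y = a * p" unfolding u2 using nz mp by simp
    have "y * v = b * m * (a * m) / (u * u)" by (simp add: y_def v_def)
    then show "y * v = m / p" unfolding u2 using nz mp by simp
    show "y / v = b / a" using u0 nz mp by (simp add: y_def v_def)
    have "x * u = s * \<gamma> * (u * u)" by (simp add: x_def)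
    then show "x * u = a * b * s * m * p * \<gamma>" unfolding u2 by (simp add: mult_ac)
  qed
  have T: "th (b * s * \<gamma> * m) * th (a * s * \<gamma> * p) * th (a * m) * th (b * p) - th (a * s * \<gamma> * m) * th (b * s * \<gamma> * p) * th (b * m) * th (a * p)
    = a * p * (th (m / p) * th (b / a) * th (a * b * s * m * p * \<gamma>) * th (s * \<gamma>))"
    using theta_three_term[OF n0] unfolding e .
  have "chat \<gamma> m * chatd \<gamma> p - chatd \<gamma> m * chat \<gamma> p =
    pinf (s / \<gamma>) * pinf (s / \<gamma>) * (pinf (c * Q / (a * s * \<gamma>)) * pinf (d * Q / (a * s * \<gamma>)) * (pinf (c * Q / (b * s * \<gamma>)) * pinf (d * Q / (b * s * \<gamma>))))
     * (th (b * s * \<gamma> * m) * th (a * s * \<gamma> * p) * th (a * m) * th (b * p) - th (a * s * \<gamma> * m) * th (b * s * \<gamma> * p) * th (b * m) * th (a * p))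
     / (prodc * (th (a * m) * th (b * m) * th (a * p) * th (b * p)))"
  proof -
    have gen: "(S * P1 * t1 / (R1 * h1)) * (S * P2 * t2 / (R2 * h2)) - (S * P2 * t3 / (R2 * h3)) * (S * P1 * t4 / (R1 * h4))
      = S * S * (P1 * P2) * (t1 * t2 * h3 * h4 - t3 * t4 * h1 * h2) / (R1 * R2 * (h3 * h1 * h2 * h4))"
      if "h1 \<noteq> 0" "h2 \<noteq> 0" "h3 \<noteq> 0" "h4 \<noteq> 0" "R1 \<noteq> 0" "R2 \<noteq> 0" for S P1 P2 t1 t2 t3 t4 h1 h2 h3 h4 R1 R2 :: complex
      using that by (simp add: field_simps)
    show ?thesis
      using gen[OF n(2) n(3) n(1) n(4), of "pinf (c * Q / a) * pinf (d * Q / a)" "pinf (c * Q / b) * pinf (d * Q / b)" "pinf (s / \<gamma>)"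
         "pinf (c * Q / (a * s * \<gamma>)) * pinf (d * Q / (a * s * \<gamma>))" "th (b * s * \<gamma> * m)" "pinf (c * Q / (b * s * \<gamma>)) * pinf (d * Q / (b * s * \<gamma>))"
         "th (a * s * \<gamma> * p)" "th (a * s * \<gamma> * m)" "th (b * s * \<gamma> * p)"]
      unfolding chat_def chatd_def prodc_def by (simp add: mult.assoc)
  qed
  then show ?thesis unfolding T .
qed

definition kk :: "complex \<Rightarrow> complex" where "kk \<gamma> = th (c * Q / (a * s) * \<gamma>) * th (d * Q / (a * s) * \<gamma>)"

text \<open>In each product the two arguments multiply to \<open>Q\<close>, by the relation for
  \<open>s\<close>. This is how products of q-shifted factorials at \<open>\<gamma>\<close> and at
  its inverse become theta functions.\<close>

lemma th_kk: assumes "\<gamma> \<noteq> 0"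
  shows "pinf (c * Q / (a * s * \<gamma>)) * pinf (d * Q / (b * s * inverse \<gamma>)) = th (c * Q / (a * s) / \<gamma>)"
    "pinf (d * Q / (a * s * \<gamma>)) * pinf (c * Q / (b * s * inverse \<gamma>)) = th (d * Q / (a * s) / \<gamma>)"
proof -
  have "Q / (c * Q / (a * s) / \<gamma>) = d * Q / (b * s * inverse \<gamma>)" "Q / (d * Q / (a * s) / \<gamma>) = c * Q / (b * s * inverse \<gamma>)"
    using nz assms s_sq3 by (simp_all add: frac_eq_eq divide_inverse[symmetric] field_simps)
  then show "pinf (c * Q / (a * s * \<gamma>)) * pinf (d * Q / (b * s * inverse \<gamma>)) = th (c * Q / (a * s) / \<gamma>)"
    "pinf (d * Q / (a * s * \<gamma>)) * pinf (c * Q / (b * s * inverse \<gamma>)) = th (d * Q / (a * s) / \<gamma>)"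
    unfolding theta1_def by (simp_all add: divide_divide_eq_left)
qed

lemma chat_cross:
  assumes g: "\<gamma> \<noteq> 0"
  shows "chat \<gamma> z * chatd (inverse \<gamma>) z = pinf (s * \<gamma>) * pinf (s / \<gamma>) * kk (inverse \<gamma>) * th (b * s * z * \<gamma>) * th (a * s * z / \<gamma>) / (prodc * (th (a * z) * th (b * z)))"
proof -
  have "chat \<gamma> z * chatd (inverse \<gamma>) z = pinf (s * \<gamma>) * pinf (s / \<gamma>)
     * ((pinf (c * Q / (a * s * \<gamma>)) * pinf (d * Q / (b * s * inverse \<gamma>))) * (pinf (d * Q / (a * s * \<gamma>)) * pinf (c * Q / (b * s * inverse \<gamma>))))
     * th (b * s * z * \<gamma>) * th (a * s * z / \<gamma>) / (prodc * (th (a * z) * th (b * z)))"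
    unfolding chat_def chatd_def prodc_def using g by (simp add: divide_inverse mult_ac)
  then show ?thesis unfolding th_kk[OF g] kk_def by (simp add: divide_inverse)
qed

text \<open>Pairs the coefficients at \<open>\<gamma>\<close> with those at its inverse at the same
  end. By the three-term relation the dependence on \<open>z\<close> becomes, up to a constant and a
  sign, the reciprocal of the limit of the weight in \<open>W_asymp\<close>, while the dependence on
  \<open>\<gamma>\<close> is common to both ends.\<close>

lemma chat_wronskian:
  assumes g: "\<gamma> \<noteq> 0" and z: "z \<noteq> 0"
  shows "chat \<gamma> z * chatd (inverse \<gamma>) z - chatd \<gamma> z * chat (inverse \<gamma>) z =
    pinf (s * \<gamma>) * pinf (s / \<gamma>) * (a * s * \<gamma> * th (b / a) * th (1 / \<gamma>\<^sup>2) * th (c * z) * th (d * z) / (c * d * z)) / (prodc * (th (a * z) * th (b * z)))"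
proof -
  define k where "k = c * Q / (a * s)"
  define u where "u = csqrt (a * b) * s * z"
  have u2: "u * u = a * b * (s * z * (s * z))" using power2_csqrt[of "a * b"] by (simp add: u_def power2_eq_square mult_ac)
  have k0: "k \<noteq> 0" using nz by (simp add: k_def)
  have u0: "u \<noteq> 0" using u2 nz z by auto
  define v x y where "v = b * s * z * \<gamma> / u" and "x = k * u / (b * s * z)" and "y = b * s * z / (\<gamma> * u)"
  have n0: "x \<noteq> 0" "y \<noteq> 0" "u \<noteq> 0" "v \<noteq> 0" using u0 nz z g k0 by (auto simp: x_def y_def v_def)
  have e: "x * y = k / \<gamma>" "x / y = k * (a / b) * \<gamma>" "u * v = b * s * z * \<gamma>" "u / v = a * s * z / \<gamma>" "x * v = k * \<gamma>" "x / v = k * (a / b) / \<gamma>"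
    "u * y = b * s * z / \<gamma>" "u / y = a * s * z * \<gamma>" "y * v = b / a" "y / v = 1 / \<gamma>\<^sup>2" "x * u = c * Q * z" "x / u = 1 / (d * z)"
  proof -
    show "x * y = k / \<gamma>" "u * v = b * s * z * \<gamma>" "x * v = k * \<gamma>" "u * y = b * s * z / \<gamma>" using u0 nz z by (simp_all add: x_def y_def v_def)
    have "x / y = k * \<gamma> * (u * u) / ((b * s * z) * (b * s * z))" by (simp add: x_def y_def mult_ac)
    then show "x / y = k * (a / b) * \<gamma>" unfolding u2 using nz z by simp
    have "u / v = (u * u) / (b * s * z * \<gamma>)" by (simp add: v_def)
    then show "u / v = a * s * z / \<gamma>" unfolding u2 using nz z by simp
    have "x / v = k * (u * u) / (\<gamma> * (b * s * z * (b * s * z)))" by (simp add: x_def v_def mult_ac)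
    then show "x / v = k * (a / b) / \<gamma>" unfolding u2 using nz z by simp
    have "u / y = \<gamma> * (u * u) / (b * s * z)" by (simp add: y_def)
    then show "u / y = a * s * z * \<gamma>" unfolding u2 using nz z by simp
    have "y * v = b * s * z * (b * s * z) / (u * u)" using g by (simp add: y_def v_def)
    then show "y * v = b / a" unfolding u2 using nz z by simp
    show "y / v = 1 / \<gamma>\<^sup>2" using u0 nz z g by (simp add: y_def v_def power2_eq_square)
    have "x * u = k * (u * u) / (b * s * z)" by (simp add: x_def)
    then show "x * u = c * Q * z" unfolding u2 k_def using nz z by simp
    have "x / u = k / (b * s * z)" using u0 by (simp add: x_def)
    also have "\<dots> = c * Q / (s * s * a * b * z)" by (simp add: k_def mult_ac)
    also have "\<dots> = 1 / (d * z)" unfolding s_sq3 using nz z by simp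
    finally show "x / u = 1 / (d * z)" .
  qed
  have q1: "th (d * Q / (a * s) / w) = th (k * (a / b) * w)" if "w \<noteq> 0" for w
  proof -
    have "Q / (d * Q / (a * s) / w) = a * s * w / d" using nz that by simp
    also have "\<dots> = k * (a / b) * w"
    proof -
      have "k * (a / b) * w = (c * d * Q) * w / (s * b * d)" using nz by (simp add: k_def)
      also have "\<dots> = a * s * w / d" unfolding s_sq3[symmetric] using nz by simp
      finally show ?thesis ..
    qed
    finally show ?thesis using th_inv[of "d * Q / (a * s) / w"] nz that by simp
  qed
  have k1: "kk (inverse \<gamma>) = th (k / \<gamma>) * th (k * (a / b) * \<gamma>)" "kk \<gamma> = th (k * \<gamma>) * th (k * (a / b) / \<gamma>)"
    using q1[OF g] q1[of "inverse \<gamma>"] g unfolding kk_def k_def[symmetric] by (simp_all add: divide_inverse)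
  have T: "th (k / \<gamma>) * th (k * (a / b) * \<gamma>) * th (b * s * z * \<gamma>) * th (a * s * z / \<gamma>) - th (k * \<gamma>) * th (k * (a / b) / \<gamma>) * th (b * s * z / \<gamma>) * th (a * s * z * \<gamma>)
    = a * s * z * \<gamma> * (th (b / a) * th (1 / \<gamma>\<^sup>2) * th (c * Q * z) * th (1 / (d * z)))"
    using theta_three_term[OF n0] unfolding e .
  have t1: "th (c * Q * z) = - th (c * z) / (c * z)" using th_mult_q[of "c * z"] nz z by (simp add: mult_ac)
  have t2: "th (1 / (d * z)) = - th (d * z) / (d * z)" using th_inverse[of "d * z"] nz z by simp
  have R: "a * s * z * \<gamma> * (th (b / a) * th (1 / \<gamma>\<^sup>2) * th (c * Q * z) * th (1 / (d * z))) = a * s * \<gamma> * th (b / a) * th (1 / \<gamma>\<^sup>2) * th (c * z) * th (d * z) / (c * d * z)"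
    unfolding t1 t2 using z by (simp add: mult_ac)
  have c2: "chatd \<gamma> z * chat (inverse \<gamma>) z = pinf (s * \<gamma>) * pinf (s / \<gamma>) * kk \<gamma> * th (b * s * z / \<gamma>) * th (a * s * z * \<gamma>) / (prodc * (th (a * z) * th (b * z)))"
    using chat_cross[of "inverse \<gamma>" z] g by (simp add: divide_inverse mult_ac)
  have "chat \<gamma> z * chatd (inverse \<gamma>) z - chatd \<gamma> z * chat (inverse \<gamma>) z =
    pinf (s * \<gamma>) * pinf (s / \<gamma>) * (th (k / \<gamma>) * th (k * (a / b) * \<gamma>) * th (b * s * z * \<gamma>) * th (a * s * z / \<gamma>) - th (k * \<gamma>) * th (k * (a / b) / \<gamma>) * th (b * s * z / \<gamma>) * th (a * s * z * \<gamma>))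
      / (prodc * (th (a * z) * th (b * z)))"
    unfolding chat_cross[OF g] c2 k1 by (simp add: diff_divide_distrib[symmetric] right_diff_distrib mult_ac)
  then show ?thesis unfolding T R .
qed

text \<open>Needed for the mixed entry \<open>v2\<close>. It produces the factor
  \<open>kk \<gamma>\<close>, which together with the \<open>kk (inverse \<gamma>)\<close> of
  \<open>chat_cross\<close> cancels against the product of the two determinants
  \<open>Delta\<close>.\<close>

lemma theta_cross:
  assumes g: "\<gamma> \<noteq> 0" and mp: "m \<noteq> 0" "p \<noteq> 0"
  shows "th (b * s * m * \<gamma>) * th (a * s * m / \<gamma>) * (th (c * p) * th (d * p)) / p - th (b * s * p * \<gamma>) * th (a * s * p / \<gamma>) * (th (c * m) * th (d * m)) / m
    = - (kk \<gamma> * th (c * d * m * p) * th (m / p) / m)"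
proof -
  define u where "u = csqrt (a * b) * s * p"
  have u2: "u * u = s * s * a * b * (p * p)" using power2_csqrt[of "a * b"] by (simp add: u_def power2_eq_square mult_ac)
  have u0: "u \<noteq> 0" using u2 nz mp by auto
  have u3: "u * u = c * d * Q * (p * p)" unfolding u2 s_sq3 ..
  define x v y where "x = u * m / p" and "v = c * Q * p / u" and "y = b * s * p * \<gamma> / u"
  have n0: "x \<noteq> 0" "y \<noteq> 0" "u \<noteq> 0" "v \<noteq> 0" using u0 nz mp g by (auto simp: x_def y_def v_def)
  have e: "x * y = b * s * m * \<gamma>" "x / y = a * s * m / \<gamma>" "u * v = c * Q * p" "u / v = d * p" "x * v = c * Q * m" "x / v = d * m"
    "u * y = b * s * p * \<gamma>" "u / y = a * s * p / \<gamma>" "y * v = c * Q / (a * s) * \<gamma>" "y / v = d / (a * s) * \<gamma>" "x * u = c * d * Q * (m * p)" "x / u = m / p"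
  proof -
    show "x * y = b * s * m * \<gamma>" "u * v = c * Q * p" "x * v = c * Q * m" "u * y = b * s * p * \<gamma>" "x / u = m / p" using u0 mp by (simp_all add: x_def y_def v_def)
    have "x / y = (u * u) * m / (p * (b * s * p * \<gamma>))" by (simp add: x_def y_def)
    then show "x / y = a * s * m / \<gamma>" unfolding u2 using nz mp by simp
    have "u / v = (u * u) / (c * Q * p)" by (simp add: v_def)
    then show "u / v = d * p" unfolding u3 using nz mp by simp
    have "x / v = (u * u) * m / (p * (c * Q * p))" by (simp add: x_def v_def)
    then show "x / v = d * m" unfolding u3 using nz mp by simp
    have "u / y = (u * u) / (b * s * p * \<gamma>)" by (simp add: y_def)
    then show "u / y = a * s * p / \<gamma>" unfolding u2 using nz mp by simp
    have "y * v = b * s * p * \<gamma> * (c * Q * p) / (u * u)" by (simp add: y_def v_def)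
    then show "y * v = c * Q / (a * s) * \<gamma>" unfolding u2 using nz mp by (simp add: mult_ac)
    have "y / v = b * s * \<gamma> / (c * Q)" using u0 mp by (simp add: y_def v_def)
    also have "\<dots> = (s * s * a * b) * \<gamma> / (c * Q * (a * s))" using nz by simp
    also have "\<dots> = d / (a * s) * \<gamma>" unfolding s_sq3 using nz by simp
    finally show "y / v = d / (a * s) * \<gamma>" .
    have "x * u = (u * u) * m / p" by (simp add: x_def)
    then show "x * u = c * d * Q * (m * p)" unfolding u3 using mp by simp
  qed
  have T: "th (b * s * m * \<gamma>) * th (a * s * m / \<gamma>) * th (c * Q * p) * th (d * p) - th (c * Q * m) * th (d * m) * th (b * s * p * \<gamma>) * th (a * s * p / \<gamma>)
    = a * s * p / \<gamma> * (th (c * Q / (a * s) * \<gamma>) * th (d / (a * s) * \<gamma>) * th (c * d * Q * (m * p)) * th (m / p))"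
    using theta_three_term[OF n0] unfolding e .
  have t1: "th (c * Q * w) = - th (c * w) / (c * w)" if "w \<noteq> 0" for w using th_mult_q[of "c * w"] nz that by (simp add: mult_ac)
  have t2: "th (c * d * Q * (m * p)) = - th (c * d * m * p) / (c * d * m * p)" using th_mult_q[of "c * d * m * p"] nz mp by (simp add: mult_ac)
  have t3: "th (d / (a * s) * \<gamma>) = - (d / (a * s) * \<gamma>) * th (d * Q / (a * s) * \<gamma>)"
    using th_mult_q[of "d / (a * s) * \<gamma>"] nz g by (simp add: mult_ac field_simps)
  have "- c * (th (b * s * m * \<gamma>) * th (a * s * m / \<gamma>) * th (c * Q * p) * th (d * p) - th (c * Q * m) * th (d * m) * th (b * s * p * \<gamma>) * th (a * s * p / \<gamma>))
     = th (b * s * m * \<gamma>) * th (a * s * m / \<gamma>) * (th (c * p) * th (d * p)) / p - th (b * s * p * \<gamma>) * th (a * s * p / \<gamma>) * (th (c * m) * th (d * m)) / m"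
  proof -
    have "- c * th (c * Q * w) = th (c * w) / w" if "w \<noteq> 0" for w using t1[OF that] nz that by simp
    note k = this[OF mp(1)] this[OF mp(2)]
    have aux: "- c * (B1 * A1 * C1 * D1 - C2 * D2 * B2 * A2) = B1 * A1 * ((- c * C1) * D1) - B2 * A2 * ((- c * C2) * D2)" for A1 B1 C1 D1 A2 B2 C2 D2
      by (simp add: algebra_simps)
    show ?thesis unfolding aux k by simp
  qed
  moreover have "- c * (a * s * p / \<gamma> * (th (c * Q / (a * s) * \<gamma>) * th (d / (a * s) * \<gamma>) * th (c * d * Q * (m * p)) * th (m / p)))
      = - (kk \<gamma> * th (c * d * m * p) * th (m / p) / m)"
    unfolding t2 t3 kk_def using nz mp g by (simp add: field_simps)
  ultimately show ?thesis unfolding T by simp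
qed

end

section \<open>Spectral measures and Stieltjes inversion\<close>

text \<open>A constant instead of a lambda term, so that the linearity of the inner product, of the
  operator and of the projections can be used for rewriting.\<close>

definition lincomb :: "complex \<Rightarrow> (real \<Rightarrow> complex) \<Rightarrow> complex \<Rightarrow> (real \<Rightarrow> complex) \<Rightarrow> real \<Rightarrow> complex" where
  "lincomb \<alpha> f \<beta> g = (\<lambda>x. \<alpha> * f x + \<beta> * g x)"

section \<open>Spectral measures given through quadratic forms\<close>

locale spectral_resolution =
  fixes H :: "(real \<Rightarrow> complex) set" and ip :: "(real \<Rightarrow> complex) \<Rightarrow> (real \<Rightarrow> complex) \<Rightarrow> complex"
    and D :: "(real \<Rightarrow> complex) set" and T :: "(real \<Rightarrow> complex) \<Rightarrow> real \<Rightarrow> complex"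
    and E :: "real set \<Rightarrow> (real \<Rightarrow> complex) \<Rightarrow> real \<Rightarrow> complex"
  assumes H_lincomb: "\<And>\<alpha> f \<beta> g. f \<in> H \<Longrightarrow> g \<in> H \<Longrightarrow> lincomb \<alpha> f \<beta> g \<in> H"
    and ip_lincomb: "\<And>\<alpha> f \<beta> g h. f \<in> H \<Longrightarrow> g \<in> H \<Longrightarrow> h \<in> H \<Longrightarrow> ip (lincomb \<alpha> f \<beta> g) h = \<alpha> * ip f h + \<beta> * ip g h"
    and ip_herm: "\<And>f g. f \<in> H \<Longrightarrow> g \<in> H \<Longrightarrow> ip g f = cnj (ip f g)"
    and ip_pos: "\<And>f. f \<in> H \<Longrightarrow> 0 \<le> Re (ip f f)"
    and D_lincomb: "\<And>\<alpha> f \<beta> g. f \<in> D \<Longrightarrow> g \<in> D \<Longrightarrow> lincomb \<alpha> f \<beta> g \<in> D"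
    and T_H: "\<And>f. f \<in> D \<Longrightarrow> T f \<in> H"
    and T_lincomb: "\<And>\<alpha> f \<beta> g. T (lincomb \<alpha> f \<beta> g) = lincomb \<alpha> (T f) \<beta> (T g)"
    and sep: "\<And>f. f \<in> H \<Longrightarrow> (\<And>h. h \<in> D \<Longrightarrow> ip f h = 0) \<Longrightarrow> f = (\<lambda>_. 0)"
    and sm: "spectral_measure_of H ip D T E"
begin

lemma pvm: "projection_valued_measure H ip E" using sm by (simp add: spectral_measure_of_def)

lemmas pvm' = pvm[unfolded projection_valued_measure_def]
lemmas E_H = pvm'[THEN conjunct1, rule_format]
lemmas E_lincomb = pvm'[THEN conjunct2, THEN conjunct1, rule_format, folded lincomb_def]
lemmas E_sym = pvm'[THEN conjunct2, THEN conjunct2, THEN conjunct2, THEN conjunct1, rule_format]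
lemmas E_UNIV = pvm'[THEN conjunct2, THEN conjunct2, THEN conjunct2, THEN conjunct2, THEN conjunct1, rule_format]
lemmas E_Int = pvm'[THEN conjunct2, THEN conjunct2, THEN conjunct2, THEN conjunct2, THEN conjunct2, THEN conjunct1, rule_format]
lemmas E_sums = pvm'[THEN conjunct2, THEN conjunct2, THEN conjunct2, THEN conjunct2, THEN conjunct2, THEN conjunct2, rule_format]

lemma D_eq: "D = {f \<in> H. (\<integral>\<^sup>+ t. ennreal (t\<^sup>2) \<partial>spectral_distr ip E f) < \<infinity>}"
  by (rule sm[unfolded spectral_measure_of_def, THEN conjunct2, THEN conjunct1])

lemma T_ip: "f \<in> D \<Longrightarrow> ip (T f) f = of_real (\<integral> t. t \<partial>spectral_distr ip E f)"
  using sm[unfolded spectral_measure_of_def, THEN conjunct2, THEN conjunct2] by (rule bspec)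

lemma D_H: "f \<in> D \<Longrightarrow> f \<in> H" using D_eq by blast

lemma ip_cb2: "f \<in> H \<Longrightarrow> g \<in> H \<Longrightarrow> h \<in> H \<Longrightarrow> ip h (lincomb \<alpha> f \<beta> g) = cnj \<alpha> * ip h f + cnj \<beta> * ip h g"
  using ip_herm[of "lincomb \<alpha> f \<beta> g" h] ip_lincomb[of f g h \<alpha> \<beta>] ip_herm[of f h] ip_herm[of g h] H_lincomb by simp

lemma ip_real: "f \<in> H \<Longrightarrow> ip f f = of_real (Re (ip f f))"
  using ip_herm[of f f] by (metis complex_is_Real_iff of_real_Re Reals_cnj_iff)

lemma E_empty: assumes "f \<in> H" "g \<in> H" shows "ip (E {} f) g = 0"
proof -
  have "(\<lambda>n::nat. ip (E {} f) g) sums ip (E (\<Union>n::nat. {}) f) g"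
    by (rule E_sums) (use assms in \<open>auto simp: disjoint_family_on_def\<close>)
  then have "(\<lambda>n::nat. ip (E {} f) g) \<longlonglongrightarrow> 0" using sums_summable summable_LIMSEQ_zero by blast
  then show ?thesis by (simp add: LIMSEQ_const_iff)
qed

lemma E_nonneg: assumes "B \<in> sets borel" "f \<in> H"
  shows "ip (E B f) f = of_real (Re (ip (E B f) f))" "0 \<le> Re (ip (E B f) f)" "ip (E B f) f = ip (E B f) (E B f)"
proof -
  have "E B (E B f) = E B f" using E_Int[OF assms(1) assms(1) assms(2)] by simp
  then show e: "ip (E B f) f = ip (E B f) (E B f)" using E_sym[OF assms(1) E_H[OF assms] assms(2)] by simp
  show "ip (E B f) f = of_real (Re (ip (E B f) f))" "0 \<le> Re (ip (E B f) f)"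
    unfolding e using ip_real[OF E_H[OF assms]] ip_pos[OF E_H[OF assms]] by simp_all
qed

abbreviation "mu \<equiv> spectral_distr ip E"

lemma sets_mu [simp, measurable_cong]: "sets (mu f) = sets borel" and space_mu [simp]: "space (mu f) = UNIV"
  unfolding spectral_distr_def by (simp_all add: sets_measure_of_conv space_measure_of_conv sets.sigma_sets_eq[of borel, simplified])

lemma emeasure_mu:
  assumes f: "f \<in> H" and B: "B \<in> sets borel"
  shows "emeasure (mu f) B = ennreal (Re (ip (E B f) f))"
proof (rule emeasure_measure_of[OF spectral_distr_def])
  show "B \<in> sets (mu f)" using B by simp
  show "positive (sets (mu f)) (\<lambda>B. ennreal (Re (ip (E B f) f)))"
    using E_empty[OF f f] by (simp add: positive_def)
  show "countably_additive (sets (mu f)) (\<lambda>B. ennreal (Re (ip (E B f) f)))"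
  proof (rule countably_additiveI)
    fix A :: "nat \<Rightarrow> real set" assume A: "range A \<subseteq> sets (mu f)" "disjoint_family A" "\<Union> (range A) \<in> sets (mu f)"
    have s: "(\<lambda>n. Re (ip (E (A n) f) f)) sums Re (ip (E (\<Union>n. A n) f) f)"
      using A E_sums[OF _ _ f f] by (intro sums_Re) auto
    have "(\<Sum>n. ennreal (Re (ip (E (A n) f) f))) = ennreal (\<Sum>n. Re (ip (E (A n) f) f))"
      by (rule suminf_ennreal2) (use A E_nonneg(2)[OF _ f] sums_summable[OF s] in auto)
    then show "(\<Sum>n. ennreal (Re (ip (E (A n) f) f))) = ennreal (Re (ip (E (\<Union> (range A)) f) f))"
      using sums_unique[OF s] by simp
  qed
qed auto

lemma finite_mu: "f \<in> H \<Longrightarrow> finite_measure (mu f)"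
  by (rule finite_measureI) (simp add: emeasure_mu)

lemma measure_mu: "f \<in> H \<Longrightarrow> B \<in> sets borel \<Longrightarrow> measure (mu f) B = Re (ip (E B f) f)"
  unfolding measure_def emeasure_mu using E_nonneg(2) by simp

lemma emeasure_mu_UNIV: "f \<in> H \<Longrightarrow> emeasure (mu f) UNIV = ennreal (Re (ip f f))"
  by (simp add: emeasure_mu E_UNIV)

lemma mu_E:
  assumes B: "B \<in> sets borel" and f: "f \<in> H"
  shows "mu (E B f) = density (mu f) (indicator B)"
proof (rule measure_eqI)
  fix A assume "A \<in> sets (mu (E B f))"
  then have A: "A \<in> sets borel" by simp
  have "ip (E A (E B f)) (E B f) = ip (E (A \<inter> B) f) f"
  proof -
    have "ip (E A (E B f)) (E B f) = ip (E B (E A (E B f))) f"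
      by (rule E_sym[symmetric]) (use A B f E_H in auto)
    also have "E B (E A (E B f)) = E (B \<inter> (A \<inter> B)) f"
      using A B f by (simp add: E_Int)
    also have "B \<inter> (A \<inter> B) = A \<inter> B" by blast
    finally show ?thesis .
  qed
  then show "emeasure (mu (E B f)) A = emeasure (density (mu f) (indicator B)) A"
    using A B f by (simp add: emeasure_mu E_H emeasure_density nn_integral_indicator' indicator_inter_arith[symmetric] Int_commute)
qed simp

lemma D_E: assumes B: "B \<in> sets borel" and f: "f \<in> D" shows "E B f \<in> D"
proof -
  have "(\<integral>\<^sup>+ t. ennreal (t\<^sup>2) \<partial>mu (E B f)) = (\<integral>\<^sup>+ t. indicator B t * ennreal (t\<^sup>2) \<partial>mu f)"
    unfolding mu_E[OF B D_H[OF f]] by (rule nn_integral_density) (use B in auto)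
  also have "\<dots> \<le> (\<integral>\<^sup>+ t. ennreal (t\<^sup>2) \<partial>mu f)"
    by (rule nn_integral_mono) (auto simp: indicator_def)
  also have "\<dots> < \<infinity>" using f D_eq by blast
  finally show ?thesis using D_eq E_H[OF B D_H[OF f]] by blast
qed

lemma D_bounded:
  assumes B: "B \<in> sets borel" "B \<subseteq> {- K..K}" and f: "f \<in> H"
  shows "E B f \<in> D"
proof -
  have "(\<integral>\<^sup>+ t. ennreal (t\<^sup>2) \<partial>mu (E B f)) = (\<integral>\<^sup>+ t. indicator B t * ennreal (t\<^sup>2) \<partial>mu f)"
    unfolding mu_E[OF B(1) f] by (rule nn_integral_density) (use B in auto)
  also have "\<dots> \<le> (\<integral>\<^sup>+ t. ennreal (K\<^sup>2) \<partial>mu f)"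
  proof (rule nn_integral_mono)
    fix t
    show "indicator B t * ennreal (t\<^sup>2) \<le> ennreal (K\<^sup>2)"
    proof (cases "t \<in> B")
      case True
      then have "t \<in> {- K..K}" by (rule subsetD[OF B(2)])
      then have "\<bar>t\<bar> \<le> \<bar>K\<bar>" by auto
      then have "t\<^sup>2 \<le> K\<^sup>2" by (simp add: abs_le_square_iff)
      then show ?thesis using True by (simp add: ennreal_leI)
    qed simp
  qed
  also have "\<dots> = ennreal (K\<^sup>2) * ennreal (Re (ip f f))" using f by (simp add: emeasure_mu_UNIV)
  also have "\<dots> < \<infinity>" by (simp add: ennreal_mult_less_top)
  finally show ?thesis using D_eq E_H[OF B(1) f] by blast
qed

lemma D_integrable: assumes "f \<in> D" shows "integrable (mu f) (\<lambda>t. t)"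
proof -
  interpret finite_measure "mu f" using finite_mu D_H assms by blast
  have "integrable (mu f) (\<lambda>t. t\<^sup>2)"
    by (rule integrableI_bounded) (use assms D_eq in auto)
  then have "integrable (mu f) (\<lambda>t. 1 + t\<^sup>2)" by simp
  then show ?thesis
  proof (rule Bochner_Integration.integrable_bound)
    show "AE t in mu f. norm t \<le> norm (1 + t\<^sup>2)"
    proof (rule AE_I2)
      fix t :: real
      have "0 \<le> (\<bar>t\<bar> - 1) * (\<bar>t\<bar> - 1)" by (rule zero_le_square)
      also have "\<dots> = t * t - 2 * \<bar>t\<bar> + 1" using abs_mult_self_eq[of t] by (simp add: algebra_simps)
      finally have "2 * \<bar>t\<bar> \<le> 1 + t * t" by linarith
      moreover have "norm (1 + t\<^sup>2) = 1 + t * t" by (simp add: power2_eq_square)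
      ultimately show "norm t \<le> norm (1 + t\<^sup>2)" by simp
    qed
  qed simp
qed

text \<open>The distribution of \<open>E B w\<close> is that of \<open>w\<close> restricted to
  \<open>B\<close>, so the integral of \<open>t\<close> splits. That the form of \<open>T\<close>
  has no cross terms between the two parts is the starting point for \<open>E_T\<close>.\<close>

lemma Q_split:
  assumes B: "B \<in> sets borel" and w: "w \<in> D"
  shows "ip (T w) w = ip (T (E B w)) (E B w) + ip (T (E (- B) w)) (E (- B) w)"
proof -
  have nB: "- B \<in> sets borel" using B by (metis Compl_eq_Diff_UNIV sets.compl_sets space_borel)
  have 1: "(\<integral> t. t \<partial>mu (E A w)) = (\<integral> t. indicator A t * t \<partial>mu w)" if A: "A \<in> sets borel" for A
  proof -
    have "density (mu w) (indicator A) = density (mu w) (\<lambda>t. ennreal (indicator A t))" by (simp add: ennreal_indicator)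
    then show ?thesis unfolding mu_E[OF A D_H[OF w]]
      using A by (simp add: integral_density)
  qed
  have i: "integrable (mu w) (\<lambda>t. indicator A t * t)" if "A \<in> sets borel" for A
    using integrable_mult_indicator[of A "mu w" "\<lambda>t. t"] that D_integrable[OF w] by simp
  have "(\<integral> t. t \<partial>mu w) = (\<integral> t. indicator B t * t + indicator (- B) t * t \<partial>mu w)"
    by (rule Bochner_Integration.integral_cong) (auto simp: indicator_def)
  also have "\<dots> = (\<integral> t. indicator B t * t \<partial>mu w) + (\<integral> t. indicator (- B) t * t \<partial>mu w)"
    by (rule Bochner_Integration.integral_add[OF i[OF B] i[OF nB]])
  finally show ?thesis using T_ip[OF w] T_ip[OF D_E[OF B w]] T_ip[OF D_E[OF nB w]] by (simp add: 1[OF B] 1[OF nB])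
qed

lemma E_disjoint: assumes "B \<in> sets borel" "B' \<in> sets borel" "B \<inter> B' = {}" "f \<in> H" shows "E B (E B' f) = (\<lambda>_. 0)"
proof -
  have "E B (E B' f) = E {} f" using E_Int[OF assms(1,2,4)] assms(3) by simp
  moreover have "E {} f = (\<lambda>_. 0)" by (rule sep) (use E_H[of "{}" f] assms E_empty[of f] D_H in auto)
  ultimately show ?thesis by simp
qed

lemma lincomb_zero [simp]: "lincomb \<alpha> f \<beta> (\<lambda>_. 0) = lincomb \<alpha> f 0 f" "lincomb \<alpha> (\<lambda>_. 0) \<beta> f = lincomb \<beta> f 0 f" "lincomb 1 f 0 g = f"
  by (auto simp: lincomb_def)

lemma E_compl_lincomb: assumes B: "B \<in> sets borel" and f: "f \<in> H" shows "lincomb 1 (E B f) 1 (E (- B) f) = f"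
proof -
  have nB: "- B \<in> sets borel" using B by (metis Compl_eq_Diff_UNIV sets.compl_sets space_borel)
  define z where "z = lincomb 1 (lincomb 1 (E B f) 1 (E (- B) f)) (-1) f"
  have zH: "z \<in> H" unfolding z_def by (intro H_lincomb E_H B nB f)
  have "z = (\<lambda>_. 0)"
  proof (rule sep[OF zH])
    fix h assume "h \<in> D"
    then have h: "h \<in> H" by (rule D_H)
    have "(\<lambda>n. ip (E (binaryset B (- B) n) f) h) sums (ip (E B f) h + ip (E (- B) f) h)"
      by (rule binaryset_sums[where f = "\<lambda>A. ip (E A f) h"]) (use E_empty[OF f h] in simp)
    moreover have "(\<lambda>n. ip (E (binaryset B (- B) n) f) h) sums ip (E (\<Union>n. binaryset B (- B) n) f) h"
      by (rule E_sums) (use B nB f h in \<open>auto simp: range_binaryset_eq disjoint_family_on_def binaryset_def split: if_splits\<close>)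
    ultimately have "ip (E B f) h + ip (E (- B) f) h = ip (E (\<Union>n. binaryset B (- B) n) f) h"
      by (rule sums_unique2)
    also have "(\<Union>n. binaryset B (- B) n) = UNIV" by (simp add: UN_binaryset_eq)
    finally have "ip (E B f) h + ip (E (- B) f) h = ip f h" unfolding E_UNIV[OF f] .
    then show "ip z h = 0" unfolding z_def using B nB f h by (simp add: ip_lincomb H_lincomb E_H)
  qed
  show ?thesis
  proof
    fix x
    have "z x = 0" unfolding \<open>z = (\<lambda>_. 0)\<close> ..
    then show "lincomb 1 (E B f) 1 (E (- B) f) x = f x" by (simp add: z_def lincomb_def)
  qed
qed

text \<open>Commutation has to be won from the quadratic form. Polarizing \<open>Q_split\<close>
  shows that \<open>T (E B u)\<close> is orthogonal to the range of \<open>E (- B)\<close>, so it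
  lies in the range of \<open>E B\<close>.\<close>

lemma E_T:
  assumes B: "B \<in> sets borel" and u: "u \<in> D"
  shows "T (E B u) = E B (T u)"
proof -
  have nB: "- B \<in> sets borel" using B by (metis Compl_eq_Diff_UNIV sets.compl_sets space_borel)
  have orth: "ip (T (E B u)) (E (- B) h) = 0" if B: "B \<in> sets borel" and nB: "- B \<in> sets borel" and u: "u \<in> D" and h: "h \<in> D" for B u h
  proof -
    define v v' where "v = E B u" and "v' = E (- B) h"
    have vD: "v \<in> D" "v' \<in> D" unfolding v_def v'_def using D_E B nB u h by auto
    note vH = D_H[OF vD(1)] D_H[OF vD(2)] T_H[OF vD(1)] T_H[OF vD(2)]
    have x: "cnj \<beta> * ip (T v) v' + \<beta> * ip (T v') v = 0" for \<beta>
    proof -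
      define w where "w = lincomb 1 v \<beta> v'"
      have wD: "w \<in> D" unfolding w_def by (intro D_lincomb vD)
      have EB: "E B v = v" "E B v' = (\<lambda>_. 0)" "E (- B) v = (\<lambda>_. 0)" "E (- B) v' = v'"
        unfolding v_def v'_def using E_Int[OF B B D_H[OF u]] E_Int[OF nB nB D_H[OF h]]
          E_disjoint[OF B nB _ D_H[OF h]] E_disjoint[OF nB B _ D_H[OF u]] by auto
      have "E B w = v" unfolding w_def E_lincomb[OF B vH(1,2)] EB by (auto simp: lincomb_def)
      moreover have "E (- B) w = lincomb \<beta> v' 0 v'" unfolding w_def E_lincomb[OF nB vH(1,2)] EB by (auto simp: lincomb_def)
      ultimately have "ip (T w) w = ip (T v) v + ip (T (lincomb \<beta> v' 0 v')) (lincomb \<beta> v' 0 v')" using Q_split[OF B wD] by simp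
      then show ?thesis unfolding w_def T_lincomb using vH by (simp add: ip_lincomb ip_cb2 H_lincomb algebra_simps)
    qed
    \<comment> \<open>The cross term vanishes for every \<open>\<beta>\<close>; the values 1 and
      \<open>\<i>\<close> give the sum and the difference of the two inner products.\<close>
    have "ip (T v) v' + ip (T v') v = 0" "ip (T v) v' = ip (T v') v" using x[of 1] x[of \<i>] by (simp_all add: algebra_simps)
    then show ?thesis unfolding v_def v'_def by simp
  qed
  have z: "E (- B) (T (E B u)) = (\<lambda>_. 0)" if B: "B \<in> sets borel" and nB: "- B \<in> sets borel" for B
  proof (rule sep)
    have TH: "T (E B u) \<in> H" by (rule T_H[OF D_E[OF B u]])
    then show "E (- B) (T (E B u)) \<in> H" by (rule E_H[OF nB])
    fix h assume h: "h \<in> D"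
    show "ip (E (- B) (T (E B u))) h = 0" unfolding E_sym[OF nB TH D_H[OF h]] by (rule orth[OF B nB u h])
  qed
  have TH: "T (E B u) \<in> H" "T (E (- B) u) \<in> H" using T_H D_E B nB u by auto
  have "T u = lincomb 1 (T (E B u)) 1 (T (E (- B) u))" using E_compl_lincomb[OF B D_H[OF u]] T_lincomb[of 1 "E B u" 1 "E (- B) u"] by simp
  then have "E B (T u) = lincomb 1 (E B (T (E B u))) 1 (E B (T (E (- B) u)))" using E_lincomb[OF B TH] by simp
  also have "E B (T (E (- B) u)) = (\<lambda>_. 0)" using z[of "- B"] B nB by simp
  also have "lincomb 1 (E B (T (E B u))) 1 (\<lambda>_. 0) = lincomb 1 (E B (T (E B u))) 1 (E (- B) (T (E B u)))" unfolding z[OF B nB] ..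
  also have "\<dots> = T (E B u)" by (rule E_compl_lincomb[OF B TH(1)])
  finally show ?thesis ..
qed

definition N :: "(real \<Rightarrow> complex) \<Rightarrow> real" where "N f = Re (ip f f)"

lemma N_nonneg: "f \<in> H \<Longrightarrow> 0 \<le> N f" unfolding N_def by (rule ip_pos)

lemma N_lincomb: "f \<in> H \<Longrightarrow> g \<in> H \<Longrightarrow> N (lincomb \<alpha> f \<beta> g) = (norm \<alpha>)\<^sup>2 * N f + (norm \<beta>)\<^sup>2 * N g + 2 * Re (\<alpha> * cnj \<beta> * ip f g)"
proof -
  assume f: "f \<in> H" and g: "g \<in> H"
  have "ip (lincomb \<alpha> f \<beta> g) (lincomb \<alpha> f \<beta> g) = (\<alpha> * cnj \<alpha>) * ip f f + (\<beta> * cnj \<beta>) * ip g g + (\<alpha> * cnj \<beta> * ip f g + cnj (\<alpha> * cnj \<beta> * ip f g))"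
    using f g ip_herm[OF f g] by (simp add: ip_lincomb ip_cb2 H_lincomb algebra_simps)
  also have "\<dots> = of_real ((norm \<alpha>)\<^sup>2 * N f + (norm \<beta>)\<^sup>2 * N g + 2 * Re (\<alpha> * cnj \<beta> * ip f g))"
    unfolding complex_add_cnj complex_norm_square[symmetric] using ip_real[OF f] ip_real[OF g] by (simp add: N_def)
  finally show ?thesis by (simp only: N_def Re_complex_of_real)
qed

text \<open>On the range of \<open>E B\<close> with \<open>B\<close> close to \<open>t0\<close>, the operator is close to \<open>t0\<close>.\<close>

lemma local_bound:
  assumes B: "B \<in> sets borel" "B \<subseteq> {t0 - \<delta>..t0 + \<delta>}" and d: "0 < \<delta>" and u: "u \<in> D"
  defines "v \<equiv> E B u"
  defines "y \<equiv> lincomb 1 (T v) (- of_real t0) v"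
  shows "ip y v \<in> \<real>" "\<bar>Re (ip y v)\<bar> \<le> \<delta> * N v" "N y \<le> \<delta>\<^sup>2 * N v"
proof -
  have Bb: "B \<subseteq> {- (\<bar>t0\<bar> + \<delta>)..\<bar>t0\<bar> + \<delta>}"
  proof
    fix t assume "t \<in> B"
    then have "t \<in> {t0 - \<delta>..t0 + \<delta>}" by (rule subsetD[OF B(2)])
    then show "t \<in> {- (\<bar>t0\<bar> + \<delta>)..\<bar>t0\<bar> + \<delta>}" by (cases "0 \<le> t0") (simp_all add: abs_if)
  qed
  \<comment> \<open>For \<open>w\<close> in the range of \<open>E B\<close> the distribution is
    carried by \<open>B\<close>, where \<open>t - t0\<close> is at most \<open>\<delta>\<close> in
    absolute value.\<close>
  have q: "ip (lincomb 1 (T w) (- of_real t0) w) w \<in> \<real> \<and> \<bar>Re (ip (lincomb 1 (T w) (- of_real t0) w) w)\<bar> \<le> \<delta> * N w" if w: "w \<in> D" and EB: "E B w = w" for w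
  proof -
    interpret finite_measure "mu w" using finite_mu D_H w by blast
    have wH: "w \<in> H" by (rule D_H[OF w])
    have "ip (lincomb 1 (T w) (- of_real t0) w) w = of_real (\<integral> t. t \<partial>mu w) - of_real t0 * of_real (N w)"
      using T_ip[OF w] ip_real[OF wH] by (simp add: ip_lincomb T_H w wH N_def)
    also have "N w = (\<integral> t. 1 \<partial>mu w)"
      using measure_mu[OF wH, of UNIV] by (simp add: N_def E_UNIV[OF wH])
    also have "of_real (\<integral> t. t \<partial>mu w) - of_real t0 * of_real (\<integral> t. 1 \<partial>mu w) = complex_of_real (\<integral> t. t - t0 \<partial>mu w)"
      using D_integrable[OF w] by simp
    finally have e: "ip (lincomb 1 (T w) (- of_real t0) w) w = complex_of_real (\<integral> t. t - t0 \<partial>mu w)" .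
    have "AE t in mu w. \<bar>t - t0\<bar> \<le> \<delta>"
    proof -
      have eq: "density (mu w) (indicator B) = mu w" using mu_E[OF B(1) wH] EB by simp
      have "AE t in density (mu w) (indicator B). \<bar>t - t0\<bar> \<le> \<delta>"
      proof (subst AE_density)
        show "indicator B \<in> borel_measurable (mu w)" using B by simp
        show "AE t in mu w. 0 < (indicator B t :: ennreal) \<longrightarrow> \<bar>t - t0\<bar> \<le> \<delta>"
        proof (rule AE_I2, rule impI)
          fix t assume "0 < (indicator B t :: ennreal)"
          then have "t \<in> B" by (cases "t \<in> B") simp_all
          then have "t \<in> {t0 - \<delta>..t0 + \<delta>}" by (rule subsetD[OF B(2)])
          then show "\<bar>t - t0\<bar> \<le> \<delta>" by (simp add: abs_le_iff)
        qed
      qed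
      then show ?thesis unfolding eq .
    qed
    then have AEn: "AE t in mu w. norm (t - t0) \<le> \<delta>" by simp
    have "integrable (mu w) (\<lambda>t. t - t0)" using D_integrable[OF w] by simp
    moreover have "integrable (mu w) (\<lambda>t. \<delta>)" by simp
    ultimately have "(\<integral> t. norm (t - t0) \<partial>mu w) \<le> (\<integral> t. \<delta> \<partial>mu w)"
      using AEn by (intro integral_mono_AE integrable_norm)
    then have "norm (\<integral> t. t - t0 \<partial>mu w) \<le> (\<integral> t. \<delta> \<partial>mu w)"
      using integral_norm_bound[of "mu w" "\<lambda>t. t - t0"] by linarith
    also have "\<dots> = \<delta> * N w" using measure_mu[OF wH, of UNIV] by (simp add: N_def E_UNIV[OF wH])
    finally show ?thesis unfolding e by simp
  qed
  have vD: "v \<in> D" unfolding v_def by (rule D_E[OF B(1) u])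
  have EBv: "E B v = v" unfolding v_def using E_Int[OF B(1) B(1) D_H[OF u]] by simp
  have yH: "y \<in> H" unfolding y_def by (intro H_lincomb T_H vD D_H[OF vD])
  have EBy: "E B y = y"
    unfolding y_def E_lincomb[OF B(1) T_H[OF vD] D_H[OF vD]] E_T[OF B(1) vD, symmetric] EBv ..
  \<comment> \<open>The set \<open>B\<close> is bounded, so the range of \<open>E B\<close> lies in
    the domain and \<open>T\<close> can be applied a second time.\<close>
  have yD: "y \<in> D" using D_bounded[OF B(1) Bb yH] EBy by simp
  show "ip y v \<in> \<real>" "\<bar>Re (ip y v)\<bar> \<le> \<delta> * N v" using q[OF vD EBv] unfolding y_def by auto
  \<comment> \<open>The bound on the form is upgraded to a bound on the vector \<open>y\<close>. The
    estimate \<open>q\<close> for \<open>v + \<beta> y\<close> is a polynomial in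
    \<open>\<beta>\<close>: the value \<open>\<i>\<close> identifies the real part of
    \<open>ip z v\<close> with \<open>N y\<close>, and real values of opposite sign isolate the term
    linear in \<open>\<beta>\<close>.\<close>
  define z where "z = lincomb 1 (T y) (- of_real t0) y"
  have zH: "z \<in> H" unfolding z_def by (intro H_lincomb T_H yD yH)
  have vH: "v \<in> H" by (rule D_H[OF vD])
  have e: "ip (lincomb 1 (T (lincomb 1 v \<beta> y)) (- of_real t0) (lincomb 1 v \<beta> y)) (lincomb 1 v \<beta> y) =
      ip y v + cnj \<beta> * ip y y + \<beta> * ip z v + \<beta> * cnj \<beta> * ip z y" for \<beta>
  proof -
    have "lincomb 1 (T (lincomb 1 v \<beta> y)) (- of_real t0) (lincomb 1 v \<beta> y) = lincomb 1 y \<beta> z"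
      unfolding T_lincomb y_def z_def by (auto simp: lincomb_def algebra_simps)
    then show ?thesis using vH yH zH by (simp add: ip_lincomb ip_cb2 H_lincomb algebra_simps)
  qed
  have q2: "ip y v + cnj \<beta> * ip y y + \<beta> * ip z v + \<beta> * cnj \<beta> * ip z y \<in> \<real> \<and>
     \<bar>Re (ip y v + cnj \<beta> * ip y y + \<beta> * ip z v + \<beta> * cnj \<beta> * ip z y)\<bar> \<le> \<delta> * N (lincomb 1 v \<beta> y)" for \<beta>
    unfolding e[symmetric] by (rule q) (intro D_lincomb vD yD, simp add: E_lincomb[OF B(1) vH yH] EBv EBy)
  have r: "Im (ip y v) = 0" "Im (ip z y) = 0" "Im (ip y y) = 0"
    using q[OF vD EBv] q[OF yD EBy] ip_real[OF yH] unfolding y_def[symmetric] z_def[symmetric] by (auto simp: complex_is_Real_iff) (metis Im_complex_of_real)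
  have zv: "Re (ip z v) = N y"
  proof -
    have "Im (cnj \<i> * ip y y + \<i> * ip z v) = 0"
      using q2[of \<i>] r by (simp add: complex_is_Real_iff)
    then show ?thesis by (simp add: N_def)
  qed
  have p: "4 * r * N y \<le> 2 * \<delta> * (N v + r\<^sup>2 * N y)" for r :: real
  proof -
    have 1: "Re (ip y v) + r * N y + r * N y + r * r * Re (ip z y) \<le> \<delta> * N (lincomb 1 v (of_real r) y)"
      using q2[of "of_real r"] zv by (auto simp: N_def)
    have 2: "- (Re (ip y v) - r * N y - r * N y + r * r * Re (ip z y)) \<le> \<delta> * N (lincomb 1 v (of_real (- r)) y)"
      using q2[of "of_real (- r)"] zv by (auto simp: N_def)
    have 3: "N (lincomb 1 v (of_real r) y) + N (lincomb 1 v (of_real (- r)) y) = 2 * (N v + r\<^sup>2 * N y)"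
      unfolding N_lincomb[OF vH yH] by simp
    have "\<delta> * N (lincomb 1 v (of_real r) y) + \<delta> * N (lincomb 1 v (of_real (- r)) y) = \<delta> * (2 * (N v + r\<^sup>2 * N y))"
      unfolding distrib_left[symmetric] 3 ..
    also have "\<dots> = 2 * \<delta> * (N v + r\<^sup>2 * N y)" by (simp only: mult.assoc mult.left_commute[of \<delta> 2])
    finally have "\<delta> * N (lincomb 1 v (of_real r) y) + \<delta> * N (lincomb 1 v (of_real (- r)) y) = 2 * \<delta> * (N v + r\<^sup>2 * N y)" .
    then show ?thesis using 1 2 by linarith
  qed
  \<comment> \<open>With \<open>r = 1 / \<delta>\<close> half of the term with \<open>N y\<close> on
    the left absorbs the one on the right.\<close>
  have "4 * (1 / \<delta>) * N y \<le> 2 * \<delta> * (N v + (1 / \<delta>)\<^sup>2 * N y)" by (rule p)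
  then have "\<delta> * (4 * (1 / \<delta>) * N y) \<le> \<delta> * (2 * \<delta> * (N v + (1 / \<delta>)\<^sup>2 * N y))" using d by (intro mult_left_mono) auto
  then show "N y \<le> \<delta>\<^sup>2 * N v" using d by (simp add: power2_eq_square field_simps)
qed

text \<open>On the range of \<open>E B\<close> the vector \<open>f\<close> is nearly
  \<open>t0 - \<lambda>\<close> times \<open>u\<close>, where
  \<open>\<lambda> = Complex \<xi> \<epsilon>\<close>, and
  \<open>(t - \<xi>)\<^sup>2 + \<epsilon>\<^sup>2\<close> is the squared distance from
  \<open>t\<close> to \<open>\<lambda>\<close>. The error is relative, so the estimates can be
  summed over a partition of the line.\<close>

lemma local_estimate:
  assumes B: "B \<in> sets borel" "B \<subseteq> {t0 - \<delta>..t0 + \<delta>}" and d: "0 < \<delta>" and u: "u \<in> D"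
    and e: "0 < \<epsilon>" and f: "f = lincomb 1 (T u) (- Complex \<xi> \<epsilon>) u" and t: "t \<in> B"
  shows "\<bar>N (E B f) - ((t - \<xi>)\<^sup>2 + \<epsilon>\<^sup>2) * N (E B u)\<bar> \<le> (4 * \<delta>\<^sup>2 / \<epsilon>\<^sup>2 + 4 * \<delta> / \<epsilon>) * (((t - \<xi>)\<^sup>2 + \<epsilon>\<^sup>2) * N (E B u))"
proof -
  define v where "v = E B u"
  define y where "y = lincomb 1 (T v) (- of_real t0) v"
  have lb: "ip y v \<in> \<real>" "\<bar>Re (ip y v)\<bar> \<le> \<delta> * N v" "N y \<le> \<delta>\<^sup>2 * N v"
    using local_bound[OF B d u] unfolding y_def v_def by auto
  have vD: "v \<in> D" unfolding v_def by (rule D_E[OF B(1) u])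
  have vH: "v \<in> H" by (rule D_H[OF vD])
  have yH: "y \<in> H" unfolding y_def by (intro H_lincomb T_H vD vH)
  have Nv: "0 \<le> N v" by (rule N_nonneg[OF vH])
  define lam where "lam = Complex \<xi> \<epsilon>"
  have Ef: "E B f = lincomb 1 y (of_real t0 - lam) v"
    unfolding f E_lincomb[OF B(1) T_H[OF u] D_H[OF u]] E_T[OF B(1) u, symmetric] v_def[symmetric] y_def lam_def
    by (auto simp: lincomb_def algebra_simps)
  define r where "r = sqrt ((t0 - \<xi>)\<^sup>2 + \<epsilon>\<^sup>2)"
  define \<rho> where "\<rho> = sqrt ((t - \<xi>)\<^sup>2 + \<epsilon>\<^sup>2)"
  have r2: "r\<^sup>2 = (t0 - \<xi>)\<^sup>2 + \<epsilon>\<^sup>2" "\<rho>\<^sup>2 = (t - \<xi>)\<^sup>2 + \<epsilon>\<^sup>2" unfolding r_def \<rho>_def by simp_all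
  have r0: "0 \<le> r" "\<epsilon> \<le> \<rho>" "\<bar>t0 - \<xi>\<bar> \<le> r"
    unfolding r_def \<rho>_def using e by (auto simp: real_le_rsqrt intro: real_sqrt_ge_abs1 real_le_rsqrt)
  have nr: "(norm (of_real t0 - lam))\<^sup>2 = r\<^sup>2" unfolding r2 lam_def by (simp add: cmod_power2)
  have tr: "\<bar>r - \<rho>\<bar> \<le> \<delta>"
  proof -
    have "r = norm (Complex (t0 - \<xi>) \<epsilon>)" "\<rho> = norm (Complex (t - \<xi>) \<epsilon>)" by (simp_all add: r_def \<rho>_def cmod_def)
    then have "\<bar>r - \<rho>\<bar> \<le> norm (Complex (t0 - \<xi>) \<epsilon> - Complex (t - \<xi>) \<epsilon>)" using norm_triangle_ineq3 by metis
    also have "Complex (t0 - \<xi>) \<epsilon> - Complex (t - \<xi>) \<epsilon> = of_real (t0 - t)" by (simp add: complex_eq_iff)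
    also have "norm (complex_of_real (t0 - t)) \<le> \<delta>" unfolding norm_of_real using B(2) t by (auto simp: abs_le_iff)
    finally show ?thesis .
  qed
  have Ny: "0 \<le> N y" by (rule N_nonneg[OF yH])
  have "N (E B f) = N y + r\<^sup>2 * N v + 2 * ((t0 - \<xi>) * Re (ip y v))"
    unfolding Ef N_lincomb[OF yH vH] nr using lb(1) by (simp add: lam_def complex_is_Real_iff)
  moreover have "\<bar>(t0 - \<xi>) * Re (ip y v)\<bar> \<le> r * (\<delta> * N v)" unfolding abs_mult by (intro mult_mono r0 lb) auto
  ultimately have 1: "\<bar>N (E B f) - r\<^sup>2 * N v\<bar> \<le> \<delta>\<^sup>2 * N v + 2 * (r * (\<delta> * N v))" using lb(3) Ny by linarith
  have 2: "\<bar>r\<^sup>2 - \<rho>\<^sup>2\<bar> \<le> \<delta> * (2 * \<rho> + \<delta>)"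
  proof -
    have "r\<^sup>2 - \<rho>\<^sup>2 = (r - \<rho>) * (r + \<rho>)" by (simp add: power2_eq_square algebra_simps)
    moreover have "\<bar>r + \<rho>\<bar> \<le> 2 * \<rho> + \<delta>" using tr r0 e by linarith
    ultimately show ?thesis unfolding abs_mult using tr d by (simp add: abs_mult mult_mono)
  qed
  have "\<bar>N (E B f) - \<rho>\<^sup>2 * N v\<bar> \<le> \<bar>N (E B f) - r\<^sup>2 * N v\<bar> + \<bar>r\<^sup>2 - \<rho>\<^sup>2\<bar> * N v"
  proof -
    have "N (E B f) - \<rho>\<^sup>2 * N v = (N (E B f) - r\<^sup>2 * N v) + (r\<^sup>2 - \<rho>\<^sup>2) * N v" by (simp add: algebra_simps)
    then show ?thesis using abs_triangle_ineq[of "N (E B f) - r\<^sup>2 * N v" "(r\<^sup>2 - \<rho>\<^sup>2) * N v"] Nv by (simp add: abs_mult)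
  qed
  also have "\<dots> \<le> \<delta>\<^sup>2 * N v + 2 * (r * (\<delta> * N v)) + \<delta> * (2 * \<rho> + \<delta>) * N v"
    by (intro add_mono 1 mult_right_mono 2 Nv)
  also have "\<dots> \<le> (4 * \<delta>\<^sup>2 + 4 * \<delta> * \<rho>) * N v"
  proof -
    have "r * (\<delta> * N v) \<le> (\<rho> + \<delta>) * (\<delta> * N v)" using tr d Nv by (intro mult_right_mono) auto
    then show ?thesis by (simp add: algebra_simps power2_eq_square)
  qed
  also have "\<dots> \<le> ((4 * \<delta>\<^sup>2 / \<epsilon>\<^sup>2 + 4 * \<delta> / \<epsilon>) * \<rho>\<^sup>2) * N v"
  proof (rule mult_right_mono[OF _ Nv])
    \<comment> \<open>The distance \<open>\<rho>\<close> from \<open>t\<close> to the spectral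
      parameter is at least \<open>\<epsilon>\<close>; this turns the absolute error into a multiple
      of \<open>\<rho>\<^sup>2\<close>.\<close>
    have "1 \<le> \<rho> / \<epsilon>" using r0 e by simp
    then have 3: "1 \<le> (\<rho> / \<epsilon>)\<^sup>2" "\<rho> \<le> \<rho> * (\<rho> / \<epsilon>)" using r0 e mult_left_mono[of 1 "\<rho> / \<epsilon>" \<rho>] by (simp_all add: one_le_power)
    have "4 * \<delta>\<^sup>2 + 4 * \<delta> * \<rho> \<le> 4 * \<delta>\<^sup>2 * (\<rho> / \<epsilon>)\<^sup>2 + 4 * \<delta> * (\<rho> * (\<rho> / \<epsilon>))"
    proof (rule add_mono)
      show "4 * \<delta>\<^sup>2 \<le> 4 * \<delta>\<^sup>2 * (\<rho> / \<epsilon>)\<^sup>2" using mult_left_mono[OF 3(1), of "4 * \<delta>\<^sup>2"] by simp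
      show "4 * \<delta> * \<rho> \<le> 4 * \<delta> * (\<rho> * (\<rho> / \<epsilon>))" by (rule mult_left_mono[OF 3(2)]) (use d in simp)
    qed
    also have "\<dots> = (4 * \<delta>\<^sup>2 / \<epsilon>\<^sup>2 + 4 * \<delta> / \<epsilon>) * \<rho>\<^sup>2" by (simp add: power_divide power2_eq_square distrib_right)
    finally show "4 * \<delta>\<^sup>2 + 4 * \<delta> * \<rho> \<le> (4 * \<delta>\<^sup>2 / \<epsilon>\<^sup>2 + 4 * \<delta> / \<epsilon>) * \<rho>\<^sup>2" .
  qed
  finally show ?thesis unfolding r2 v_def by (simp only: mult.assoc)
qed

text \<open>States that \<open>u\<close> is the resolvent applied to \<open>f\<close>, in terms of
  masses. The line is cut into intervals of length \<open>\<delta>\<close>; on each,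
  \<open>local_estimate\<close> compares the mass of \<open>u\<close> with the weighted mass of
  \<open>f\<close> up to the factors \<open>1 - c\<close> and \<open>1 + c\<close>, and
  \<open>c\<close> tends to 0 with \<open>\<delta>\<close>.\<close>

lemma resolvent_mass:
  assumes u: "u \<in> D" and e: "0 < \<epsilon>" and f: "f = lincomb 1 (T u) (- Complex \<xi> \<epsilon>) u"
  shows "(\<integral>\<^sup>+ t. ennreal (1 / ((t - \<xi>)\<^sup>2 + \<epsilon>\<^sup>2)) \<partial>mu f) = ennreal (N u)"
proof -
  have uH: "u \<in> H" by (rule D_H[OF u])
  have fH: "f \<in> H" unfolding f by (intro H_lincomb T_H u uH)
  define k where "k = (\<lambda>t. 1 / ((t - \<xi>)\<^sup>2 + \<epsilon>\<^sup>2))"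
  have kp: "0 < (t - \<xi>)\<^sup>2 + \<epsilon>\<^sup>2" for t using e by (simp add: add_nonneg_pos)
  have k0: "0 < k t" for t using kp unfolding k_def by simp
  have kb: "k t \<le> 1 / \<epsilon>\<^sup>2" for t unfolding k_def using e by (intro divide_left_mono) (auto intro: kp mult_pos_pos)
  have km [measurable]: "k \<in> borel_measurable borel" unfolding k_def by measurable
  define \<nu> where "\<nu> = density (mu f) (\<lambda>t. ennreal (k t))"
  have kmu: "(\<lambda>t. ennreal (k t)) \<in> borel_measurable (mu f)" by simp
  have \<nu>: "emeasure \<nu> B = (\<integral>\<^sup>+ t. ennreal (k t) * indicator B t \<partial>mu f)" if "B \<in> sets borel" for B
    unfolding \<nu>_def by (rule emeasure_density[OF kmu]) (use that in simp)
  have loc: "ennreal (1 - c) * emeasure (mu u) B \<le> emeasure \<nu> B \<and> emeasure \<nu> B \<le> ennreal (1 + c) * emeasure (mu u) B"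
    if B: "B \<in> sets borel" "B \<subseteq> {t0 - \<delta>..t0 + \<delta>}" "B \<noteq> {}" and d: "0 < \<delta>" and c: "c = 4 * \<delta>\<^sup>2 / \<epsilon>\<^sup>2 + 4 * \<delta> / \<epsilon>" for B t0 \<delta> c
  proof -
    define nf nu where "nf = N (E B f)" and "nu = N (E B u)"
    have n0: "0 \<le> nf" "0 \<le> nu" unfolding nf_def nu_def using N_nonneg E_H B(1) fH uH by auto
    have c0: "0 \<le> c" unfolding c using d e by simp
    have mf: "emeasure (mu f) B = ennreal nf" "emeasure (mu u) B = ennreal nu"
      unfolding nf_def nu_def N_def using emeasure_mu[OF fH B(1)] emeasure_mu[OF uH B(1)] E_nonneg(3)[OF B(1) fH] E_nonneg(3)[OF B(1) uH] by simp_all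
    have est: "(1 - c) * nu \<le> k t * nf" "k t * nf \<le> (1 + c) * nu" if t: "t \<in> B" for t
    proof -
      define p where "p = (t - \<xi>)\<^sup>2 + \<epsilon>\<^sup>2"
      have p: "0 < p" unfolding p_def by (rule kp)
      have "\<bar>nf - p * nu\<bar> \<le> c * (p * nu)"
        using local_estimate[OF B(1,2) d u e f t] unfolding nf_def nu_def p_def c .
      then have "p * ((1 - c) * nu) \<le> nf" "nf \<le> p * ((1 + c) * nu)" by (auto simp: abs_le_iff algebra_simps)
      then show "(1 - c) * nu \<le> k t * nf" "k t * nf \<le> (1 + c) * nu"
        unfolding k_def p_def[symmetric] using p by (simp_all add: field_simps)
    qed
    have up: "emeasure \<nu> B \<le> ennreal ((1 + c) * nu)"
    proof (cases "nf = 0")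
      case True
      have "emeasure \<nu> B \<le> (\<integral>\<^sup>+ t. ennreal (1 / \<epsilon>\<^sup>2) * indicator B t \<partial>mu f)"
        unfolding \<nu>[OF B(1)] by (intro nn_integral_mono mult_right_mono ennreal_leI kb) auto
      also have "\<dots> = 0" using B(1) mf(1) True by (simp add: nn_integral_cmult_indicator)
      finally show ?thesis by simp
    next
      case False
      then have nf: "0 < nf" using n0 by simp
      have "emeasure \<nu> B \<le> (\<integral>\<^sup>+ t. ennreal ((1 + c) * nu / nf) * indicator B t \<partial>mu f)"
        unfolding \<nu>[OF B(1)]
      proof (rule nn_integral_mono)
        fix t
        have "k t \<le> (1 + c) * nu / nf" if "t \<in> B" using est(2)[OF that] nf by (simp add: field_simps)
        then show "ennreal (k t) * indicator B t \<le> ennreal ((1 + c) * nu / nf) * indicator B t"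
          by (cases "t \<in> B") (auto intro: ennreal_leI)
      qed
      also have "\<dots> = ennreal ((1 + c) * nu / nf) * ennreal nf" using B(1) mf(1) by (simp add: nn_integral_cmult_indicator)
      also have "\<dots> = ennreal ((1 + c) * nu)" using nf c0 n0 by (simp flip: ennreal_mult)
      finally show ?thesis .
    qed
    have lo: "ennreal ((1 - c) * nu) \<le> emeasure \<nu> B"
    proof (cases "nf = 0")
      case True
      obtain t where "t \<in> B" using B(3) by blast
      from est(1)[OF this] True have "(1 - c) * nu \<le> 0" by simp
      then show ?thesis by (simp add: ennreal_neg)
    next
      case False
      then have nf: "0 < nf" using n0 by simp
      have "ennreal ((1 - c) * nu) = ennreal ((1 - c) * nu / nf) * ennreal nf"
      proof (cases "0 \<le> (1 - c) * nu")
        case True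
        then show ?thesis using nf by (simp flip: ennreal_mult)
      next
        case False
        then have "(1 - c) * nu / nf \<le> 0" using nf by (simp add: divide_le_0_iff)
        then show ?thesis using False by (simp only: ennreal_neg mult_zero_left linear not_le less_imp_le)
      qed
      also have "\<dots> = (\<integral>\<^sup>+ t. ennreal ((1 - c) * nu / nf) * indicator B t \<partial>mu f)"
        using B(1) mf(1) by (simp add: nn_integral_cmult_indicator)
      also have "\<dots> \<le> emeasure \<nu> B" unfolding \<nu>[OF B(1)]
      proof (rule nn_integral_mono)
        fix t
        have "(1 - c) * nu / nf \<le> k t" if "t \<in> B" using est(1)[OF that] nf by (simp add: field_simps)
        then show "ennreal ((1 - c) * nu / nf) * indicator B t \<le> ennreal (k t) * indicator B t"
          by (cases "t \<in> B") (auto intro: ennreal_leI)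
      qed
      finally show ?thesis .
    qed
    have "ennreal (1 - c) * ennreal nu = ennreal ((1 - c) * nu)"
      using n0 by (cases "0 \<le> 1 - c") (simp_all add: ennreal_neg mult_nonpos_nonneg flip: ennreal_mult)
    moreover have "ennreal (1 + c) * ennreal nu = ennreal ((1 + c) * nu)"
      by (rule ennreal_mult[symmetric]) (use n0 c0 in simp_all)
    ultimately show ?thesis using up lo unfolding mf by (simp only: simp_thms)
  qed
  have glob: "ennreal (1 - c) * emeasure (mu u) UNIV \<le> emeasure \<nu> UNIV \<and> emeasure \<nu> UNIV \<le> ennreal (1 + c) * emeasure (mu u) UNIV"
    if d: "0 < \<delta>" and c: "c = 4 * \<delta>\<^sup>2 / \<epsilon>\<^sup>2 + 4 * \<delta> / \<epsilon>" for \<delta> c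
  proof -
    \<comment> \<open>Half-open intervals, so that they are disjoint and cover the line, enumerated
      by the natural numbers through \<open>int_decode\<close>. Each lies within
      \<open>\<delta>\<close> of its left end, which serves as \<open>t0\<close>.\<close>
    define B where "B = (\<lambda>n. {real_of_int (int_decode n) * \<delta> ..< (real_of_int (int_decode n) + 1) * \<delta>})"
    have Bs: "B n \<in> sets borel" for n unfolding B_def by simp
    have fl: "t \<in> B n \<longleftrightarrow> \<lfloor>t / \<delta>\<rfloor> = int_decode n" for t n
      unfolding B_def floor_eq_iff using d by (simp add: field_simps)
    have disj: "disjoint_family B"
      unfolding disjoint_family_on_def using fl by (auto simp: inj_eq[OF inj_int_decode])
    have un: "(\<Union>n. B n) = UNIV"
    proof -
      have "t \<in> B (int_encode \<lfloor>t / \<delta>\<rfloor>)" for t by (simp add: fl)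
      then show ?thesis by blast
    qed
    have sub: "B n \<subseteq> {real_of_int (int_decode n) * \<delta> - \<delta>..real_of_int (int_decode n) * \<delta> + \<delta>}" for n
      unfolding B_def using d by (auto simp: algebra_simps)
    have ne: "B n \<noteq> {}" for n unfolding B_def using d by (simp add: algebra_simps)
    note l = loc[OF Bs sub ne d c]
    have S1: "(\<Sum>n. emeasure \<nu> (B n)) = emeasure \<nu> UNIV"
      using suminf_emeasure[of B \<nu>] Bs disj un by (simp add: \<nu>_def image_subset_iff)
    have S2: "(\<Sum>n. emeasure (mu u) (B n)) = emeasure (mu u) UNIV"
      using suminf_emeasure[of B "mu u"] Bs disj un by (simp add: image_subset_iff)
    have "ennreal (1 - c) * emeasure (mu u) UNIV = (\<Sum>n. ennreal (1 - c) * emeasure (mu u) (B n))" unfolding S2[symmetric] by (rule ennreal_suminf_cmult[symmetric])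
    also have "\<dots> \<le> (\<Sum>n. emeasure \<nu> (B n))"
      by (rule suminf_le[OF conjunct1[OF l]]) (rule summableI)+
    finally have 1: "ennreal (1 - c) * emeasure (mu u) UNIV \<le> emeasure \<nu> UNIV" unfolding S1 .
    have "(\<Sum>n. emeasure \<nu> (B n)) \<le> (\<Sum>n. ennreal (1 + c) * emeasure (mu u) (B n))"
      by (rule suminf_le[OF conjunct2[OF l]]) (rule summableI)+
    also have "\<dots> = ennreal (1 + c) * emeasure (mu u) UNIV" unfolding S2[symmetric] by (rule ennreal_suminf_cmult)
    finally show ?thesis using 1 unfolding S1 by simp
  qed
  define c where "c = (\<lambda>n. 4 * (inverse (real (Suc n)))\<^sup>2 / \<epsilon>\<^sup>2 + 4 * inverse (real (Suc n)) / \<epsilon>)"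
  have c0: "0 \<le> c n" for n unfolding c_def using e by simp
  have mu: "emeasure (mu u) UNIV = ennreal (N u)" unfolding N_def by (rule emeasure_mu_UNIV[OF uH])
  have Nu: "0 \<le> N u" by (rule N_nonneg[OF uH])
  have g: "ennreal (1 - c n) * ennreal (N u) \<le> emeasure \<nu> UNIV" "emeasure \<nu> UNIV \<le> ennreal (1 + c n) * ennreal (N u)" for n
    using glob[of "inverse (real (Suc n))" "c n"] unfolding mu c_def by auto
  have cl: "c \<longlonglongrightarrow> 0"
  proof -
    have "c \<longlonglongrightarrow> 4 * 0\<^sup>2 / \<epsilon>\<^sup>2 + 4 * 0 / \<epsilon>" unfolding c_def
      by (intro tendsto_intros LIMSEQ_inverse_real_of_nat) (use e in auto)
    then show ?thesis by simp
  qed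
  have l1: "(\<lambda>n. ennreal (1 - c n) * ennreal (N u)) \<longlonglongrightarrow> ennreal (N u)"
  proof -
    have "(\<lambda>n. ennreal ((1 - c n) * N u)) \<longlonglongrightarrow> ennreal ((1 - 0) * N u)" by (intro tendsto_ennrealI tendsto_intros cl)
    moreover have "ennreal (1 - c n) * ennreal (N u) = ennreal ((1 - c n) * N u)" for n
      using Nu by (cases "0 \<le> 1 - c n") (simp_all add: ennreal_neg mult_nonpos_nonneg flip: ennreal_mult)
    ultimately show ?thesis by simp
  qed
  have l2: "(\<lambda>n. ennreal (1 + c n) * ennreal (N u)) \<longlonglongrightarrow> ennreal (N u)"
  proof -
    have "(\<lambda>n. ennreal ((1 + c n) * N u)) \<longlonglongrightarrow> ennreal ((1 + 0) * N u)" by (intro tendsto_ennrealI tendsto_intros cl)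
    then show ?thesis using Nu c0 by (simp add: ennreal_mult add_nonneg_nonneg del: ennreal_plus)
  qed
  have "ennreal (N u) \<le> emeasure \<nu> UNIV" by (rule LIMSEQ_le_const2[OF l1]) (use g in auto)
  moreover have "emeasure \<nu> UNIV \<le> ennreal (N u)" by (rule LIMSEQ_le_const[OF l2]) (use g in auto)
  ultimately have "emeasure \<nu> UNIV = ennreal (N u)" by simp
  then show ?thesis using \<nu>[of UNIV] unfolding k_def by simp
qed

text \<open>Since \<open>\<langle>T u, u\<rangle>\<close> is real, both sides equal \<open>\<epsilon> \<langle>u, u\<rangle>\<close>.\<close>

lemma resolvent_Im:
  assumes u: "u \<in> D" and e: "0 < \<epsilon>" and f: "f = lincomb 1 (T u) (- Complex \<xi> \<epsilon>) u"
  shows "(\<integral> t. \<epsilon> / ((t - \<xi>)\<^sup>2 + \<epsilon>\<^sup>2) \<partial>mu f) = Im (ip u f)"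
proof -
  have uH: "u \<in> H" by (rule D_H[OF u])
  have kp: "0 < (t - \<xi>)\<^sup>2 + \<epsilon>\<^sup>2" for t using e by (simp add: add_nonneg_pos)
  have "(\<integral> t. 1 / ((t - \<xi>)\<^sup>2 + \<epsilon>\<^sup>2) \<partial>mu f) = enn2real (\<integral>\<^sup>+ t. ennreal (1 / ((t - \<xi>)\<^sup>2 + \<epsilon>\<^sup>2)) \<partial>mu f)"
    by (rule integral_eq_nn_integral) (auto intro!: AE_I2 less_imp_le kp)
  also have "\<dots> = N u" unfolding resolvent_mass[OF u e f] using N_nonneg[OF uH] by simp
  finally have 1: "(\<integral> t. 1 / ((t - \<xi>)\<^sup>2 + \<epsilon>\<^sup>2) \<partial>mu f) = N u" .
  have "(\<integral> t. \<epsilon> / ((t - \<xi>)\<^sup>2 + \<epsilon>\<^sup>2) \<partial>mu f) = \<epsilon> * (\<integral> t. 1 / ((t - \<xi>)\<^sup>2 + \<epsilon>\<^sup>2) \<partial>mu f)"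
    by (subst Bochner_Integration.integral_mult_right_zero[symmetric]) simp
  also have "\<dots> = \<epsilon> * N u" unfolding 1 ..
  also have "\<dots> = Im (ip u f)"
  proof -
    have r: "Im (ip (T u) u) = 0" "Im (ip u u) = 0" using T_ip[OF u] ip_real[OF uH] by (metis Im_complex_of_real)+
    have "ip u f = ip u (T u) + cnj (- Complex \<xi> \<epsilon>) * ip u u" unfolding f using uH T_H[OF u] by (simp add: ip_cb2)
    also have "ip u (T u) = cnj (ip (T u) u)" by (rule ip_herm[OF T_H[OF u] uH])
    finally show ?thesis using r by (simp add: N_def)
  qed
  finally show ?thesis .
qed

end

section \<open>Stieltjes inversion for a finite measure on the line\<close>

lemma poisson_integral:
  fixes t :: real
  assumes e: "0 < \<epsilon>" and l: "l1 \<le> l2"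
  shows "((\<lambda>\<xi>. \<epsilon> / ((t - \<xi>)\<^sup>2 + \<epsilon>\<^sup>2)) has_integral (arctan ((l2 - t) / \<epsilon>) - arctan ((l1 - t) / \<epsilon>))) {l1..l2}"
proof (rule fundamental_theorem_of_calculus[OF l])
  fix x assume "x \<in> {l1..l2}"
  have "((\<lambda>x. arctan ((x - t) / \<epsilon>)) has_real_derivative inverse (1 + ((x - t) / \<epsilon>)\<^sup>2) * (1 / \<epsilon>)) (at x within {l1..l2})"
    using e by (auto intro!: derivative_eq_intros)
  moreover have "inverse (1 + ((x - t) / \<epsilon>)\<^sup>2) * (1 / \<epsilon>) = \<epsilon> / ((t - x)\<^sup>2 + \<epsilon>\<^sup>2)"
  proof -
    have "0 < (t - x)\<^sup>2 + \<epsilon>\<^sup>2" using e by (simp add: add_nonneg_pos)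
    moreover have "1 + ((x - t) / \<epsilon>)\<^sup>2 = ((t - x)\<^sup>2 + \<epsilon>\<^sup>2) / \<epsilon>\<^sup>2" using e by (simp add: power_divide power2_commute add_divide_distrib)
    ultimately show ?thesis using e by (simp add: power2_eq_square)
  qed
  ultimately show "((\<lambda>x. arctan ((x - t) / \<epsilon>)) has_vector_derivative \<epsilon> / ((t - x)\<^sup>2 + \<epsilon>\<^sup>2)) (at x within {l1..l2})"
    by (simp add: has_real_derivative_iff_has_vector_derivative)
qed

text \<open>The Poisson kernel is bounded by \<open>1 / \<epsilon>\<close> and the measure is
  finite, so the integration over \<open>\<xi>\<close> may be carried out first.\<close>

lemma stieltjes_fubini:
  assumes fin: "finite_measure M" and sM: "sets M = sets borel" and e: "0 < \<epsilon>" and l: "l1 \<le> l2"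
    and c: "continuous_on {l1..l2} J" and J: "\<And>\<xi>. \<xi> \<in> {l1..l2} \<Longrightarrow> J \<xi> = (\<integral> t. \<epsilon> / ((t - \<xi>)\<^sup>2 + \<epsilon>\<^sup>2) \<partial>M)"
  shows "integral {l1..l2} J = (\<integral> t. arctan ((l2 - t) / \<epsilon>) - arctan ((l1 - t) / \<epsilon>) \<partial>M)"
proof -
  interpret M: finite_measure M by (rule fin)
  interpret P: pair_sigma_finite lborel M by unfold_locales
  note [measurable_cong] = sM
  have sp: "space M = UNIV" using sets_eq_imp_space_eq[OF sM] by simp
  define h where "h = (\<lambda>(\<xi>, t). indicator {l1..l2} \<xi> * (\<epsilon> / ((t - \<xi>)\<^sup>2 + \<epsilon>\<^sup>2)))"
  have kp: "0 < (t - \<xi>)\<^sup>2 + \<epsilon>\<^sup>2" for t \<xi> using e by (simp add: add_nonneg_pos)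
  have kb: "\<epsilon> / ((t - \<xi>)\<^sup>2 + \<epsilon>\<^sup>2) \<le> 1 / \<epsilon>" "0 \<le> \<epsilon> / ((t - \<xi>)\<^sup>2 + \<epsilon>\<^sup>2)" for t \<xi>
  proof -
    have "\<epsilon> * \<epsilon> \<le> (t - \<xi>)\<^sup>2 + \<epsilon>\<^sup>2" by (simp add: power2_eq_square)
    then show "\<epsilon> / ((t - \<xi>)\<^sup>2 + \<epsilon>\<^sup>2) \<le> 1 / \<epsilon>" using e kp[of t \<xi>] by (simp add: field_simps)
    show "0 \<le> \<epsilon> / ((t - \<xi>)\<^sup>2 + \<epsilon>\<^sup>2)" using e kp[of t \<xi>] by simp
  qed
  have "integrable (lborel \<Otimes>\<^sub>M M) h"
  proof (rule integrableI_bounded_set[where A = "{l1..l2} \<times> UNIV" and B = "1 / \<epsilon>"])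
    have u: "UNIV \<in> sets M" using sM by simp
    show "{l1..l2} \<times> UNIV \<in> sets (lborel \<Otimes>\<^sub>M M)" using u by (intro pair_measureI) auto
    show "h \<in> borel_measurable (lborel \<Otimes>\<^sub>M M)" unfolding h_def by measurable
    have "emeasure (lborel \<Otimes>\<^sub>M M) ({l1..l2} \<times> UNIV) = emeasure lborel {l1..l2} * emeasure M UNIV"
      by (rule M.emeasure_pair_measure_Times) (use u in auto)
    also have "\<dots> < \<infinity>" using l less_top[THEN iffD1, OF M.emeasure_finite[of UNIV]] by (simp add: ennreal_mult_less_top)
    finally show "emeasure (lborel \<Otimes>\<^sub>M M) ({l1..l2} \<times> UNIV) < \<infinity>" .
    show "AE x\<in>{l1..l2} \<times> UNIV in lborel \<Otimes>\<^sub>M M. norm (h x) \<le> 1 / \<epsilon>"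
      by (rule AE_I2) (use kb in \<open>auto simp: abs_of_pos[OF e] h_def abs_of_nonneg\<close>)
    show "AE x in lborel \<Otimes>\<^sub>M M. x \<notin> {l1..l2} \<times> UNIV \<longrightarrow> h x = 0"
      by (rule AE_I2) (auto simp: h_def indicator_def)
  qed
  from P.Fubini_integral[OF this[unfolded h_def]]
  have F: "(\<integral> t. (\<integral> \<xi>. indicator {l1..l2} \<xi> * (\<epsilon> / ((t - \<xi>)\<^sup>2 + \<epsilon>\<^sup>2)) \<partial>lborel) \<partial>M) = (\<integral> \<xi>. (\<integral> t. indicator {l1..l2} \<xi> * (\<epsilon> / ((t - \<xi>)\<^sup>2 + \<epsilon>\<^sup>2)) \<partial>M) \<partial>lborel)" .
  have set: "(\<integral> \<xi>. indicator {l1..l2} \<xi> * f \<xi> \<partial>lborel) = integral {l1..l2} f" if "continuous_on {l1..l2} f" for f :: "real \<Rightarrow> real"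
    using set_borel_integral_eq_integral(2)[OF borel_integrable_compact[OF compact_Icc that, folded set_integrable_def]]
    by (simp add: set_lebesgue_integral_def)
  have in1: "(\<integral> \<xi>. indicator {l1..l2} \<xi> * (\<epsilon> / ((t - \<xi>)\<^sup>2 + \<epsilon>\<^sup>2)) \<partial>lborel) = arctan ((l2 - t) / \<epsilon>) - arctan ((l1 - t) / \<epsilon>)" for t
  proof -
    have "continuous_on {l1..l2} (\<lambda>\<xi>. \<epsilon> / ((t - \<xi>)\<^sup>2 + \<epsilon>\<^sup>2))"
      by (intro continuous_intros) (use kp in \<open>auto simp: less_imp_neq[symmetric] dest: less_imp_neq\<close>)
    from set[OF this] show ?thesis using integral_unique[OF poisson_integral[OF e l]] by simp
  qed
  have "(\<integral> \<xi>. (\<integral> t. indicator {l1..l2} \<xi> * (\<epsilon> / ((t - \<xi>)\<^sup>2 + \<epsilon>\<^sup>2)) \<partial>M) \<partial>lborel) = (\<integral> \<xi>. indicator {l1..l2} \<xi> * J \<xi> \<partial>lborel)"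
  proof (rule Bochner_Integration.integral_cong[OF refl])
    fix \<xi>
    show "(\<integral> t. indicator {l1..l2} \<xi> * (\<epsilon> / ((t - \<xi>)\<^sup>2 + \<epsilon>\<^sup>2)) \<partial>M) = indicator {l1..l2} \<xi> * J \<xi>"
      using J by (cases "\<xi> \<in> {l1..l2}") simp_all
  qed
  then show ?thesis using F set[OF c] unfolding in1 by simp
qed

lemma arctan_step_limit:
  assumes e: "\<And>n. 0 < e n" "e \<longlonglongrightarrow> (0::real)"
  shows "(\<lambda>n. arctan (x / e n)) \<longlonglongrightarrow> (if 0 < x then pi / 2 else if x < 0 then - (pi / 2) else 0)"
proof -
  have inv: "filterlim (\<lambda>n. inverse (e n)) at_top sequentially"
    by (rule filterlim_inverse_at_top) (use e in auto)
  consider "0 < x" | "x < 0" | "x = 0" by linarith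
  then show ?thesis
  proof cases
    case 1
    have "filterlim (\<lambda>n. x * inverse (e n)) at_top sequentially"
      by (rule filterlim_tendsto_pos_mult_at_top[OF tendsto_const 1 inv])
    then have "((\<lambda>n. arctan (x * inverse (e n))) \<longlongrightarrow> pi / 2) sequentially"
      by (rule filterlim_compose[OF tendsto_arctan_at_top])
    then show ?thesis using 1 by (simp only: divide_inverse[symmetric] if_True if_False less_asym less_irrefl if_not_P)
  next
    case 2
    have "filterlim (\<lambda>n. x * inverse (e n)) at_bot sequentially"
      by (rule filterlim_tendsto_neg_mult_at_bot[OF tendsto_const 2 inv])
    then have "((\<lambda>n. arctan (x * inverse (e n))) \<longlongrightarrow> - (pi / 2)) sequentially"
      by (rule filterlim_compose[OF tendsto_arctan_at_bot])
    then show ?thesis using 2 by (simp only: divide_inverse[symmetric] if_True if_False less_asym less_irrefl if_not_P)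
  qed simp
qed

text \<open>The difference of arctangents tends to \<open>pi\<close> inside the interval, to
  \<open>pi / 2\<close> at its ends and to 0 outside. Uniform convergence on the closed interval
  excludes atoms there, so the values at the ends do not count.\<close>

lemma stieltjes_inversion:
  assumes fin: "finite_measure M" and sM: "sets M = sets borel" and l: "l1 < l2"
    and e: "\<And>n. 0 < e n" "e \<longlonglongrightarrow> (0::real)"
    and c: "\<And>n. continuous_on {l1..l2} (J n)"
    and J: "\<And>n \<xi>. \<xi> \<in> {l1..l2} \<Longrightarrow> J n \<xi> = (\<integral> t. e n / ((t - \<xi>)\<^sup>2 + (e n)\<^sup>2) \<partial>M)"
    and u: "uniform_limit {l1..l2} J k sequentially"
  shows "measure M {l1<..<l2} = integral {l1..l2} k / pi"
proof -
  interpret M: finite_measure M by (rule fin)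
  note [measurable_cong] = sM
  have sp: "space M = UNIV" using sets_eq_imp_space_eq[OF sM] by simp
  have kp: "0 < (t - \<xi>)\<^sup>2 + (e n)\<^sup>2" for t \<xi> n using e(1)[of n] by (simp add: add_nonneg_pos)
  \<comment> \<open>At \<open>\<xi>\<close> the kernel equals \<open>1 / e n\<close>, so an atom at
    \<open>\<xi>\<close> would force \<open>J n \<xi>\<close> to grow at least like
    \<open>1 / e n\<close>, against convergence.\<close>
  have atom: "measure M {\<xi>} = 0" if x: "\<xi> \<in> {l1..l2}" for \<xi>
  proof -
    have le: "measure M {\<xi>} \<le> e n * J n \<xi>" for n
    proof -
      have kb: "norm (e n / ((t - \<xi>)\<^sup>2 + (e n)\<^sup>2)) \<le> 1 / e n" for t
      proof -
        have "e n * e n \<le> (t - \<xi>)\<^sup>2 + (e n)\<^sup>2" by (simp add: power2_eq_square)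
        then have "e n / ((t - \<xi>)\<^sup>2 + (e n)\<^sup>2) \<le> 1 / e n" using e(1)[of n] kp[of t \<xi> n] by (simp add: field_simps)
        moreover have "0 \<le> e n / ((t - \<xi>)\<^sup>2 + (e n)\<^sup>2)" using e(1)[of n] kp[of t \<xi> n] by simp
        ultimately show ?thesis by simp
      qed
      have i: "integrable M (\<lambda>t. e n / ((t - \<xi>)\<^sup>2 + (e n)\<^sup>2))"
        by (rule M.integrable_const_bound[where B = "1 / e n"]) (use kb in \<open>auto intro!: AE_I2\<close>)
      have "(\<integral> t. (1 / e n) * indicator {\<xi>} t \<partial>M) \<le> (\<integral> t. e n / ((t - \<xi>)\<^sup>2 + (e n)\<^sup>2) \<partial>M)"
      proof (rule integral_mono[OF _ i])
        show "integrable M (\<lambda>t. (1 / e n) * indicator {\<xi>} t)"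
          using sM less_top[THEN iffD1, OF M.emeasure_finite] by (intro integrable_mult_right integrable_real_indicator) auto
        fix t
        show "1 / e n * indicator {\<xi>} t \<le> e n / ((t - \<xi>)\<^sup>2 + (e n)\<^sup>2)"
          using e(1)[of n] kp[of t \<xi> n] by (cases "t = \<xi>") (auto simp: power2_eq_square)
      qed
      also have "\<dots> = J n \<xi>" using J[OF x] by simp
      finally have "1 / e n * measure M {\<xi>} \<le> J n \<xi>" using sM sp by simp
      then show ?thesis using e(1)[of n] by (simp add: field_simps)
    qed
    have "(\<lambda>n. e n * J n \<xi>) \<longlonglongrightarrow> 0 * k \<xi>" by (intro tendsto_mult e tendsto_uniform_limitI[OF u x])
    then have "measure M {\<xi>} \<le> 0 * k \<xi>" by (rule LIMSEQ_le_const) (use le in auto)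
    then show ?thesis using measure_nonneg[of M "{\<xi>}"] by simp
  qed
  define g where "g = (\<lambda>t. pi * indicator {l1<..<l2} t + pi / 2 * indicator {l1} t + pi / 2 * indicator {l2} t :: real)"
  have "(\<lambda>n. \<integral> t. arctan ((l2 - t) / e n) - arctan ((l1 - t) / e n) \<partial>M) \<longlonglongrightarrow> (\<integral> t. g t \<partial>M)"
  proof (rule integral_dominated_convergence[where w = "\<lambda>_. pi"])
    show "g \<in> borel_measurable M" unfolding g_def by measurable
    show "(\<lambda>t. arctan ((l2 - t) / e n) - arctan ((l1 - t) / e n)) \<in> borel_measurable M" for n by measurable
    show "integrable M (\<lambda>_. pi)" by simp
    show "AE t in M. norm (arctan ((l2 - t) / e n) - arctan ((l1 - t) / e n)) \<le> pi" for n
    proof (rule AE_I2)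
      fix t
      show "norm (arctan ((l2 - t) / e n) - arctan ((l1 - t) / e n)) \<le> pi"
        using arctan_bounded[of "(l2 - t) / e n"] arctan_bounded[of "(l1 - t) / e n"] by (simp add: abs_le_iff)
    qed
    show "AE t in M. (\<lambda>n. arctan ((l2 - t) / e n) - arctan ((l1 - t) / e n)) \<longlonglongrightarrow> g t"
    proof (rule AE_I2)
      fix t
      have "(if 0 < l2 - t then pi / 2 else if l2 - t < 0 then - (pi / 2) else 0) - (if 0 < l1 - t then pi / 2 else if l1 - t < 0 then - (pi / 2) else 0) = g t"
        using l by (auto simp: g_def indicator_def)
      then show "(\<lambda>n. arctan ((l2 - t) / e n) - arctan ((l1 - t) / e n)) \<longlonglongrightarrow> g t"
        using tendsto_diff[OF arctan_step_limit[OF e] arctan_step_limit[OF e], of "l2 - t" "l1 - t"] by simp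
    qed
  qed
  moreover have "(\<integral> t. arctan ((l2 - t) / e n) - arctan ((l1 - t) / e n) \<partial>M) = integral {l1..l2} (J n)" for n
    by (rule stieltjes_fubini[OF fin sM e(1) less_imp_le[OF l] c J, symmetric])
  moreover have "(\<lambda>n. integral {l1..l2} (J n)) \<longlonglongrightarrow> integral {l1..l2} k"
  proof -
    obtain I K where I: "\<And>n. (J n has_integral I n) {l1..l2}" and K: "(k has_integral K) {l1..l2}" and IK: "I \<longlonglongrightarrow> K"
      by (rule uniform_limit_integral[OF u c sequentially_bot], rule that) assumption+
    have "(\<lambda>n. integral {l1..l2} (J n)) = I" by (rule ext) (rule integral_unique[OF I])
    then show ?thesis using IK integral_unique[OF K] by simp
  qed
  ultimately have "integral {l1..l2} k = (\<integral> t. g t \<partial>M)" by (simp add: LIMSEQ_unique)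
  also have "\<dots> = pi * measure M {l1<..<l2}"
  proof -
    have i: "integrable M (indicat_real A)" if "A \<in> sets borel" for A
      using that sM less_top[THEN iffD1, OF M.emeasure_finite] by (intro integrable_real_indicator) auto
    have "(\<integral> t. g t \<partial>M) = pi * measure M {l1<..<l2} + pi / 2 * measure M {l1} + pi / 2 * measure M {l2}"
      unfolding g_def using i[of "{l1<..<l2}"] i[of "{l1}"] i[of "{l2}"] sp sM by (simp add: Bochner_Integration.integral_add)
    then show ?thesis using atom[of l1] atom[of l2] l by simp
  qed
  finally show ?thesis by simp
qed

section \<open>The resolvent\<close>

context bqj
begin

abbreviation "R \<equiv> Rq q zm zp"
abbreviation "ww \<equiv> wt q a b c d"
abbreviation "HH \<equiv> L2 q zm zp a b c d"
abbreviation "inn \<equiv> L2_inner q zm zp a b c d"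
abbreviation "DD \<equiv> domL q zm zp a b c d"
abbreviation "LL \<equiv> L q a b c d"

text \<open>The partial products are products of the pairs in \<open>p\<close> at the lattice points
  \<open>x * q ^ k\<close>, so the limit is real and nonnegative; \<open>n\<close> excludes
  0.\<close>

lemma positive_pochhammer_pair:
  assumes x: "x \<in> R" and p: "\<And>x. x \<in> R \<Longrightarrow> (1 - u * of_real x) * (1 - v * of_real x) \<in> \<real> \<and> 0 < Re ((1 - u * of_real x) * (1 - v * of_real x))"
    and n: "pinf (u * of_real x) * pinf (v * of_real x) \<noteq> 0"
  shows "\<exists>r. 0 < r \<and> pinf (u * of_real x) * pinf (v * of_real x) = of_real r"
proof -
  have "poch (u * of_real x) n * poch (v * of_real x) n \<in> \<real> \<and> 0 \<le> Re (poch (u * of_real x) n * poch (v * of_real x) n)" for n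
  proof (induction n)
    case (Suc n)
    have "poch (u * of_real x) (Suc n) * poch (v * of_real x) (Suc n) =
      (poch (u * of_real x) n * poch (v * of_real x) n) * ((1 - u * of_real (x * q ^ n)) * (1 - v * of_real (x * q ^ n)))"
      unfolding poch_Suc by (simp add: mult_ac)
    then show ?case using Suc p[OF Rq_mult'(1)[OF x, of n]] by (auto simp: complex_is_Real_iff)
  qed (simp add: qpoch_def)
  moreover have l: "(\<lambda>n. poch (u * of_real x) n * poch (v * of_real x) n) \<longlonglongrightarrow> pinf (u * of_real x) * pinf (v * of_real x)"
    by (intro tendsto_mult poch_tendsto)
  ultimately have r: "pinf (u * of_real x) * pinf (v * of_real x) \<in> \<real>"
    using Lim_in_closed_set[OF closed_complex_Reals _ _ l] by simp
  have "0 \<le> Re (pinf (u * of_real x) * pinf (v * of_real x))"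
    using \<open>\<And>n. _ n \<in> \<real> \<and> _ n\<close> by (intro LIMSEQ_le_const[OF tendsto_Re[OF l]]) auto
  moreover have "Re (pinf (u * of_real x) * pinf (v * of_real x)) \<noteq> 0"
    using n r by (auto simp: complex_is_Real_iff complex_eq_iff)
  ultimately show ?thesis using r of_real_Re[OF r, symmetric]
    by (intro exI[of _ "Re (pinf (u * of_real x) * pinf (v * of_real x))"]) simp
qed

text \<open>The mass of the lattice point \<open>x\<close> in the inner product. The absolute value
  accounts for the minus sign with which the negative half of the lattice enters the
  q-integral.\<close>

definition W :: "real \<Rightarrow> real" where "W x = (1 - q) * \<bar>x\<bar> * Re (ww x)"

lemma wt_eq: "ww x = pinf (a * of_real x) * pinf (b * of_real x) / (pinf (c * of_real x) * pinf (d * of_real x))"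
  by (simp add: wt_def qpochs_inf_def)

lemma wt_real: assumes "x \<in> R" shows "ww x = of_real (Re (ww x))" "0 < Re (ww x)"
proof -
  obtain r1 where r1: "0 < r1" "pinf (a * of_real x) * pinf (b * of_real x) = of_real r1"
    using positive_pochhammer_pair[OF assms pos(1)] pinf_Rq_ne[OF assms] by auto
  obtain r2 where r2: "0 < r2" "pinf (c * of_real x) * pinf (d * of_real x) = of_real r2"
    using positive_pochhammer_pair[OF assms pos(2)] pinf_Rq_ne[OF assms] by auto
  have e: "ww x = of_real (r1 / r2)" unfolding wt_eq r1 r2 by simp
  show "ww x = of_real (Re (ww x))" "0 < Re (ww x)" unfolding e using r1 r2 by simp_all
qed

lemma W_pos: "x \<in> R \<Longrightarrow> 0 < W x"
  unfolding W_def using wt_real(2)[of x] Rq_ne_0[of x] q1 by simp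

lemma W_cx: "x \<in> R \<Longrightarrow> of_real (W x) = of_real ((1 - q) * \<bar>x\<bar>) * ww x"
  unfolding W_def using wt_real(1)[of x] by simp

lemma R_eq: "R = (\<lambda>n. zm * q powi n) ` UNIV \<union> (\<lambda>n. zp * q powi n) ` UNIV"
  by (simp add: Rq_def)

lemma inj_powi: "z \<noteq> 0 \<Longrightarrow> inj (\<lambda>n::int. z * q powi n)"
proof (rule injI)
  fix m n :: int assume "z \<noteq> 0" "z * q powi m = z * q powi n"
  then have e: "q powi m = q powi n" by simp
  show "m = n"
  proof (rule linorder_cases[of m n])
    assume "m < n" then show ?thesis using power_int_strict_decreasing[of m n q] q0 q1 e by simp
  next
    assume "n < m" then show ?thesis using power_int_strict_decreasing[of n m q] q0 q1 e by simp
  qed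
qed

lemma R_disj: "(\<lambda>n::int. zm * q powi n) ` UNIV \<inter> (\<lambda>n::int. zp * q powi n) ` UNIV = {}"
proof -
  have "zm * q powi m \<noteq> zp * q powi n" for m n :: int
  proof -
    have "zm * q powi m < 0" "0 < zp * q powi n" using zm zp q0 by (simp_all add: mult_neg_pos)
    then show ?thesis by simp
  qed
  then show ?thesis by blast
qed

lemma qint_has_sum:
  fixes F :: "real \<Rightarrow> 'c::banach"
  assumes "(F has_sum S) R"
  shows "((\<lambda>n. F (zp * q powi n) + F (zm * q powi n)) has_sum S) UNIV"
proof -
  let ?A = "(\<lambda>n::int. zm * q powi n) ` UNIV" and ?B = "(\<lambda>n::int. zp * q powi n) ` UNIV"
  have s: "F summable_on ?A" "F summable_on ?B"
    by (rule summable_on_subset_banach[OF has_sum_imp_summable[OF assms]], simp add: R_eq)+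
  have "(F has_sum (infsum F ?A + infsum F ?B)) R"
    unfolding R_eq by (rule has_sum_Un_disjoint[OF has_sum_infsum[OF s(1)] has_sum_infsum[OF s(2)] R_disj])
  then have S: "S = infsum F ?A + infsum F ?B" using assms has_sum_unique by blast
  have "((\<lambda>n. F (zm * q powi n)) has_sum infsum F ?A) UNIV" "((\<lambda>n. F (zp * q powi n)) has_sum infsum F ?B) UNIV"
    using has_sum_infsum[OF s(1)] has_sum_infsum[OF s(2)] has_sum_reindex[OF inj_powi[of zm], of F] has_sum_reindex[OF inj_powi[of zp], of F] zm zp
    by (simp_all add: o_def)
  from has_sum_add[OF this(2,1)] show ?thesis unfolding S by (simp add: add.commute)
qed

lemma qint_term_eq:
  assumes F: "\<And>x. F x * of_real ((1 - q) * \<bar>x\<bar>) = G x"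
  shows "of_real (1 - q) * qint_term q zm zp F n = G (zp * q powi n) + G (zm * q powi n)"
proof -
  have "\<bar>zp * q powi n\<bar> = zp * q powi n" "\<bar>zm * q powi n\<bar> = - (zm * q powi n)" using zm zp q0 by (simp_all add: abs_mult)
  then show ?thesis unfolding qint_term_def F[symmetric] by (simp add: algebra_simps)
qed

definition weighted_square :: "(real \<Rightarrow> complex) \<Rightarrow> real \<Rightarrow> real" where "weighted_square f x = (norm (f x))\<^sup>2 * W x"

lemma weighted_square_nonneg: "f \<in> fun_on R \<Longrightarrow> 0 \<le> weighted_square f x"
  unfolding weighted_square_def using W_pos[of x] by (cases "x \<in> R") (auto simp: fun_on_def)

lemma term_eq: assumes f: "f \<in> fun_on R" shows "(f x * cnj (g x) * ww x) * of_real ((1 - q) * \<bar>x\<bar>) = f x * cnj (g x) * of_real (W x)"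
proof (cases "x \<in> R")
  case True show ?thesis unfolding W_cx[OF True] by (simp add: mult_ac)
qed (use f in \<open>simp add: fun_on_def\<close>)

text \<open>The q-integral adds the values on the two half lattices under one index. As the terms
  are nonnegative, this is the same as summing over the points of the lattice.\<close>

lemma HH_iff: "f \<in> HH \<longleftrightarrow> f \<in> fun_on R \<and> weighted_square f summable_on R"
proof (cases "f \<in> fun_on R")
  case f: True
  let ?F = "\<lambda>x. f x * cnj (f x) * ww x"
  have e: "of_real (1 - q) * qint_term q zm zp ?F n = complex_of_real (weighted_square f (zp * q powi n) + weighted_square f (zm * q powi n))" for n
    using qint_term_eq[OF term_eq[OF f, of _ f], of n] by (simp only: weighted_square_def of_real_add of_real_mult complex_norm_square)
  have "qint_term q zm zp ?F summable_on UNIV \<longleftrightarrow> (\<lambda>n. complex_of_real (1 - q) * qint_term q zm zp ?F n) summable_on UNIV"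
    using q1 by (subst summable_on_cmult_right') auto
  also have "\<dots> \<longleftrightarrow> (\<lambda>n. weighted_square f (zp * q powi n) + weighted_square f (zm * q powi n)) summable_on (UNIV :: int set)"
    unfolding e
  proof
    assume "(\<lambda>n. complex_of_real (weighted_square f (zp * q powi n) + weighted_square f (zm * q powi n))) summable_on (UNIV :: int set)"
    from summable_on_Re[OF this] show "(\<lambda>n. weighted_square f (zp * q powi n) + weighted_square f (zm * q powi n)) summable_on (UNIV :: int set)"
      by (simp only: Re_complex_of_real)
  next
    assume "(\<lambda>n. weighted_square f (zp * q powi n) + weighted_square f (zm * q powi n)) summable_on (UNIV :: int set)"
    then show "(\<lambda>n. complex_of_real (weighted_square f (zp * q powi n) + weighted_square f (zm * q powi n))) summable_on (UNIV :: int set)"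
      by (rule summable_on_of_real)
  qed
  also have "\<dots> \<longleftrightarrow> weighted_square f summable_on R"
  proof
    assume s: "(\<lambda>n. weighted_square f (zp * q powi n) + weighted_square f (zm * q powi n)) summable_on (UNIV :: int set)"
    have 1: "(\<lambda>n. weighted_square f (zp * q powi n)) summable_on (UNIV :: int set)" "(\<lambda>n. weighted_square f (zm * q powi n)) summable_on (UNIV :: int set)"
      by (rule summable_on_comparison_test[OF s], use weighted_square_nonneg[OF f] in auto)+
    show "weighted_square f summable_on R" unfolding R_eq
    proof (rule summable_on_Un_disjoint[OF _ _ R_disj])
      show "weighted_square f summable_on (\<lambda>n::int. zm * q powi n) ` UNIV" using 1(2) summable_on_reindex[OF inj_powi[of zm], of "weighted_square f"] zm by (simp add: o_def)
      show "weighted_square f summable_on (\<lambda>n::int. zp * q powi n) ` UNIV" using 1(1) summable_on_reindex[OF inj_powi[of zp], of "weighted_square f"] zp by (simp add: o_def)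
    qed
  next
    assume "weighted_square f summable_on R"
    from qint_has_sum[OF has_sum_infsum[OF this]] show "(\<lambda>n. weighted_square f (zp * q powi n) + weighted_square f (zm * q powi n)) summable_on (UNIV :: int set)"
      by (rule has_sum_imp_summable)
  qed
  finally show ?thesis using f by (simp add: L2_def)
qed (simp add: L2_def)

lemma HH_prod:
  assumes f: "f \<in> HH" and g: "g \<in> HH"
  shows "(\<lambda>x. f x * cnj (g x) * of_real (W x)) summable_on R"
proof (rule abs_summable_summable, rule summable_on_comparison_test)
  show "(\<lambda>x. weighted_square f x + weighted_square g x) summable_on R" using f g by (auto simp: HH_iff intro: summable_on_add)
  fix x assume x: "x \<in> R"
  have "0 \<le> (norm (f x) - norm (g x))\<^sup>2 + (norm (f x))\<^sup>2 + (norm (g x))\<^sup>2" by simp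
  then have "norm (f x) * norm (g x) \<le> (norm (f x))\<^sup>2 + (norm (g x))\<^sup>2" by (simp add: power2_diff)
  from mult_right_mono[OF this less_imp_le[OF W_pos[OF x]]]
  show "norm (f x * cnj (g x) * of_real (W x)) \<le> weighted_square f x + weighted_square g x"
    using W_pos[OF x] by (simp add: norm_mult weighted_square_def distrib_right)
qed simp

lemma inn_has_sum: assumes f: "f \<in> HH" and g: "g \<in> HH"
  shows "((\<lambda>x. f x * cnj (g x) * of_real (W x)) has_sum inn f g) R"
proof -
  have fo: "f \<in> fun_on R" using f by (simp add: HH_iff)
  let ?S = "infsum (\<lambda>x. f x * cnj (g x) * of_real (W x)) R"
  have "((\<lambda>x. f x * cnj (g x) * of_real (W x)) has_sum ?S) R" by (rule has_sum_infsum[OF HH_prod[OF f g]])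
  note h = this qint_has_sum[OF this]
  have "((\<lambda>n. of_real (1 - q) * qint_term q zm zp (\<lambda>x. f x * cnj (g x) * ww x) n) has_sum ?S) UNIV"
    using h(2) unfolding qint_term_eq[OF term_eq[OF fo, of _ g]] .
  then have "infsum (\<lambda>n. of_real (1 - q) * qint_term q zm zp (\<lambda>x. f x * cnj (g x) * ww x) n) UNIV = ?S" by (rule infsumI)
  then have "inn f g = ?S" unfolding L2_inner_def qint_def using q1 by (subst infsum_cmult_right'[symmetric]) simp
  then show ?thesis using h(1) by simp
qed

lemma HH_lincomb: assumes f: "f \<in> HH" and g: "g \<in> HH" shows "lincomb \<alpha> f \<beta> g \<in> HH"
proof -
  have fo: "lincomb \<alpha> f \<beta> g \<in> fun_on R" using f g by (auto simp: HH_iff fun_on_def lincomb_def)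
  have "weighted_square (lincomb \<alpha> f \<beta> g) summable_on R"
  proof (rule summable_on_comparison_test)
    show "(\<lambda>x. 2 * (norm \<alpha>)\<^sup>2 * weighted_square f x + 2 * (norm \<beta>)\<^sup>2 * weighted_square g x) summable_on R"
      using f g by (auto simp: HH_iff intro!: summable_on_add summable_on_cmult_right)
    fix x assume x: "x \<in> R"
    have "norm (lincomb \<alpha> f \<beta> g x) \<le> norm (\<alpha> * f x) + norm (\<beta> * g x)" unfolding lincomb_def by (rule norm_triangle_ineq)
    then have "(norm (lincomb \<alpha> f \<beta> g x))\<^sup>2 \<le> (norm (\<alpha> * f x) + norm (\<beta> * g x))\<^sup>2" by (rule power_mono) simp
    also have "\<dots> \<le> 2 * (norm (\<alpha> * f x))\<^sup>2 + 2 * (norm (\<beta> * g x))\<^sup>2"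
      using zero_le_power2[of "norm (\<alpha> * f x) - norm (\<beta> * g x)"] by (simp add: power2_diff power2_sum)
    finally have "(norm (lincomb \<alpha> f \<beta> g x))\<^sup>2 \<le> 2 * (norm \<alpha>)\<^sup>2 * (norm (f x))\<^sup>2 + 2 * (norm \<beta>)\<^sup>2 * (norm (g x))\<^sup>2"
      by (simp add: norm_mult power_mult_distrib)
    from mult_right_mono[OF this less_imp_le[OF W_pos[OF x]]]
    show "weighted_square (lincomb \<alpha> f \<beta> g) x \<le> 2 * (norm \<alpha>)\<^sup>2 * weighted_square f x + 2 * (norm \<beta>)\<^sup>2 * weighted_square g x"
      by (simp add: weighted_square_def algebra_simps)
    show "0 \<le> weighted_square (lincomb \<alpha> f \<beta> g) x" by (rule weighted_square_nonneg[OF fo])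
  qed
  then show ?thesis using fo by (simp add: HH_iff)
qed

lemma LL_lincomb: "LL (lincomb \<alpha> f \<beta> g) = lincomb \<alpha> (LL f) \<beta> (LL g)"
  by (rule ext) (simp add: L_def lincomb_def algebra_simps)

lemma DD_lincomb: assumes f: "f \<in> DD" and g: "g \<in> DD" shows "lincomb \<alpha> f \<beta> g \<in> DD"
proof -
  have Dq: "Dq q (lincomb \<alpha> f \<beta> g) x = \<alpha> * Dq q f x + \<beta> * Dq q g x" for x
    unfolding Dq_def lincomb_def by (simp add: diff_divide_distrib add_divide_distrib algebra_simps)
  obtain l1 where l1: "(\<lambda>k. f (zm * q ^ k)) \<longlonglongrightarrow> l1" "(\<lambda>k. f (zp * q ^ k)) \<longlonglongrightarrow> l1" using f by (auto simp: domL_def)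
  obtain l2 where l2: "(\<lambda>k. g (zm * q ^ k)) \<longlonglongrightarrow> l2" "(\<lambda>k. g (zp * q ^ k)) \<longlonglongrightarrow> l2" using g by (auto simp: domL_def)
  obtain m1 where m1: "(\<lambda>k. Dq q f (zm * q ^ k)) \<longlonglongrightarrow> m1" "(\<lambda>k. Dq q f (zp * q ^ k)) \<longlonglongrightarrow> m1" using f by (auto simp: domL_def)
  obtain m2 where m2: "(\<lambda>k. Dq q g (zm * q ^ k)) \<longlonglongrightarrow> m2" "(\<lambda>k. Dq q g (zp * q ^ k)) \<longlonglongrightarrow> m2" using g by (auto simp: domL_def)
  have "(\<lambda>k. lincomb \<alpha> f \<beta> g (zm * q ^ k)) \<longlonglongrightarrow> \<alpha> * l1 + \<beta> * l2" "(\<lambda>k. lincomb \<alpha> f \<beta> g (zp * q ^ k)) \<longlonglongrightarrow> \<alpha> * l1 + \<beta> * l2"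
    unfolding lincomb_def by (intro tendsto_add tendsto_mult tendsto_const l1 l2)+
  moreover have "(\<lambda>k. Dq q (lincomb \<alpha> f \<beta> g) (zm * q ^ k)) \<longlonglongrightarrow> \<alpha> * m1 + \<beta> * m2" "(\<lambda>k. Dq q (lincomb \<alpha> f \<beta> g) (zp * q ^ k)) \<longlonglongrightarrow> \<alpha> * m1 + \<beta> * m2"
    unfolding Dq by (intro tendsto_add tendsto_mult tendsto_const m1 m2)+
  ultimately show ?thesis using f g by (auto simp: domL_def HH_lincomb LL_lincomb)
qed

lemma finsupp_HH: assumes "f \<in> finsupp R" shows "f \<in> HH"
proof -
  have "weighted_square f summable_on R"
  proof -
    have "weighted_square f summable_on {x. f x \<noteq> 0}" using assms by (intro summable_on_finite) (simp add: finsupp_def)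
    then show ?thesis by (rule summable_on_cong_neutral[THEN iffD1, rotated 3]) (use assms in \<open>auto simp: weighted_square_def finsupp_def fun_on_def\<close>)
  qed
  then show ?thesis using assms by (simp add: HH_iff finsupp_def)
qed

lemma lattice_tendsto_0: "(\<lambda>k. z * q ^ k) \<longlonglongrightarrow> 0"
  by (rule tendsto_mult_right_zero, rule LIMSEQ_power_zero) (use q0 q1 in auto)

lemma finsupp_eventually_0:
  assumes f: "f \<in> finsupp R" shows "\<forall>\<^sub>F k in sequentially. f (z * q ^ k) = 0"
proof -
  have 0: "f 0 = 0" using f Rq_ne_0 by (auto simp: finsupp_def fun_on_def)
  have "closed {x. f x \<noteq> 0}" using f by (intro finite_imp_closed) (simp add: finsupp_def)
  then have "open (- {x. f x \<noteq> 0})" by (simp add: open_Compl)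
  then have "\<forall>\<^sub>F k in sequentially. z * q ^ k \<in> - {x. f x \<noteq> 0}"
    by (rule topological_tendstoD[OF lattice_tendsto_0]) (use 0 in simp)
  then show ?thesis by eventually_elim simp
qed

lemma finsupp_LL: assumes f: "f \<in> finsupp R" shows "LL f \<in> finsupp R"
proof -
  let ?S = "{x. f x \<noteq> 0}"
  have fin: "finite ?S" and fo: "\<And>x. x \<notin> R \<Longrightarrow> f x = 0" using f by (auto simp: finsupp_def fun_on_def)
  have "{x. LL f x \<noteq> 0} \<subseteq> ?S \<union> (\<lambda>x. q * x) ` ?S \<union> (\<lambda>x. x / q) ` ?S"
  proof
    fix x assume "x \<in> {x. LL f x \<noteq> 0}"
    then have "f (x / q) \<noteq> 0 \<or> f (q * x) \<noteq> 0 \<or> f x \<noteq> 0" by (auto simp: L_def)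
    moreover have "x = q * (x / q)" "x = q * x / q" using q0 by simp_all
    ultimately show "x \<in> ?S \<union> (\<lambda>x. q * x) ` ?S \<union> (\<lambda>x. x / q) ` ?S" by blast
  qed
  then have "finite {x. LL f x \<noteq> 0}" by (rule finite_subset) (use fin in simp)
  moreover have "LL f x = 0" if x: "x \<notin> R" for x
  proof -
    have "x / q \<notin> R" "q * x \<notin> R" using x Rq_mult'(2)[of "x / q"] Rq_mult'(3)[of "q * x"] q0 by auto
    then show ?thesis using x fo by (simp add: L_def)
  qed
  ultimately show ?thesis by (simp add: finsupp_def fun_on_def)
qed

lemma finsupp_DD: assumes f: "f \<in> finsupp R" shows "f \<in> DD"
proof -
  have l: "(\<lambda>k. f (z * q ^ k)) \<longlonglongrightarrow> 0" for z by (rule tendsto_eventually[OF finsupp_eventually_0[OF f]])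
  have "\<forall>\<^sub>F k in sequentially. Dq q f (z * q ^ k) = 0" for z
    using finsupp_eventually_0[OF f, of z] finsupp_eventually_0[OF f, of "q * z"]
    by eventually_elim (simp add: Dq_def mult_ac)
  then have "(\<lambda>k. Dq q f (z * q ^ k)) \<longlonglongrightarrow> 0" for z by (rule tendsto_eventually)
  then show ?thesis using l finsupp_HH[OF f] finsupp_HH[OF finsupp_LL[OF f]] by (auto simp: domL_def)
qed

lemma DD_HH: "f \<in> DD \<Longrightarrow> f \<in> HH" by (simp add: domL_def)

lemma inn_finsupp: assumes f: "f \<in> HH" and g: "g \<in> finsupp R"
  shows "inn f g = (\<Sum>x | g x \<noteq> 0. f x * cnj (g x) * of_real (W x))"
proof -
  have "((\<lambda>x. f x * cnj (g x) * of_real (W x)) has_sum inn f g) R" by (rule inn_has_sum[OF f finsupp_HH[OF g]])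
  then have "((\<lambda>x. f x * cnj (g x) * of_real (W x)) has_sum inn f g) {x. g x \<noteq> 0}"
    by (rule has_sum_cong_neutral[THEN iffD1, rotated 3]) (use g in \<open>auto simp: finsupp_def fun_on_def\<close>)
  then show ?thesis using g by (simp add: has_sum_finite_iff finsupp_def)
qed

lemma spectral_resolution_bqj:
  assumes E: "spectral_measure_of HH inn DD LL E"
  shows "spectral_resolution HH inn DD LL E"
proof
  fix f g h and \<alpha> \<beta>
  assume f: "f \<in> HH" and g: "g \<in> HH"
  show "lincomb \<alpha> f \<beta> g \<in> HH" by (rule HH_lincomb[OF f g])
  show "inn g f = cnj (inn f g)"
  proof (rule has_sum_unique[OF inn_has_sum[OF g f]])
    have "((\<lambda>x. cnj (f x * cnj (g x) * of_real (W x))) has_sum cnj (inn f g)) R"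
      using inn_has_sum[OF f g] by (simp only: has_sum_cnj_iff)
    then show "((\<lambda>x. g x * cnj (f x) * of_real (W x)) has_sum cnj (inn f g)) R" by (simp add: mult_ac)
  qed
  assume h: "h \<in> HH"
  show "inn (lincomb \<alpha> f \<beta> g) h = \<alpha> * inn f h + \<beta> * inn g h"
  proof (rule has_sum_unique[OF inn_has_sum[OF HH_lincomb[OF f g] h]])
    show "((\<lambda>x. lincomb \<alpha> f \<beta> g x * cnj (h x) * of_real (W x)) has_sum (\<alpha> * inn f h + \<beta> * inn g h)) R"
      using has_sum_add[OF has_sum_cmult_right[OF inn_has_sum[OF f h], of \<alpha>] has_sum_cmult_right[OF inn_has_sum[OF g h], of \<beta>]]
      by (simp add: lincomb_def algebra_simps)
  qed
next
  fix f assume f: "f \<in> HH"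
  show "0 \<le> Re (inn f f)"
  proof -
    have "((\<lambda>x. Re (f x * cnj (f x) * of_real (W x))) has_sum Re (inn f f)) R" by (rule has_sum_Re[OF inn_has_sum[OF f f]])
    then show ?thesis
    proof (rule has_sum_nonneg)
      fix x assume "x \<in> R"
      have "Re (f x * cnj (f x) * of_real (W x)) = (norm (f x))\<^sup>2 * W x"
        unfolding complex_norm_square[symmetric] by (simp flip: of_real_mult of_real_power)
      then show "0 \<le> Re (f x * cnj (f x) * of_real (W x))" using W_pos[OF \<open>x \<in> R\<close>] by simp
    qed
  qed
  assume z: "\<And>h. h \<in> DD \<Longrightarrow> inn f h = 0"
  show "f = (\<lambda>_. 0)"
  proof
    fix x
    show "f x = 0"
    proof (cases "x \<in> R")
      case True
      \<comment> \<open>A unit mass at one lattice point belongs to the domain, and pairing with it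
        recovers the value of \<open>f\<close> there.\<close>
      define h where "h = (\<lambda>y. if y = x then 1 else 0 :: complex)"
      have h: "h \<in> finsupp R" using True by (auto simp: h_def finsupp_def fun_on_def)
      have "{y. h y \<noteq> 0} = {x}" by (auto simp: h_def)
      then have "inn f h = f x * of_real (W x)" using inn_finsupp[OF f h] by (simp add: h_def)
      then show ?thesis using z[OF finsupp_DD[OF h]] W_pos[OF True] by simp
    qed (use f in \<open>simp add: HH_iff fun_on_def\<close>)
  qed
next
  show "\<And>\<alpha> f \<beta> g. f \<in> DD \<Longrightarrow> g \<in> DD \<Longrightarrow> lincomb \<alpha> f \<beta> g \<in> DD" by (rule DD_lincomb)
  show "\<And>f. f \<in> DD \<Longrightarrow> LL f \<in> HH" by (simp add: domL_def)
  show "\<And>\<alpha> f \<beta> g. LL (lincomb \<alpha> f \<beta> g) = lincomb \<alpha> (LL f) \<beta> (LL g)" by (rule LL_lincomb)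
  show "spectral_measure_of HH inn DD LL E" by (rule E)
qed

end

text \<open>Since \<open>r\<close> tends to 0, \<open>r n\<close> is the sum of all later
  increments, and these are dominated by a geometric series.\<close>

lemma geometric_tail_bound:
  fixes r :: "nat \<Rightarrow> complex"
  assumes lim: "r \<longlonglongrightarrow> 0" and \<rho>: "0 < \<rho>" "\<rho> < 1"
    and step: "\<And>n. N \<le> n \<Longrightarrow> norm (r n - r (Suc n)) \<le> C * \<rho> ^ n" and n: "N \<le> n"
  shows "norm (r n) \<le> C / (1 - \<rho>) * \<rho> ^ n"
proof -
  have C: "0 \<le> C * \<rho> ^ n" using step[OF n] norm_ge_zero order_trans by blast
  have "norm (r n - r (n + k)) \<le> C * \<rho> ^ n * ((1 - \<rho> ^ k) / (1 - \<rho>))" for k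
  proof (induction k)
    case (Suc k)
    have "norm (r n - r (n + Suc k)) \<le> norm (r n - r (n + k)) + norm (r (n + k) - r (Suc (n + k)))"
      using norm_triangle_ineq[of "r n - r (n + k)" "r (n + k) - r (Suc (n + k))"] by simp
    also have "\<dots> \<le> C * \<rho> ^ n * ((1 - \<rho> ^ k) / (1 - \<rho>)) + C * \<rho> ^ (n + k)" by (intro add_mono Suc step) (use n in simp)
    also have "\<dots> = C * \<rho> ^ n * ((1 - \<rho> ^ Suc k) / (1 - \<rho>))"
    proof -
      have "(1 - \<rho> ^ k) / (1 - \<rho>) + \<rho> ^ k = (1 - \<rho> ^ Suc k) / (1 - \<rho>)" using \<rho> by (simp add: field_simps)
      then show ?thesis unfolding power_add by (simp only: distrib_left[symmetric] mult.assoc)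
    qed
    finally show ?case .
  qed simp
  moreover have "C * \<rho> ^ n * ((1 - \<rho> ^ k) / (1 - \<rho>)) \<le> C / (1 - \<rho>) * \<rho> ^ n" for k
  proof -
    have "C * \<rho> ^ n * ((1 - \<rho> ^ k) / (1 - \<rho>)) \<le> C * \<rho> ^ n * (1 / (1 - \<rho>))"
      by (rule mult_left_mono[OF _ C]) (use \<rho> in \<open>simp add: divide_right_mono\<close>)
    then show ?thesis by simp
  qed
  ultimately have b: "norm (r n - r (n + k)) \<le> C / (1 - \<rho>) * \<rho> ^ n" for k using order_trans by blast
  have "(\<lambda>k. norm (r n - r (n + k))) \<longlonglongrightarrow> norm (r n - 0)"
    by (intro tendsto_norm tendsto_diff tendsto_const) (use LIMSEQ_ignore_initial_segment[OF lim, of n] in \<open>simp add: add.commute\<close>)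
  then show ?thesis using LIMSEQ_le_const2[of _ "norm (r n - 0)" "C / (1 - \<rho>) * \<rho> ^ n"] b by auto
qed

lemma summable_on_Un:
  fixes h :: "'a \<Rightarrow> real"
  assumes "h summable_on A" "h summable_on B" shows "h summable_on (A \<union> B)"
proof -
  have "h summable_on (A \<union> (B - A))"
    by (rule summable_on_Un_disjoint[OF assms(1) summable_on_subset_banach[OF assms(2)]]) auto
  then show ?thesis by simp
qed

section \<open>The solutions decaying at one end, and the Green kernel\<close>

context bqj
begin

abbreviation "Phid \<equiv> bqj.Phi q zm zp b a c d s"

definition casorati :: "(real \<Rightarrow> complex) \<Rightarrow> (real \<Rightarrow> complex) \<Rightarrow> real \<Rightarrow> complex" where
  "casorati f g x = f x * g (x / q) - f (x / q) * g x"

text \<open>Equals \<open>W x * coefA q a b c d x\<close> up to the sign of \<open>x\<close>, see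
  \<open>W_coefA\<close>. It is the factor that makes the Casoratian of two eigenfunctions
  constant.\<close>

definition casorati_weight :: "complex \<Rightarrow> complex" where
  "casorati_weight x = (1 - Q) * Q\<^sup>2 / (s * a * b * x) * (pinf (a * (x / Q)) * pinf (b * (x / Q)) / (pinf (c * x) * pinf (d * x)))"

text \<open>The constant value of the weighted Casoratian of \<open>\<phi>\<^sub>\<gamma>\<close>
  and its dagger, the same on both half lattices, see \<open>casorati_Phi\<close>.\<close>

definition D0 :: "complex \<Rightarrow> complex" where "D0 \<gamma> = (1 - Q) * Q * kap \<gamma> / (s * a * b)"

lemma W_coefA: assumes x: "x \<in> R" shows "of_real (W x) * coefA q a b c d x = of_real (sgn x) * casorati_weight (of_real x)"
proof -
  define y where "y = complex_of_real x"
  have y: "y \<noteq> 0" using Rq_ne_0[OF x] by (simp add: y_def)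
  define A B V where "A = 1 - a * (y / Q)" and "B = 1 - b * (y / Q)" and "V = pinf (a * y) * pinf (b * y) / (pinf (c * y) * pinf (d * y))"
  have p: "pinf (a * (y / Q)) = A * pinf (a * y)" "pinf (b * (y / Q)) = B * pinf (b * y)"
    unfolding A_def B_def using pinf_rec[of "a * (y / Q)"] pinf_rec[of "b * (y / Q)"] by simp_all
  have e: "1 - Q / (a * y) = - (Q / (a * y)) * A" "1 - Q / (b * y) = - (Q / (b * y)) * B"
    unfolding A_def B_def using y nz by (simp_all add: field_simps)
  have ax: "complex_of_real \<bar>x\<bar> = of_real (sgn x) * y" by (simp add: y_def flip: of_real_mult abs_sgn) (simp add: mult.commute abs_sgn)
  have "of_real (W x) * coefA q a b c d x = (1 - Q) * (of_real (sgn x) * y) * V * (inverse s * (- (Q / (a * y)) * A) * (- (Q / (b * y)) * B))"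
    unfolding W_cx[OF x] wt_eq coefA_def sroot_eq y_def[symmetric] e V_def by (simp add: ax)
  also have "\<dots> = of_real (sgn x) * ((1 - Q) * Q\<^sup>2 / (s * a * b * y) * (A * B * V))"
    using y nz by (simp add: field_simps power2_eq_square)
  also have "\<dots> = of_real (sgn x) * casorati_weight y" unfolding casorati_weight_def p V_def by simp
  finally show ?thesis unfolding y_def .
qed

lemma casorati_Phi: assumes g: "1 \<le> norm \<gamma>" and x: "x \<in> R"
  shows "casorati_weight (of_real x) * casorati (Phi \<gamma>) (Phid \<gamma>) x = D0 \<gamma>"
proof -
  interpret sw: bqj q zm zp b a c d s by (rule swap_ab)
  define y where "y = complex_of_real x"
  define u where "u = y / Q"
  have y: "y \<noteq> 0" using Rq_ne_0[OF x] by (simp add: y_def)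
  have yu: "y = Q * u" by (simp add: u_def)
  note x' = Rq_mult'(3)[OF x]
  define A B where "A = pinf (a * u)" and "B = pinf (b * u)"
  have AB: "A \<noteq> 0" "B \<noteq> 0" unfolding A_def B_def u_def y_def using pinf_Rq_ne(1,2)[OF x'] by simp_all
  define A' B' where "A' = pinf (a * y)" and "B' = pinf (b * y)"
  have AB': "A' \<noteq> 0" "B' \<noteq> 0" unfolding A'_def B'_def y_def using pinf_Rq_ne(1,2)[OF x] by simp_all
  have A: "A = (1 - a * u) * A'" "B = (1 - b * u) * B'" unfolding A_def B_def A'_def B'_def yu using pinf_rec[of "a * u"] pinf_rec[of "b * u"] by (simp_all add: mult_ac)
  define n1 n2 m1 m2 where "n1 = NN \<gamma> u" and "n2 = NN \<gamma> y" and "m1 = sw.NN \<gamma> u" and "m2 = sw.NN \<gamma> y"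
  have ab1: "1 - a * u \<noteq> 0" "1 - b * u \<noteq> 0" using AB A by auto
  have "casorati (Phi \<gamma>) (Phid \<gamma>) x = n2 / B' * (m1 / A) - n1 / B * (m2 / A')"
    unfolding casorati_def Phi_def sw.Phi_def using x x' by (simp add: n1_def n2_def m1_def m2_def A_def B_def A'_def B'_def u_def y_def)
  also have "\<dots> = ((1 - b * u) * n2 * m1 - (1 - a * u) * n1 * m2) / (A * B)"
  proof -
    have "n2 / B' * (m1 / A) = (1 - b * u) * n2 * m1 / (A * B)" "n1 / B * (m2 / A') = (1 - a * u) * n1 * m2 / (A * B)"
      unfolding A using AB' ab1 by simp_all
    then show ?thesis by (simp only: diff_divide_distrib)
  qed
  also have "(1 - b * u) * n2 * m1 - (1 - a * u) * n1 * m2 = Dh \<gamma> u"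
    unfolding Dh_def n1_def n2_def m1_def m2_def yu ..
  also have "Dh \<gamma> u = kap \<gamma> * u * (pinf (c * y) * pinf (d * y))" unfolding Dh_eq[OF g] yu by (simp add: mult.assoc)
  finally have cs: "casorati (Phi \<gamma>) (Phid \<gamma>) x = kap \<gamma> * u * (pinf (c * y) * pinf (d * y)) / (A * B)" .
  have CD: "pinf (c * y) \<noteq> 0" "pinf (d * y) \<noteq> 0" using pinf_Rq_ne(3,4)[OF x] by (simp_all add: y_def)
  have "casorati_weight y * casorati (Phi \<gamma>) (Phid \<gamma>) x = (1 - Q) * Q\<^sup>2 / (s * a * b * y) * (A * B / (pinf (c * y) * pinf (d * y))) * (kap \<gamma> * u * (pinf (c * y) * pinf (d * y)) / (A * B))"
    unfolding cs casorati_weight_def A_def B_def u_def ..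
  also have "\<dots> = (1 - Q) * Q\<^sup>2 / (s * a * b * y) * (kap \<gamma> * u)" using AB CD by (simp add: mult_ac)
  also have "\<dots> = D0 \<gamma>" unfolding D0_def u_def using y by (simp add: power2_eq_square mult_ac)
  finally show ?thesis unfolding y_def .
qed

definition Psi :: "complex \<Rightarrow> real \<Rightarrow> real \<Rightarrow> complex" where
  "Psi \<gamma> z x = chatd \<gamma> (of_real z) * Phi \<gamma> x - chat \<gamma> (of_real z) * Phid \<gamma> x"

definition Delta :: "complex \<Rightarrow> complex" where
  "Delta \<gamma> = chat \<gamma> (of_real zm) * chatd \<gamma> (of_real zp) - chatd \<gamma> (of_real zm) * chat \<gamma> (of_real zp)"

lemma casorati_Psi: "casorati (Psi \<gamma> zm) (Psi \<gamma> zp) x = Delta \<gamma> * casorati (Phi \<gamma>) (Phid \<gamma>) x"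
  unfolding casorati_def Psi_def Delta_def by (simp add: algebra_simps)

lemma Psi_L: assumes g: "1 \<le> norm \<gamma>" and x: "x \<in> R"
  shows "LL (Psi \<gamma> z) x = (\<gamma> + inverse \<gamma>) * Psi \<gamma> z x"
proof -
  interpret sw: bqj q zm zp b a c d s by (rule swap_ab)
  have "L q b a c d f x = LL f x" for f
    by (simp add: L_def coefA_def coefB_def coefC_def sroot_eq sw.sroot_eq mult_ac)
  then have 1: "LL (Phid \<gamma>) x = (\<gamma> + inverse \<gamma>) * Phid \<gamma> x" using sw.Phi_L[OF g x] by simp
  have "Psi \<gamma> z = lincomb (chatd \<gamma> (of_real z)) (Phi \<gamma>) (- chat \<gamma> (of_real z)) (Phid \<gamma>)"
    by (rule ext) (simp add: Psi_def lincomb_def)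
  then have "LL (Psi \<gamma> z) x = chatd \<gamma> (of_real z) * LL (Phi \<gamma>) x - chat \<gamma> (of_real z) * LL (Phid \<gamma>) x"
    by (simp add: LL_lincomb) (simp add: lincomb_def)
  also have "\<dots> = (\<gamma> + inverse \<gamma>) * Psi \<gamma> z x" unfolding Phi_L[OF g x] 1 Psi_def by (simp add: algebra_simps)
  finally show ?thesis .
qed

text \<open>Quotients of q-shifted factorials along the lattice grow geometrically with theta
  quotients as limits. The power of \<open>s * s = c * d * Q / (a * b)\<close> compensates this
  growth; its factor \<open>Q\<close> belongs to the length
  \<open>\<bar>z\<bar> / q ^ n\<close>.\<close>

lemma W_asymp: assumes z: "z \<in> {zm, zp}"
  shows "(\<lambda>n. of_real (W (z / q ^ n)) * (s * s) ^ n) \<longlonglongrightarrow> of_real ((1 - q) * \<bar>z\<bar>) *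
    (th (a * of_real z) / th (c * of_real z) * (th (b * of_real z) / th (d * of_real z)))"
    "of_real ((1 - q) * \<bar>z\<bar>) * (th (a * of_real z) / th (c * of_real z) * (th (b * of_real z) / th (d * of_real z))) \<noteq> 0"
proof -
  define zc where "zc = complex_of_real z"
  have zR: "z \<in> R" using RqI[of z zm zp 0] z by simp
  have z0: "zc \<noteq> 0" using zm zp z by (auto simp: zc_def)
  note thn = th_Rq_ne[OF zR, folded zc_def]
  have l: "(\<lambda>n. of_real ((1 - q) * \<bar>z\<bar>) * ((pinf (a * zc / Q ^ n) / pinf (c * zc / Q ^ n) * (c * zc / (a * zc)) ^ n) * (pinf (b * zc / Q ^ n) / pinf (d * zc / Q ^ n) * (d * zc / (b * zc)) ^ n)))
     \<longlonglongrightarrow> of_real ((1 - q) * \<bar>z\<bar>) * (th (a * zc) / th (c * zc) * (th (b * zc) / th (d * zc)))"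
    by (intro tendsto_mult[OF tendsto_const] tendsto_mult pinf_ratio_limit) (use z0 nz thn in auto)
  have e: "of_real (W (z / q ^ n)) * (s * s) ^ n = of_real ((1 - q) * \<bar>z\<bar>) * ((pinf (a * zc / Q ^ n) / pinf (c * zc / Q ^ n) * (c * zc / (a * zc)) ^ n) * (pinf (b * zc / Q ^ n) / pinf (d * zc / Q ^ n) * (d * zc / (b * zc)) ^ n))" for n
  proof -
    have "\<bar>z / q ^ n\<bar> = \<bar>z\<bar> / q ^ n" using q0 by (simp add: abs_divide)
    moreover have "(s * s) ^ n = (c / a) ^ n * (d / b) ^ n * Q ^ n" unfolding s_sq' by (simp add: power_divide power_mult_distrib)
    ultimately show ?thesis using z0 unfolding W_cx[OF Rq_mult'(4)[OF zR]] wt_eq by (simp add: zc_def)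
  qed
  show "(\<lambda>n. of_real (W (z / q ^ n)) * (s * s) ^ n) \<longlonglongrightarrow> of_real ((1 - q) * \<bar>z\<bar>) *
    (th (a * of_real z) / th (c * of_real z) * (th (b * of_real z) / th (d * of_real z)))"
    using l unfolding e zc_def .
  show "of_real ((1 - q) * \<bar>z\<bar>) * (th (a * of_real z) / th (c * of_real z) * (th (b * of_real z) / th (d * of_real z))) \<noteq> 0"
    using thn z0 q1 by (simp add: zc_def)
qed

lemma coefA_asymp: "(\<lambda>n. coefA q a b c d (z / q ^ n)) \<longlonglongrightarrow> inverse s"
proof -
  have l: "(\<lambda>n. of_real q / (w * of_real (z / q ^ n))) \<longlonglongrightarrow> 0" for w :: complex
  proof -
    have "(\<lambda>n. Q / (w * of_real z) * Q ^ n) \<longlonglongrightarrow> 0"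
      by (rule tendsto_mult_right_zero, rule LIMSEQ_power_zero) (use q0 q1 in auto)
    moreover have "of_real q / (w * of_real (z / q ^ n)) = Q / (w * of_real z) * Q ^ n" for n by simp
    ultimately show ?thesis by simp
  qed
  have "(\<lambda>n. coefA q a b c d (z / q ^ n)) \<longlonglongrightarrow> inverse s * (1 - 0) * (1 - 0)"
    unfolding coefA_def sroot_eq by (intro tendsto_mult tendsto_diff tendsto_const l)
  then show ?thesis by simp
qed

text \<open>\<open>Psi \<gamma> z\<close> is the combination of the two solutions in which the leading terms at the end \<open>z\<close> cancel.
  By the constancy of the Casoratian the quotient \<open>Psi / Phi\<close> has increments of order \<open>\<gamma>\<^sup>-\<^sup>2\<^sup>n\<close>.\<close>

lemma Psi_decay:
  assumes g: "1 < norm \<gamma>" and z: "z \<in> {zm, zp}" and ch: "chat \<gamma> (of_real z) \<noteq> 0"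
  shows "summable (\<lambda>n. weighted_square (Psi \<gamma> z) (z / q ^ n))"
proof -
  interpret sw: bqj q zm zp b a c d s by (rule swap_ab)
  have zR: "z \<in> R" using RqI[of z zm zp 0] z by simp
  have g1: "1 \<le> norm \<gamma>" "\<gamma> \<noteq> 0" using g by auto
  define x where "x = (\<lambda>n. z / q ^ n)"
  have xR: "x n \<in> R" for n unfolding x_def by (rule Rq_mult'(4)[OF zR])
  have xS: "x n / q = x (Suc n)" for n by (simp add: x_def)
  define g2 where "g2 = pinf (1 / \<gamma>\<^sup>2)"
  have g2: "g2 \<noteq> 0"
  proof -
    have "1 < (norm \<gamma>)\<^sup>2" by (rule one_less_power[OF g]) simp
    then have "1 / (norm \<gamma>)\<^sup>2 < 1" by (subst divide_less_eq_1_pos) linarith+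
    then have "norm (1 / \<gamma>\<^sup>2) < 1" by (simp add: norm_divide norm_power)
    then show ?thesis unfolding g2_def by (rule pinf_ne_0_lt1)
  qed
  define ch1 ch2 where "ch1 = chat \<gamma> (of_real z)" and "ch2 = chatd \<gamma> (of_real z)"
  define \<phi> p where "\<phi> = (\<lambda>n. Phi \<gamma> (x n) / (s * \<gamma>) ^ n)" and "p = (\<lambda>n. Psi \<gamma> z (x n) / (s * \<gamma>) ^ n)"
  have \<phi>: "\<phi> \<longlonglongrightarrow> ch1 / g2" unfolding \<phi>_def x_def ch1_def g2_def by (rule Phi_asymp[OF g z])
  have \<phi>d: "(\<lambda>n. Phid \<gamma> (x n) / (s * \<gamma>) ^ n) \<longlonglongrightarrow> ch2 / g2" unfolding x_def ch2_def g2_def by (rule sw.Phi_asymp[OF g z])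
  have "p = (\<lambda>n. ch2 * \<phi> n - ch1 * (Phid \<gamma> (x n) / (s * \<gamma>) ^ n))"
    by (rule ext) (simp add: p_def \<phi>_def Psi_def ch1_def ch2_def diff_divide_distrib)
  moreover have "(\<lambda>n. ch2 * \<phi> n - ch1 * (Phid \<gamma> (x n) / (s * \<gamma>) ^ n)) \<longlonglongrightarrow> ch2 * (ch1 / g2) - ch1 * (ch2 / g2)"
    by (intro tendsto_diff tendsto_mult tendsto_const \<phi> \<phi>d)
  ultimately have p0: "p \<longlonglongrightarrow> 0" by simp
  have c0: "ch1 / g2 \<noteq> 0" using ch g2 by (simp add: ch1_def)
  define r where "r = (\<lambda>n. p n / \<phi> n)"
  have r0: "r \<longlonglongrightarrow> 0" unfolding r_def using tendsto_divide[OF p0 \<phi> c0] by simp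
  have "\<forall>\<^sub>F n in sequentially. \<phi> n \<noteq> 0" by (rule tendsto_imp_eventually_ne[OF \<phi> c0])
  then obtain N where N: "\<And>n. N \<le> n \<Longrightarrow> \<phi> n \<noteq> 0" by (auto simp: eventually_sequentially)
  define K where "K = complex_of_real ((1 - q) * \<bar>z\<bar>) * (th (a * of_real z) / th (c * of_real z) * (th (b * of_real z) / th (d * of_real z)))"
  define \<omega> where "\<omega> = (\<lambda>n. of_real (W (x n)) * (s * s) ^ n)"
  have \<omega>: "\<omega> \<longlonglongrightarrow> K" "K \<noteq> 0" unfolding \<omega>_def x_def K_def by (rule W_asymp[OF z])+
  define \<alpha> where "\<alpha> = (\<lambda>n. coefA q a b c d (x n))"
  have \<alpha>: "\<alpha> \<longlonglongrightarrow> inverse s" unfolding \<alpha>_def x_def by (rule coefA_asymp)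
  define \<sigma> where "\<sigma> = complex_of_real (sgn z)"
  \<comment> \<open>The increment of \<open>r\<close> multiplied by
    \<open>(\<gamma> * \<gamma>) ^ n\<close>, see \<open>er\<close>: in the constant weighted
    Casoratian, \<open>W\<close> contributes \<open>(s * s) ^ n\<close> in the denominator, and the
    two values of \<open>Phi\<close> that form the common denominator of the quotients contribute
    powers of \<open>s * \<gamma>\<close>.\<close>
  define e where "e = (\<lambda>n. ch1 * \<sigma> * D0 \<gamma> / (\<omega> n * \<alpha> n * (\<phi> n * \<phi> (Suc n)) * (s * \<gamma>)))"
  have "e \<longlonglongrightarrow> ch1 * \<sigma> * D0 \<gamma> / (K * inverse s * (ch1 / g2 * (ch1 / g2)) * (s * \<gamma>))"
    unfolding e_def by (intro tendsto_divide tendsto_mult tendsto_const \<phi> \<omega> \<alpha> LIMSEQ_Suc[OF \<phi>]) (use c0 \<omega>(2) g1 in auto)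
  then have "Bseq e" by (intro convergent_imp_Bseq convergentI)
  then obtain C where C: "0 < C" "\<And>n. norm (e n) \<le> C" by (auto elim: BseqE)
  have er: "(r n - r (Suc n)) * (\<gamma> * \<gamma>) ^ n = e n" if n: "N \<le> n" for n
  proof -
    have nn: "\<phi> n \<noteq> 0" "\<phi> (Suc n) \<noteq> 0" using N n by auto
    have w0: "of_real (W (x n)) * \<alpha> n \<noteq> 0" using W_pos[OF xR] coefA_ne(1)[OF xR] unfolding \<alpha>_def by (metis less_irrefl mult_eq_0_iff of_real_eq_0_iff)
    have k: "of_real (W (x n)) * \<alpha> n * casorati (Phi \<gamma>) (Phid \<gamma>) (x n) = \<sigma> * D0 \<gamma>"
    proof -
      have "sgn (x n) = sgn z" using q0 by (simp add: x_def sgn_divide)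
      then show ?thesis unfolding \<alpha>_def W_coefA[OF xR] mult.assoc casorati_Phi[OF g1(1) xR] \<sigma>_def by simp
    qed
    have c: "Psi \<gamma> z (x n) * Phi \<gamma> (x (Suc n)) - Psi \<gamma> z (x (Suc n)) * Phi \<gamma> (x n) = ch1 * casorati (Phi \<gamma>) (Phid \<gamma>) (x n)"
      unfolding casorati_def Psi_def xS ch1_def by (simp add: algebra_simps)
    have P: "Psi \<gamma> z (x k) = p k * (s * \<gamma>) ^ k" "Phi \<gamma> (x k) = \<phi> k * (s * \<gamma>) ^ k" for k
      using g1 by (simp_all add: p_def \<phi>_def)
    have sg: "(s * \<gamma>) ^ n * (s * \<gamma>) ^ Suc n = (s * s) ^ n * (\<gamma> * \<gamma>) ^ n * (s * \<gamma>)" by (simp add: power_mult_distrib)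
    have d: "(p n * \<phi> (Suc n) - p (Suc n) * \<phi> n) * ((s * s) ^ n * (\<gamma> * \<gamma>) ^ n * (s * \<gamma>)) = ch1 * casorati (Phi \<gamma>) (Phid \<gamma>) (x n)"
      unfolding c[symmetric] P sg[symmetric] by (simp only: algebra_simps)
    have "(r n - r (Suc n)) * (\<gamma> * \<gamma>) ^ n * (\<omega> n * \<alpha> n * (\<phi> n * \<phi> (Suc n)) * (s * \<gamma>))
      = (p n * \<phi> (Suc n) - p (Suc n) * \<phi> n) * ((s * s) ^ n * (\<gamma> * \<gamma>) ^ n * (s * \<gamma>)) * (of_real (W (x n)) * \<alpha> n)"
      unfolding r_def \<omega>_def using nn by (simp add: field_simps)
    also have "\<dots> = ch1 * (of_real (W (x n)) * \<alpha> n * casorati (Phi \<gamma>) (Phid \<gamma>) (x n))" unfolding d by (simp only: mult_ac)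
    also have "\<dots> = ch1 * \<sigma> * D0 \<gamma>" unfolding k by (simp only: mult_ac)
    finally have f: "(r n - r (Suc n)) * (\<gamma> * \<gamma>) ^ n * (\<omega> n * \<alpha> n * (\<phi> n * \<phi> (Suc n)) * (s * \<gamma>)) = ch1 * \<sigma> * D0 \<gamma>" .
    have "\<omega> n * \<alpha> n * (\<phi> n * \<phi> (Suc n)) * (s * \<gamma>) \<noteq> 0" using w0 nn g1 by (simp add: \<omega>_def)
    then show ?thesis unfolding e_def f[symmetric] by simp
  qed
  define \<rho> where "\<rho> = 1 / (norm \<gamma> * norm \<gamma>)"
  have gg: "1 < norm \<gamma> * norm \<gamma>" using g less_1_mult by blast
  have \<rho>: "0 < \<rho>" "\<rho> < 1" unfolding \<rho>_def using gg by auto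
  have st: "norm (r n - r (Suc n)) \<le> C * \<rho> ^ n" if n: "N \<le> n" for n
  proof -
    have "norm (r n - r (Suc n)) * (norm \<gamma> * norm \<gamma>) ^ n = norm (e n)" unfolding er[OF n, symmetric] by (simp add: norm_mult norm_power)
    then have "norm (r n - r (Suc n)) = norm (e n) * \<rho> ^ n" using g1 unfolding \<rho>_def by (simp add: field_simps)
    also have "\<dots> \<le> C * \<rho> ^ n" by (rule mult_right_mono[OF C(2)]) (use \<rho> in simp)
    finally show ?thesis .
  qed
  define C2 where "C2 = C / (1 - \<rho>)"
  have rb: "norm (r n) \<le> C2 * \<rho> ^ n" if "N \<le> n" for n unfolding C2_def
    by (rule geometric_tail_bound[OF r0 \<rho> st that])
  have "Bseq \<omega>" "Bseq \<phi>" using \<omega> \<phi> by (auto intro!: convergent_imp_Bseq convergentI)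
  then obtain B1 B2 where B: "0 < B1" "0 < B2" "\<And>n. norm (\<omega> n) \<le> B1" "\<And>n. norm (\<phi> n) \<le> B2" by (auto elim!: BseqE)
  \<comment> \<open>The square of \<open>r\<close> decays like \<open>\<rho> ^ (2 * n)\<close>. The
    powers of \<open>s\<close> cancel between the solution and the weight, and the growth of the
    powers of \<open>\<gamma>\<close> costs one factor \<open>\<rho> ^ n\<close>.\<close>
  have fin: "norm (weighted_square (Psi \<gamma> z) (x n)) \<le> B1 * (B2 * C2)\<^sup>2 * \<rho> ^ n" if n: "N \<le> n" for n
  proof -
    have Wp: "0 < W (x n)" by (rule W_pos[OF xR])
    have "Psi \<gamma> z (x n) = r n * \<phi> n * (s * \<gamma>) ^ n" unfolding r_def p_def using N[OF n] g1 by simp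
    then have "weighted_square (Psi \<gamma> z) (x n) = (norm (r n) * norm (\<phi> n))\<^sup>2 * (W (x n) * (norm s * norm s) ^ n) * (norm \<gamma> * norm \<gamma>) ^ n"
      unfolding weighted_square_def by (simp add: norm_mult norm_power power_mult_distrib power2_eq_square mult_ac)
    also have "W (x n) * (norm s * norm s) ^ n = norm (\<omega> n)" unfolding \<omega>_def using Wp by (simp add: norm_mult norm_power)
    also have "(norm (r n) * norm (\<phi> n))\<^sup>2 * norm (\<omega> n) * (norm \<gamma> * norm \<gamma>) ^ n \<le> (C2 * \<rho> ^ n * B2)\<^sup>2 * B1 * (norm \<gamma> * norm \<gamma>) ^ n"
    proof (intro mult_right_mono mult_mono power_mono rb[OF n] B)
      show "0 \<le> C2 * \<rho> ^ n" using rb[OF n] norm_ge_zero order_trans by blast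
    qed auto
    also have "\<dots> = B1 * (B2 * C2)\<^sup>2 * \<rho> ^ n * (\<rho> ^ n * (norm \<gamma> * norm \<gamma>) ^ n)" by (simp only: power_mult_distrib power2_eq_square mult_ac)
    also have "\<rho> ^ n * (norm \<gamma> * norm \<gamma>) ^ n = 1" unfolding power_mult_distrib[symmetric] \<rho>_def using g1 by simp
    finally have "weighted_square (Psi \<gamma> z) (x n) \<le> B1 * (B2 * C2)\<^sup>2 * \<rho> ^ n" by simp
    moreover have "0 \<le> weighted_square (Psi \<gamma> z) (x n)" unfolding weighted_square_def using Wp by simp
    ultimately show ?thesis by simp
  qed
  have "summable (\<lambda>n. weighted_square (Psi \<gamma> z) (x n))"
    by (rule summable_comparison_test'[OF _ fin]) (use \<rho> in \<open>auto intro!: summable_mult summable_geometric\<close>)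
  then show ?thesis unfolding x_def .
qed

lemma HH_I:
  assumes f: "f \<in> fun_on R"
    and s: "\<And>z. z \<in> {zm, zp} \<Longrightarrow> summable (\<lambda>n. weighted_square f (z * q ^ n))" "\<And>z. z \<in> {zm, zp} \<Longrightarrow> summable (\<lambda>n. weighted_square f (z / q ^ n))"
  shows "f \<in> HH"
proof -
  have 1: "weighted_square f summable_on range (\<lambda>n. z * q ^ n)" "weighted_square f summable_on range (\<lambda>n. z / q ^ n)" if z: "z \<in> {zm, zp}" for z
  proof -
    have z0: "z \<noteq> 0" using z zm zp by auto
    have i: "inj (\<lambda>n::nat. z * q ^ n)" "inj (\<lambda>n::nat. z / q ^ n)"
    proof -
      have "z * q ^ n = z * q powi (int n)" "z / q ^ n = z * q powi (- int n)" for n by (simp_all add: power_int_minus divide_inverse)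
      moreover have "inj (\<lambda>n. z * q powi (int n))" "inj (\<lambda>n. z * q powi (- int n))"
      proof -
        show "inj (\<lambda>n. z * q powi (int n))"
        proof (rule injI)
          fix m n assume "z * q powi (int m) = z * q powi (int n)"
          from injD[OF inj_powi[OF z0] this] show "m = n" by simp
        qed
        show "inj (\<lambda>n. z * q powi (- int n))"
        proof (rule injI)
          fix m n assume "z * q powi (- int m) = z * q powi (- int n)"
          from injD[OF inj_powi[OF z0] this] show "m = n" by simp
        qed
      qed
      ultimately show "inj (\<lambda>n::nat. z * q ^ n)" "inj (\<lambda>n::nat. z / q ^ n)" by simp_all
    qed
    show "weighted_square f summable_on range (\<lambda>n. z * q ^ n)" "weighted_square f summable_on range (\<lambda>n. z / q ^ n)"
      unfolding summable_on_reindex[OF i(1)] summable_on_reindex[OF i(2)]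
      using s[OF z] weighted_square_nonneg[OF f] by (simp_all add: summable_on_UNIV_nonneg_real_iff o_def)
  qed
  have "weighted_square f summable_on (range (\<lambda>n. zm * q ^ n) \<union> range (\<lambda>n. zm / q ^ n) \<union> (range (\<lambda>n. zp * q ^ n) \<union> range (\<lambda>n. zp / q ^ n)))"
    by (intro summable_on_Un 1) auto
  then have "weighted_square f summable_on R"
  proof (rule summable_on_subset_banach)
    show "R \<subseteq> range (\<lambda>n. zm * q ^ n) \<union> range (\<lambda>n. zm / q ^ n) \<union> (range (\<lambda>n. zp * q ^ n) \<union> range (\<lambda>n. zp / q ^ n))"
    proof
      fix x assume "x \<in> R"
      then obtain z k where z: "z \<in> {zm, zp}" "x = z * q powi k" by (rule Rq_cases)
      have "x \<in> range (\<lambda>n. z * q ^ n) \<union> range (\<lambda>n. z / q ^ n)"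
      proof (cases k rule: int_cases2)
        case (nonneg n)
        then have "x = z * q ^ n" using z by simp
        then show ?thesis by (intro UnI1 image_eqI[of _ _ n]) auto
      next
        case (nonpos n)
        then have "x = z / q ^ n" using z by (simp add: power_int_minus divide_inverse)
        then show ?thesis by (intro UnI2 image_eqI[of _ _ n]) auto
      qed
      then show "x \<in> range (\<lambda>n. zm * q ^ n) \<union> range (\<lambda>n. zm / q ^ n) \<union> (range (\<lambda>n. zp * q ^ n) \<union> range (\<lambda>n. zp / q ^ n))"
        using z(1) by auto
    qed
  qed
  then show ?thesis using f by (simp add: HH_iff)
qed

lemma cx_lattice_tendsto_0: "(\<lambda>k. complex_of_real (z * q ^ k)) \<longlonglongrightarrow> 0"
  using tendsto_of_real[OF lattice_tendsto_0[of z]] by simp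

lemma summable_near_0:
  assumes z: "z \<in> {zm, zp}" and l: "(\<lambda>n. f (z * q ^ n)) \<longlonglongrightarrow> l"
  shows "summable (\<lambda>n. weighted_square f (z * q ^ n))"
proof -
  define e where "e = (\<lambda>n. (norm (f (z * q ^ n)))\<^sup>2 * ((1 - q) * \<bar>z\<bar> * Re (ww (z * q ^ n))))"
  have p: "(\<lambda>n. pinf (u * of_real (z * q ^ n))) \<longlonglongrightarrow> 1" for u
  proof -
    have "(\<lambda>n. u * of_real (z * q ^ n)) \<longlonglongrightarrow> u * 0" by (intro tendsto_mult tendsto_const cx_lattice_tendsto_0)
    from tendsto_pinf[OF this] show ?thesis by (simp add: qpoch_inf_def)
  qed
  have "(\<lambda>n. ww (z * q ^ n)) \<longlonglongrightarrow> 1 * 1 / (1 * 1)" unfolding wt_eq by (intro tendsto_divide tendsto_mult p) auto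
  then have "e \<longlonglongrightarrow> (norm l)\<^sup>2 * ((1 - q) * \<bar>z\<bar> * Re (1 * 1 / (1 * 1)))"
    unfolding e_def by (intro tendsto_mult tendsto_power tendsto_norm l tendsto_const tendsto_Re)
  then have "Bseq e" by (intro convergent_imp_Bseq convergentI)
  then obtain C where C: "0 < C" "\<And>n. norm (e n) \<le> C" by (auto elim: BseqE)
  have "norm (weighted_square f (z * q ^ n)) \<le> C * q ^ n" for n
  proof -
    have "weighted_square f (z * q ^ n) = e n * q ^ n" unfolding weighted_square_def W_def e_def using q0 by (simp add: abs_mult)
    then have "norm (weighted_square f (z * q ^ n)) = norm (e n) * q ^ n" using q0 by (simp add: abs_mult)
    also have "\<dots> \<le> C * q ^ n" by (rule mult_right_mono[OF C(2)]) (use q0 in simp)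
    finally show ?thesis .
  qed
  note b = this
  have "summable (\<lambda>n. C * q ^ n)" by (rule summable_mult, rule summable_geometric) (use q0 q1 in simp)
  then show ?thesis by (rule summable_comparison_test'[where N = 0]) (rule b)
qed

text \<open>With the difference quotient \<open>h\<close> of \<open>F\<close> at 0, the q-derivative
  at \<open>x\<close> is \<open>(h x - Q * h (Q * x)) / (1 - Q)\<close>, and both values of
  \<open>h\<close> tend to \<open>F'\<close>. The limits do not depend on \<open>z\<close>, hence
  are the same from both sides of 0.\<close>

lemma derivative_at_0:
  fixes F :: "complex \<Rightarrow> complex"
  assumes F: "(F has_field_derivative F') (at 0)" and z: "z \<noteq> 0"
    and e: "\<forall>\<^sub>F k in sequentially. f (z * q ^ k) = F (of_real (z * q ^ k))"
  shows "(\<lambda>k. f (z * q ^ k)) \<longlonglongrightarrow> F 0" "(\<lambda>k. Dq q f (z * q ^ k)) \<longlonglongrightarrow> F'"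
proof -
  have "isCont F 0" by (rule DERIV_isCont[OF F])
  then have "(\<lambda>k. F (of_real (z * q ^ k))) \<longlonglongrightarrow> F 0" by (rule isCont_tendsto_compose[OF _ cx_lattice_tendsto_0])
  then show "(\<lambda>k. f (z * q ^ k)) \<longlonglongrightarrow> F 0" by (rule Lim_transform_eventually) (use e in \<open>auto elim: eventually_mono\<close>)
  define h where "h = (\<lambda>w. (F w - F 0) / w)"
  have h: "h \<midarrow>0\<rightarrow> F'" using F unfolding has_field_derivative_iff h_def by simp
  have "filterlim (\<lambda>k. complex_of_real (z * q ^ k)) (at 0) sequentially"
    unfolding filterlim_at using cx_lattice_tendsto_0[of z] z q0 by (auto intro!: always_eventually)
  from filterlim_compose[OF h this] have l: "(\<lambda>k. h (of_real (z * q ^ k))) \<longlonglongrightarrow> F'" .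
  have "(\<lambda>k. (h (of_real (z * q ^ k)) - Q * h (of_real (z * q ^ Suc k))) / (1 - Q)) \<longlonglongrightarrow> (F' - Q * F') / (1 - Q)"
    by (intro tendsto_divide tendsto_diff tendsto_mult tendsto_const l LIMSEQ_Suc[OF l]) (use q1 in auto)
  moreover have "(F' - Q * F') / (1 - Q) = F'"
  proof -
    have "F' - Q * F' = (1 - Q) * F'" by (simp add: algebra_simps)
    moreover have "1 - Q \<noteq> 0" using q1 by auto
    ultimately show ?thesis by simp
  qed
  ultimately have l2: "(\<lambda>k. (h (of_real (z * q ^ k)) - Q * h (of_real (z * q ^ Suc k))) / (1 - Q)) \<longlonglongrightarrow> F'" by simp
  show "(\<lambda>k. Dq q f (z * q ^ k)) \<longlonglongrightarrow> F'"
  proof (rule Lim_transform_eventually[OF l2])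
    have "\<forall>\<^sub>F k in sequentially. f (z * q ^ Suc k) = F (of_real (z * q ^ Suc k))" using e by (subst eventually_sequentially_Suc)
    with e show "\<forall>\<^sub>F k in sequentially. (h (of_real (z * q ^ k)) - Q * h (of_real (z * q ^ Suc k))) / (1 - Q) = Dq q f (z * q ^ k)"
    proof eventually_elim
      case (elim k)
      define x where "x = complex_of_real (z * q ^ k)"
      have x0: "x \<noteq> 0" using z q0 by (simp add: x_def)
      have x1: "complex_of_real (z * q ^ Suc k) = Q * x" by (simp add: x_def)
      have qx: "q * (z * q ^ k) = z * q ^ Suc k" by simp
      have "Dq q f (z * q ^ k) = (F x - F (Q * x)) / ((1 - Q) * x)"
        unfolding Dq_def qx elim x1 by (simp add: x_def)
      moreover have "h x - Q * h (Q * x) = (F x - F (Q * x)) / x" unfolding h_def using x0 q0 by (simp add: field_simps)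
      ultimately show ?case unfolding x1 x_def[symmetric] by (simp add: mult.commute)
    qed
  qed
qed

text \<open>On both half lattices \<open>Psi\<close> is the restriction of this single function,
  which is differentiable at 0. The matching conditions at 0 in \<open>domL\<close> follow from
  this.\<close>

definition Psi_extension :: "complex \<Rightarrow> real \<Rightarrow> complex \<Rightarrow> complex" where
  "Psi_extension \<gamma> z x = chatd \<gamma> (of_real z) * (NN \<gamma> x / pinf (b * x)) - chat \<gamma> (of_real z) * (bqj.NN q b a c d s \<gamma> x / pinf (a * x))"

lemma Psi_Psi_extension: "x \<in> R \<Longrightarrow> Psi \<gamma> z x = Psi_extension \<gamma> z (of_real x)"
proof -
  interpret sw: bqj q zm zp b a c d s by (rule swap_ab)
  show "x \<in> R \<Longrightarrow> ?thesis" by (simp add: Psi_def Psi_extension_def Phi_def sw.Phi_def)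
qed

lemma Psi_off: "x \<notin> R \<Longrightarrow> Psi \<gamma> z x = 0"
proof -
  interpret sw: bqj q zm zp b a c d s by (rule swap_ab)
  show "x \<notin> R \<Longrightarrow> ?thesis" by (simp add: Psi_def Phi_def sw.Phi_def)
qed

lemma Psi_extension_deriv: assumes g: "1 \<le> norm \<gamma>" shows "\<exists>F'. (Psi_extension \<gamma> z has_field_derivative F') (at 0)"
proof -
  interpret sw: bqj q zm zp b a c d s by (rule swap_ab)
  have fd: "f field_differentiable at 0" if "f holomorphic_on UNIV" for f :: "complex \<Rightarrow> complex"
    using that by (auto simp: holomorphic_on_def)
  have 1: "NN \<gamma> field_differentiable at 0" "sw.NN \<gamma> field_differentiable at 0"
    "(\<lambda>x. pinf (b * x)) field_differentiable at 0" "(\<lambda>x. pinf (a * x)) field_differentiable at 0"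
    by (intro fd NN_holomorphic_x[OF g] sw.NN_holomorphic_x[OF g] holomorphic_pinf holomorphic_intros)+
  have 2: "pinf 0 = 1" by (simp add: qpoch_inf_def)
  have "(\<lambda>x. chatd \<gamma> (of_real z) * (NN \<gamma> x / pinf (b * x)) - chat \<gamma> (of_real z) * (sw.NN \<gamma> x / pinf (a * x))) field_differentiable at 0"
    by (intro field_differentiable_diff field_differentiable_mult field_differentiable_divide field_differentiable_const 1) (simp_all add: 2)
  then show ?thesis unfolding field_differentiable_def Psi_extension_def[abs_def] .
qed

lemma not_real_ne: "x \<in> \<real> \<Longrightarrow> Im \<gamma> \<noteq> 0 \<Longrightarrow> x \<noteq> 0 \<Longrightarrow> x * \<gamma> * Q ^ k \<noteq> 1 \<and> x / \<gamma> * Q ^ k \<noteq> 1"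
proof -
  assume x: "x \<in> \<real>" "Im \<gamma> \<noteq> 0" "x \<noteq> 0"
  have g0: "\<gamma> \<noteq> 0" using x by auto
  have "\<gamma> \<in> \<real>" if "x * \<gamma> * Q ^ k = 1"
  proof -
    have "\<gamma> = 1 / (x * Q ^ k)" using that x(3) by (simp add: field_simps)
    then show ?thesis using x(1) by simp
  qed
  moreover have "\<gamma> \<in> \<real>" if "x / \<gamma> * Q ^ k = 1"
  proof -
    have "\<gamma> = x * Q ^ k" using that g0 by (simp add: field_simps)
    then show ?thesis using x(1) by simp
  qed
  ultimately show ?thesis using x(2) by (auto simp: complex_is_Real_iff)
qed

lemma pinf_s_ne: "Im \<gamma> \<noteq> 0 \<Longrightarrow> pinf (s * \<gamma>) \<noteq> 0" "Im \<gamma> \<noteq> 0 \<Longrightarrow> pinf (s / \<gamma>) \<noteq> 0"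
  unfolding pinf_eq_0_iff using not_real_ne[OF s_pos(1)] by auto

lemma th_real_ne: assumes x: "x \<in> \<real>" "x \<noteq> 0" and g: "Im \<gamma> \<noteq> 0" shows "th (x * \<gamma>) \<noteq> 0"
proof -
  have g0: "\<gamma> \<noteq> 0" using g by auto
  have "x * \<gamma> \<noteq> Q powi k" for k
  proof
    assume "x * \<gamma> = Q powi k"
    then have "\<gamma> = Q powi k / x" using x(2) by (simp add: field_simps)
    moreover have "Q powi k \<in> \<real>" by (metis Reals_of_real of_real_power_int)
    ultimately have "\<gamma> \<in> \<real>" using x(1) by simp
    then show False using g by (simp add: complex_is_Real_iff)
  qed
  then show ?thesis using th_eq_0_iff[of "x * \<gamma>"] x g0 by auto
qed

text \<open>A zero requires that \<open>c * Q / (a * s * \<gamma>)\<close> be a power of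
  \<open>q\<close> with exponent at most 0. If \<open>c / a\<close> is real, a non-real
  \<open>\<gamma>\<close> excludes this. Otherwise one of the two parameter pairs is conjugate, so
  one of the moduli \<open>norm (c / d)\<close>, \<open>norm (b / a)\<close> is 1 and the other is
  below \<open>1 / q\<close>; the argument is then inside the unit disc.\<close>

lemma pinf_quot_ne: assumes g: "1 \<le> norm \<gamma>" "Im \<gamma> \<noteq> 0"
  shows "pinf (c * Q / (a * s * \<gamma>)) \<noteq> 0"
proof (cases "c / a \<in> \<real>")
  case True
  then have "c * Q / (a * s) \<in> \<real>" "c * Q / (a * s) \<noteq> 0" using s_pos nz q0 Reals_mult[of "c / a" "Q / s"] by (simp_all add: Reals_divide)
  then have "c * Q / (a * s) / \<gamma> * Q ^ k \<noteq> 1" for k using not_real_ne[of "c * Q / (a * s)" \<gamma> k] g(2) by blast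
  then have "pinf (c * Q / (a * s) / \<gamma>) \<noteq> 0" unfolding pinf_eq_0_iff by blast
  then show ?thesis by (simp add: divide_divide_eq_left)
next
  case False
  have r: "norm (c / d) * norm (b / a) * q < 1"
  proof -
    have "norm (c / d) = 1 \<or> norm (b / a) = 1"
    proof -
      have "c = cnj d \<or> a = cnj b" using False ab(1) cd(1) by (auto intro: Reals_divide)
      then show ?thesis using nz by (auto simp: norm_divide)
    qed
    moreover have "norm (b / a) * q < 1" "norm (c / d) * q < 1" using bqj.ab(4)[OF swap_ab] cd(3) q0 by (simp_all add: field_simps)
    ultimately show ?thesis by auto
  qed
  have "(c * Q / (a * s))\<^sup>2 = c / d * (b / a) * Q"
  proof -
    have "(c * Q / (a * s))\<^sup>2 = c * c * Q * Q / (a * a * (s * s))" by (simp add: power2_eq_square mult_ac)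
    also have "\<dots> = c / d * (b / a) * Q" unfolding s_sq' using nz q0 by (simp add: field_simps)
    finally show ?thesis .
  qed
  then have "norm ((c * Q / (a * s))\<^sup>2) = norm (c / d * (b / a) * Q)" by (rule arg_cong)
  then have "(norm (c * Q / (a * s)))\<^sup>2 = norm (c / d) * norm (b / a) * q"
    using q0 unfolding norm_power norm_mult by simp
  then have "norm (c * Q / (a * s)) < 1" using r by (metis abs_norm_cancel abs_square_less_1)
  moreover have "norm (c * Q / (a * s * \<gamma>)) = norm (c * Q / (a * s)) / norm \<gamma>" by (simp add: norm_divide norm_mult)
  ultimately have "norm (c * Q / (a * s * \<gamma>)) < 1" using g(1) by (simp add: divide_less_eq)
  then show ?thesis by (rule pinf_ne_0_lt1)
qed

text \<open>The modulus of \<open>b / a\<close> lies strictly between \<open>q\<close> and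
  \<open>1 / q\<close>, so 1 is the only power of \<open>q\<close> that it could be, and
  \<open>a \<noteq> b\<close>.\<close>

lemma th_ba_ne: "th (b / a) \<noteq> 0"
proof -
  have n: "q < norm (b / a)" "norm (b / a) < 1 / q" using bqj.ab(3,4)[OF swap_ab] by auto
  have "b / a \<noteq> Q powi k" for k
  proof
    assume k: "b / a = Q powi k"
    then have nk: "norm (b / a) = q powi k" using q0 by (simp add: norm_power_int)
    show False
    proof (cases k "0 :: int" rule: linorder_cases)
      case less
      then have "q powi (- 1) \<le> q powi k" using q0 q1 by (intro power_int_decreasing) auto
      then show False using n nk by (simp add: power_int_minus divide_inverse)
    next
      case equal
      then show False using k nz ab(5) by simp
    next
      case greater
      then have "q powi k \<le> q powi 1" using q0 q1 by (intro power_int_decreasing) auto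
      then show False using n nk by simp
    qed
  qed
  then show ?thesis using th_eq_0_iff[of "b / a"] nz by auto
qed

lemma D0_ne: assumes g: "Im \<gamma> \<noteq> 0" shows "D0 \<gamma> \<noteq> 0"
proof -
  have "1 - Q \<noteq> 0" using q1 by auto
  then show ?thesis unfolding D0_def kap_def using nz q0 pinf_s_ne[OF g] pinf_ca_ne th_ba_ne by simp
qed

text \<open>Read off from the factors in \<open>chat_delta\<close>. The theta factors vanish only at
  powers of \<open>q\<close>, whereas \<open>zm / zp\<close> is negative and real multiples of a
  non-real \<open>\<gamma>\<close> are not real.\<close>

lemma Delta_ne: assumes g: "1 \<le> norm \<gamma>" "Im \<gamma> \<noteq> 0" shows "Delta \<gamma> \<noteq> 0"
proof -
  interpret sw: bqj q zm zp b a c d s by (rule swap_ab)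
  interpret sc: bqj q zm zp a b d c s by (rule swap_cd)
  interpret ss: bqj q zm zp b a d c s by (rule sw.swap_cd)
  have zR: "zm \<in> R" "zp \<in> R" using RqI[of zm zm zp 0] RqI[of zp zm zp 0] by auto
  have g0: "\<gamma> \<noteq> 0" using g by auto
  have z0: "complex_of_real zm \<noteq> 0" "complex_of_real zp \<noteq> 0" using zm zp by auto
  have abr: "a * b \<in> \<real>" using ab(1) by (auto simp: complex_is_Real_iff)
  have mp: "th (of_real zm / of_real zp) \<noteq> 0"
  proof (rule th_ne_0_qZ)
    have "zm / zp \<noteq> q powi k" for k
    proof -
      have "zm / zp < 0" "0 < q powi k" using zm zp q0 by (auto simp: divide_neg_pos)
      then show ?thesis by simp
    qed
    then show "complex_of_real zm / of_real zp \<notin> qZ q" 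
    proof (intro notI)
      assume "complex_of_real zm / of_real zp \<in> qZ q"
      then obtain k where "complex_of_real zm / of_real zp = of_real (q powi k)" unfolding qZ_def by (elim imageE)
      then have "complex_of_real (zm / zp) = of_real (q powi k)" by simp
      then have "zm / zp = q powi k" by (simp only: of_real_eq_iff)
      then show False using \<open>\<And>k. zm / zp \<noteq> q powi k\<close> by blast
    qed
  qed (use z0 in simp)
  have 1: "th (a * b * s * of_real zm * of_real zp * \<gamma>) \<noteq> 0"
    by (rule th_real_ne) (use abr s_pos nz z0 g in auto)
  have 2: "th (s * \<gamma>) \<noteq> 0" by (rule th_real_ne) (use s_pos g in auto)
  show ?thesis
    unfolding Delta_def chat_delta[OF g0 z0 th_Rq_ne(1)[OF zR(1)] th_Rq_ne(2)[OF zR(1)] th_Rq_ne(1)[OF zR(2)] th_Rq_ne(2)[OF zR(2)]]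
    by (simp only: divide_eq_0_iff mult_eq_0_iff simp_thms pinf_s_ne[OF g(2)] pinf_quot_ne[OF g] sw.pinf_quot_ne[OF g]
      sc.pinf_quot_ne[OF g] ss.pinf_quot_ne[OF g] mp th_ba_ne 1 2 nz z0 prodc_ne th_Rq_ne[OF zR(1)] th_Rq_ne[OF zR(2)])
qed

text \<open>If \<open>chat\<close> vanishes at the end \<open>z\<close>, then \<open>chatd\<close>
  does not, because \<open>Delta \<gamma> \<noteq> 0\<close>. Then \<open>Psi_decay\<close> is used
  with \<open>a\<close> and \<open>b\<close> interchanged, which only changes the sign of
  \<open>Psi\<close>.\<close>

lemma Psi_decay':
  assumes g: "1 < norm \<gamma>" "Im \<gamma> \<noteq> 0" and z: "z \<in> {zm, zp}"
  shows "summable (\<lambda>n. weighted_square (Psi \<gamma> z) (z / q ^ n))"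
proof (cases "chat \<gamma> (of_real z) = 0")
  case False
  show ?thesis by (rule Psi_decay[OF g(1) z False])
next
  case True
  interpret sw: bqj q zm zp b a c d s by (rule swap_ab)
  have "Delta \<gamma> \<noteq> 0" by (rule Delta_ne) (use g in auto)
  then have "chatd \<gamma> (of_real z) \<noteq> 0" using z True unfolding Delta_def by auto
  from sw.Psi_decay[OF g(1) z this]
  have "summable (\<lambda>n. sw.weighted_square (sw.Psi \<gamma> z) (z / q ^ n))" .
  moreover have "sw.weighted_square (sw.Psi \<gamma> z) x = weighted_square (Psi \<gamma> z) x" for x
  proof -
    have "sw.Psi \<gamma> z x = - Psi \<gamma> z x" by (simp add: sw.Psi_def Psi_def)
    moreover have "sw.W x = W x" by (simp add: sw.W_def W_def sw.wt_eq wt_eq mult.commute)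
    ultimately show ?thesis by (simp add: sw.weighted_square_def weighted_square_def)
  qed
  ultimately show ?thesis by simp
qed

text \<open>The order is that of the real line, across 0: the end of the lattice belonging to
  \<open>zm\<close> is on the left, the one belonging to \<open>zp\<close> on the right. The
  denominator is the weighted Casoratian of \<open>Psi \<gamma> zm\<close> and
  \<open>Psi \<gamma> zp\<close>.\<close>

definition green :: "complex \<Rightarrow> real \<Rightarrow> real \<Rightarrow> complex" where
  "green \<gamma> y x = (if x \<le> y then Psi \<gamma> zm x * Psi \<gamma> zp y else Psi \<gamma> zm y * Psi \<gamma> zp x) / (Delta \<gamma> * D0 \<gamma>)"

lemma green_off: "x \<notin> R \<Longrightarrow> green \<gamma> y x = 0"
  by (simp add: green_def Psi_off)

text \<open>The operator couples \<open>x\<close> to \<open>x / q\<close> and \<open>q * x\<close>.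
  On one half lattice these are the adjacent points, and points of different sign never pass each
  other, so away from the diagonal the operator sees a single branch of the kernel.\<close>

lemma R_neighbours:
  assumes x: "x \<in> R" and y: "y \<in> R" and l: "x < y"
  shows "x / q \<le> y" "q * x \<le> y" "x \<le> y / q" "x \<le> q * y"
proof -
  obtain z k where zk: "z \<in> {zm, zp}" "x = z * q powi k" using x by (rule Rq_cases)
  obtain z' k' where zk': "z' \<in> {zm, zp}" "y = z' * q powi k'" using y by (rule Rq_cases)
  have qp: "0 < q powi n" for n using q0 by simp
  have mono: "q powi n \<le> q powi m" if "m \<le> n" for m n using that q0 q1 by (intro power_int_decreasing) auto
  have lt: "n < m" if "q powi m < q powi n" for m n using that mono[of m n] by linarith
  have q': "q powi (n + 1) = q * q powi n" "q powi (n - 1) = q powi n / q" for n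
    using q0 by (simp_all add: power_int_add power_int_diff)
  consider "z = zm" "z' = zp" | "z = zp" "z' = zm" | "z = zp" "z' = zp" | "z = zm" "z' = zm" using zk(1) zk'(1) by auto
  then have "x / q \<le> y \<and> q * x \<le> y \<and> x \<le> y / q \<and> x \<le> q * y"
  proof cases
    case 1
    then have "x < 0" "0 < y" using zk zk' zm zp qp by (auto simp: mult_neg_pos)
    then have "x / q < 0" "q * x < 0" "0 < y / q" "0 < q * y" using q0 by (auto simp: divide_neg_pos mult_pos_neg)
    then show ?thesis using \<open>x < 0\<close> \<open>0 < y\<close> by linarith
  next
    case 2
    then have "0 < x" "y < 0" using zk zk' zm zp qp by (auto simp: mult_neg_pos)
    then show ?thesis using l by simp
  next
    case 3
    then have "q powi k < q powi k'" using l zk zk' zp by simp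
    then have k: "k' + 1 \<le> k" using lt by fastforce
    have xp: "0 < x" "0 < y" using 3 zk zk' zp qp by auto
    have "q powi k \<le> q * q powi k'" using mono[OF k] q' by simp
    then have xy: "x \<le> q * y" using 3 zk zk' zp by (simp add: mult.left_commute)
    then have "x / q \<le> y" using q0 by (simp add: divide_le_eq mult.commute)
    moreover have "q * x \<le> x" using xp q1 by simp
    moreover have "y \<le> y / q" using xp q0 q1 by (simp add: le_divide_eq)
    ultimately show ?thesis using xy l by linarith
  next
    case 4
    then have "q powi k' < q powi k" using l zk zk' zm by simp
    then have k: "k + 1 \<le> k'" using lt by fastforce
    have xp: "x < 0" "y < 0" using 4 zk zk' zm qp by (auto simp: mult_neg_pos)
    have "q powi k' \<le> q * q powi k" using mono[OF k] q' by simp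
    then have "zm * (q * q powi k) \<le> zm * q powi k'" using zm by (intro mult_left_mono_neg) auto
    then have xy: "q * x \<le> y" using 4 zk zk' by (simp add: mult.left_commute)
    then have "x \<le> y / q" using q0 by (simp add: le_divide_eq mult.commute)
    moreover have "x / q \<le> x" using xp q0 q1 by (simp add: divide_le_eq)
    moreover have "y \<le> q * y" using xp q1 by simp
    ultimately show ?thesis using xy l by linarith
  qed
  then show "x / q \<le> y" "q * x \<le> y" "x \<le> y / q" "x \<le> q * y" by auto
qed

text \<open>Off the diagonal this is the eigenvalue equation of a single \<open>Psi\<close>. On the
  diagonal the neighbour \<open>y / q\<close> is to the right of \<open>y\<close> for positive
  \<open>y\<close> and to the left for negative \<open>y\<close>; the sign of the Casoratian term
  changes accordingly, and so does the sign in \<open>W_coefA\<close>, so the source term is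
  \<open>1 / W y\<close> in both cases.\<close>

lemma LL_green:
  assumes g: "1 \<le> norm \<gamma>" "Im \<gamma> \<noteq> 0" and x: "x \<in> R" and y: "y \<in> R"
  shows "LL (green \<gamma> y) x = (\<gamma> + inverse \<gamma>) * green \<gamma> y x + (if x = y then 1 / of_real (W y) else 0)"
proof -
  define DD' where "DD' = Delta \<gamma> * D0 \<gamma>"
  have D: "DD' \<noteq> 0" unfolding DD'_def using Delta_ne[OF g] D0_ne[OF g(2)] by simp
  note L' = Psi_L[OF g(1) x]
  show ?thesis
  proof (cases x y rule: linorder_cases)
    case less
    have "LL (green \<gamma> y) x = LL (Psi \<gamma> zm) x * (Psi \<gamma> zp y / DD')"
      using R_neighbours(1,2)[OF x y less] less unfolding L_def green_def DD'_def[symmetric]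
      by (simp add: algebra_simps add_divide_distrib)
    then show ?thesis using less unfolding L' green_def DD'_def[symmetric] by simp
  next
    case greater
    have n: "\<not> x / q \<le> y \<or> x / q = y" "\<not> q * x \<le> y \<or> q * x = y"
      using R_neighbours(3,4)[OF y x greater] by auto
    \<comment> \<open>At \<open>w = y\<close> the two branches of the kernel agree, so a neighbour
      that hits the diagonal is harmless.\<close>
    have G: "green \<gamma> y w = Psi \<gamma> zm y * Psi \<gamma> zp w / DD'" if "\<not> w \<le> y \<or> w = y" for w
      using that unfolding green_def DD'_def by auto
    have G3: "green \<gamma> y x = Psi \<gamma> zm y * Psi \<gamma> zp x / DD'" by (rule G) (use greater in auto)
    have "LL (green \<gamma> y) x = LL (Psi \<gamma> zp) x * (Psi \<gamma> zm y / DD')"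
      unfolding L_def G[OF n(1)] G[OF n(2)] G3 by (simp add: algebra_simps add_divide_distrib)
    then show ?thesis using greater unfolding L' G3 by simp
  next
    case equal
    define A B C where "A = coefA q a b c d y" and "B = coefB q a b c d y" and "C = coefC q a b c d y"
    define m0 m1 m2 p0 p1 p2 where "m0 = Psi \<gamma> zm (y / q)" and "m1 = Psi \<gamma> zm y" and "m2 = Psi \<gamma> zm (q * y)"
      and "p0 = Psi \<gamma> zp (y / q)" and "p1 = Psi \<gamma> zp y" and "p2 = Psi \<gamma> zp (q * y)"
    have Lm: "A * m0 + B * m2 + C * m1 = (\<gamma> + inverse \<gamma>) * m1" "A * p0 + B * p2 + C * p1 = (\<gamma> + inverse \<gamma>) * p1"
      using L'[of zm] L'[of zp] unfolding equal L_def A_def B_def C_def m0_def m1_def m2_def p0_def p1_def p2_def by simp_all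
    have Wy: "complex_of_real (W y) \<noteq> 0" using W_pos[OF y] by simp
    have "of_real (W y) * A * (m1 * p0 - m0 * p1) = of_real (sgn y) * (Delta \<gamma> * (casorati_weight (of_real y) * casorati (Phi \<gamma>) (Phid \<gamma>) y))"
      unfolding A_def W_coefA[OF y] using casorati_Psi[of \<gamma> y] unfolding casorati_def[of "Psi \<gamma> zm"] m0_def m1_def p0_def p1_def by simp
    also have "\<dots> = of_real (sgn y) * DD'" unfolding casorati_Phi[OF g(1) y] DD'_def ..
    finally have c: "A * (m1 * p0 - m0 * p1) = of_real (sgn y) * DD' / of_real (W y)" using Wy by (simp add: field_simps)
    have G1: "green \<gamma> y y = m1 * p1 / DD'" unfolding green_def DD'_def m1_def p1_def by simp
    have y0: "y \<noteq> 0" by (rule Rq_ne_0[OF y])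
    show ?thesis
    proof (cases "0 < y")
      case True
      have "y < y / q" "q * y < y" using True q0 q1 by (auto simp: less_divide_eq)
      then have G: "green \<gamma> y (y / q) = m1 * p0 / DD'" "green \<gamma> y (q * y) = m2 * p1 / DD'"
        unfolding green_def DD'_def m0_def m1_def m2_def p0_def p1_def p2_def by simp_all
      have "LL (green \<gamma> y) y = ((A * m0 + B * m2 + C * m1) * p1 + A * (m1 * p0 - m0 * p1)) / DD'"
        unfolding L_def G G1 A_def[symmetric] B_def[symmetric] C_def[symmetric] by (simp add: algebra_simps add_divide_distrib diff_divide_distrib)
      also have "\<dots> = (\<gamma> + inverse \<gamma>) * (m1 * p1 / DD') + 1 / of_real (W y)"
        unfolding Lm c using True D by (simp add: add_divide_distrib)
      finally show ?thesis unfolding equal G1 by simp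
    next
      case False
      then have yn: "y < 0" using y0 by simp
      have "y / q < y" "y < q * y" using yn q0 q1 by (auto simp: divide_less_eq)
      then have G: "green \<gamma> y (y / q) = m0 * p1 / DD'" "green \<gamma> y (q * y) = m1 * p2 / DD'"
        unfolding green_def DD'_def m0_def m1_def m2_def p0_def p1_def p2_def by simp_all
      have "LL (green \<gamma> y) y = ((A * p0 + B * p2 + C * p1) * m1 - A * (m1 * p0 - m0 * p1)) / DD'"
        unfolding L_def G G1 A_def[symmetric] B_def[symmetric] C_def[symmetric] by (simp add: algebra_simps add_divide_distrib diff_divide_distrib)
      also have "\<dots> = (\<gamma> + inverse \<gamma>) * (m1 * p1 / DD') + 1 / of_real (W y)"
        unfolding Lm c using yn D by (simp add: add_divide_distrib mult_ac)
      finally show ?thesis unfolding equal G1 by simp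
    qed
  qed
qed

lemma green_DD:
  assumes g: "1 < norm \<gamma>" "Im \<gamma> \<noteq> 0" and y: "y \<in> R"
  shows "green \<gamma> y \<in> DD"
proof -
  have g1: "1 \<le> norm \<gamma>" using g by simp
  have y0: "y \<noteq> 0" by (rule Rq_ne_0[OF y])
  define DD' where "DD' = Delta \<gamma> * D0 \<gamma>"
  \<comment> \<open>Near 0 the points of both half lattices lie on the same side of
    \<open>y\<close>, so the kernel is there a multiple of the single solution
    \<open>Psi \<gamma> z1\<close>.\<close>
  define z1 k1 where "z1 = (if 0 < y then zm else zp)" and "k1 = Psi \<gamma> (if 0 < y then zp else zm) y / DD'"
  have zR: "z * q ^ k \<in> R" "z / q ^ k \<in> R" if "z \<in> {zm, zp}" for z k
    using Rq_mult'(1,4)[OF RqI[of z zm zp 0, OF that]] by simp_all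
  have ev: "\<forall>\<^sub>F k in sequentially. green \<gamma> y (z * q ^ k) = k1 * Psi_extension \<gamma> z1 (of_real (z * q ^ k))" if z: "z \<in> {zm, zp}" for z
  proof (cases "0 < y")
    case True
    have "\<forall>\<^sub>F k in sequentially. z * q ^ k < y" by (rule order_tendstoD(2)[OF lattice_tendsto_0 True])
    then show ?thesis
    proof eventually_elim
      case (elim k)
      then show ?case using True Psi_Psi_extension[OF zR(1)[OF z], of \<gamma> zm k] by (simp add: green_def z1_def k1_def DD'_def)
    qed
  next
    case False
    then have yn: "y < 0" using y0 by simp
    have "\<forall>\<^sub>F k in sequentially. y < z * q ^ k" by (rule order_tendstoD(1)[OF lattice_tendsto_0 yn])
    then show ?thesis
    proof eventually_elim
      case (elim k)
      then show ?case using False Psi_Psi_extension[OF zR(1)[OF z], of \<gamma> zp k] by (simp add: green_def z1_def k1_def DD'_def)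
    qed
  qed
  obtain F' where F': "(Psi_extension \<gamma> z1 has_field_derivative F') (at 0)" using Psi_extension_deriv[OF g1] by blast
  have F: "((\<lambda>x. k1 * Psi_extension \<gamma> z1 x) has_field_derivative k1 * F') (at 0)" by (rule DERIV_cmult[OF F'])
  have l: "(\<lambda>k. green \<gamma> y (z * q ^ k)) \<longlonglongrightarrow> k1 * Psi_extension \<gamma> z1 0" "(\<lambda>k. Dq q (green \<gamma> y) (z * q ^ k)) \<longlonglongrightarrow> k1 * F'" if z: "z \<in> {zm, zp}" for z
  proof -
    have z0: "z \<noteq> 0" using z zm zp by auto
    show "(\<lambda>k. green \<gamma> y (z * q ^ k)) \<longlonglongrightarrow> k1 * Psi_extension \<gamma> z1 0" "(\<lambda>k. Dq q (green \<gamma> y) (z * q ^ k)) \<longlonglongrightarrow> k1 * F'"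
      using derivative_at_0[OF F z0 ev[OF z]] by auto
  qed
  have GH: "green \<gamma> y \<in> HH"
  proof (rule HH_I)
    show "green \<gamma> y \<in> fun_on R" by (simp add: fun_on_def green_off)
    fix z assume z: "z \<in> {zm, zp}"
    show "summable (\<lambda>n. weighted_square (green \<gamma> y) (z * q ^ n))" by (rule summable_near_0[OF z l(1)[OF z]])
    define k2 where "k2 = Psi \<gamma> (if z = zm then zp else zm) y / DD'"
    have "\<forall>\<^sub>F n in sequentially. green \<gamma> y (z / q ^ n) = k2 * Psi \<gamma> z (z / q ^ n)"
    proof (cases "z = zm")
      case True
      have "\<forall>\<^sub>F n in sequentially. zm < y * q ^ n" by (rule order_tendstoD(1)[OF lattice_tendsto_0 zm])
      then show ?thesis
      proof eventually_elim
        case (elim n)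
        then have "zm / q ^ n < y" using q0 by (simp add: divide_less_eq)
        then show ?case using True by (simp add: green_def k2_def DD'_def)
      qed
    next
      case False
      then have zz: "z = zp" using z by simp
      have "\<forall>\<^sub>F n in sequentially. y * q ^ n < zp" by (rule order_tendstoD(2)[OF lattice_tendsto_0 zp])
      then show ?thesis
      proof eventually_elim
        case (elim n)
        then have "y < zp / q ^ n" using q0 by (simp add: less_divide_eq)
        then show ?case using False zz by (simp add: green_def k2_def DD'_def)
      qed
    qed
    then have e: "\<forall>\<^sub>F n in sequentially. weighted_square (green \<gamma> y) (z / q ^ n) = (norm k2)\<^sup>2 * weighted_square (Psi \<gamma> z) (z / q ^ n)"
      by eventually_elim (simp add: weighted_square_def norm_mult power_mult_distrib)
    show "summable (\<lambda>n. weighted_square (green \<gamma> y) (z / q ^ n))"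
      unfolding summable_cong[OF e] by (rule summable_mult[OF Psi_decay'[OF g z]])
  qed
  define \<delta> where "\<delta> = (\<lambda>x. if x = y then 1 / of_real (W y) else 0 :: complex)"
  have \<delta>: "\<delta> \<in> finsupp R" using y by (auto simp: \<delta>_def finsupp_def fun_on_def intro: finite_subset[of _ "{y}"])
  have "LL (green \<gamma> y) = lincomb (\<gamma> + inverse \<gamma>) (green \<gamma> y) 1 \<delta>"
  proof
    fix x
    show "LL (green \<gamma> y) x = lincomb (\<gamma> + inverse \<gamma>) (green \<gamma> y) 1 \<delta> x"
    proof (cases "x \<in> R")
      case True
      then show ?thesis unfolding LL_green[OF g1 g(2) True y] by (simp add: lincomb_def \<delta>_def)
    next
      case False
      then have "x / q \<notin> R" "q * x \<notin> R" using Rq_mult'(2)[of "x / q"] Rq_mult'(3)[of "q * x"] q0 by auto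
      moreover have "x \<noteq> y" using False y by auto
      ultimately show ?thesis using False by (simp add: L_def lincomb_def green_off \<delta>_def)
    qed
  qed
  then have "LL (green \<gamma> y) \<in> HH" using HH_lincomb[OF GH finsupp_HH[OF \<delta>]] by simp
  then show ?thesis using GH l[of zm] l[of zp] by (auto simp: domL_def)
qed

definition resolvent :: "complex \<Rightarrow> (real \<Rightarrow> complex) \<Rightarrow> real \<Rightarrow> complex" where
  "resolvent \<gamma> f x = (\<Sum>y | f y \<noteq> 0. f y * of_real (W y) * green \<gamma> y x)"

lemma DD_sum:
  assumes "finite S" "\<And>y. y \<in> S \<Longrightarrow> h y \<in> DD"
  shows "(\<lambda>x. \<Sum>y\<in>S. k y * h y x) \<in> DD"
  using assms
proof (induction S rule: finite_induct)
  case empty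
  show ?case using finsupp_DD[of "\<lambda>_. 0"] by (simp add: finsupp_def fun_on_def)
next
  case (insert y S)
  have "lincomb (k y) (h y) 1 (\<lambda>x. \<Sum>y\<in>S. k y * h y x) \<in> DD" by (rule DD_lincomb) (use insert in auto)
  then show ?case using insert by (simp add: lincomb_def)
qed

lemma resolvent_DD: assumes g: "1 < norm \<gamma>" "Im \<gamma> \<noteq> 0" and f: "f \<in> finsupp R" shows "resolvent \<gamma> f \<in> DD"
  unfolding resolvent_def[abs_def]
proof (rule DD_sum)
  show "finite {y. f y \<noteq> 0}" using f by (simp add: finsupp_def)
  fix y assume "y \<in> {y. f y \<noteq> 0}"
  then have "y \<in> R" using f by (auto simp: finsupp_def fun_on_def)
  then show "green \<gamma> y \<in> DD" by (rule green_DD[OF g])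
qed

lemma resolvent_eq: assumes g: "1 \<le> norm \<gamma>" "Im \<gamma> \<noteq> 0" and f: "f \<in> finsupp R"
  shows "f = lincomb 1 (LL (resolvent \<gamma> f)) (- (\<gamma> + inverse \<gamma>)) (resolvent \<gamma> f)"
proof
  fix x
  let ?S = "{y. f y \<noteq> 0}"
  have fin: "finite ?S" and fR: "\<And>y. f y \<noteq> 0 \<Longrightarrow> y \<in> R" using f by (auto simp: finsupp_def fun_on_def)
  have "LL (resolvent \<gamma> f) x = (\<Sum>y\<in>?S. f y * of_real (W y) * LL (green \<gamma> y) x)"
    unfolding L_def resolvent_def by (simp add: sum_distrib_left sum.distrib algebra_simps)
  also have "\<dots> = (\<gamma> + inverse \<gamma>) * resolvent \<gamma> f x + f x"
  proof (cases "x \<in> R")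
    case True
    have "(\<Sum>y\<in>?S. f y * of_real (W y) * LL (green \<gamma> y) x) = (\<Sum>y\<in>?S. (\<gamma> + inverse \<gamma>) * (f y * of_real (W y) * green \<gamma> y x) + (if y = x then f x else 0))"
    proof (rule sum.cong[OF refl])
      fix y assume "y \<in> ?S"
      then have y: "y \<in> R" using fR by simp
      have "complex_of_real (W y) \<noteq> 0" using W_pos[OF y] by simp
      then show "f y * of_real (W y) * LL (green \<gamma> y) x = (\<gamma> + inverse \<gamma>) * (f y * of_real (W y) * green \<gamma> y x) + (if y = x then f x else 0)"
        unfolding LL_green[OF g True y] by (cases "y = x") (simp_all add: distrib_left mult.left_commute)
    qed
    also have "\<dots> = (\<gamma> + inverse \<gamma>) * resolvent \<gamma> f x + f x"
      unfolding sum.distrib sum_distrib_left[symmetric] resolvent_def using fin by (simp add: sum.delta)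
    finally show ?thesis .
  next
    case False
    then have "x / q \<notin> R" "q * x \<notin> R" using Rq_mult'(2)[of "x / q"] Rq_mult'(3)[of "q * x"] q0 by auto
    then have "LL (green \<gamma> y) x = 0" for y using False by (simp add: L_def green_off)
    then show ?thesis using False fR by (auto simp: resolvent_def green_off)
  qed
  finally show "f x = lincomb 1 (LL (resolvent \<gamma> f)) (- (\<gamma> + inverse \<gamma>)) (resolvent \<gamma> f) x" by (simp add: lincomb_def algebra_simps)
qed

text \<open>\<open>resolvent_form \<gamma> f\<close> is \<open>\<langle>(L - \<lambda>)\<^sup>-\<^sup>1 f, f\<rangle>\<close> for \<open>\<lambda> = \<gamma> + 1/\<gamma>\<close> and \<open>\<bar>\<gamma>\<bar> > 1\<close>; it continues to the unit circle.\<close>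

definition resolvent_form :: "complex \<Rightarrow> (real \<Rightarrow> complex) \<Rightarrow> complex" where
  "resolvent_form \<gamma> f = (\<Sum>x | f x \<noteq> 0. \<Sum>y | f y \<noteq> 0. f y * of_real (W y) * green \<gamma> y x * cnj (f x) * of_real (W x))"

lemma inn_resolvent: assumes g: "1 < norm \<gamma>" "Im \<gamma> \<noteq> 0" and f: "f \<in> finsupp R" shows "inn (resolvent \<gamma> f) f = resolvent_form \<gamma> f"
  unfolding inn_finsupp[OF DD_HH[OF resolvent_DD[OF g f]] f] resolvent_form_def resolvent_def by (simp add: sum_distrib_right)

lemma chat_continuous: "continuous_on {\<gamma>. 1 \<le> norm \<gamma>} (\<lambda>\<gamma>. chat \<gamma> z)"
proof -
  define K where "K = inverse (pinf (c * Q / a) * pinf (d * Q / a) * th (b * z))"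
  have "chat \<gamma> z = pinf (s / \<gamma>) * pinf (c * Q / (a * s) / \<gamma>) * pinf (d * Q / (a * s) / \<gamma>) * (pinf (b * s * \<gamma> * z) * pinf (Q / (b * s * z) / \<gamma>)) * K" for \<gamma>
  proof -
    have e: "c * Q / (a * s) / \<gamma> = c * Q / (a * s * \<gamma>)" "d * Q / (a * s) / \<gamma> = d * Q / (a * s * \<gamma>)" "Q / (b * s * z) / \<gamma> = Q / (b * s * \<gamma> * z)"
      by (simp_all add: mult_ac)
    show ?thesis unfolding e chat_def theta1_def K_def by (rule divide_inverse)
  qed
  moreover have "continuous_on {\<gamma>. 1 \<le> norm \<gamma>} (\<lambda>\<gamma>. pinf (s / \<gamma>) * pinf (c * Q / (a * s) / \<gamma>) * pinf (d * Q / (a * s) / \<gamma>) * (pinf (b * s * \<gamma> * z) * pinf (Q / (b * s * z) / \<gamma>)) * K)"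
  proof -
    have g0: "\<forall>\<gamma>\<in>{\<gamma>. 1 \<le> norm \<gamma>}. \<gamma> \<noteq> (0::complex)" by auto
    show ?thesis by (intro continuous_intros g0)
  qed
  ultimately show ?thesis by (simp only:)
qed

lemma Phi_continuous: "continuous_on {\<gamma>. 1 \<le> norm \<gamma>} (\<lambda>\<gamma>. Phi \<gamma> x)"
  unfolding Phi_def using pinf_Rq_ne(2)[of x] by (cases "x \<in> R") (auto intro!: continuous_intros NN_continuous_gamma)

text \<open>Numerators are continuous for \<open>1 \<le> norm \<gamma>\<close>, and a non-real
  \<open>\<gamma>\<close> keeps \<open>Delta\<close> and \<open>D0\<close> away from 0. The kernel
  thus has continuous boundary values on the unit circle except at 1 and -1, the ends of the
  continuous spectrum.\<close>

lemma resolvent_form_continuous: "continuous_on {\<gamma>. 1 \<le> norm \<gamma> \<and> Im \<gamma> \<noteq> 0} (\<lambda>\<gamma>. resolvent_form \<gamma> f)"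
proof -
  interpret sw: bqj q zm zp b a c d s by (rule swap_ab)
  let ?S = "{\<gamma>. 1 \<le> norm \<gamma> \<and> Im \<gamma> \<noteq> 0}"
  have sub: "?S \<subseteq> {\<gamma>. 1 \<le> norm \<gamma>}" by auto
  note c = continuous_on_subset[OF chat_continuous sub] continuous_on_subset[OF sw.chat_continuous sub]
    continuous_on_subset[OF Phi_continuous sub] continuous_on_subset[OF sw.Phi_continuous sub]
  have P: "continuous_on ?S (\<lambda>\<gamma>. Psi \<gamma> z x)" for z x unfolding Psi_def by (intro continuous_intros c)
  have De: "continuous_on ?S Delta" unfolding Delta_def[abs_def] by (intro continuous_intros c)
  have D: "continuous_on ?S D0" unfolding D0_def[abs_def] kap_def
    by (intro continuous_intros) (use pinf_ca_ne nz in auto)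
  have "continuous_on ?S (\<lambda>\<gamma>. green \<gamma> y x)" for y x
    unfolding green_def using Delta_ne D0_ne by (cases "x \<le> y") (auto intro!: continuous_intros P De D)
  then show ?thesis unfolding resolvent_form_def by (intro continuous_intros)
qed

section \<open>The jump of the Green kernel across the continuous spectrum\<close>

lemma kap_eq: "kap \<gamma> = a * th (b / a) * (pinf (s * \<gamma>) * pinf (s / \<gamma>)) / prodc"
  by (simp add: kap_def prodc_def mult_ac)

text \<open>The factor shared by \<open>chat_wronskian\<close> at the two ends, divided by the Casoratian \<open>D0\<close>.\<close>

lemma jump_factor:
  assumes g: "Im \<gamma> \<noteq> 0"
  shows "(inverse \<gamma> - \<gamma>) * (a * s * \<gamma> * th (b / a) * th (1 / \<gamma>\<^sup>2) / (c * d)) / D0 \<gamma>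
    = pinf (\<gamma>\<^sup>2) * pinf ((inverse \<gamma>)\<^sup>2) * prodc / ((1 - Q) * (pinf (s * \<gamma>) * pinf (s / \<gamma>)))"
proof -
  have g0: "\<gamma> \<noteq> 0" using g by auto
  define S t where "S = pinf (s * \<gamma>) * pinf (s / \<gamma>)" and "t = th (b / a)"
  have S: "S \<noteq> 0" "t \<noteq> 0" "1 - Q \<noteq> 0" unfolding S_def t_def using pinf_s_ne[OF g] th_ba_ne q1 by auto
  have t2: "(inverse \<gamma> - \<gamma>) * \<gamma> * th (1 / \<gamma>\<^sup>2) = pinf (\<gamma>\<^sup>2) * pinf ((inverse \<gamma>)\<^sup>2)"
  proof -
    have "(inverse \<gamma> - \<gamma>) * \<gamma> = 1 - \<gamma>\<^sup>2" using g0 by (simp add: left_diff_distrib power2_eq_square)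
    moreover have "th (1 / \<gamma>\<^sup>2) = pinf ((inverse \<gamma>)\<^sup>2) * pinf (\<gamma>\<^sup>2 * Q)"
      unfolding theta1_def by (simp add: power_inverse divide_inverse mult.commute)
    ultimately show ?thesis using pinf_rec[of "\<gamma>\<^sup>2"] by (simp add: mult_ac)
  qed
  have D: "D0 \<gamma> = (1 - Q) * Q * (a * t * S / prodc) / (s * a * b)" unfolding D0_def kap_eq S_def t_def ..
  have "(inverse \<gamma> - \<gamma>) * (a * s * \<gamma> * t * th (1 / \<gamma>\<^sup>2) / (c * d)) / D0 \<gamma>
    = ((inverse \<gamma> - \<gamma>) * \<gamma> * th (1 / \<gamma>\<^sup>2)) * (s * s * a * b) * prodc / (c * d * Q * (1 - Q) * S)"
    unfolding D using S nz q0 prodc_ne by (simp add: field_simps)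
  also have "\<dots> = pinf (\<gamma>\<^sup>2) * pinf ((inverse \<gamma>)\<^sup>2) * prodc / ((1 - Q) * S)"
    unfolding t2 s_sq3 using nz q0 by (simp add: mult_ac)
  finally show ?thesis unfolding S_def t_def .
qed

lemma D0_inverse: "D0 (inverse \<gamma>) = D0 \<gamma>"
  unfolding D0_def kap_def by (simp add: divide_inverse mult_ac)

lemma th_flip: "x \<noteq> 0 \<Longrightarrow> y \<noteq> 0 \<Longrightarrow> th (x / y) = - (x / y) * th (y / x)"
  using th_inverse[of "y / x"] by (simp add: field_simps)

abbreviation "mm \<equiv> complex_of_real zm"
abbreviation "pp \<equiv> complex_of_real zp"

definition qa :: "complex \<Rightarrow> complex" where
  "qa \<gamma> = pinf (c * Q / (a * s * \<gamma>)) * pinf (d * Q / (a * s * \<gamma>))"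

definition qb :: "complex \<Rightarrow> complex" where
  "qb \<gamma> = pinf (c * Q / (b * s * \<gamma>)) * pinf (d * Q / (b * s * \<gamma>))"

definition Th :: "complex \<Rightarrow> complex" where
  "Th \<gamma> = th (a * b * s * mm * pp * \<gamma>) * th (s * \<gamma>)"

definition TT :: complex where "TT = th (a * mm) * th (b * mm) * th (a * pp) * th (b * pp)"

definition om :: "complex \<Rightarrow> complex \<Rightarrow> complex" where
  "om \<gamma> z = chat \<gamma> z * chatd (inverse \<gamma>) z - chatd \<gamma> z * chat (inverse \<gamma>) z"

lemma mp_R: "zm \<in> R" "zp \<in> R" using RqI[of zm zm zp 0] RqI[of zp zm zp 0] by auto

lemma mp_ne0 [simp]: "zm \<noteq> 0" "zp \<noteq> 0" using zm zp by auto

lemma mp_ne: "mm \<noteq> 0" "pp \<noteq> 0" by simp_all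

lemma Delta_eq: "\<gamma> \<noteq> 0 \<Longrightarrow> Delta \<gamma> =
    pinf (s / \<gamma>) * pinf (s / \<gamma>) * (qa \<gamma> * qb \<gamma>) * (a * pp * (th (mm / pp) * th (b / a)) * Th \<gamma>) / (prodc * TT)"
  unfolding Delta_def qa_def qb_def Th_def TT_def
  by (subst chat_delta) (simp_all add: th_Rq_ne[OF mp_R(1)] th_Rq_ne[OF mp_R(2)] mult_ac)

lemma Delta_prod: "\<gamma> \<noteq> 0 \<Longrightarrow> Delta \<gamma> * Delta (inverse \<gamma>) =
    (pinf (s * \<gamma>) * pinf (s / \<gamma>))\<^sup>2 * (qa \<gamma> * qa (inverse \<gamma>)) * (qb \<gamma> * qb (inverse \<gamma>))
     * (a * pp * (th (mm / pp) * th (b / a)))\<^sup>2 * (Th \<gamma> * Th (inverse \<gamma>)) / (prodc * TT)\<^sup>2"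
  by (simp add: Delta_eq power2_eq_square divide_inverse mult_ac)

lemma om_eq: "\<gamma> \<noteq> 0 \<Longrightarrow> z \<noteq> 0 \<Longrightarrow> om \<gamma> z = (a * s * \<gamma> * th (b / a) * th (1 / \<gamma>\<^sup>2) / (c * d)) * ((pinf (s * \<gamma>) * pinf (s / \<gamma>)) * (th (c * z) * th (d * z) / z) / (prodc * (th (a * z) * th (b * z))))"
  unfolding om_def by (subst chat_wronskian) (simp_all add: mult_ac)

lemma jump_ne:
  assumes g: "norm \<gamma> = 1" "Im \<gamma> \<noteq> 0"
  shows "pinf (s * \<gamma>) * pinf (s / \<gamma>) \<noteq> 0" "qa \<gamma> * qa (inverse \<gamma>) \<noteq> 0" "qb \<gamma> * qb (inverse \<gamma>) \<noteq> 0"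
    "th (mm / pp) \<noteq> 0" "Th \<gamma> * Th (inverse \<gamma>) \<noteq> 0" "TT \<noteq> 0" "Delta \<gamma> \<noteq> 0" "Delta (inverse \<gamma>) \<noteq> 0" "Im (inverse \<gamma>) \<noteq> 0"
proof -
  have g0: "\<gamma> \<noteq> 0" "inverse \<gamma> \<noteq> 0" using g by auto
  show i: "Im (inverse \<gamma>) \<noteq> 0" using g g0 by (simp add: complex_inverse)
  show D: "Delta \<gamma> \<noteq> 0" "Delta (inverse \<gamma>) \<noteq> 0" by (rule Delta_ne; use g i in \<open>simp add: norm_inverse\<close>)+
  \<comment> \<open>The nonvanishing of the individual factors is read off from that of their
    product.\<close>
  then have "Delta \<gamma> * Delta (inverse \<gamma>) \<noteq> 0" by simp
  then show "pinf (s * \<gamma>) * pinf (s / \<gamma>) \<noteq> 0" "qa \<gamma> * qa (inverse \<gamma>) \<noteq> 0" "qb \<gamma> * qb (inverse \<gamma>) \<noteq> 0"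
    "th (mm / pp) \<noteq> 0" "Th \<gamma> * Th (inverse \<gamma>) \<noteq> 0" "TT \<noteq> 0" unfolding Delta_prod[OF g0(1)] by auto
qed

definition Br :: "complex \<Rightarrow> complex" where
  "Br \<gamma> = mm * (th (a * pp) * th (c * pp) * th (d * pp) * th (b * mm) * (th (a * s * mm * \<gamma>) * th (a * s * mm * inverse \<gamma>)))
        - pp * (th (a * mm) * th (c * mm) * th (d * mm) * th (b * pp) * (th (a * s * pp * \<gamma>) * th (a * s * pp * inverse \<gamma>)))"

lemma v1_eq: "v1 q zm zp a b c d \<gamma> =
    (pinf (c * Q / a) * pinf (d * Q / a))\<^sup>2 * (th (b * pp) * th (b * mm)) / ((1 - Q) * a * b * mm\<^sup>2 * pp\<^sup>2 * (th (mm / pp) * th (pp / mm) * th (a / b) * th (b / a)))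
    * (pinf (\<gamma>\<^sup>2) * pinf ((inverse \<gamma>)\<^sup>2) / ((pinf (s * \<gamma>) * pinf (s / \<gamma>)) * (qa \<gamma> * qa (inverse \<gamma>)) * (Th \<gamma> * Th (inverse \<gamma>)))) * Br \<gamma>"
proof -
  have e: "c * Q * \<gamma> / (a * s) = c * Q / (a * s * inverse \<gamma>)" "d * Q * \<gamma> / (a * s) = d * Q / (a * s * inverse \<gamma>)"
    "c * Q * inverse \<gamma> / (a * s) = c * Q / (a * s * \<gamma>)" "d * Q * inverse \<gamma> / (a * s) = d * Q / (a * s * \<gamma>)" "s * inverse \<gamma> = s / \<gamma>"
    by (simp_all add: divide_inverse mult_ac)
  show ?thesis unfolding v1_def Let_def sroot_eq qpochs_inf_def theta_def Br_def qa_def Th_def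
    by (simp only: list.map prod_list.Cons prod_list.Nil mult_1_right e) (simp only: mult_ac)
qed

lemma v2_eq: "v2 q zm zp a b c d \<gamma> =
    prodc * TT * th (c * d * mm * pp) / (a * b * mm\<^sup>2 * pp * (1 - Q) * (th (pp / mm) * th (a / b) * th (b / a)))
    * (pinf (\<gamma>\<^sup>2) * pinf ((inverse \<gamma>)\<^sup>2) / ((pinf (s * \<gamma>) * pinf (s / \<gamma>)) * (Th \<gamma> * Th (inverse \<gamma>))))"
proof -
  have e: "s * inverse \<gamma> = s / \<gamma>" by (simp add: divide_inverse)
  show ?thesis unfolding v2_def Let_def sroot_eq qpochs_inf_def theta_def prodc_def TT_def Th_def
    by (simp only: list.map prod_list.Cons prod_list.Nil mult_1_right e) (simp only: mult_ac)
qed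

text \<open>Over the common denominator the numerator regrouped is a combination of determinants
  that pair the values at \<open>\<gamma>\<close> with the primed values at its inverse, each at a
  single end. These are the determinants evaluated in \<open>chat_wronskian\<close>.\<close>

lemma quot_diff_11:
  fixes cm :: complex
  assumes "D = cm * dp - dm * cp" "D' = cm' * dp' - dm' * cp'" "D \<noteq> 0" "D' \<noteq> 0"
  shows "dm * dp / D - dm' * dp' / D' = ((cp * dp' - dp * cp') * (dm * dm') - (cm * dm' - dm * cm') * (dp * dp')) / (D * D')"
proof -
  have "dm * dp / D - dm' * dp' / D' = (dm * dp * D' - dm' * dp' * D) / (D * D')" using assms(3,4) by (simp add: diff_frac_eq)
  also have "dm * dp * D' - dm' * dp' * D = (cp * dp' - dp * cp') * (dm * dm') - (cm * dm' - dm * cm') * (dp * dp')"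
    unfolding assms(1,2) by (simp add: algebra_simps)
  finally show ?thesis .
qed

lemma quot_diff_21:
  fixes cm :: complex
  assumes "D = cm * dp - dm * cp" "D' = cm' * dp' - dm' * cp'" "D \<noteq> 0" "D' \<noteq> 0"
  shows "- (cm * dp) / D - - (cm' * dp') / D' = ((cm * dm' - dm * cm') * (cp * dp') - (cp * dp' - dp * cp') * (cm * dm')) / (D * D')"
proof -
  have "- (cm * dp) / D - - (cm' * dp') / D' = (- (cm * dp) * D' - - (cm' * dp') * D) / (D * D')" using assms(3,4) by (simp add: diff_frac_eq)
  also have "- (cm * dp) * D' - - (cm' * dp') * D = (cm * dm' - dm * cm') * (cp * dp') - (cp * dp' - dp * cp') * (cm * dm')"
    unfolding assms(1,2) by (simp add: algebra_simps)
  finally show ?thesis .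
qed

text \<open>The coefficient of \<open>Phi \<gamma> x * Phi \<gamma> y\<close> in the jump of the
  kernel. The determinants at the two ends carry the common factor \<open>G\<close>; what remains is
  the bracket \<open>Br\<close> in the definition of \<open>v1\<close>.\<close>

lemma jump_11:
  assumes g: "norm \<gamma> = 1" "Im \<gamma> \<noteq> 0"
  shows "(inverse \<gamma> - \<gamma>) * (chatd \<gamma> mm * chatd \<gamma> pp / Delta \<gamma> - chatd (inverse \<gamma>) mm * chatd (inverse \<gamma>) pp / Delta (inverse \<gamma>)) / D0 \<gamma>
    = v1 q zm zp a b c d \<gamma>"
proof -
  have g0: "\<gamma> \<noteq> 0" using g by auto
  note ne = jump_ne[OF g]
  define G where "G = a * s * \<gamma> * th (b / a) * th (1 / \<gamma>\<^sup>2) / (c * d)"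
  define S where "S = pinf (s * \<gamma>) * pinf (s / \<gamma>)"
  define ea eb where "ea = pinf (c * Q / a) * pinf (d * Q / a)" and "eb = pinf (c * Q / b) * pinf (d * Q / b)"
  define A B where "A = qa \<gamma> * qa (inverse \<gamma>)" and "B = qb \<gamma> * qb (inverse \<gamma>)"
  define H where "H = Th \<gamma> * Th (inverse \<gamma>)"
  define tam tbm tap tbp where "tam = th (a * mm)" and "tbm = th (b * mm)" and "tap = th (a * pp)" and "tbp = th (b * pp)"
  define tcm tdm tcp tdp where "tcm = th (c * mm)" and "tdm = th (d * mm)" and "tcp = th (c * pp)" and "tdp = th (d * pp)"
  define Am Ap where "Am = th (a * s * mm * \<gamma>) * th (a * s * mm * inverse \<gamma>)" and "Ap = th (a * s * pp * \<gamma>) * th (a * s * pp * inverse \<gamma>)"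
  define t u where "t = th (b / a)" and "u = th (mm / pp)"
  note defs = S_def A_def B_def H_def t_def u_def ea_def eb_def tam_def tbm_def tap_def tbp_def
  have n: "S \<noteq> 0" "A \<noteq> 0" "B \<noteq> 0" "H \<noteq> 0" "t \<noteq> 0" "u \<noteq> 0" "ea \<noteq> 0" "eb \<noteq> 0" "tam \<noteq> 0" "tbm \<noteq> 0" "tap \<noteq> 0" "tbp \<noteq> 0" "1 - Q \<noteq> 0"
    unfolding defs using ne th_ba_ne th_Rq_ne[OF mp_R(1)] th_Rq_ne[OF mp_R(2)] q1 by (simp_all add: ne)
  have prodc: "prodc = ea * eb" unfolding prodc_def ea_def eb_def by (simp add: mult_ac)
  have TT: "TT = tam * tbm * tap * tbp" unfolding TT_def tam_def tbm_def tap_def tbp_def ..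
  have dd: "chatd \<gamma> z * chatd (inverse \<gamma>) z = S * B * (th (a * s * z * \<gamma>) * th (a * s * z * inverse \<gamma>)) / (eb\<^sup>2 * (th (a * z))\<^sup>2)" for z
  proof -
    have "s / inverse \<gamma> = s * \<gamma>" by (simp add: divide_inverse)
    then show ?thesis unfolding chatd_def S_def B_def qb_def eb_def power2_eq_square by (simp add: mult_ac)
  qed
  have om: "om \<gamma> mm = G * (S * (tcm * tdm / mm) / (prodc * (tam * tbm)))" "om \<gamma> pp = G * (S * (tcp * tdp / pp) / (prodc * (tap * tbp)))"
    unfolding G_def S_def tcm_def tdm_def tcp_def tdp_def tam_def tbm_def tap_def tbp_def by (rule om_eq[OF g0], simp)+
  define K where "K = S\<^sup>2 * B / (prodc * eb\<^sup>2 * TT * tam * tap * mm * pp)"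
  have "om \<gamma> pp * (chatd \<gamma> mm * chatd (inverse \<gamma>) mm) = G * (K * (mm * (tap * tcp * tdp * tbm * Am)))"
    unfolding om dd Am_def[symmetric] tam_def[symmetric] K_def TT using n prodc_ne by (simp add: divide_simps power2_eq_square, (simp add: mult_ac)?)
  moreover have "om \<gamma> mm * (chatd \<gamma> pp * chatd (inverse \<gamma>) pp) = G * (K * (pp * (tam * tcm * tdm * tbp * Ap)))"
    unfolding om dd Ap_def[symmetric] tap_def[symmetric] K_def TT using n prodc_ne by (simp add: divide_simps power2_eq_square, (simp add: mult_ac)?)
  ultimately have num: "om \<gamma> pp * (chatd \<gamma> mm * chatd (inverse \<gamma>) mm) - om \<gamma> mm * (chatd \<gamma> pp * chatd (inverse \<gamma>) pp) = G * (K * Br \<gamma>)"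
    unfolding Br_def Am_def[symmetric] Ap_def[symmetric] tam_def[symmetric] tbm_def[symmetric] tap_def[symmetric] tbp_def[symmetric]
      tcm_def[symmetric] tdm_def[symmetric] tcp_def[symmetric] tdp_def[symmetric] by (simp add: right_diff_distrib)
  have DD: "Delta \<gamma> * Delta (inverse \<gamma>) = S\<^sup>2 * A * B * (a * pp * (u * t))\<^sup>2 * H / (prodc * TT)\<^sup>2"
    unfolding Delta_prod[OF g0] S_def A_def B_def H_def t_def u_def ..
  have "(inverse \<gamma> - \<gamma>) * (chatd \<gamma> mm * chatd \<gamma> pp / Delta \<gamma> - chatd (inverse \<gamma>) mm * chatd (inverse \<gamma>) pp / Delta (inverse \<gamma>)) / D0 \<gamma>
     = ((inverse \<gamma> - \<gamma>) * G / D0 \<gamma>) * (K * Br \<gamma> / (Delta \<gamma> * Delta (inverse \<gamma>)))"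
    unfolding quot_diff_11[OF Delta_def Delta_def ne(7,8)] om_def[symmetric] num by (simp add: mult_ac)
  also have "\<dots> = pinf (\<gamma>\<^sup>2) * pinf ((inverse \<gamma>)\<^sup>2) * prodc / ((1 - Q) * S) * (K * Br \<gamma> / (Delta \<gamma> * Delta (inverse \<gamma>)))"
    unfolding G_def jump_factor[OF g(2)] S_def ..
  also have "\<dots> = ea\<^sup>2 * (tbp * tbm) / ((1 - Q) * a * b * mm\<^sup>2 * pp\<^sup>2 * (u * (- (pp / mm) * u) * (- (a / b) * t) * t))
    * (pinf (\<gamma>\<^sup>2) * pinf ((inverse \<gamma>)\<^sup>2) / (S * A * H)) * Br \<gamma>"
    unfolding DD K_def prodc TT using n nz by (simp add: divide_simps power2_eq_square, (simp add: mult_ac)?)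
  also have "\<dots> = v1 q zm zp a b c d \<gamma>"
    unfolding v1_eq th_flip[OF mp_ne(2,1)] th_flip[OF nz(1,2)] defs ..
  finally show ?thesis .
qed

lemma qab: assumes "\<gamma> \<noteq> 0" shows "qa \<gamma> * qa (inverse \<gamma>) * (qb \<gamma> * qb (inverse \<gamma>)) = kk \<gamma> * kk (inverse \<gamma>)"
proof -
  have "kk (inverse \<gamma>) = qa \<gamma> * qb (inverse \<gamma>)" if "\<gamma> \<noteq> 0" for \<gamma>
  proof -
    have "kk (inverse \<gamma>) = th (c * Q / (a * s) / \<gamma>) * th (d * Q / (a * s) / \<gamma>)" unfolding kk_def by (simp only: divide_inverse[of _ \<gamma>])
    then show ?thesis unfolding th_kk[OF that, symmetric] qa_def qb_def by (simp only: mult_ac)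
  qed
  from this[OF assms] this[of "inverse \<gamma>"] assms show ?thesis by simp
qed

text \<open>The coefficient of the mixed products in the jump. Here the two terms of the numerator
  merge into one by \<open>theta_cross\<close>, which is why \<open>v2\<close> is a plain
  product.\<close>

lemma jump_21:
  assumes g: "norm \<gamma> = 1" "Im \<gamma> \<noteq> 0"
  shows "(inverse \<gamma> - \<gamma>) * (- (chat \<gamma> mm * chatd \<gamma> pp) / Delta \<gamma> - - (chat (inverse \<gamma>) mm * chatd (inverse \<gamma>) pp) / Delta (inverse \<gamma>)) / D0 \<gamma>
    = v2 q zm zp a b c d \<gamma>"
proof -
  have g0: "\<gamma> \<noteq> 0" using g by auto
  note ne = jump_ne[OF g]
  define G where "G = a * s * \<gamma> * th (b / a) * th (1 / \<gamma>\<^sup>2) / (c * d)"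
  define S where "S = pinf (s * \<gamma>) * pinf (s / \<gamma>)"
  define A where "A = kk \<gamma> * kk (inverse \<gamma>)"
  define H where "H = Th \<gamma> * Th (inverse \<gamma>)"
  define t u v where "t = th (b / a)" and "u = th (mm / pp)" and "v = th (c * d * mm * pp)"
  define tam tbm tap tbp where "tam = th (a * mm)" and "tbm = th (b * mm)" and "tap = th (a * pp)" and "tbp = th (b * pp)"
  have n: "S \<noteq> 0" "A \<noteq> 0" "H \<noteq> 0" "t \<noteq> 0" "u \<noteq> 0" "TT \<noteq> 0" "1 - Q \<noteq> 0" "kk (inverse \<gamma>) \<noteq> 0"
    unfolding S_def A_def H_def t_def u_def qab[OF g0, symmetric] using ne th_ba_ne q1 by (simp_all add: ne)
      (use ne(2,3) qab[OF g0] in auto)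
  have nt: "tam \<noteq> 0" "tbm \<noteq> 0" "tap \<noteq> 0" "tbp \<noteq> 0" 
    unfolding tam_def tbm_def tap_def tbp_def using th_Rq_ne[OF mp_R(1)] th_Rq_ne[OF mp_R(2)] by simp_all
  have TT: "TT = tam * tbm * tap * tbp" unfolding TT_def tam_def tbm_def tap_def tbp_def ..
  define Xm Xp Ym Yp where "Xm = th (b * s * mm * \<gamma>) * th (a * s * mm / \<gamma>)" and "Xp = th (b * s * pp * \<gamma>) * th (a * s * pp / \<gamma>)"
    and "Ym = th (c * mm) * th (d * mm)" and "Yp = th (c * pp) * th (d * pp)"
  have cross: "Xp * Ym / mm - Xm * Yp / pp = kk \<gamma> * v * u / mm"
    using theta_cross[OF g0 mp_ne(1,2)] unfolding Xm_def Xp_def Ym_def Yp_def v_def u_def by (simp add: algebra_simps)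
  have ch: "chat \<gamma> mm * chatd (inverse \<gamma>) mm = S * kk (inverse \<gamma>) * Xm / (prodc * (tam * tbm))"
    "chat \<gamma> pp * chatd (inverse \<gamma>) pp = S * kk (inverse \<gamma>) * Xp / (prodc * (tap * tbp))"
    unfolding chat_cross[OF g0] S_def Xm_def Xp_def tam_def tbm_def tap_def tbp_def by (simp_all only: mult_ac)
  have om: "om \<gamma> mm = G * (S * (Ym / mm) / (prodc * (tam * tbm)))" "om \<gamma> pp = G * (S * (Yp / pp) / (prodc * (tap * tbp)))"
    unfolding G_def S_def Ym_def Yp_def tam_def tbm_def tap_def tbp_def by (rule om_eq[OF g0], simp)+
  define K where "K = S\<^sup>2 * kk (inverse \<gamma>) / (prodc\<^sup>2 * TT)"
  have "om \<gamma> mm * (chat \<gamma> pp * chatd (inverse \<gamma>) pp) = G * (K * (Xp * Ym / mm))" "om \<gamma> pp * (chat \<gamma> mm * chatd (inverse \<gamma>) mm) = G * (K * (Xm * Yp / pp))"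
    unfolding om ch K_def TT by (simp_all add: power2_eq_square mult_ac)
  then have num: "om \<gamma> mm * (chat \<gamma> pp * chatd (inverse \<gamma>) pp) - om \<gamma> pp * (chat \<gamma> mm * chatd (inverse \<gamma>) mm) = G * (K * (kk \<gamma> * v * u / mm))"
    unfolding cross[symmetric] by (simp add: right_diff_distrib)
  have DD: "Delta \<gamma> * Delta (inverse \<gamma>) = S\<^sup>2 * A * (a * pp * (u * t))\<^sup>2 * H / (prodc * TT)\<^sup>2"
    unfolding Delta_prod[OF g0] S_def A_def H_def t_def u_def qab[OF g0, symmetric] by (simp only: mult_ac)
  have "(inverse \<gamma> - \<gamma>) * (- (chat \<gamma> mm * chatd \<gamma> pp) / Delta \<gamma> - - (chat (inverse \<gamma>) mm * chatd (inverse \<gamma>) pp) / Delta (inverse \<gamma>)) / D0 \<gamma>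
     = ((inverse \<gamma> - \<gamma>) * G / D0 \<gamma>) * (K * (kk \<gamma> * v * u / mm) / (Delta \<gamma> * Delta (inverse \<gamma>)))"
    unfolding quot_diff_21[OF Delta_def Delta_def ne(7,8)] om_def[symmetric] num by (simp add: mult_ac)
  also have "\<dots> = pinf (\<gamma>\<^sup>2) * pinf ((inverse \<gamma>)\<^sup>2) * prodc / ((1 - Q) * S) * (K * (kk \<gamma> * v * u / mm) / (Delta \<gamma> * Delta (inverse \<gamma>)))"
    unfolding G_def jump_factor[OF g(2)] S_def ..
  also have "K * (kk \<gamma> * v * u / mm) = S\<^sup>2 * A * (v * u / mm) / (prodc\<^sup>2 * TT)" unfolding K_def A_def by (simp add: mult_ac)
  also have "pinf (\<gamma>\<^sup>2) * pinf ((inverse \<gamma>)\<^sup>2) * prodc / ((1 - Q) * S) * (S\<^sup>2 * A * (v * u / mm) / (prodc\<^sup>2 * TT) / (Delta \<gamma> * Delta (inverse \<gamma>)))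
     = prodc * TT * v / (a * b * mm\<^sup>2 * pp * (1 - Q) * ((- (pp / mm) * u) * (- (a / b) * t) * t))
    * (pinf (\<gamma>\<^sup>2) * pinf ((inverse \<gamma>)\<^sup>2) / (S * H))"
    unfolding DD using n nz prodc_ne by (simp add: divide_simps power2_eq_square, (simp add: mult_ac)?)
  also have "\<dots> = v2 q zm zp a b c d \<gamma>"
    unfolding v2_eq th_flip[OF mp_ne(2,1)] th_flip[OF nz(1,2)] S_def H_def t_def u_def v_def ..
  finally show ?thesis .
qed

text \<open>\<open>jump_11\<close> with \<open>a\<close> and \<open>b\<close> interchanged: both
  \<open>Delta\<close> and \<open>D0\<close> change their sign, so the quotient is
  unaffected.\<close>

lemma jump_22:
  assumes g: "norm \<gamma> = 1" "Im \<gamma> \<noteq> 0"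
  shows "(inverse \<gamma> - \<gamma>) * (chat \<gamma> mm * chat \<gamma> pp / Delta \<gamma> - chat (inverse \<gamma>) mm * chat (inverse \<gamma>) pp / Delta (inverse \<gamma>)) / D0 \<gamma>
    = v1 q zm zp b a c d \<gamma>"
proof -
  interpret sw: bqj q zm zp b a c d s by (rule swap_ab)
  have D: "sw.Delta \<gamma> = - Delta \<gamma>" for \<gamma> unfolding sw.Delta_def Delta_def by simp
  have D0: "sw.D0 \<gamma> = - D0 \<gamma>"
  proof -
    have "b * th (a / b) = - (a * th (b / a))" unfolding th_flip[OF nz(1,2)] using nz by simp
    then have "sw.kap \<gamma> = - kap \<gamma>" unfolding sw.kap_def kap_def by (simp add: mult_ac)
    then show ?thesis unfolding sw.D0_def D0_def by (simp add: mult_ac)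
  qed
  have e: "k * (x / - y - x' / - y') / - z = k * (x / y - x' / y') / z" for k x x' y y' z :: complex
  proof -
    have "x / - y - x' / - y' = - (x / y - x' / y')" by simp
    then show ?thesis by (simp only: mult_minus_right minus_divide_divide)
  qed
  show ?thesis using sw.jump_11[OF g] unfolding D D0 e .
qed

lemma green_jump:
  assumes g: "norm \<gamma> = 1" "Im \<gamma> \<noteq> 0"
  shows "(inverse \<gamma> - \<gamma>) * (green \<gamma> y x - green (inverse \<gamma>) y x) =
    v1 q zm zp a b c d \<gamma> * (Phi \<gamma> x * Phi \<gamma> y) + v2 q zm zp a b c d \<gamma> * (Phi \<gamma> x * Phid \<gamma> y + Phid \<gamma> x * Phi \<gamma> y)
     + v1 q zm zp b a c d \<gamma> * (Phid \<gamma> x * Phid \<gamma> y)"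
proof -
  interpret sw: bqj q zm zp b a c d s by (rule swap_ab)
  note ne = jump_ne[OF g]
  define cm cp dm dp \<Delta> where "cm = chat \<gamma> mm" and "cp = chat \<gamma> pp" and "dm = chatd \<gamma> mm" and "dp = chatd \<gamma> pp" and "\<Delta> = Delta \<gamma>"
  define cm' cp' dm' dp' \<Delta>' where "cm' = chat (inverse \<gamma>) mm" and "cp' = chat (inverse \<gamma>) pp" and "dm' = chatd (inverse \<gamma>) mm" and "dp' = chatd (inverse \<gamma>) pp" and "\<Delta>' = Delta (inverse \<gamma>)"
  note defs = cm_def cp_def dm_def dp_def \<Delta>_def cm'_def cp'_def dm'_def dp'_def \<Delta>'_def
  have \<Delta>: "\<Delta> = cm * dp - dm * cp" "\<Delta>' = cm' * dp' - dm' * cp'" "\<Delta> \<noteq> 0" "\<Delta>' \<noteq> 0" unfolding defs using ne by (simp_all add: Delta_def)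
  define D where "D = D0 \<gamma>"
  define k where "k = inverse \<gamma> - \<gamma>"
  have v1: "k * (dm * dp / \<Delta> - dm' * dp' / \<Delta>') / D = v1 q zm zp a b c d \<gamma>" unfolding defs k_def D_def by (rule jump_11[OF g])
  have v2: "k * (- (cm * dp) / \<Delta> - - (cm' * dp') / \<Delta>') / D = v2 q zm zp a b c d \<gamma>" unfolding defs k_def D_def by (rule jump_21[OF g])
  have v1d: "k * (cm * cp / \<Delta> - cm' * cp' / \<Delta>') / D = v1 q zm zp b a c d \<gamma>" unfolding defs k_def D_def by (rule jump_22[OF g])
  \<comment> \<open>The two mixed quotients differ by the constant 1, since \<open>\<Delta>\<close>
    is the difference of their numerators. The constant cancels in the jump, so both mixed entries
    equal \<open>v2\<close>.\<close>
  have v2': "k * (- (dm * cp) / \<Delta> - - (dm' * cp') / \<Delta>') / D = v2 q zm zp a b c d \<gamma>"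
  proof -
    have "- (dm * cp) / \<Delta> = - (cm * dp) / \<Delta> + 1" "- (dm' * cp') / \<Delta>' = - (cm' * dp') / \<Delta>' + 1" using \<Delta> by (simp_all add: field_simps)
    then show ?thesis unfolding v2[symmetric] by simp
  qed
  have P: "Phi (inverse \<gamma>) w = Phi \<gamma> w" "Phid (inverse \<gamma>) w = Phid \<gamma> w" for w
    unfolding Phi_def sw.Phi_def using NN_inverse_gamma[OF g(1)] sw.NN_inverse_gamma[OF g(1)] by auto
  have *: "k * ((dm * f - cm * f') * (dp * h - cp * h') / (\<Delta> * D) - (dm' * f - cm' * f') * (dp' * h - cp' * h') / (\<Delta>' * D)) =
     v1 q zm zp a b c d \<gamma> * (f * h) + v2 q zm zp a b c d \<gamma> * (f * h' + f' * h) + v1 q zm zp b a c d \<gamma> * (f' * h')" for f f' h h'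
  proof -
    have e: "(dm * f - cm * f') * (dp * h - cp * h') / (\<Delta> * D) =
      ((dm * dp / \<Delta>) * (f * h) + (- (dm * cp) / \<Delta>) * (f * h') + (- (cm * dp) / \<Delta>) * (f' * h) + (cm * cp / \<Delta>) * (f' * h')) / D" for dm dp cm cp \<Delta>
      by (simp add: algebra_simps add_divide_distrib diff_divide_distrib)
    have "k * ((dm * f - cm * f') * (dp * h - cp * h') / (\<Delta> * D) - (dm' * f - cm' * f') * (dp' * h - cp' * h') / (\<Delta>' * D)) =
      (k * (dm * dp / \<Delta> - dm' * dp' / \<Delta>') / D) * (f * h) + (k * (- (dm * cp) / \<Delta> - - (dm' * cp') / \<Delta>') / D) * (f * h')
      + (k * (- (cm * dp) / \<Delta> - - (cm' * dp') / \<Delta>') / D) * (f' * h) + (k * (cm * cp / \<Delta> - cm' * cp' / \<Delta>') / D) * (f' * h')"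
      unfolding e by (simp add: algebra_simps add_divide_distrib diff_divide_distrib)
    also have "\<dots> = v1 q zm zp a b c d \<gamma> * (f * h) + v2 q zm zp a b c d \<gamma> * (f * h' + f' * h) + v1 q zm zp b a c d \<gamma> * (f' * h')"
      unfolding v1 v2 v2' v1d by (simp add: distrib_left)
    finally show ?thesis .
  qed
  show ?thesis
  proof (cases "x \<le> y")
    case True
    then show ?thesis using *[of "Phi \<gamma> x" "Phid \<gamma> x" "Phi \<gamma> y" "Phid \<gamma> y"]
      unfolding green_def Psi_def P D0_inverse k_def D_def defs by simp
  next
    case False
    then show ?thesis using *[of "Phi \<gamma> y" "Phid \<gamma> y" "Phi \<gamma> x" "Phid \<gamma> x"]
      unfolding green_def Psi_def P D0_inverse k_def D_def defs by (simp add: mult_ac add_ac)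
  qed
qed

end

section \<open>The branch of the inverse of \<open>\<gamma> + 1/\<gamma>\<close> on the upper half
  strip\<close>

definition joukowski_inv :: "complex \<Rightarrow> complex" where
  "joukowski_inv l = l / 2 + \<i> * csqrt (1 - l\<^sup>2 / 4)"

lemma joukowski_inv_inverse:
  "joukowski_inv l \<noteq> 0" "inverse (joukowski_inv l) = l / 2 - \<i> * csqrt (1 - l\<^sup>2 / 4)" "joukowski_inv l + inverse (joukowski_inv l) = l"
proof -
  have "joukowski_inv l * (l / 2 - \<i> * csqrt (1 - l\<^sup>2 / 4)) = (l / 2)\<^sup>2 - (\<i> * csqrt (1 - l\<^sup>2 / 4))\<^sup>2"
    unfolding joukowski_inv_def by (simp add: power2_eq_square algebra_simps)
  also have "\<dots> = 1" by (simp add: power_mult_distrib power_divide)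
  finally have e: "joukowski_inv l * (l / 2 - \<i> * csqrt (1 - l\<^sup>2 / 4)) = 1" .
  then show "joukowski_inv l \<noteq> 0" by auto
  show i: "inverse (joukowski_inv l) = l / 2 - \<i> * csqrt (1 - l\<^sup>2 / 4)" by (rule inverse_unique[OF e])
  show "joukowski_inv l + inverse (joukowski_inv l) = l" unfolding i by (simp add: joukowski_inv_def)
qed

lemma joukowski_not_nonpos:
  assumes l: "0 \<le> Im l" "\<bar>Re l\<bar> < 2"
  shows "1 - l\<^sup>2 / 4 \<notin> \<real>\<^sub>\<le>\<^sub>0"
proof
  assume "1 - l\<^sup>2 / 4 \<in> \<real>\<^sub>\<le>\<^sub>0"
  then have r: "Re (1 - l\<^sup>2 / 4) \<le> 0" "Im (1 - l\<^sup>2 / 4) = 0" by (auto simp: complex_nonpos_Reals_iff)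
  have "Re (l\<^sup>2) = (Re l)\<^sup>2 - (Im l)\<^sup>2" by (simp add: power2_eq_square)
  moreover have "(Re l)\<^sup>2 < 4" using power_strict_mono[OF l(2), of 2] by simp
  moreover have "0 \<le> (Im l)\<^sup>2" by simp
  moreover have "4 \<le> Re (l\<^sup>2)" using r(1) by simp
  ultimately show False by linarith
qed

text \<open>In the strip the argument of the square root avoids the nonpositive reals, so the
  principal root has positive real part, and multiplication by \<open>\<i>\<close> makes
  \<open>Im \<gamma>\<close> positive. Then
  \<open>Im l = Im \<gamma> * (1 - 1 / (norm \<gamma>)\<^sup>2)\<close> transfers the sign of
  \<open>Im l\<close> to the position of \<open>\<gamma>\<close> relative to the unit
  circle.\<close>

lemma joukowski_inv_bounds:
  assumes l: "0 \<le> Im l" "\<bar>Re l\<bar> < 2"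
  shows "0 < Im (joukowski_inv l)" "1 \<le> norm (joukowski_inv l)" "0 < Im l \<Longrightarrow> 1 < norm (joukowski_inv l)"
proof -
  define g where "g = joukowski_inv l"
  have "0 < Re (csqrt (1 - l\<^sup>2 / 4))"
  proof -
    have "Re (csqrt (1 - l\<^sup>2 / 4)) \<noteq> 0"
    proof
      assume 0: "Re (csqrt (1 - l\<^sup>2 / 4)) = 0"
      have "1 - l\<^sup>2 / 4 = (csqrt (1 - l\<^sup>2 / 4))\<^sup>2" by simp
      also have "\<dots> = of_real (- ((Im (csqrt (1 - l\<^sup>2 / 4)))\<^sup>2))" using 0 by (simp add: complex_eq_iff power2_eq_square)
      finally have "1 - l\<^sup>2 / 4 = of_real (- ((Im (csqrt (1 - l\<^sup>2 / 4)))\<^sup>2))" .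
      moreover have "complex_of_real (- ((Im (csqrt (1 - l\<^sup>2 / 4)))\<^sup>2)) \<in> \<real>\<^sub>\<le>\<^sub>0" by (simp add: complex_nonpos_Reals_iff)
      ultimately show False using joukowski_not_nonpos[OF l] by metis
    qed
    then show ?thesis using Re_csqrt[of "1 - l\<^sup>2 / 4"] by linarith
  qed
  then have Ig: "0 < Im g" unfolding g_def joukowski_inv_def using l by (simp del: csqrt.simps)
  then show "0 < Im (joukowski_inv l)" by (simp add: g_def)
  have g0: "g \<noteq> 0" using Ig by auto
  have n: "0 < (norm g)\<^sup>2" using g0 by simp
  have "Im l = Im (g + inverse g)" unfolding g_def joukowski_inv_inverse(3) ..
  also have "\<dots> = Im g * (1 - 1 / (norm g)\<^sup>2)" using g0 by (simp add: complex_inverse cmod_power2 algebra_simps)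
  finally have e: "Im l = Im g * (1 - 1 / (norm g)\<^sup>2)" .
  have "0 \<le> 1 - 1 / (norm g)\<^sup>2" using e l(1) Ig by (metis zero_le_mult_iff less_le_not_le)
  then have "1 \<le> (norm g)\<^sup>2" using n by (simp add: divide_le_eq)
  then show "1 \<le> norm (joukowski_inv l)" unfolding g_def by (simp add: power2_nonneg_ge_1_iff)
  assume "0 < Im l"
  then have "0 < 1 - 1 / (norm g)\<^sup>2" using e Ig by (metis zero_less_mult_pos)
  then have "1 < (norm g)\<^sup>2" using n by (simp add: divide_less_eq)
  then show "1 < norm (joukowski_inv l)" unfolding g_def using power2_le_imp_le[of "norm (joukowski_inv l)" 1] by (meson linorder_not_le norm_ge_zero power_le_one)
qed

lemma joukowski_inv_continuous: "continuous_on {l. 0 \<le> Im l \<and> \<bar>Re l\<bar> < 2} joukowski_inv"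
  unfolding joukowski_inv_def[abs_def]
  by (intro continuous_intros continuous_on_compose2[OF continuous_on_csqrt]) (auto simp: joukowski_not_nonpos)

lemma joukowski_inv_cos: assumes "0 < \<psi>" "\<psi> < pi" shows "joukowski_inv (of_real (2 * cos \<psi>)) = cis \<psi>"
proof -
  have "1 - (complex_of_real (2 * cos \<psi>))\<^sup>2 / 4 = (of_real (sin \<psi>))\<^sup>2"
  proof -
    have "1 - (2 * cos \<psi>)\<^sup>2 / 4 = (sin \<psi>)\<^sup>2" using sin_squared_eq[of \<psi>] by (simp add: power_mult_distrib)
    then have "complex_of_real (1 - (2 * cos \<psi>)\<^sup>2 / 4) = of_real ((sin \<psi>)\<^sup>2)" by (rule arg_cong)
    then show ?thesis by simp
  qed
  moreover have "csqrt ((of_real (sin \<psi>))\<^sup>2) = of_real (sin \<psi>)" by (rule csqrt_square) (use sin_gt_zero[OF assms] in simp)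
  ultimately show ?thesis by (simp add: joukowski_inv_def complex_eq_iff)
qed

text \<open>Uniform continuity on the compact rectangle.\<close>

lemma uniform_limit_slice:
  fixes h :: "real \<times> real \<Rightarrow> real"
  assumes h: "continuous_on ({l1..l2} \<times> {0..1}) h" and e: "\<And>n. 0 \<le> e n" "\<And>n. e n \<le> 1" "e \<longlonglongrightarrow> 0"
  shows "uniform_limit {l1..l2} (\<lambda>n \<xi>. h (\<xi>, e n)) (\<lambda>\<xi>. h (\<xi>, 0)) sequentially"
proof (rule uniform_limitI)
  fix \<epsilon> :: real assume \<epsilon>: "0 < \<epsilon>"
  have "uniformly_continuous_on ({l1..l2} \<times> {0..1}) h"
    by (rule compact_uniformly_continuous[OF h]) (intro compact_Times compact_Icc)
  then obtain \<delta> where \<delta>: "0 < \<delta>" "\<And>x x'. x \<in> {l1..l2} \<times> {0..1} \<Longrightarrow> x' \<in> {l1..l2} \<times> {0..1} \<Longrightarrow> dist x' x < \<delta> \<Longrightarrow> dist (h x') (h x) < \<epsilon>"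
    using \<epsilon> by (metis uniformly_continuous_onE)
  have "\<forall>\<^sub>F n in sequentially. e n < \<delta>" by (rule order_tendstoD(2)[OF e(3) \<delta>(1)])
  then show "\<forall>\<^sub>F n in sequentially. \<forall>\<xi>\<in>{l1..l2}. dist (h (\<xi>, e n)) (h (\<xi>, 0)) < \<epsilon>"
  proof eventually_elim
    case (elim n)
    show ?case
    proof
      fix \<xi> assume \<xi>: "\<xi> \<in> {l1..l2}"
      have "dist (\<xi>, e n) (\<xi>, 0) < \<delta>" using elim e(1)[of n] by (simp add: dist_Pair_Pair dist_norm)
      then show "dist (h (\<xi>, e n)) (h (\<xi>, 0)) < \<epsilon>" using \<xi> e(1,2)[of n] by (intro \<delta>(2)) auto
    qed
  qed
qed

section \<open>The inversion formula on the unit circle, and polarization\<close>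

context spectral_resolution
begin

lemma T_sym: assumes u: "u \<in> D" and v: "v \<in> D" shows "ip (T u) v = ip u (T v)"
proof -
  note H = D_H[OF u] D_H[OF v] T_H[OF u] T_H[OF v]
  have re: "Im (ip (T w) w) = 0" if "w \<in> D" for w using T_ip[OF that] by simp
  have x: "Im (cnj \<beta> * ip (T u) v + \<beta> * ip (T v) u) = 0" for \<beta>
  proof -
    have eq: "ip (T (lincomb 1 u \<beta> v)) (lincomb 1 u \<beta> v) = ip (T u) u + (cnj \<beta> * ip (T u) v + \<beta> * ip (T v) u) + \<beta> * cnj \<beta> * ip (T v) v"
      unfolding T_lincomb using H by (simp add: ip_lincomb ip_cb2 H_lincomb algebra_simps)
    have "Im (ip (T (lincomb 1 u \<beta> v)) (lincomb 1 u \<beta> v)) = 0" by (intro re D_lincomb u v)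
    then have "Im (ip (T u) u) + Im (cnj \<beta> * ip (T u) v + \<beta> * ip (T v) u) + Im (\<beta> * cnj \<beta> * ip (T v) v) = 0"
      unfolding eq plus_complex.sel(2) .
    moreover have "Im (\<beta> * cnj \<beta> * ip (T v) v) = 0"
      unfolding complex_norm_square[symmetric] using re[OF v] by (simp del: of_real_power)
    ultimately show ?thesis using re[OF u] by linarith
  qed
  have "ip (T v) u = cnj (ip (T u) v)" using x[of 1] x[of \<i>] by (simp add: complex_eq_iff)
  then show ?thesis using ip_herm[OF H(4) H(1)] by simp
qed

end

context bqj
begin

text \<open>The resolvents at conjugate spectral parameters are adjoint to each other, by the
  symmetry of the operator on its domain.\<close>

lemma resolvent_form_cnj_off:
  assumes E: "spectral_measure_of HH inn DD LL E" and g: "1 < norm \<gamma>" "Im \<gamma> \<noteq> 0" and f: "f \<in> finsupp R"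
  shows "resolvent_form (cnj \<gamma>) f = cnj (resolvent_form \<gamma> f)"
proof -
  interpret S: spectral_resolution HH inn DD LL E by (rule spectral_resolution_bqj[OF E])
  define u v where "u = resolvent \<gamma> f" and "v = resolvent (cnj \<gamma>) f"
  have g': "1 < norm (cnj \<gamma>)" "Im (cnj \<gamma>) \<noteq> 0" using g by auto
  have uD: "u \<in> DD" "v \<in> DD" unfolding u_def v_def using resolvent_DD[OF g f] resolvent_DD[OF g' f] by auto
  note H = DD_HH[OF uD(1)] DD_HH[OF uD(2)] S.T_H[OF uD(1)] S.T_H[OF uD(2)]
  have fH: "f \<in> HH" by (rule finsupp_HH[OF f])
  have fu: "f = lincomb 1 (LL u) (- (\<gamma> + inverse \<gamma>)) u" unfolding u_def by (rule resolvent_eq) (use g f in auto)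
  have fv: "f = lincomb 1 (LL v) (- (cnj \<gamma> + inverse (cnj \<gamma>))) v" unfolding v_def by (rule resolvent_eq) (use g' f in auto)
  have "inn u f = inn u (lincomb 1 (LL v) (- (cnj \<gamma> + inverse (cnj \<gamma>))) v)" by (subst (1) fv) rule
  also have "\<dots> = inn u (LL v) - (\<gamma> + inverse \<gamma>) * inn u v" using H by (simp add: S.ip_cb2 algebra_simps)
  also have "\<dots> = inn (LL u) v - (\<gamma> + inverse \<gamma>) * inn u v" unfolding S.T_sym[OF uD] ..
  also have "\<dots> = inn (lincomb 1 (LL u) (- (\<gamma> + inverse \<gamma>)) u) v" using H by (simp add: S.ip_lincomb algebra_simps)
  also have "\<dots> = inn f v" unfolding fu[symmetric] ..
  also have "\<dots> = cnj (inn v f)" by (rule S.ip_herm[OF H(2) fH])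
  finally have "cnj (inn u f) = inn v f" by simp
  then show ?thesis unfolding u_def v_def inn_resolvent[OF g f] inn_resolvent[OF g' f] by simp
qed

text \<open>Radial limit of \<open>resolvent_form_cnj_off\<close>. On the unit circle the conjugate
  of \<open>\<gamma>\<close> is its inverse, so the jump of the form between the two is twice its
  imaginary part times \<open>\<i>\<close>.\<close>

lemma resolvent_form_cnj:
  assumes E: "spectral_measure_of HH inn DD LL E" and g: "norm \<gamma> = 1" "Im \<gamma> \<noteq> 0" and f: "f \<in> finsupp R"
  shows "resolvent_form (cnj \<gamma>) f = cnj (resolvent_form \<gamma> f)"
proof -
  define t where "t = (\<lambda>n. 1 + inverse (real (Suc n)))"
  have t: "t \<longlonglongrightarrow> 1" unfolding t_def using tendsto_add[OF tendsto_const LIMSEQ_inverse_real_of_nat, of 1] by simp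
  have t1: "1 < t n" for n unfolding t_def by simp
  have l: "(\<lambda>n. resolvent_form (of_real (t n) * w) f) \<longlonglongrightarrow> resolvent_form w f" if w: "norm w = 1" "Im w \<noteq> 0" for w
  proof (rule continuous_on_tendsto_compose[OF resolvent_form_continuous[of f]])
    have "(\<lambda>n. of_real (t n) * w) \<longlonglongrightarrow> of_real 1 * w" by (intro tendsto_mult tendsto_of_real t tendsto_const)
    then show "(\<lambda>n. of_real (t n) * w) \<longlonglongrightarrow> w" by simp
    show "w \<in> {\<gamma>. 1 \<le> cmod \<gamma> \<and> Im \<gamma> \<noteq> 0}" using w by simp
    have "of_real (t n) * w \<in> {\<gamma>. 1 \<le> cmod \<gamma> \<and> Im \<gamma> \<noteq> 0}" for n using w t1[of n] by (simp add: norm_mult)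
    then show "\<forall>\<^sub>F n in sequentially. of_real (t n) * w \<in> {\<gamma>. 1 \<le> cmod \<gamma> \<and> Im \<gamma> \<noteq> 0}" by simp
  qed
  have e: "resolvent_form (of_real (t n) * cnj \<gamma>) f = cnj (resolvent_form (of_real (t n) * \<gamma>) f)" for n
  proof -
    have "1 < norm (of_real (t n) * \<gamma>)" "Im (of_real (t n) * \<gamma>) \<noteq> 0" using g t1[of n] by (simp_all add: norm_mult)
    from resolvent_form_cnj_off[OF E this f] show ?thesis by simp
  qed
  have g': "norm (cnj \<gamma>) = 1" "Im (cnj \<gamma>) \<noteq> 0" using g by auto
  have "(\<lambda>n. cnj (resolvent_form (of_real (t n) * \<gamma>) f)) \<longlonglongrightarrow> cnj (resolvent_form \<gamma> f)" by (intro tendsto_cnj l g)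
  moreover have "(\<lambda>n. cnj (resolvent_form (of_real (t n) * \<gamma>) f)) \<longlonglongrightarrow> resolvent_form (cnj \<gamma>) f" using l[OF g'] unfolding e .
  ultimately show ?thesis using LIMSEQ_unique by blast
qed

text \<open>The transforms \<open>Fc\<close> and \<open>Fc_dagger\<close> of finitely supported
  functions as finite sums, with \<open>h\<close> being \<open>\<phi>\<^sub>\<gamma>\<close> or its
  dagger, see \<open>Fc_eq\<close>.\<close>

definition transform_sum :: "(real \<Rightarrow> complex) \<Rightarrow> (real \<Rightarrow> complex) \<Rightarrow> complex" where
  "transform_sum h f = (\<Sum>x | f x \<noteq> 0. f x * h x * of_real (W x))"

lemma transform_sum_superset: "finite S \<Longrightarrow> {x. f x \<noteq> 0} \<subseteq> S \<Longrightarrow> transform_sum h f = (\<Sum>x\<in>S. f x * h x * of_real (W x))"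
  unfolding transform_sum_def by (rule sum.mono_neutral_left) auto

lemma transform_sum_lincomb: assumes "f \<in> finsupp R" "g \<in> finsupp R" shows "transform_sum h (lincomb \<alpha> f \<beta> g) = \<alpha> * transform_sum h f + \<beta> * transform_sum h g"
proof -
  let ?S = "{x. f x \<noteq> 0} \<union> {x. g x \<noteq> 0}"
  have fin: "finite ?S" using assms by (simp add: finsupp_def)
  have "{x. lincomb \<alpha> f \<beta> g x \<noteq> 0} \<subseteq> ?S" by (auto simp: lincomb_def)
  then have "transform_sum h (lincomb \<alpha> f \<beta> g) = (\<Sum>x\<in>?S. lincomb \<alpha> f \<beta> g x * h x * of_real (W x))" by (rule transform_sum_superset[OF fin])
  also have "\<dots> = \<alpha> * (\<Sum>x\<in>?S. f x * h x * of_real (W x)) + \<beta> * (\<Sum>x\<in>?S. g x * h x * of_real (W x))"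
    by (simp add: lincomb_def sum_distrib_left sum.distrib algebra_simps)
  also have "\<dots> = \<alpha> * transform_sum h f + \<beta> * transform_sum h g" by (subst (1 2) transform_sum_superset[OF fin]) auto
  finally show ?thesis .
qed

definition spectral_form :: "complex \<Rightarrow> (real \<Rightarrow> complex) \<Rightarrow> (real \<Rightarrow> complex) \<Rightarrow> complex" where
  "spectral_form \<gamma> f g = transform_sum (Phid \<gamma>) (\<lambda>x. cnj (g x)) * (v2 q zm zp a b c d \<gamma> * transform_sum (Phi \<gamma>) f + v1 q zm zp b a c d \<gamma> * transform_sum (Phid \<gamma>) f)
    + transform_sum (Phi \<gamma>) (\<lambda>x. cnj (g x)) * (v1 q zm zp a b c d \<gamma> * transform_sum (Phi \<gamma>) f + v2 q zm zp a b c d \<gamma> * transform_sum (Phid \<gamma>) f)"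

lemma spectral_form_eq_jump:
  assumes g: "norm \<gamma> = 1" "Im \<gamma> \<noteq> 0"
  shows "spectral_form \<gamma> f f = (inverse \<gamma> - \<gamma>) * (resolvent_form \<gamma> f - resolvent_form (inverse \<gamma>) f)"
proof -
  let ?S = "{x. f x \<noteq> 0}"
  define A B C where "A = v1 q zm zp a b c d \<gamma>" and "B = v2 q zm zp a b c d \<gamma>" and "C = v1 q zm zp b a c d \<gamma>"
  have "(inverse \<gamma> - \<gamma>) * (resolvent_form \<gamma> f - resolvent_form (inverse \<gamma>) f) =
    (\<Sum>x\<in>?S. \<Sum>y\<in>?S. f y * of_real (W y) * cnj (f x) * of_real (W x) * ((inverse \<gamma> - \<gamma>) * (green \<gamma> y x - green (inverse \<gamma>) y x)))"
    unfolding resolvent_form_def by (simp add: sum_distrib_left sum_subtractf[symmetric] algebra_simps)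
  also have "\<dots> = (\<Sum>x\<in>?S. \<Sum>y\<in>?S. A * ((cnj (f x) * Phi \<gamma> x * of_real (W x)) * (f y * Phi \<gamma> y * of_real (W y)))
      + B * ((cnj (f x) * Phi \<gamma> x * of_real (W x)) * (f y * Phid \<gamma> y * of_real (W y)))
      + B * ((cnj (f x) * Phid \<gamma> x * of_real (W x)) * (f y * Phi \<gamma> y * of_real (W y)))
      + C * ((cnj (f x) * Phid \<gamma> x * of_real (W x)) * (f y * Phid \<gamma> y * of_real (W y))))"
    unfolding green_jump[OF g] A_def[symmetric] B_def[symmetric] C_def[symmetric] by (intro sum.cong refl) (simp add: algebra_simps)
  also have "\<dots> = A * (transform_sum (Phi \<gamma>) (\<lambda>x. cnj (f x)) * transform_sum (Phi \<gamma>) f) + B * (transform_sum (Phi \<gamma>) (\<lambda>x. cnj (f x)) * transform_sum (Phid \<gamma>) f)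
     + B * (transform_sum (Phid \<gamma>) (\<lambda>x. cnj (f x)) * transform_sum (Phi \<gamma>) f) + C * (transform_sum (Phid \<gamma>) (\<lambda>x. cnj (f x)) * transform_sum (Phid \<gamma>) f)"
  proof -
    have F: "transform_sum h (\<lambda>x. cnj (f x)) = (\<Sum>x\<in>?S. cnj (f x) * h x * of_real (W x))" for h by (simp add: transform_sum_def)
    show ?thesis unfolding F unfolding transform_sum_def unfolding sum_product unfolding sum.distrib sum_distrib_left ..
  qed
  finally show ?thesis unfolding spectral_form_def A_def B_def C_def by (simp add: algebra_simps)
qed

text \<open>Stieltjes inversion for the distribution of \<open>f\<close>, with the imaginary part of
  the resolvent form at height \<open>e n\<close> above the real axis as the Poisson integral;
  \<open>hc\<close> gives the uniform convergence to the boundary values. The substitution by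
  \<open>2 * cos \<psi>\<close> then leads to the unit circle.\<close>

lemma quadratic_formula:
  assumes E: "spectral_measure_of HH inn DD LL E" and f: "f \<in> finsupp R" and \<psi>: "0 < \<psi>1" "\<psi>1 < \<psi>2" "\<psi>2 < pi"
  shows "((\<lambda>\<psi>. spectral_form (cis \<psi>) f f) has_integral (2 * of_real pi * inn (E {2 * cos \<psi>2<..<2 * cos \<psi>1} f) f)) {\<psi>1..\<psi>2}"
proof -
  interpret S: spectral_resolution HH inn DD LL E by (rule spectral_resolution_bqj[OF E])
  define l1 l2 where "l1 = 2 * cos \<psi>2" and "l2 = 2 * cos \<psi>1"
  have fH: "f \<in> HH" by (rule finsupp_HH[OF f])
  have l: "l1 < l2" unfolding l1_def l2_def using cos_monotone_0_pi[of \<psi>1 \<psi>2] \<psi> by simp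
  have lb: "- 2 < l1" "l2 < 2" unfolding l1_def l2_def using cos_monotone_0_pi[of \<psi>2 pi] cos_monotone_0_pi[of 0 \<psi>1] \<psi> by simp_all
  define h where "h = (\<lambda>(\<xi>, \<epsilon>). Im (resolvent_form (joukowski_inv (Complex \<xi> \<epsilon>)) f))"
  have in_dom: "0 \<le> Im (Complex \<xi> \<epsilon>)" "\<bar>Re (Complex \<xi> \<epsilon>)\<bar> < 2" if "\<xi> \<in> {l1..l2}" "0 \<le> \<epsilon>" for \<xi> \<epsilon>
    using that lb by (auto simp: abs_less_iff)
  have hc: "continuous_on ({l1..l2} \<times> {0..1}) h"
  proof -
    have "continuous_on ({l1..l2} \<times> {0..1}) (\<lambda>p. Complex (fst p) (snd p))"
      unfolding Complex_eq by (intro continuous_intros)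
    then have "continuous_on ({l1..l2} \<times> {0..1}) (\<lambda>p. joukowski_inv (Complex (fst p) (snd p)))"
      by (rule continuous_on_compose2[OF joukowski_inv_continuous]) (use in_dom in auto)
    then have "continuous_on ({l1..l2} \<times> {0..1}) (\<lambda>p. resolvent_form (joukowski_inv (Complex (fst p) (snd p))) f)"
    proof (rule continuous_on_compose2[OF resolvent_form_continuous])
      show "(\<lambda>p. joukowski_inv (Complex (fst p) (snd p))) ` ({l1..l2} \<times> {0..1}) \<subseteq> {\<gamma>. 1 \<le> cmod \<gamma> \<and> Im \<gamma> \<noteq> 0}"
      proof (rule image_subsetI)
        fix p assume "p \<in> {l1..l2} \<times> {0..1::real}"
        then have "fst p \<in> {l1..l2}" "0 \<le> snd p" by auto
        from joukowski_inv_bounds(1,2)[OF in_dom[OF this]]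
        show "joukowski_inv (Complex (fst p) (snd p)) \<in> {\<gamma>. 1 \<le> cmod \<gamma> \<and> Im \<gamma> \<noteq> 0}" by simp
      qed
    qed
    then show ?thesis unfolding h_def case_prod_unfold by (rule continuous_on_Im)
  qed
  define e where "e = (\<lambda>n. inverse (real (Suc n)))"
  have e: "0 < e n" "e n \<le> 1" for n unfolding e_def by (simp_all add: field_simps)
  have e0: "e \<longlonglongrightarrow> 0" unfolding e_def by (rule LIMSEQ_inverse_real_of_nat)
  define k where "k = (\<lambda>\<xi>. h (\<xi>, 0))"
  have slice: "continuous_on {l1..l2} (\<lambda>\<xi>. h (\<xi>, t))" if "t \<in> {0..1}" for t
    by (rule continuous_on_compose2[OF hc]) (use that in \<open>auto intro!: continuous_intros\<close>)
  have m: "measure (S.mu f) {l1<..<l2} = integral {l1..l2} k / pi"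
  proof (rule stieltjes_inversion[OF S.finite_mu[OF fH] S.sets_mu l e(1) e0, where J = "\<lambda>n \<xi>. h (\<xi>, e n)"])
    show "continuous_on {l1..l2} (\<lambda>\<xi>. h (\<xi>, e n))" for n by (rule slice) (use e[of n] in auto)
    show "uniform_limit {l1..l2} (\<lambda>n \<xi>. h (\<xi>, e n)) k sequentially"
      unfolding k_def by (rule uniform_limit_slice[OF hc less_imp_le[OF e(1)] e(2) e0])
    fix n \<xi> assume \<xi>: "\<xi> \<in> {l1..l2}"
    define \<gamma> where "\<gamma> = joukowski_inv (Complex \<xi> (e n))"
    have g: "1 < norm \<gamma>" "Im \<gamma> \<noteq> 0"
      using joukowski_inv_bounds(1,3)[OF in_dom[OF \<xi> less_imp_le[OF e(1)[of n]]]] e(1)[of n] by (auto simp: \<gamma>_def)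
    have "f = lincomb 1 (LL (resolvent \<gamma> f)) (- Complex \<xi> (e n)) (resolvent \<gamma> f)"
      using resolvent_eq[OF less_imp_le[OF g(1)] g(2) f] unfolding \<gamma>_def joukowski_inv_inverse(3) .
    from S.resolvent_Im[OF resolvent_DD[OF g f] e(1) this]
    have "Im (resolvent_form \<gamma> f) = (\<integral> t. e n / ((t - \<xi>)\<^sup>2 + (e n)\<^sup>2) \<partial>S.mu f)"
      unfolding inn_resolvent[OF g f] by simp
    then show "h (\<xi>, e n) = (\<integral> t. e n / ((t - \<xi>)\<^sup>2 + (e n)\<^sup>2) \<partial>S.mu f)"
      by (simp add: h_def \<gamma>_def)
  qed
  have B: "{l1<..<l2} \<in> sets borel" by simp
  have M: "inn (E {l1<..<l2} f) f = of_real (measure (S.mu f) {l1<..<l2})"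
    unfolding S.measure_mu[OF fH B] by (rule S.E_nonneg(1)[OF B fH])
  \<comment> \<open>The map \<open>2 * cos\<close> is decreasing, so the first of the two integrals
    is over an empty interval and the second enters with a minus sign.\<close>
  have H1: "((\<lambda>\<psi>. (- 2 * sin \<psi>) *\<^sub>R k (2 * cos \<psi>)) has_integral (integral {2 * cos \<psi>1..2 * cos \<psi>2} k - integral {2 * cos \<psi>2..2 * cos \<psi>1} k)) {\<psi>1..\<psi>2}"
  proof (rule has_integral_substitution_general[where s = "{}" and c = l1 and d = l2])
    show "(\<lambda>\<psi>. 2 * cos \<psi>) ` {\<psi>1..\<psi>2} \<subseteq> {l1..l2}"
      unfolding l1_def l2_def using \<psi> by (auto intro!: cos_monotone_0_pi_le)
    show "continuous_on {l1..l2} k" unfolding k_def by (rule slice) simp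
    show "((\<lambda>\<psi>. 2 * cos \<psi>) has_real_derivative - 2 * sin x) (at x within {\<psi>1..\<psi>2})" for x
      by (auto intro!: derivative_eq_intros)
  qed (use \<psi> in \<open>auto intro!: continuous_intros\<close>)
  have "integral {2 * cos \<psi>1..2 * cos \<psi>2} k - integral {2 * cos \<psi>2..2 * cos \<psi>1} k = - (pi * measure (S.mu f) {l1<..<l2})"
    using m l unfolding l1_def l2_def by simp
  then have H: "((\<lambda>\<psi>. (- 2 * sin \<psi>) *\<^sub>R k (2 * cos \<psi>)) has_integral - (pi * measure (S.mu f) {l1<..<l2})) {\<psi>1..\<psi>2}"
    using H1 by (simp only:)
  have "((\<lambda>\<psi>. complex_of_real ((- 2 * sin \<psi>) *\<^sub>R k (2 * cos \<psi>))) has_integral complex_of_real (- (pi * measure (S.mu f) {l1<..<l2}))) {\<psi>1..\<psi>2}"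
    using has_integral_linear[OF H bounded_linear_of_real[where 'a = complex]] unfolding o_def .
  then have I: "((\<lambda>\<psi>. - 2 * complex_of_real ((- 2 * sin \<psi>) *\<^sub>R k (2 * cos \<psi>))) has_integral - 2 * complex_of_real (- (pi * measure (S.mu f) {l1<..<l2}))) {\<psi>1..\<psi>2}"
    by (rule has_integral_mult_right)
  have V: "- 2 * complex_of_real (- (pi * measure (S.mu f) {l1<..<l2})) = 2 * of_real pi * inn (E {l1<..<l2} f) f" unfolding M by simp
  have "((\<lambda>\<psi>. spectral_form (cis \<psi>) f f) has_integral - 2 * complex_of_real (- (pi * measure (S.mu f) {l1<..<l2}))) {\<psi>1..\<psi>2}"
  proof (rule has_integral_eq[OF _ I])
    fix \<psi> assume "\<psi> \<in> {\<psi>1..\<psi>2}"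
    then have p: "0 < \<psi>" "\<psi> < pi" using \<psi> by auto
    have sp: "0 < sin \<psi>" by (rule sin_gt_zero[OF p])
    have g: "norm (cis \<psi>) = 1" "Im (cis \<psi>) \<noteq> 0" using sp by auto
    have k: "k (2 * cos \<psi>) = Im (resolvent_form (cis \<psi>) f)"
    proof -
      have "Complex (2 * cos \<psi>) 0 = of_real (2 * cos \<psi>)" by (simp add: complex_eq_iff)
      then show ?thesis unfolding k_def h_def using joukowski_inv_cos[OF p] by simp
    qed
    have i: "inverse (cis \<psi>) = cnj (cis \<psi>)" by (simp add: cis_cnj)
    \<comment> \<open>The first factor is \<open>- 2 * \<i> * sin \<psi>\<close> and the second is
      \<open>2 * \<i>\<close> times the imaginary part. Their product is -2 times the integrand of
      the substitution formula \<open>H\<close>, which is the factor in \<open>I\<close>.\<close>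
    have "spectral_form (cis \<psi>) f f = (cnj (cis \<psi>) - cis \<psi>) * (resolvent_form (cis \<psi>) f - cnj (resolvent_form (cis \<psi>) f))"
      unfolding spectral_form_eq_jump[OF g] i resolvent_form_cnj[OF E g f] ..
    also have "\<dots> = of_real (4 * sin \<psi> * Im (resolvent_form (cis \<psi>) f))" by (simp add: complex_eq_iff)
    finally show "- 2 * complex_of_real ((- 2 * sin \<psi>) *\<^sub>R k (2 * cos \<psi>)) = spectral_form (cis \<psi>) f f" unfolding k by simp
  qed
  then show ?thesis unfolding V unfolding l1_def l2_def .
qed

lemma lincomb_finsupp: "f \<in> finsupp R \<Longrightarrow> g \<in> finsupp R \<Longrightarrow> lincomb \<alpha> f \<beta> g \<in> finsupp R"
  by (auto simp: finsupp_def fun_on_def lincomb_def intro: finite_subset[of _ "{x. f x \<noteq> 0} \<union> {x. g x \<noteq> 0}"])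

lemma spectral_form_lincomb:
  assumes f: "f \<in> finsupp R" and g: "g \<in> finsupp R"
  shows "spectral_form \<gamma> (lincomb 1 f \<beta> g) (lincomb 1 f \<beta> g) = spectral_form \<gamma> f f + cnj \<beta> * spectral_form \<gamma> f g + \<beta> * spectral_form \<gamma> g f + \<beta> * cnj \<beta> * spectral_form \<gamma> g g"
proof -
  have fg: "(\<lambda>x. cnj (f x)) \<in> finsupp R" "(\<lambda>x. cnj (g x)) \<in> finsupp R" using f g by (auto simp: finsupp_def fun_on_def)
  have c: "(\<lambda>x. cnj (lincomb 1 f \<beta> g x)) = lincomb 1 (\<lambda>x. cnj (f x)) (cnj \<beta>) (\<lambda>x. cnj (g x))" by (auto simp: lincomb_def)
  show ?thesis unfolding spectral_form_def c transform_sum_lincomb[OF f g] transform_sum_lincomb[OF fg] by (simp add: algebra_simps)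
qed

text \<open>Polarization: both sides are linear in \<open>f\<close> and conjugate linear in
  \<open>g\<close>, hence determined by their diagonal values at \<open>f + \<beta> g\<close> for
  the four fourth roots of unity \<open>\<beta>\<close>.\<close>

lemma sesquilinear_formula:
  assumes E: "spectral_measure_of HH inn DD LL E" and f: "f \<in> finsupp R" and g: "g \<in> finsupp R" and \<psi>: "0 < \<psi>1" "\<psi>1 < \<psi>2" "\<psi>2 < pi"
  shows "((\<lambda>\<psi>. spectral_form (cis \<psi>) f g) has_integral (2 * of_real pi * inn (E {2 * cos \<psi>2<..<2 * cos \<psi>1} f) g)) {\<psi>1..\<psi>2}"
proof -
  interpret S: spectral_resolution HH inn DD LL E by (rule spectral_resolution_bqj[OF E])
  define M where "M = (\<lambda>f g. inn (E {2 * cos \<psi>2<..<2 * cos \<psi>1} f) g)"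
  have B: "{2 * cos \<psi>2<..<2 * cos \<psi>1} \<in> sets borel" by simp
  note fH = finsupp_HH[OF f] finsupp_HH[OF g]
  have Mcb: "M (lincomb 1 f \<beta> g) (lincomb 1 f \<beta> g) = M f f + cnj \<beta> * M f g + \<beta> * M g f + \<beta> * cnj \<beta> * M g g" for \<beta>
    unfolding M_def S.E_lincomb[OF B fH] using fH S.E_H[OF B fH(1)] S.E_H[OF B fH(2)]
    by (simp add: S.ip_lincomb S.ip_cb2 S.H_lincomb algebra_simps)
  have q: "((\<lambda>\<psi>. spectral_form (cis \<psi>) (lincomb 1 f \<beta> g) (lincomb 1 f \<beta> g)) has_integral (2 * of_real pi * M (lincomb 1 f \<beta> g) (lincomb 1 f \<beta> g))) {\<psi>1..\<psi>2}" for \<beta>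
    unfolding M_def by (rule quadratic_formula[OF E lincomb_finsupp[OF f g] \<psi>])
  have pol: "X f g = (1 / 4) * (1 * (X f f + cnj 1 * X f g + 1 * X g f + 1 * cnj 1 * X g g) + (- 1) * (X f f + cnj (- 1) * X f g + (- 1) * X g f + (- 1) * cnj (- 1) * X g g)
      + (\<i> * (X f f + cnj \<i> * X f g + \<i> * X g f + \<i> * cnj \<i> * X g g) + (- \<i>) * (X f f + cnj (- \<i>) * X f g + (- \<i>) * X g f + (- \<i>) * cnj (- \<i>) * X g g)))"
    for X :: "(real \<Rightarrow> complex) \<Rightarrow> (real \<Rightarrow> complex) \<Rightarrow> complex"
  proof -
    define A B C D where "A = X f f" and "B = X f g" and "C = X g f" and "D = X g g"
    show ?thesis unfolding A_def[symmetric] B_def[symmetric] C_def[symmetric] D_def[symmetric] by (simp add: complex_eq_iff)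
  qed
  have sc: "(1 / 4) * (1 * (k * A) + (- 1) * (k * B) + (\<i> * (k * C) + (- \<i>) * (k * D))) = k * ((1 / 4) * (1 * A + (- 1) * B + (\<i> * C + (- \<i>) * D)))"
    for A B C D k :: complex by (simp add: algebra_simps)
  have "((\<lambda>\<psi>. (1 / 4) * (1 * spectral_form (cis \<psi>) (lincomb 1 f 1 g) (lincomb 1 f 1 g) + (- 1) * spectral_form (cis \<psi>) (lincomb 1 f (- 1) g) (lincomb 1 f (- 1) g)
     + (\<i> * spectral_form (cis \<psi>) (lincomb 1 f \<i> g) (lincomb 1 f \<i> g) + (- \<i>) * spectral_form (cis \<psi>) (lincomb 1 f (- \<i>) g) (lincomb 1 f (- \<i>) g)))) has_integral
     (1 / 4) * (1 * (2 * of_real pi * M (lincomb 1 f 1 g) (lincomb 1 f 1 g)) + (- 1) * (2 * of_real pi * M (lincomb 1 f (- 1) g) (lincomb 1 f (- 1) g))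
     + (\<i> * (2 * of_real pi * M (lincomb 1 f \<i> g) (lincomb 1 f \<i> g)) + (- \<i>) * (2 * of_real pi * M (lincomb 1 f (- \<i>) g) (lincomb 1 f (- \<i>) g))))) {\<psi>1..\<psi>2}"
    by (intro has_integral_mult_right has_integral_add q)
  moreover have "(1 / 4) * (1 * (2 * of_real pi * M (lincomb 1 f 1 g) (lincomb 1 f 1 g)) + (- 1) * (2 * of_real pi * M (lincomb 1 f (- 1) g) (lincomb 1 f (- 1) g))
     + (\<i> * (2 * of_real pi * M (lincomb 1 f \<i> g) (lincomb 1 f \<i> g)) + (- \<i>) * (2 * of_real pi * M (lincomb 1 f (- \<i>) g) (lincomb 1 f (- \<i>) g)))) = 2 * of_real pi * M f g"
    unfolding sc Mcb pol[of M, symmetric] ..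
  ultimately show ?thesis unfolding spectral_form_lincomb[OF f g] pol[of "spectral_form _", symmetric] M_def by (simp only:)
qed

lemma Fc_eq:
  assumes f: "f \<in> finsupp R" and g: "norm \<gamma> = 1"
  shows "Fc q zm zp a b c d f \<gamma> = transform_sum (Phi \<gamma>) f" "Fc_dagger q zm zp a b c d f \<gamma> = transform_sum (Phid \<gamma>) f"
proof -
  interpret sw: bqj q zm zp b a c d s by (rule swap_ab)
  have m: "qint q zm zp (\<lambda>x. f x * h x * ww x) = transform_sum h f" for h
  proof -
    \<comment> \<open>With the indicator \<open>k\<close> of the support of \<open>f\<close>, the
      q-integral is an inner product of finitely supported functions, which
      \<open>inn_finsupp\<close> evaluates.\<close>
    define u k where "u = (\<lambda>x. f x * h x)" and "k = (\<lambda>x. if f x \<noteq> 0 then 1 else 0 :: complex)"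
    have uk: "u \<in> finsupp R" "k \<in> finsupp R"
      using f by (auto simp: u_def k_def finsupp_def fun_on_def intro: finite_subset[of _ "{x. f x \<noteq> 0}"])
    have "qint q zm zp (\<lambda>x. f x * h x * ww x) = inn u k"
      unfolding L2_inner_def by (rule arg_cong[where f = "qint q zm zp"]) (auto simp: u_def k_def)
    also have "\<dots> = (\<Sum>x | k x \<noteq> 0. u x * cnj (k x) * of_real (W x))" by (rule inn_finsupp[OF finsupp_HH[OF uk(1)] uk(2)])
    also have "\<dots> = transform_sum h f" unfolding transform_sum_def by (rule sum.cong) (auto simp: u_def k_def)
    finally show ?thesis .
  qed
  show "Fc q zm zp a b c d f \<gamma> = transform_sum (Phi \<gamma>) f" unfolding Fc_def bigqJacobi_eq[OF g] m ..
  show "Fc_dagger q zm zp a b c d f \<gamma> = transform_sum (Phid \<gamma>) f" unfolding Fc_dagger_def sw.bigqJacobi_eq[OF g] m ..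
qed

lemma row_col_eq:
  assumes f: "f \<in> finsupp R" and g: "g \<in> finsupp R"
  shows "row_col
        (vector [Fc_dagger q zm zp a b c d (\<lambda>x. cnj (g x)) (cis \<psi>), Fc q zm zp a b c d (\<lambda>x. cnj (g x)) (cis \<psi>)])
        (vmatrix q zm zp a b c d (cis \<psi>) *v vector [Fc q zm zp a b c d f (cis \<psi>), Fc_dagger q zm zp a b c d f (cis \<psi>)]) = spectral_form (cis \<psi>) f g"
proof -
  have g': "(\<lambda>x. cnj (g x)) \<in> finsupp R" using g by (auto simp: finsupp_def fun_on_def)
  have n: "norm (cis \<psi>) = 1" by simp
  show ?thesis unfolding Fc_eq[OF f n] Fc_eq[OF g' n] spectral_form_def
    by (simp add: row_col_def vmatrix_def matrix_vector_mult_def sum_2 v1_dagger_def)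
qed

end

section \<open>Passage from the parameter set to the locale \<open>bqj\<close>\<close>

lemma (in qbase) real_pair:
  fixes x y z w :: real
  assumes z: "0 < z" and o: "z * q powi k < inverse y" "inverse y < inverse x" "inverse x < z * q powi (k - 1)"
    and w: "w \<le> 0 \<or> (\<exists>n. w = z * q powi n)"
  shows "0 < x" "0 < y" "q < x / y" "x / y < 1" "0 < (1 - x * w) * (1 - y * w)"
proof -
  have qp: "0 < q powi n" for n using q0 by simp
  have "0 < z * q powi k" using z qp by simp
  then have "0 < inverse y" "0 < inverse x" using o by linarith+
  then show xy: "0 < x" "0 < y" by simp_all
  have lt: "x < y" using o(2) xy by simp
  then show "x / y < 1" using xy by simp
  have "q powi (k - 1) = q powi k / q" using q0 by (simp add: power_int_diff)
  then have "q * inverse x < z * q powi k" using mult_strict_left_mono[OF o(3) q0] q0 by simp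
  then have "q * inverse x < inverse y" using o(1) by linarith
  then show "q < x / y" using xy by (simp add: field_simps)
  \<comment> \<open>Both reciprocals lie in the same gap between two consecutive points of the half
    lattice, so at every lattice point the two factors have the same sign.\<close>
  show "0 < (1 - x * w) * (1 - y * w)"
  proof (cases "w \<le> 0")
    case True
    then have "x * w \<le> 0" "y * w \<le> 0" using xy by (simp_all add: mult_nonneg_nonpos)
    then show ?thesis by (intro mult_pos_pos) linarith+
  next
    case False
    then obtain n where n: "w = z * q powi n" using w by blast
    show ?thesis
    proof (cases "k \<le> n")
      case True
      then have "q powi n \<le> q powi k" using q0 q1 by (intro power_int_decreasing) auto
      then have "w \<le> z * q powi k" unfolding n using z by simp
      then have "w < inverse y" "w < inverse x" using o by linarith+
      then have "x * w < 1" "y * w < 1" using xy by (simp_all add: field_simps)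
      then show ?thesis by (intro mult_pos_pos) linarith+
    next
      case False
      then have "q powi (k - 1) \<le> q powi n" using q0 q1 by (intro power_int_decreasing) auto
      then have "z * q powi (k - 1) \<le> w" unfolding n using z by simp
      then have "inverse y < w" "inverse x < w" using o by linarith+
      then have "1 < x * w" "1 < y * w" using xy by (simp_all add: field_simps)
      then show ?thesis by (intro mult_neg_neg) linarith+
    qed
  qed
qed

lemma (in qbase) Ppair_D:
  assumes z: "zm < 0" "0 < zp" and p: "(u, v) \<in> Ppair q zm zp"
  shows "u \<noteq> 0" "v \<noteq> 0" "u = cnj v \<or> u \<in> \<real> \<and> v \<in> \<real>" "0 < Re (u * v)" "u * v \<in> \<real>" "q < norm (u / v)" "norm (u / v) < 1 / q"
    "\<And>x. x \<in> Rq q zm zp \<Longrightarrow> (1 - u * of_real x) * (1 - v * of_real x) \<in> \<real> \<and> 0 < Re ((1 - u * of_real x) * (1 - v * of_real x))"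
proof -
  have q1': "1 < 1 / q" using q0 q1 by simp
  show n: "u \<noteq> 0" "v \<noteq> 0" using p by (auto simp: Ppair_def)
  have off: "v \<noteq> of_real (inverse z * q powi k)" if "z \<in> {zm, zp}" for z k using p that by (auto simp: Ppair_def)
  consider (conj) "u = cnj v"
    | (pos) x y k where "u = of_real x" "v = of_real y" "zp * q powi k < inverse y" "inverse y < inverse x" "inverse x < zp * q powi (k - 1)"
    | (neg) x y k where "u = of_real x" "v = of_real y" "zm * q powi (k - 1) < inverse x" "inverse x < inverse y" "inverse y < zm * q powi k"
    using p unfolding Ppair_def by blast
  then have "(u = cnj v \<or> u \<in> \<real> \<and> v \<in> \<real>) \<and> 0 < Re (u * v) \<and> u * v \<in> \<real> \<and> q < norm (u / v) \<and> norm (u / v) < 1 / q \<and>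
    (\<forall>x\<in>Rq q zm zp. (1 - u * of_real x) * (1 - v * of_real x) \<in> \<real> \<and> 0 < Re ((1 - u * of_real x) * (1 - v * of_real x)))"
  proof cases
    case conj
    have sq: "cnj w * w = of_real ((norm w)\<^sup>2)" for w using complex_norm_square[of w] by (simp add: mult.commute)
    have "(1 - u * of_real x) * (1 - v * of_real x) = of_real ((norm (1 - v * of_real x))\<^sup>2)" for x
      unfolding conj sq[symmetric] by simp
    moreover have "1 - v * of_real x \<noteq> 0" if x: "x \<in> Rq q zm zp" for x
    proof
      assume e: "1 - v * of_real x = 0"
      obtain z' k where zk: "z' \<in> {zm, zp}" "x = z' * q powi k" using x by (rule Rq_cases)
      have x0: "x \<noteq> 0" using zk z q0 by auto
      have "v = inverse (of_real x)" using e x0 by (simp add: field_simps)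
      also have "\<dots> = of_real (inverse z' * q powi (- k))" unfolding zk by (simp add: power_int_minus)
      finally show False using off[OF zk(1)] by blast
    qed
    moreover have "u * v = of_real ((norm v)\<^sup>2)" unfolding conj sq ..
    moreover have "norm (u / v) = 1" unfolding conj using n by (simp add: norm_divide)
    ultimately show ?thesis using conj q1 q1' n by (auto simp del: of_real_power)
  next
    case pos
    have r: "(1 - u * of_real w) * (1 - v * of_real w) = of_real ((1 - x * w) * (1 - y * w))" for w unfolding pos by simp
    note base = real_pair[OF z(2) pos(3-5)]
    \<comment> \<open>The first four conclusions of \<open>real_pair\<close> do not involve
      \<open>w\<close>; the value 0 meets its condition on \<open>w\<close>.\<close>
    have 0: "0 < x" "0 < y" "q < x / y" "x / y < 1" by (rule base[of 0], simp)+
    have "0 < (1 - x * w) * (1 - y * w)" if w: "w \<in> Rq q zm zp" for w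
    proof (rule base(5))
      obtain z' k where zk: "z' \<in> {zm, zp}" "w = z' * q powi k" using w by (rule Rq_cases)
      then show "w \<le> 0 \<or> (\<exists>n. w = zp * q powi n)" using z q0 by (auto simp: mult_nonpos_nonneg)
    qed
    moreover have "u * v = of_real (x * y)" "norm (u / v) = x / y" unfolding pos using 0 by (simp_all add: norm_divide)
    moreover have "0 < x * y" using 0 by simp
    moreover have "x / y < 1 / q" using 0(4) q1' by linarith
    ultimately show ?thesis using 0(3) unfolding r by (simp add: pos(1,2))
  next
    case neg
    \<comment> \<open>The reflection that changes the sign of the parameters, of \<open>zm\<close>
      and of the lattice points reduces this case to \<open>real_pair\<close>.\<close>
    have r: "(1 - u * of_real w) * (1 - v * of_real w) = of_real ((1 - (- x) * (- w)) * (1 - (- y) * (- w)))" for w unfolding neg by simp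
    have zz: "0 < - zm" using z by simp
    have ineq: "- zm * q powi k < inverse (- y)" "inverse (- y) < inverse (- x)" "inverse (- x) < - zm * q powi (k - 1)" using neg(3-5) by simp_all
    note base = real_pair[OF zz ineq]
    have 0: "0 < - x" "0 < - y" "q < - x / - y" "- x / - y < 1" by (rule base[of 0], simp)+
    have "0 < (1 - (- x) * (- w)) * (1 - (- y) * (- w))" if w: "w \<in> Rq q zm zp" for w
    proof (rule base(5))
      obtain z' k where zk: "z' \<in> {zm, zp}" "w = z' * q powi k" using w by (rule Rq_cases)
      then show "- w \<le> 0 \<or> (\<exists>n. - w = - zm * q powi n)" using z q0 by auto
    qed
    moreover have "u * v = of_real (x * y)" "norm (u / v) = x / y" unfolding neg using 0 by (simp_all add: norm_divide)
    moreover have "0 < x * y" using 0 by (simp add: mult_neg_neg)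
    moreover have "x / y < 1 / q" using 0(4) q1' minus_divide_divide[of x y] by linarith
    ultimately show ?thesis using 0(3) unfolding r by (simp add: neg(1,2))
  qed
  then show "u = cnj v \<or> u \<in> \<real> \<and> v \<in> \<real>" "0 < Re (u * v)" "u * v \<in> \<real>" "q < norm (u / v)" "norm (u / v) < 1 / q"
    "\<And>x. x \<in> Rq q zm zp \<Longrightarrow> (1 - u * of_real x) * (1 - v * of_real x) \<in> \<real> \<and> 0 < Re ((1 - u * of_real x) * (1 - v * of_real x))"
    by blast+
qed

lemma (in qbase) Pgen_bqj:
  assumes z: "zm < 0" "0 < zp" and p: "(a, b, c, d) \<in> Pgen q zm zp"
  shows "bqj q zm zp a b c d (sroot q a b c d)"
proof -
  have P: "(a, b) \<in> Ppair q zm zp" "(c, d) \<in> Ppair q zm zp" "a \<noteq> b" "c / a \<notin> qZ q" "c / b \<notin> qZ q" "d / a \<notin> qZ q" "d / b \<notin> qZ q"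
    using p by (auto simp: Pgen_def P_def)
  note ab = Ppair_D[OF z P(1)] and cd = Ppair_D[OF z P(2)]
  define r where "r = Re (c * d) * q / Re (a * b)"
  have r: "0 < r" unfolding r_def using ab(4) cd(4) q0 by simp
  have "a * b = of_real (Re (a * b))" "c * d = of_real (Re (c * d))" using ab(5) cd(5) by (simp_all only: of_real_Re)
  then have e: "c * d * of_real q / (a * b) = of_real r" unfolding r_def by (metis of_real_divide of_real_mult)
  then have s: "sroot q a b c d = of_real (sqrt r)" unfolding sroot_def using r by simp
  show ?thesis
  proof
    show "(sroot q a b c d)\<^sup>2 * (a * b) = c * d * of_real q"
      unfolding sroot_def power2_csqrt using ab(1,2) by simp
    show "sroot q a b c d \<in> \<real>" "0 < Re (sroot q a b c d)" unfolding s using r by simp_all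
    show "a = cnj b \<or> a \<in> \<real> \<and> b \<in> \<real>" "c = cnj d \<or> c \<in> \<real> \<and> d \<in> \<real>" by (rule ab(3), rule cd(3))
  qed (use z P ab cd in \<open>simp_all only: simp_thms not_False_eq_True\<close>)
qed

theorem proposition4p3:
  fixes q zm zp \<psi>1 \<psi>2 lam1 lam2 :: real
    and a b c d :: complex
    and E :: "real set \<Rightarrow> (real \<Rightarrow> complex) \<Rightarrow> (real \<Rightarrow> complex)"
    and f g :: "real \<Rightarrow> complex"
  assumes "0 < q" and "q < 1" and "zm < 0" and "0 < zp"
    and "(a, b, c, d) \<in> Pgen q zm zp"
    and "0 < \<psi>1" and "\<psi>1 < \<psi>2" and "\<psi>2 < pi"
    and "lam1 = 2 * cos \<psi>2" and "lam2 = 2 * cos \<psi>1"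
    and "spectral_measure_of (L2 q zm zp a b c d) (L2_inner q zm zp a b c d)
           (domL q zm zp a b c d) (L q a b c d) E"
    and "f \<in> finsupp (Rq q zm zp)" and "g \<in> finsupp (Rq q zm zp)"
  shows "L2_inner q zm zp a b c d (E {lam1<..<lam2} f) g =
    1 / (2 * of_real pi) * integral {\<psi>1..\<psi>2} (\<lambda>\<psi>.
      row_col
        (vector [Fc_dagger q zm zp a b c d (\<lambda>x. cnj (g x)) (cis \<psi>),
                 Fc q zm zp a b c d (\<lambda>x. cnj (g x)) (cis \<psi>)])
        (vmatrix q zm zp a b c d (cis \<psi>) *v
           vector [Fc q zm zp a b c d f (cis \<psi>),
                   Fc_dagger q zm zp a b c d f (cis \<psi>)]))"
proof -
  interpret qbase q using assms(1,2) by unfold_locales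
  interpret bqj q zm zp a b c d "sroot q a b c d" by (rule Pgen_bqj[OF assms(3-5)])
  have "integral {\<psi>1..\<psi>2} (\<lambda>\<psi>. spectral_form (cis \<psi>) f g) = 2 * of_real pi * L2_inner q zm zp a b c d (E {lam1<..<lam2} f) g"
    unfolding assms(9,10) by (rule integral_unique, rule sesquilinear_formula[OF assms(11-13,6-8)])
  then show ?thesis unfolding row_col_eq[OF assms(12,13)] by simp
qed

end
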